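(* Let $y\in\mathbb{R}$, and let $g=g^y$ and $X=(X_t)_{t\ge0}$ be the random variable and the process (depending on $y$) constructed in the context. Let $\Gamma:=\int_0^\infty\mathbf{1}_{\{X_s<0\}}\,\mathrm{d}s$ and $\tau:=\inf\{t\ge0: X_t\le 0\}$ (with $\inf\emptyset=\infty$). Then $$2\,\mathbb{P}(g\in(0,u])=\mathbb{P}(\tau+\Gamma\le u),\qquad u\in[0,1].$$
   Context: For $t>0$ and $u\ge 0$ let $q^y(t,u):=\mathbb{P}\left(\int_0^t \mathbf{1}_{\{b'_s<0\}}\,\mathrm{d}s\le u\right)$, where $(b'_s)_{s\in[0,t]}$ is a Brownian bridge of length $t$ with $b'_0=y$ and $b'_t=0$. Construction of $g$ and $X$ for fixed $y\in\mathbb{R}$: 1. Let $g=g^y$ be a non-negative random variable whose distribution function is, for $x\ge 0$, $$\mathbb{P}(g\le x)=\begin{cases}\mathbf{1}_{\{x\le 1\}}\frac{\sqrt{x}}{2}+\mathbf{1}_{\{x>1\}}\left(1-\frac{1}{2\sqrt{x}}\right), & y=0,\\[2mm] \dfrac{\int_0^x q^y(t,1)\frac{1}{\sqrt t}e^{-\frac{y^2}{2t}}\,\mathrm{d}t}{2\int_0^1\frac{1}{\sqrt t}e^{-\frac{y^2}{2t}}\,\mathrm{d}t}, & y<0,\\[4mm] \dfrac{2\sqrt{2\pi}\,y+\int_0^x q^y(t,1)\frac{1}{\sqrt t}e^{-\frac{y^2}{2t}}\,\mathrm{d}t}{2\sqrt{2\pi}\,y+4}, & y>0.\end{cases}$$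 2. Let $b=(b_t)_{t\in[0,1]}$ be a process whose conditional law given $\{g=x\}$, for $x\ge 0$, is that of a standard Brownian bridge on $[0,1]$ (from $0$ to $0$) conditioned on the event $\int_0^x\mathbf{1}_{\{\sqrt{x}\,b_{s/x}+y-\frac{s}{x}y<0\}}\,\mathrm{d}s\le 1$ (for $x=0$ this condition is vacuous). 3. Let $Z=(Z_t)_{t\ge0}$ be a three-dimensional Bessel process starting in $0$, independent of $(g,b)$. 4. For $y>0$, let $Y=(Y_t)_{t\ge0}$ be a three-dimensional Bessel process starting in $y$, independent of $(g,b,Z)$. 5. Define, for $t\ge0$, $$X_t:=\mathbf{1}_{\{g>0,\,t<g\}}\left(\sqrt{g}\,b_{t/g}+y-\tfrac{t}{g}y\right)+\mathbf{1}_{\{g>0,\,t\ge g\}}Z_{t-g}+\mathbf{1}_{\{g=0,\,y>0\}}Y_t.$$ *)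

theory Defs
  imports "HOL-Probability.Probability"
begin

section \<open>Processes and their laws\<close>

abbreviation path_space :: "real set \<Rightarrow> (real \<Rightarrow> real) measure"
  where "path_space I \<equiv> PiM I (\<lambda>_. borel)"

definition path_of :: "real set \<Rightarrow> (real \<Rightarrow> 'a \<Rightarrow> real) \<Rightarrow> 'a \<Rightarrow> (real \<Rightarrow> real)"
  where "path_of I X \<omega> = (\<lambda>t\<in>I. X t \<omega>)"

definition path_law :: "'a measure \<Rightarrow> real set \<Rightarrow> (real \<Rightarrow> 'a \<Rightarrow> real) \<Rightarrow> (real \<Rightarrow> real) measure"
  where "path_law M I X = distr M (path_space I) (path_of I X)"

definition continuous_process :: "'a measure \<Rightarrow> real set \<Rightarrow> (real \<Rightarrow> 'a \<Rightarrow> real) \<Rightarrow> bool"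
  where "continuous_process M I X \<longleftrightarrow>
    prob_space M \<and>
    (\<forall>t\<in>I. X t \<in> borel_measurable M) \<and>
    (\<forall>\<omega>\<in>space M. continuous_on I (\<lambda>t. X t \<omega>))"

text \<open>Degenerate normal variables are admitted: the processes below are constant at their end points.\<close>

definition gaussian_rv :: "'a measure \<Rightarrow> ('a \<Rightarrow> real) \<Rightarrow> bool"
  where "gaussian_rv M X \<longleftrightarrow>
    X \<in> borel_measurable M \<and>
    ((\<exists>\<mu>. AE \<omega> in M. X \<omega> = \<mu>) \<or>
     (\<exists>\<mu> \<sigma>. 0 < \<sigma> \<and> distributed M lborel X (\<lambda>x. ennreal (normal_density \<mu> \<sigma> x))))"

definition gaussian_process ::
    "'a measure \<Rightarrow> real set \<Rightarrow> (real \<Rightarrow> real) \<Rightarrow> (real \<Rightarrow> real \<Rightarrow> real) \<Rightarrow> (real \<Rightarrow> 'a \<Rightarrow> real) \<Rightarrow> bool"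
  where "gaussian_process M I m k X \<longleftrightarrow>
    (\<forall>J c. finite J \<and> J \<subseteq> I \<longrightarrow> gaussian_rv M (\<lambda>\<omega>. \<Sum>t\<in>J. c t * X t \<omega>)) \<and>
    (\<forall>t\<in>I. (LINT \<omega>|M. X t \<omega>) = m t) \<and>
    (\<forall>s\<in>I. \<forall>t\<in>I. (LINT \<omega>|M. (X s \<omega> - m s) * (X t \<omega> - m t)) = k s t)"

definition brownian_motion :: "'a measure \<Rightarrow> real \<Rightarrow> (real \<Rightarrow> 'a \<Rightarrow> real) \<Rightarrow> bool"
  where "brownian_motion M a W \<longleftrightarrow>
    continuous_process M {0..} W \<and> gaussian_process M {0..} (\<lambda>_. a) min W"

text \<open>Bridge of length \<open>T\<close> from \<open>a\<close> at time \<open>0\<close> to \<open>c\<close> at time \<open>T\<close>.\<close>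

definition brownian_bridge ::
    "'a measure \<Rightarrow> real \<Rightarrow> real \<Rightarrow> real \<Rightarrow> (real \<Rightarrow> 'a \<Rightarrow> real) \<Rightarrow> bool"
  where "brownian_bridge M T a c B \<longleftrightarrow>
    0 < T \<and> continuous_process M {0..T} B \<and>
    gaussian_process M {0..T} (\<lambda>t. a + (c - a) * t / T) (\<lambda>s t. min s t - s * t / T) B"

definition brownian_motion3 :: "'a measure \<Rightarrow> real ^ 3 \<Rightarrow> (real \<Rightarrow> 'a \<Rightarrow> real ^ 3) \<Rightarrow> bool"
  where "brownian_motion3 M v W \<longleftrightarrow>
    (\<forall>i. brownian_motion M (v $ i) (\<lambda>t \<omega>. W t \<omega> $ i)) \<and>
    prob_space.indep_vars M (\<lambda>_. path_space {0..}) (\<lambda>i. path_of {0..} (\<lambda>t \<omega>. W t \<omega> $ i)) UNIV"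

text \<open>
  A three-dimensional Bessel process started at \<open>a\<close> has the law of the Euclidean norm of a
  three-dimensional Brownian motion started at a point of norm \<open>a\<close>. The Brownian motion need
  not live on the space carrying \<open>Z\<close>. Letting its space have underlying type \<^typ>\<open>real\<close> is no
  restriction, since the unit interval with Lebesgue measure already carries such a process.
\<close>

definition bessel3 :: "'a measure \<Rightarrow> real \<Rightarrow> (real \<Rightarrow> 'a \<Rightarrow> real) \<Rightarrow> bool"
  where "bessel3 M a Z \<longleftrightarrow>
    continuous_process M {0..} Z \<and>
    (\<exists>(N :: real measure) v W. norm v = a \<and> brownian_motion3 N v W \<and>
       path_law M {0..} Z = path_law N {0..} (\<lambda>t \<omega>. norm (W t \<omega>)))"

text \<open>The library's \<open>indep_var\<close> requires both variables to take values in the same type.\<close>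

definition independent_rvs ::
    "'a measure \<Rightarrow> 'b measure \<Rightarrow> ('a \<Rightarrow> 'b) \<Rightarrow> 'c measure \<Rightarrow> ('a \<Rightarrow> 'c) \<Rightarrow> bool"
  where "independent_rvs M S X T Y \<longleftrightarrow>
    X \<in> M \<rightarrow>\<^sub>M S \<and> Y \<in> M \<rightarrow>\<^sub>M T \<and>
    prob_space.indep_set M {X -` A \<inter> space M | A. A \<in> sets S} {Y -` C \<inter> space M | C. C \<in> sets T}"

text \<open>\<open>K x\<close> is the conditional law of \<open>Y\<close> given that \<open>X = x\<close>.\<close>

definition has_conditional_law ::
    "'a measure \<Rightarrow> 'b measure \<Rightarrow> ('a \<Rightarrow> 'b) \<Rightarrow> 'c measure \<Rightarrow> ('a \<Rightarrow> 'c) \<Rightarrow> ('b \<Rightarrow> 'c measure) \<Rightarrow> bool"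
  where "has_conditional_law M S X T Y K \<longleftrightarrow>
    X \<in> M \<rightarrow>\<^sub>M S \<and> Y \<in> M \<rightarrow>\<^sub>M T \<and>
    (\<forall>A\<in>sets S. \<forall>C\<in>sets T.
       emeasure M {\<omega>\<in>space M. X \<omega> \<in> A \<and> Y \<omega> \<in> C} =
       (\<integral>\<^sup>+ x\<in>A. emeasure (K x) C \<partial>distr M S X))"


section \<open>Occupation and hitting times\<close>

definition time_below_zero :: "real set \<Rightarrow> (real \<Rightarrow> real) \<Rightarrow> ennreal"
  where "time_below_zero I f = (\<integral>\<^sup>+ s\<in>I. of_bool (f s < 0) \<partial>lborel)"

definition hitting_time :: "(real \<Rightarrow> real) \<Rightarrow> ennreal"
  where "hitting_time f = Inf {ennreal t | t. 0 \<le> t \<and> f t \<le> 0}"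

text \<open>\<open>B t\<close>, living on \<open>N t\<close>, is meant to be a bridge of length \<open>t\<close> from \<open>y\<close> to \<open>0\<close>.\<close>

definition bridge_occupation_cdf ::
    "(real \<Rightarrow> 'a measure) \<Rightarrow> (real \<Rightarrow> real \<Rightarrow> 'a \<Rightarrow> real) \<Rightarrow> real \<Rightarrow> real \<Rightarrow> real"
  where "bridge_occupation_cdf N B t u =
    \<P>(\<omega> in N t. time_below_zero {0..t} (\<lambda>s. B t s \<omega>) \<le> ennreal u)"


section \<open>The construction\<close>

definition g_cdf :: "(real \<Rightarrow> real \<Rightarrow> real) \<Rightarrow> real \<Rightarrow> real \<Rightarrow> real"
  where "g_cdf q y x =
    (if y = 0 then of_bool (x \<le> 1) * (sqrt x / 2) + of_bool (x > 1) * (1 - 1 / (2 * sqrt x))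
     else if y < 0 then
       (LBINT t:{0<..x}. q t 1 * (1 / sqrt t) * exp (- (y\<^sup>2 / (2 * t)))) /
       (2 * (LBINT t:{0<..1}. (1 / sqrt t) * exp (- (y\<^sup>2 / (2 * t)))))
     else
       (2 * sqrt (2 * pi) * y +
        (LBINT t:{0<..x}. q t 1 * (1 / sqrt t) * exp (- (y\<^sup>2 / (2 * t))))) /
       (2 * sqrt (2 * pi) * y + 4))"

text \<open>Turns a path of a standard bridge on \<open>[0, 1]\<close> into one from \<open>y\<close> to \<open>0\<close> on \<open>[0, x]\<close>.\<close>

definition scaled_bridge :: "real \<Rightarrow> real \<Rightarrow> (real \<Rightarrow> real) \<Rightarrow> real \<Rightarrow> real"
  where "scaled_bridge y x f s = sqrt x * f (s / x) + y - s / x * y"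

text \<open>For \<open>x = 0\<close> the time interval is a null set, so that the conditioning event is the whole space.\<close>

definition conditioned_bridge_law ::
    "'a measure \<Rightarrow> (real \<Rightarrow> 'a \<Rightarrow> real) \<Rightarrow> real \<Rightarrow> real \<Rightarrow> (real \<Rightarrow> real) measure"
  where "conditioned_bridge_law N \<beta> y x =
    path_law
      (uniform_measure N
        {\<omega>\<in>space N. time_below_zero {0..x} (scaled_bridge y x (\<lambda>t. \<beta> t \<omega>)) \<le> 1})
      {0..1} \<beta>"

definition X_process ::
    "real \<Rightarrow> ('a \<Rightarrow> real) \<Rightarrow> (real \<Rightarrow> 'a \<Rightarrow> real) \<Rightarrow> (real \<Rightarrow> 'a \<Rightarrow> real) \<Rightarrow> (real \<Rightarrow> 'a \<Rightarrow> real) \<Rightarrow>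
     real \<Rightarrow> 'a \<Rightarrow> real"
  where "X_process y g b Z Y t \<omega> =
    of_bool (g \<omega> > 0 \<and> t < g \<omega>) * scaled_bridge y (g \<omega>) (\<lambda>s. b s \<omega>) t +
    of_bool (g \<omega> > 0 \<and> t \<ge> g \<omega>) * Z (t - g \<omega>) \<omega> +
    of_bool (g \<omega> = 0 \<and> y > 0) * Y t \<omega>"

end

theory Submission
  imports Defs "HOL-Real_Asymp.Real_Asymp"
begin

text \<open>
  Given \<open>g = x > 0\<close>, the path up to time \<open>g\<close> is \<open>sqrt x\<close> times a bridge with drift, and
  \<open>\<tau> + \<Gamma>\<close> equals \<open>x\<close> times the hitting time of \<open>0\<close> plus the time spent below \<open>0\<close> by that
  bridge. The density of \<open>g\<close> is proportional to \<open>q(x, 1) w(x)\<close> with \<open>w(x) = exp (- y\<^sup>2 / 2 x) / sqrt x\<close>, and the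
  factor \<open>q(x, 1)\<close> is the normalisation of the conditioning. As \<open>\<tau> + \<Gamma> \<le> u \<le> 1\<close> implies the
  conditioning event, the claim becomes an identity for unconditioned bridges:
  \<open>\<integral> w(x) P(total time \<le> u) dx = 2 \<integral>\<^sub>0\<^sup>u w(x) dx\<close>. After hitting \<open>0\<close> the bridge is a bridge from \<open>0\<close>
  to \<open>0\<close>, whose time below \<open>0\<close> is uniformly distributed (by invariance under cyclic shifts); decomposing \<open>w\<close> at
  the hitting time reduces the identity to the case \<open>y = 0\<close>, where it is elementary. On \<open>g = 0\<close>, which has
  positive probability only for \<open>y > 0\<close>, the process is a three-dimensional Bessel process and never
  reaches \<open>0\<close>.
\<close>

section \<open>Uniqueness of laws of families of random variables\<close>

text \<open>The laws live on an uncountable product, where neither the time below 0 nor the hitting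
  time of 0 is measurable. Both are replaced by versions that read countably many coordinates and
  agree with the originals on continuous paths; then events can be carried between different spaces
  supporting a bridge. Up to a constant, w(x) is the Gaussian transition density from y to 0 in time
  x. Averaging over the length therefore turns the decomposition of the bridge at its first zero
  into the classical first-passage decomposition, and what remains is a bridge from 0 to 0 of length
  l with weight 1/sqrt l. The factor 2 is the elementary fact that the integral of min(1, c/l)/sqrt
  l over l > 0 is twice its part over l < c. For y < 0 the hitting time is 0, but all the time
  before the first zero is spent below 0, so the sum of hitting time and occupation time has the
  same form for both signs of y. The Bessel process has to avoid 0 only up to time 1, because u
  \<le> 1.\<close>

lemma weighted_law_unique:
  fixes X h :: "'a \<Rightarrow> real" and X' h' :: "'b \<Rightarrow> real"
  assumes M: "prob_space M" "prob_space M'"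
    and [measurable]: "X \<in> borel_measurable M" "h \<in> borel_measurable M"
    and [measurable]: "X' \<in> borel_measurable M'" "h' \<in> borel_measurable M'"
    and h: "\<And>\<omega>. 0 \<le> h \<omega>" "\<And>\<omega>. h \<omega> \<le> B" and h': "\<And>\<omega>. 0 \<le> h' \<omega>" "\<And>\<omega>. h' \<omega> \<le> B"
    and eq: "\<And>t. (CLINT \<omega>|M. iexp (t * X \<omega>) * of_real (h \<omega>)) = (CLINT \<omega>|M'. iexp (t * X' \<omega>) * of_real (h' \<omega>))"
    and A[measurable]: "A \<in> sets borel"
  shows "(LINT \<omega>|M. indicator A (X \<omega>) * h \<omega>) = (LINT \<omega>|M'. indicator A (X' \<omega>) * h' \<omega>)"
proof -
  interpret M: prob_space M by fact
  interpret M': prob_space M' by fact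
  have ih: "integrable M h" by (rule M.integrable_const_bound[where B=B]) (use h in auto)
  have ih': "integrable M' h'" by (rule M'.integrable_const_bound[where B=B]) (use h' in auto)
  define c where "c = (LINT \<omega>|M. h \<omega>)"
  \<comment> \<open>At frequency 0 the hypothesis compares total masses, so both weights are
    normalised by the same \<open>c\<close>.\<close>
  have "(CLINT \<omega>|M. of_real (h \<omega>)) = (CLINT \<omega>|M'. of_real (h' \<omega>))"
    using eq[of 0] by simp
  then have c': "c = (LINT \<omega>|M'. h' \<omega>)"
    unfolding c_def integral_complex_of_real by simp
  have cnn: "0 \<le> c" unfolding c_def using h by simp
  show ?thesis
  proof (cases "c = 0")
    case True
    have "AE \<omega> in M. h \<omega> = 0" 
      using integral_nonneg_eq_0_iff_AE[OF ih] h True c_def by auto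
    then have 1: "(LINT \<omega>|M. indicator A (X \<omega>) * h \<omega>) = 0"
      by (intro integral_eq_zero_AE) auto
    have "AE \<omega> in M'. h' \<omega> = 0" 
      using integral_nonneg_eq_0_iff_AE[OF ih'] h' True c' by auto
    then have 2: "(LINT \<omega>|M'. indicator A (X' \<omega>) * h' \<omega>) = 0"
      by (intro integral_eq_zero_AE) auto
    show ?thesis using 1 2 by simp
  next
    case False
    then have cpos: "c > 0" using cnn by simp
    \<comment> \<open>Tilting by the normalised weight gives a probability measure. The weighted
      transform divided by \<open>c\<close> is the characteristic function of the variable under it,
      so Levy's uniqueness theorem applies.\<close>
    have *: "\<exists>D. real_distribution D \<and> (\<forall>t. char D t = (CLINT \<omega>|K. iexp (t * Z \<omega>) * of_real (k \<omega>)) / c)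
        \<and> measure D A = (LINT \<omega>|K. indicator A (Z \<omega>) * k \<omega>) / c"
      if K: "prob_space K" and [measurable]: "Z \<in> borel_measurable K" "k \<in> borel_measurable K"
        and k: "\<And>\<omega>. 0 \<le> k \<omega>" "integrable K k" "c = (LINT \<omega>|K. k \<omega>)"
      for K :: "'c measure" and Z k :: "'c \<Rightarrow> real"
    proof -
      interpret K: prob_space K by fact
      define E where "E = density K (\<lambda>\<omega>. ennreal (k \<omega> / c))"
      have [measurable]: "Z \<in> borel_measurable E" unfolding E_def by simp
      have "emeasure E (space E) = (\<integral>\<^sup>+\<omega>. ennreal (k \<omega> / c) \<partial>K)"
        unfolding E_def by (subst emeasure_density) (auto intro!: nn_integral_cong simp: indicator_def)
      also have "\<dots> = ennreal (LINT \<omega>|K. k \<omega> / c)"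
        by (rule nn_integral_eq_integral) (use k cpos in auto)
      also have "\<dots> = 1" using k cpos by simp
      finally have E: "prob_space E" by (rule prob_spaceI)
      interpret E: prob_space E by fact
      define D where "D = distr E borel Z"
      have D: "real_distribution D" unfolding D_def by (rule E.real_distribution_distr) simp
      have "char D t = (CLINT \<omega>|K. iexp (t * Z \<omega>) * of_real (k \<omega>)) / c" for t
      proof -
        have "char D t = (CLINT \<omega>|E. iexp (t * Z \<omega>))"
          unfolding char_def D_def by (subst integral_distr) auto
        also have "\<dots> = (CLINT \<omega>|K. (k \<omega> / c) *\<^sub>R iexp (t * Z \<omega>))"
          unfolding E_def by (subst integral_density) (use k cpos in auto)
        also have "\<dots> = (CLINT \<omega>|K. (iexp (t * Z \<omega>) * of_real (k \<omega>)) / c)"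
          by (rule Bochner_Integration.integral_cong) (auto simp: scaleR_conv_of_real)
        also have "\<dots> = (CLINT \<omega>|K. iexp (t * Z \<omega>) * of_real (k \<omega>)) / c"
          by simp
        finally show ?thesis .
      qed
      moreover have "measure D A = (LINT \<omega>|K. indicator A (Z \<omega>) * k \<omega>) / c"
      proof -
        have "measure D A = (LINT x|D. indicator A x)" unfolding D_def by simp
        also have "\<dots> = (LINT \<omega>|E. indicator A (Z \<omega>))"
          unfolding D_def by (subst integral_distr) auto
        also have "\<dots> = (LINT \<omega>|K. (k \<omega> / c) *\<^sub>R indicator A (Z \<omega>))"
          unfolding E_def by (subst integral_density) (use k cpos in auto)
        also have "\<dots> = (LINT \<omega>|K. (indicator A (Z \<omega>) * k \<omega>) / c)"
          by (rule Bochner_Integration.integral_cong) (auto)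
        also have "\<dots> = (LINT \<omega>|K. indicator A (Z \<omega>) * k \<omega>) / c"
          by simp
        finally show ?thesis .
      qed
      ultimately show ?thesis using D by blast
    qed
    obtain D where D: "real_distribution D" "\<And>t. char D t = (CLINT \<omega>|M. iexp (t * X \<omega>) * of_real (h \<omega>)) / c"
      "measure D A = (LINT \<omega>|M. indicator A (X \<omega>) * h \<omega>) / c"
      using *[OF M(1) _ _ h(1) ih c_def, of X] by auto
    obtain D' where D': "real_distribution D'" "\<And>t. char D' t = (CLINT \<omega>|M'. iexp (t * X' \<omega>) * of_real (h' \<omega>)) / c"
      "measure D' A = (LINT \<omega>|M'. indicator A (X' \<omega>) * h' \<omega>) / c"
      using *[OF M(2) _ _ h'(1) ih' c', of X'] by auto
    have "D = D'" by (rule Levy_uniqueness) (use D D' eq in auto)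
    then show ?thesis using D(3) D'(3) cpos by simp
  qed
qed

text \<open>A Cramer-Wold argument resting on the one-dimensional uniqueness theorem only:
  frequencies are exchanged for indicator functions one index at a time, while the remaining indices
  stay in the exponent.\<close>

lemma finite_families_unique:
  fixes X :: "'i \<Rightarrow> 'a \<Rightarrow> real" and X' :: "'i \<Rightarrow> 'b \<Rightarrow> real"
  assumes M: "prob_space M" "prob_space M'" and J: "finite J"
    and [measurable]: "\<And>i. i \<in> J \<Longrightarrow> X i \<in> borel_measurable M" "\<And>i. i \<in> J \<Longrightarrow> X' i \<in> borel_measurable M'"
    and eq: "\<And>c. (CLINT \<omega>|M. iexp (\<Sum>i\<in>J. c i * X i \<omega>)) = (CLINT \<omega>|M'. iexp (\<Sum>i\<in>J. c i * X' i \<omega>))"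
    and A[measurable]: "\<And>i. i \<in> J \<Longrightarrow> A i \<in> sets borel"
  shows "measure M {\<omega>\<in>space M. \<forall>i\<in>J. X i \<omega> \<in> A i} = measure M' {\<omega>\<in>space M'. \<forall>i\<in>J. X' i \<omega> \<in> A i}"
proof -
  interpret M: prob_space M by fact
  interpret M': prob_space M' by fact
  \<comment> \<open>\<open>K\<close> collects the indices already turned into indicators;
    \<open>K = J\<close> is the assertion. The quantifier over \<open>c\<close> is inside because
    the induction step rescales the frequencies.\<close>
  have claim: "\<forall>c. (CLINT \<omega>|M. iexp (\<Sum>i\<in>J-K. c i * X i \<omega>) * of_real (\<Prod>i\<in>K. indicator (A i) (X i \<omega>)))
        = (CLINT \<omega>|M'. iexp (\<Sum>i\<in>J-K. c i * X' i \<omega>) * of_real (\<Prod>i\<in>K. indicator (A i) (X' i \<omega>)))"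
    if "K \<subseteq> J" for K
    using finite_subset[OF that J] that
  proof (induction K rule: finite_induct)
    case empty then show ?case using eq by simp
  next
    case (insert k K)
    then have IH: "\<And>c. (CLINT \<omega>|M. iexp (\<Sum>i\<in>J-K. c i * X i \<omega>) * of_real (\<Prod>i\<in>K. indicator (A i) (X i \<omega>)))
        = (CLINT \<omega>|M'. iexp (\<Sum>i\<in>J-K. c i * X' i \<omega>) * of_real (\<Prod>i\<in>K. indicator (A i) (X' i \<omega>)))"
      by auto
    have k: "k \<in> J" "K \<subseteq> J" "finite K" "k \<notin> K" using insert by auto
    show ?case
    proof
      fix c :: "'i \<Rightarrow> real"
      define L where "L \<omega> = (\<Sum>i\<in>J - insert k K. c i * X i \<omega>)" for \<omega>
      define L' where "L' \<omega> = (\<Sum>i\<in>J - insert k K. c i * X' i \<omega>)" for \<omega>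
      define I where "I \<omega> = (\<Prod>i\<in>K. indicator (A i) (X i \<omega>) :: real)" for \<omega>
      define I' where "I' \<omega> = (\<Prod>i\<in>K. indicator (A i) (X' i \<omega>) :: real)" for \<omega>
      have [measurable]: "L \<in> borel_measurable M" "L' \<in> borel_measurable M'"
        unfolding L_def L'_def by (measurable; simp)+
      have [measurable]: "X k \<in> borel_measurable M" "X' k \<in> borel_measurable M'" "A k \<in> sets borel"
        using k by auto
      have [measurable]: "I \<in> borel_measurable M" "I' \<in> borel_measurable M'"
        unfolding I_def I'_def using k(2) 
        by (auto intro!: borel_measurable_prod borel_measurable_indicator' simp: subset_eq)
      have I01: "0 \<le> I \<omega>" "I \<omega> \<le> 1" for \<omega>
        unfolding I_def by (auto intro!: prod_nonneg prod_le_1)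
      have I01': "0 \<le> I' \<omega>" "I' \<omega> \<le> 1" for \<omega>
        unfolding I'_def by (auto intro!: prod_nonneg prod_le_1)
      have split: "J - K = insert k (J - insert k K)" using k by auto
      have E: "(CLINT \<omega>|M. iexp (t * X k \<omega> + r * L \<omega>) * of_real (I \<omega>)) =
         (CLINT \<omega>|M'. iexp (t * X' k \<omega> + r * L' \<omega>) * of_real (I' \<omega>))" for t r
      proof -
        define d where "d i = (if i = k then t else r * c i)" for i
        have "(\<Sum>i\<in>J-K. d i * X i \<omega>) = t * X k \<omega> + r * L \<omega>" for \<omega>
        proof -
          have "(\<Sum>i\<in>J-insert k K. d i * X i \<omega>) = r * L \<omega>"
            unfolding L_def sum_distrib_left by (rule sum.cong) (auto simp: d_def)
          then show ?thesis unfolding split using J by (simp add: d_def)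
        qed
        moreover have "(\<Sum>i\<in>J-K. d i * X' i \<omega>) = t * X' k \<omega> + r * L' \<omega>" for \<omega>
        proof -
          have "(\<Sum>i\<in>J-insert k K. d i * X' i \<omega>) = r * L' \<omega>"
            unfolding L'_def sum_distrib_left by (rule sum.cong) (auto simp: d_def)
          then show ?thesis unfolding split using J by (simp add: d_def)
        qed
        ultimately show ?thesis using IH[of d] unfolding I_def I'_def by simp
      qed
      \<comment> \<open>\<open>weighted_law_unique\<close> asks for a nonnegative real weight,
        whereas \<open>iexp\<close> of the remaining sum is complex. The weights
        \<open>I \<omega> * (1 + r * cos (L \<omega> + p))\<close> are nonnegative for r between 0
        and 1, and the difference between r = 1 and r = 0 isolates the cosine with an arbitrary
        phase.\<close>
      have W: "(LINT \<omega>|M. indicator (A k) (X k \<omega>) * (I \<omega> * (1 + r * cos (L \<omega> + p)))) =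
          (LINT \<omega>|M'. indicator (A k) (X' k \<omega>) * (I' \<omega> * (1 + r * cos (L' \<omega> + p))))"
        if r: "0 \<le> r" "r \<le> 1" for p r
      proof (rule weighted_law_unique[where B=2, OF M])
        have r': "0 \<le> 1 + r * cos x" "1 + r * cos x \<le> 2" for x
        proof -
          have "\<bar>r * cos x\<bar> \<le> 1 * 1" unfolding abs_mult by (rule mult_mono) (use r in auto)
          then show "0 \<le> 1 + r * cos x" "1 + r * cos x \<le> 2" by auto
        qed
        show "0 \<le> I \<omega> * (1 + r * cos (L \<omega> + p))" for \<omega> using r' I01 by simp
        show "0 \<le> I' \<omega> * (1 + r * cos (L' \<omega> + p))" for \<omega> using r' I01' by simp
        show "I \<omega> * (1 + r * cos (L \<omega> + p)) \<le> 2" for \<omega>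
          using mult_mono[of "I \<omega>" 1 "1 + r * cos (L \<omega> + p)" 2] r' I01 by simp
        show "I' \<omega> * (1 + r * cos (L' \<omega> + p)) \<le> 2" for \<omega>
          using mult_mono[of "I' \<omega>" 1 "1 + r * cos (L' \<omega> + p)" 2] r' I01' by simp
        show "(CLINT \<omega>|M. iexp (t * X k \<omega>) * of_real (I \<omega> * (1 + r * cos (L \<omega> + p)))) =
          (CLINT \<omega>|M'. iexp (t * X' k \<omega>) * of_real (I' \<omega> * (1 + r * cos (L' \<omega> + p))))" for t
        proof -
          have exp: "iexp a * of_real (i * (1 + r * cos (l + p))) =
             iexp (a + 0 * l) * of_real i + (iexp p * (r/2)) * (iexp (a + 1 * l) * of_real i)
              + (iexp (-p) * (r/2)) * (iexp (a + (-1) * l) * of_real i)" for a i l :: real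
          proof -
            have c: "complex_of_real (cos (l + p)) = (iexp l * iexp p + iexp (-l) * iexp (-p)) / 2"
              unfolding cos_of_real[symmetric] cos_exp_eq by (simp add: exp_add[symmetric] algebra_simps)
            have e: "iexp (a + 1 * l) = iexp a * iexp l" "iexp (a + (-1) * l) = iexp a * iexp (-l)" "iexp (a + 0 * l) = iexp a"
              by (simp_all add: exp_add[symmetric] algebra_simps)
            show ?thesis unfolding e unfolding of_real_mult of_real_add of_real_1 c by (simp add: algebra_simps add_divide_distrib)
          qed
          have int: "integrable M (\<lambda>\<omega>. iexp (t * X k \<omega> + s * L \<omega>) * of_real (I \<omega>))" for s
            by (rule M.integrable_const_bound[where B=1]) (use I01 in \<open>auto simp: norm_mult\<close>)
          have int': "integrable M' (\<lambda>\<omega>. iexp (t * X' k \<omega> + s * L' \<omega>) * of_real (I' \<omega>))" for s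
            by (rule M'.integrable_const_bound[where B=1]) (use I01' in \<open>auto simp: norm_mult\<close>)
          show ?thesis unfolding exp
            by (subst (1 2) Bochner_Integration.integral_add; (intro Bochner_Integration.integrable_add integrable_mult_right int int')?)+
               (simp only: integral_mult_right_zero E)
        qed
      qed measurable
      have int: "integrable M (\<lambda>\<omega>. indicator (A k) (X k \<omega>) * (I \<omega> * f (L \<omega>)))" 
        if [measurable]: "f \<in> borel_measurable borel" and f: "\<And>x. \<bar>f x\<bar> \<le> 1" for f :: "real \<Rightarrow> real"
        by (rule M.integrable_const_bound[where B=1])
           (use I01 f in \<open>auto simp: abs_mult indicator_def intro!: mult_le_one\<close>)
      have int': "integrable M' (\<lambda>\<omega>. indicator (A k) (X' k \<omega>) * (I' \<omega> * f (L' \<omega>)))" 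
        if [measurable]: "f \<in> borel_measurable borel" and f: "\<And>x. \<bar>f x\<bar> \<le> 1" for f :: "real \<Rightarrow> real"
        by (rule M'.integrable_const_bound[where B=1])
           (use I01' f in \<open>auto simp: abs_mult indicator_def intro!: mult_le_one\<close>)
      have cc: "(LINT \<omega>|M. indicator (A k) (X k \<omega>) * (I \<omega> * cos (L \<omega> + p))) =
          (LINT \<omega>|M'. indicator (A k) (X' k \<omega>) * (I' \<omega> * cos (L' \<omega> + p)))" for p
      proof -
        have 1: "(LINT \<omega>|M. indicator (A k) (X k \<omega>) * (I \<omega> * (1 + 1 * cos (L \<omega> + p)))) = 
          (LINT \<omega>|M. indicator (A k) (X k \<omega>) * (I \<omega> * 1)) + (LINT \<omega>|M. indicator (A k) (X k \<omega>) * (I \<omega> * cos (L \<omega> + p)))"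
          using int[of "\<lambda>x. 1"] int[of "\<lambda>x. cos (x + p)"]
          by (subst Bochner_Integration.integral_add[symmetric]) (auto simp: algebra_simps)
        have 2: "(LINT \<omega>|M'. indicator (A k) (X' k \<omega>) * (I' \<omega> * (1 + 1 * cos (L' \<omega> + p)))) = 
          (LINT \<omega>|M'. indicator (A k) (X' k \<omega>) * (I' \<omega> * 1)) + (LINT \<omega>|M'. indicator (A k) (X' k \<omega>) * (I' \<omega> * cos (L' \<omega> + p)))"
          using int'[of "\<lambda>x. 1"] int'[of "\<lambda>x. cos (x + p)"]
          by (subst Bochner_Integration.integral_add[symmetric]) (auto simp: algebra_simps)
        show ?thesis using W[of 1 p] W[of 0 p] 1 2 by simp
      qed
      \<comment> \<open>The phases 0 and \<open>- pi/2\<close> give the real and the imaginary part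
        of the exponential.\<close>
      have cos_sin: "cos (x + - pi/2) = sin x" for x :: real
        by (simp add: cos_diff)
      have P: "(\<Prod>i\<in>insert k K. indicator (A i) (Z i) :: real) = indicator (A k) (Z k) * (\<Prod>i\<in>K. indicator (A i) (Z i))" for Z :: "'i \<Rightarrow> real"
        using k by simp
      have ie: "iexp l * of_real a = of_real (a * cos l) + \<i> * of_real (a * sin l)" for l a :: real
        by (simp add: exp_Euler cos_of_real sin_of_real algebra_simps)
      have 1: "(CLINT \<omega>|M. iexp (L \<omega>) * of_real (indicator (A k) (X k \<omega>) * I \<omega>)) =
          of_real (LINT \<omega>|M. indicator (A k) (X k \<omega>) * (I \<omega> * cos (L \<omega> + 0))) + \<i> * of_real (LINT \<omega>|M. indicator (A k) (X k \<omega>) * (I \<omega> * cos (L \<omega> + - pi/2)))"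
        unfolding ie integral_complex_of_real[symmetric] cos_sin
        by (subst Bochner_Integration.integral_add)
           (use int[of cos] int[of sin] in \<open>auto simp: mult.assoc simp del: of_real_mult intro!: integrable_mult_right integrable_of_real\<close>)
      have 2: "(CLINT \<omega>|M'. iexp (L' \<omega>) * of_real (indicator (A k) (X' k \<omega>) * I' \<omega>)) =
          of_real (LINT \<omega>|M'. indicator (A k) (X' k \<omega>) * (I' \<omega> * cos (L' \<omega> + 0))) + \<i> * of_real (LINT \<omega>|M'. indicator (A k) (X' k \<omega>) * (I' \<omega> * cos (L' \<omega> + - pi/2)))"
        unfolding ie integral_complex_of_real[symmetric] cos_sin
        by (subst Bochner_Integration.integral_add)
           (use int'[of cos] int'[of sin] in \<open>auto simp: mult.assoc simp del: of_real_mult intro!: integrable_mult_right integrable_of_real\<close>)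
      show "(CLINT \<omega>|M. iexp (\<Sum>i\<in>J-insert k K. c i * X i \<omega>) * of_real (\<Prod>i\<in>insert k K. indicator (A i) (X i \<omega>)))
        = (CLINT \<omega>|M'. iexp (\<Sum>i\<in>J-insert k K. c i * X' i \<omega>) * of_real (\<Prod>i\<in>insert k K. indicator (A i) (X' i \<omega>)))"
        using trans[OF 1[unfolded cc] 2[symmetric]] unfolding P L_def[symmetric] L'_def[symmetric] I_def[symmetric] I'_def[symmetric] .
    qed
  qed
  have pe: "(\<Prod>i\<in>J. indicator (A i) (Z i) :: real) = indicator {Z. \<forall>i\<in>J. Z i \<in> A i} Z" for Z :: "'i \<Rightarrow> real"
    using J by (auto simp: indicator_def prod_zero_iff)
  have [measurable]: "{\<omega>\<in>space M. \<forall>i\<in>J. X i \<omega> \<in> A i} \<in> sets M" "{\<omega>\<in>space M'. \<forall>i\<in>J. X' i \<omega> \<in> A i} \<in> sets M'"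
    using J by (auto intro!: sets.sets_Collect_finite_All')
  have "(CLINT \<omega>|M. of_real (indicator {\<omega>\<in>space M. \<forall>i\<in>J. X i \<omega> \<in> A i} \<omega>)) = (CLINT \<omega>|M'. of_real (indicator {\<omega>\<in>space M'. \<forall>i\<in>J. X' i \<omega> \<in> A i} \<omega>))"
  proof -
    have "(CLINT \<omega>|M. of_real (indicator {\<omega>\<in>space M. \<forall>i\<in>J. X i \<omega> \<in> A i} \<omega>)) = (CLINT \<omega>|M. of_real (\<Prod>i\<in>J. indicator (A i) (X i \<omega>)))"
      unfolding pe by (rule Bochner_Integration.integral_cong) (auto simp: indicator_def)
    also have "\<dots> = (CLINT \<omega>|M'. of_real (\<Prod>i\<in>J. indicator (A i) (X' i \<omega>)))"
      using claim[of J] by simp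
    also have "\<dots> = (CLINT \<omega>|M'. of_real (indicator {\<omega>\<in>space M'. \<forall>i\<in>J. X' i \<omega> \<in> A i} \<omega>))"
      unfolding pe by (rule Bochner_Integration.integral_cong) (auto simp: indicator_def)
    finally show ?thesis .
  qed
  then show ?thesis
    unfolding integral_complex_of_real by (simp add: Int_absorb1)
qed

text \<open>Finite measures on a product over an arbitrary index set are determined by cylinders, so
  only finitely many coordinates enter at a time.\<close>

lemma path_law_unique:
  fixes X :: "'i \<Rightarrow> 'a \<Rightarrow> real" and X' :: "'i \<Rightarrow> 'b \<Rightarrow> real"
  assumes M: "prob_space M" "prob_space M'" 
    and [measurable]: "\<And>i. i \<in> I \<Longrightarrow> X i \<in> borel_measurable M" "\<And>i. i \<in> I \<Longrightarrow> X' i \<in> borel_measurable M'"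
    and eq: "\<And>J c. finite J \<Longrightarrow> J \<subseteq> I \<Longrightarrow> (CLINT \<omega>|M. iexp (\<Sum>i\<in>J. c i * X i \<omega>)) = (CLINT \<omega>|M'. iexp (\<Sum>i\<in>J. c i * X' i \<omega>))"
  shows "distr M (PiM I (\<lambda>_. borel)) (\<lambda>\<omega>. \<lambda>i\<in>I. X i \<omega>) = distr M' (PiM I (\<lambda>_. borel)) (\<lambda>\<omega>. \<lambda>i\<in>I. X' i \<omega>)"
proof (rule measure_eqI_PiM_infinite)
  interpret M: prob_space M by fact
  interpret M': prob_space M' by fact
  have [measurable]: "(\<lambda>\<omega>. \<lambda>i\<in>I. X i \<omega>) \<in> M \<rightarrow>\<^sub>M PiM I (\<lambda>_. borel)" "(\<lambda>\<omega>. \<lambda>i\<in>I. X' i \<omega>) \<in> M' \<rightarrow>\<^sub>M PiM I (\<lambda>_. borel)"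
    by (intro measurable_restrict; simp)+
  show "finite_measure (distr M (PiM I (\<lambda>_. borel)) (\<lambda>\<omega>. \<lambda>i\<in>I. X i \<omega>))"
    by (intro M.finite_measure_distr) simp
  fix A :: "'i \<Rightarrow> real set" and J assume J: "finite J" "J \<subseteq> I" and A: "\<And>i. i \<in> J \<Longrightarrow> A i \<in> sets borel"
  have s: "prod_emb I (\<lambda>_. borel) J (Pi\<^sub>E J A) \<in> sets (PiM I (\<lambda>_. borel))"
    using J A by (intro sets_PiM_I) auto
  have 1: "(\<lambda>\<omega>. \<lambda>i\<in>I. X i \<omega>) -` prod_emb I (\<lambda>_. borel) J (Pi\<^sub>E J A) \<inter> space M = {\<omega>\<in>space M. \<forall>i\<in>J. X i \<omega> \<in> A i}"
    using J by (auto simp: prod_emb_def PiE_iff subset_eq extensional_def restrict_def)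
  have 2: "(\<lambda>\<omega>. \<lambda>i\<in>I. X' i \<omega>) -` prod_emb I (\<lambda>_. borel) J (Pi\<^sub>E J A) \<inter> space M' = {\<omega>\<in>space M'. \<forall>i\<in>J. X' i \<omega> \<in> A i}"
    using J by (auto simp: prod_emb_def PiE_iff subset_eq extensional_def restrict_def)
  have "measure M {\<omega>\<in>space M. \<forall>i\<in>J. X i \<omega> \<in> A i} = measure M' {\<omega>\<in>space M'. \<forall>i\<in>J. X' i \<omega> \<in> A i}"
    by (rule finite_families_unique[OF M J(1)]) (use J A eq in auto)
  then show "distr M (PiM I (\<lambda>_. borel)) (\<lambda>\<omega>. \<lambda>i\<in>I. X i \<omega>) (prod_emb I (\<lambda>_. borel) J (Pi\<^sub>E J A)) =
     distr M' (PiM I (\<lambda>_. borel)) (\<lambda>\<omega>. \<lambda>i\<in>I. X' i \<omega>) (prod_emb I (\<lambda>_. borel) J (Pi\<^sub>E J A))"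
    by (simp add: emeasure_distr s 1 2 M.emeasure_eq_measure M'.emeasure_eq_measure)
qed simp_all

section \<open>Gaussian spaces\<close>

text \<open>Normality is recorded through the characteristic function rather than through a density,
  so degenerate variables need no separate case, and closure under linear combinations makes
  \<open>V\<close> jointly Gaussian. All members are centred; means are subtracted
  beforehand.\<close>

locale gaussian_space = prob_space M for M :: "'a measure" +
  fixes V :: "('a \<Rightarrow> real) set"
  assumes zero_mem: "(\<lambda>_. 0) \<in> V"
    and add_mem: "\<And>S T. S \<in> V \<Longrightarrow> T \<in> V \<Longrightarrow> (\<lambda>\<omega>. S \<omega> + T \<omega>) \<in> V"
    and scale_mem: "\<And>S c. S \<in> V \<Longrightarrow> (\<lambda>\<omega>. c * S \<omega>) \<in> V"
    and mem_measurable: "\<And>S. S \<in> V \<Longrightarrow> S \<in> borel_measurable M"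
    and mem_square_integrable: "\<And>S. S \<in> V \<Longrightarrow> integrable M (\<lambda>\<omega>. (S \<omega>)\<^sup>2)"
    and mem_mean: "\<And>S. S \<in> V \<Longrightarrow> expectation S = 0"
    and mem_char: "\<And>S. S \<in> V \<Longrightarrow> (CLINT \<omega>|M. iexp (S \<omega>)) = of_real (exp (- expectation (\<lambda>\<omega>. (S \<omega>)\<^sup>2) / 2))"
begin

lemma diff_mem: "S \<in> V \<Longrightarrow> T \<in> V \<Longrightarrow> (\<lambda>\<omega>. S \<omega> - T \<omega>) \<in> V"
  using add_mem[of S "\<lambda>\<omega>. (-1) * T \<omega>"] scale_mem[of T "-1"] by simp

lemma sum_mem: "finite J \<Longrightarrow> (\<And>j. j \<in> J \<Longrightarrow> X j \<in> V) \<Longrightarrow> (\<lambda>\<omega>. \<Sum>j\<in>J. c j * X j \<omega>) \<in> V"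
  by (induction J rule: finite_induct) (auto simp: zero_mem intro!: add_mem scale_mem)

lemma mem_prod_integrable:
  assumes "S \<in> V" "T \<in> V" shows "integrable M (\<lambda>\<omega>. S \<omega> * T \<omega>)"
proof (rule Bochner_Integration.integrable_bound)
  show "integrable M (\<lambda>\<omega>. (S \<omega>)\<^sup>2 + (T \<omega>)\<^sup>2)"
    using assms by (intro Bochner_Integration.integrable_add mem_square_integrable)
  have "\<bar>a * b\<bar> \<le> \<bar>a\<^sup>2 + b\<^sup>2\<bar>" for a b :: real
  proof -
    have "2 * \<bar>a\<bar> * \<bar>b\<bar> \<le> \<bar>a\<bar>\<^sup>2 + \<bar>b\<bar>\<^sup>2" by (rule sum_squares_bound)
    then have "2 * (\<bar>a\<bar> * \<bar>b\<bar>) \<le> a\<^sup>2 + b\<^sup>2" by (simp only: power2_abs mult.assoc)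
    moreover have "0 \<le> \<bar>a\<bar> * \<bar>b\<bar>" by simp
    ultimately have "\<bar>a\<bar> * \<bar>b\<bar> \<le> a\<^sup>2 + b\<^sup>2" by linarith
    then show ?thesis unfolding abs_mult by (rule order_trans) simp
  qed
  then show "AE \<omega> in M. norm (S \<omega> * T \<omega>) \<le> norm ((S \<omega>)\<^sup>2 + (T \<omega>)\<^sup>2)" by simp
qed (use assms mem_measurable in measurable)

lemma mem_integrable: "S \<in> V \<Longrightarrow> integrable M S"
  using square_integrable_imp_integrable[of S] mem_measurable mem_square_integrable by blast

lemma expectation_diff_mult_diff:
  assumes "S \<in> V" "T \<in> V" "U \<in> V" "W \<in> V"
  shows "expectation (\<lambda>\<omega>. (S \<omega> - T \<omega>) * (U \<omega> - W \<omega>)) =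
    expectation (\<lambda>\<omega>. S \<omega> * U \<omega>) - expectation (\<lambda>\<omega>. S \<omega> * W \<omega>)
     - expectation (\<lambda>\<omega>. T \<omega> * U \<omega>) + expectation (\<lambda>\<omega>. T \<omega> * W \<omega>)"
proof -
  note i = mem_prod_integrable[OF assms(1,3)] mem_prod_integrable[OF assms(1,4)]
    mem_prod_integrable[OF assms(2,3)] mem_prod_integrable[OF assms(2,4)]
  have "(S \<omega> - T \<omega>) * (U \<omega> - W \<omega>) = S \<omega> * U \<omega> - S \<omega> * W \<omega> - T \<omega> * U \<omega> + T \<omega> * W \<omega>" for \<omega>
    by (simp add: algebra_simps)
  then show ?thesis
    by (simp only: Bochner_Integration.integral_add Bochner_Integration.integral_diff
        Bochner_Integration.integrable_add Bochner_Integration.integrable_diff i)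
qed

lemma expectation_sum_square:
  assumes "finite J" "\<And>j. j \<in> J \<Longrightarrow> X j \<in> V"
  shows "expectation (\<lambda>\<omega>. (\<Sum>j\<in>J. c j * X j \<omega>)\<^sup>2) = (\<Sum>i\<in>J. \<Sum>j\<in>J. c i * c j * expectation (\<lambda>\<omega>. X i \<omega> * X j \<omega>))"
proof -
  have *: "(\<Sum>j\<in>J. c j * X j \<omega>)\<^sup>2 = (\<Sum>i\<in>J. \<Sum>j\<in>J. c i * c j * (X i \<omega> * X j \<omega>))" for \<omega>
    by (simp add: power2_eq_square sum_product algebra_simps)
  have "integrable M (\<lambda>\<omega>. c i * c j * (X i \<omega> * X j \<omega>))" if "i \<in> J" "j \<in> J" for i j
    using that assms by (intro integrable_mult_right mem_prod_integrable) auto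
  then show ?thesis unfolding * by (simp add: Bochner_Integration.integral_sum)
qed

lemma char_sum:
  assumes "finite J" "\<And>j. j \<in> J \<Longrightarrow> X j \<in> V"
  shows "(CLINT \<omega>|M. iexp (\<Sum>j\<in>J. c j * X j \<omega>)) = 
    of_real (exp (- (\<Sum>i\<in>J. \<Sum>j\<in>J. c i * c j * expectation (\<lambda>\<omega>. X i \<omega> * X j \<omega>)) / 2))"
  using mem_char[OF sum_mem[OF assms]] expectation_sum_square[OF assms] by simp

text \<open>Levy's theorem, applied against a rescaled standard normal variable, recovers the
  density when the variance is positive.\<close>

lemma mem_distributed:
  assumes S: "S \<in> V" and s: "0 < s" "expectation (\<lambda>\<omega>. (S \<omega>)\<^sup>2) = s\<^sup>2"
  shows "distributed M lborel S (normal_density 0 s)"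
proof -
  interpret N: real_distribution std_normal_distribution by (rule real_dist_normal_dist)
  have [measurable]: "S \<in> borel_measurable M" by (rule mem_measurable[OF S])
  have "distributed std_normal_distribution lborel (\<lambda>x. x) (std_normal_density)"
    unfolding distributed_def by (auto simp: distr_id2)
  then have "distributed std_normal_distribution lborel (\<lambda>x. 0 + s * x) (normal_density (0 + s * 0) (\<bar>s\<bar> * 1))"
    by (rule N.normal_density_affine) (use s in auto)
  then have D: "distr std_normal_distribution lborel (\<lambda>x. s * x) = density lborel (normal_density 0 s)"
    using s by (auto simp: distributed_def)
  have "distr M borel S = distr std_normal_distribution borel (\<lambda>x. s * x)"
  proof (rule Levy_uniqueness)
    show "real_distribution (distr M borel S)" by (rule real_distribution_distr) simp
    show "real_distribution (distr std_normal_distribution borel (\<lambda>x. s * x))" by (rule N.real_distribution_distr) simp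
    show "char (distr M borel S) = char (distr std_normal_distribution borel ((*) s))"
    proof
      fix t
      have "char (distr M borel S) t = (CLINT \<omega>|M. iexp (t * S \<omega>))"
        unfolding char_def by (subst integral_distr) auto
      also have "\<dots> = of_real (exp (- (t * s)\<^sup>2 / 2))"
        by (subst mem_char[OF scale_mem[OF S]]) (simp add: power_mult_distrib s)
      also have "\<dots> = char std_normal_distribution (t * s)"
        unfolding char_std_normal_distribution by simp
      also have "\<dots> = char (distr std_normal_distribution borel ((*) s)) t"
        unfolding char_def by (subst integral_distr) (auto simp: mult.assoc)
      finally show "char (distr M borel S) t = char (distr std_normal_distribution borel ((*) s)) t" .
    qed
  qed
  then have "distr M lborel S = density lborel (normal_density 0 s)"
    unfolding D[symmetric] by (metis distr_cong sets_lborel)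
  then show ?thesis unfolding distributed_def by auto
qed

lemma mem_prob_eq:
  assumes S: "S \<in> V" and s: "0 < expectation (\<lambda>\<omega>. (S \<omega>)\<^sup>2)"
  shows "AE \<omega> in M. S \<omega> \<noteq> c"
proof -
  have D: "distributed M lborel S (normal_density 0 (sqrt (expectation (\<lambda>\<omega>. (S \<omega>)\<^sup>2))))"
    by (rule mem_distributed[OF S]) (use s in auto)
  have "AE x in lborel. x \<noteq> c" by (rule AE_lborel_singleton)
  then have "AE x in density lborel (\<lambda>x. ennreal (normal_density 0 (sqrt (expectation (\<lambda>\<omega>. (S \<omega>)\<^sup>2))) x)). x \<noteq> c"
    by (subst AE_density) auto
  moreover have "distr M lborel S = density lborel (\<lambda>x. ennreal (normal_density 0 (sqrt (expectation (\<lambda>\<omega>. (S \<omega>)\<^sup>2))) x))"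
    using D unfolding distributed_def by (rule conjunct1)
  ultimately have "AE x in distr M lborel S. x \<noteq> c" by (rule ssubst[rotated])
  then show ?thesis 
    using mem_measurable[OF S] by (subst (asm) AE_distr_iff) auto
qed

lemma mem_zero_AE:
  assumes S: "S \<in> V" and s: "expectation (\<lambda>\<omega>. (S \<omega>)\<^sup>2) = 0"
  shows "AE \<omega> in M. S \<omega> = 0"
  using integral_nonneg_eq_0_iff_AE[OF mem_square_integrable[OF S]] s by auto

end

lemma gaussian_path_law_unique:
  assumes "gaussian_space M V" "gaussian_space M' V'"
    and X: "\<And>i. i \<in> I \<Longrightarrow> X i \<in> V" and X': "\<And>i. i \<in> I \<Longrightarrow> X' i \<in> V'"
    and cov: "\<And>i j. i \<in> I \<Longrightarrow> j \<in> I \<Longrightarrow> (LINT \<omega>|M. X i \<omega> * X j \<omega>) = (LINT \<omega>|M'. X' i \<omega> * X' j \<omega>)"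
  shows "distr M (PiM I (\<lambda>_. borel)) (\<lambda>\<omega>. \<lambda>i\<in>I. X i \<omega>) = distr M' (PiM I (\<lambda>_. borel)) (\<lambda>\<omega>. \<lambda>i\<in>I. X' i \<omega>)"
proof -
  interpret M: gaussian_space M V by fact
  interpret M': gaussian_space M' V' by fact
  show ?thesis
  proof (rule path_law_unique)
    fix J and c :: "_ \<Rightarrow> real" assume J: "finite J" "J \<subseteq> I"
    show "(CLINT \<omega>|M. iexp (\<Sum>i\<in>J. c i * X i \<omega>)) = (CLINT \<omega>|M'. iexp (\<Sum>i\<in>J. c i * X' i \<omega>))"
      using J X X' cov
      by (subst M.char_sum, simp, blast, subst M'.char_sum, simp, blast) 
         (simp add: subset_eq)
  qed (use X X' M.mem_measurable M'.mem_measurable M.prob_space_axioms M'.prob_space_axioms in auto)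
qed

text \<open>The joint family is compared with the pair of families on the product of
  \<open>M\<close> with itself, where independence holds by construction. The transforms of all
  linear combinations agree because variances of uncorrelated elements of \<open>V\<close> add;
  hence the two joint laws agree.\<close>

lemma (in gaussian_space) uncorrelated_imp_independent:
  fixes X :: "'i \<Rightarrow> 'a \<Rightarrow> real" and Y :: "'j \<Rightarrow> 'a \<Rightarrow> real"
  assumes X: "\<And>i. i \<in> I \<Longrightarrow> X i \<in> V" and Y: "\<And>j. j \<in> J \<Longrightarrow> Y j \<in> V"
    and cov: "\<And>i j. i \<in> I \<Longrightarrow> j \<in> J \<Longrightarrow> expectation (\<lambda>\<omega>. X i \<omega> * Y j \<omega>) = 0"
    and P: "P \<in> sets (PiM I (\<lambda>_. borel))" and Q: "Q \<in> sets (PiM J (\<lambda>_. borel))"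
  shows "prob {\<omega>\<in>space M. (\<lambda>i\<in>I. X i \<omega>) \<in> P \<and> (\<lambda>j\<in>J. Y j \<omega>) \<in> Q} =
    prob {\<omega>\<in>space M. (\<lambda>i\<in>I. X i \<omega>) \<in> P} * prob {\<omega>\<in>space M. (\<lambda>j\<in>J. Y j \<omega>) \<in> Q}"
proof -
  interpret MM: pair_prob_space M M ..
  define U where "U k = (case k of Inl i \<Rightarrow> X i | Inr j \<Rightarrow> Y j)" for k
  define U' where "U' k = (case k of Inl i \<Rightarrow> (\<lambda>(\<omega>, \<omega>'). X i \<omega>) | Inr j \<Rightarrow> (\<lambda>(\<omega>, \<omega>'). Y j \<omega>'))" for k
  have [measurable]: "X i \<in> borel_measurable M" if "i \<in> I" for i using X mem_measurable that by auto
  have [measurable]: "Y i \<in> borel_measurable M" if "i \<in> J" for i using Y mem_measurable that by auto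
  have UV: "U k \<in> V" if "k \<in> I <+> J" for k using that X Y by (auto simp: U_def)
  have Um: "U k \<in> borel_measurable M" if "k \<in> I <+> J" for k using that UV mem_measurable by blast
  have U'm: "U' k \<in> borel_measurable (M \<Otimes>\<^sub>M M)" if "k \<in> I <+> J" for k 
    using that by (auto simp: U'_def split_beta)
  have D: "distr M (PiM (I <+> J) (\<lambda>_. borel)) (\<lambda>\<omega>. \<lambda>i\<in>I <+> J. U i \<omega>) = 
     distr (M \<Otimes>\<^sub>M M) (PiM (I <+> J) (\<lambda>_. borel)) (\<lambda>\<omega>. \<lambda>i\<in>I <+> J. U' i \<omega>)"
  proof (rule path_law_unique)
    fix K :: "('i + 'j) set" and c :: "'i + 'j \<Rightarrow> real" assume K: "finite K" "K \<subseteq> I <+> J"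
    define K1 where "K1 = Inl -` K"
    define K2 where "K2 = Inr -` K"
    have fin: "finite K1" "finite K2" unfolding K1_def K2_def using K by (auto intro!: finite_vimageI)
    have sub: "K1 \<subseteq> I" "K2 \<subseteq> J" unfolding K1_def K2_def using K by auto
    have KK: "K = K1 <+> K2" unfolding K1_def K2_def
      using K by (auto simp: Plus_def)
    define S where "S \<omega> = (\<Sum>i\<in>K1. c (Inl i) * X i \<omega>)" for \<omega>
    define T where "T \<omega> = (\<Sum>i\<in>K2. c (Inr i) * Y i \<omega>)" for \<omega>
    have ST: "S \<in> V" "T \<in> V" unfolding S_def T_def using sub X Y fin by (auto intro!: sum_mem)
    have [measurable]: "S \<in> borel_measurable M" "T \<in> borel_measurable M" using ST mem_measurable by auto
    have 1: "(\<Sum>i\<in>K. c i * U i \<omega>) = S \<omega> + T \<omega>" for \<omega>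
      unfolding KK S_def T_def by (simp add: sum.Plus fin U_def)
    have 2: "(\<Sum>i\<in>K. c i * U' i p) = S (fst p) + T (snd p)" for p
      unfolding KK S_def T_def by (simp add: sum.Plus fin U'_def split_beta)
    have ST0: "expectation (\<lambda>\<omega>. S \<omega> * T \<omega>) = 0"
    proof -
      have *: "S \<omega> * T \<omega> = (\<Sum>i\<in>K1. \<Sum>j\<in>K2. c (Inl i) * c (Inr j) * (X i \<omega> * Y j \<omega>))" for \<omega>
        unfolding S_def T_def by (simp add: sum_product algebra_simps)
      have i: "integrable M (\<lambda>\<omega>. c (Inl i) * c (Inr j) * (X i \<omega> * Y j \<omega>))" if "i \<in> K1" "j \<in> K2" for i j
        using that sub by (intro integrable_mult_right mem_prod_integrable X Y) auto
      have "expectation (\<lambda>\<omega>. S \<omega> * T \<omega>) = (\<Sum>i\<in>K1. \<Sum>j\<in>K2. expectation (\<lambda>\<omega>. c (Inl i) * c (Inr j) * (X i \<omega> * Y j \<omega>)))"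
        unfolding * using i by (simp add: Bochner_Integration.integral_sum)
      also have "\<dots> = 0" 
        using cov sub by (intro sum.neutral ballI) auto
      finally show ?thesis .
    qed
    have "expectation (\<lambda>\<omega>. (S \<omega> + T \<omega>)\<^sup>2) = expectation (\<lambda>\<omega>. (S \<omega>)\<^sup>2 + (T \<omega>)\<^sup>2 + 2 * (S \<omega> * T \<omega>))"
      by (simp add: power2_sum algebra_simps)
    also have "\<dots> = expectation (\<lambda>\<omega>. (S \<omega>)\<^sup>2) + expectation (\<lambda>\<omega>. (T \<omega>)\<^sup>2)"
      using ST ST0 mem_square_integrable mem_prod_integrable by simp
    finally have sq: "expectation (\<lambda>\<omega>. (S \<omega> + T \<omega>)\<^sup>2) = expectation (\<lambda>\<omega>. (S \<omega>)\<^sup>2) + expectation (\<lambda>\<omega>. (T \<omega>)\<^sup>2)" .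
    have "(CLINT \<omega>|M. iexp (\<Sum>i\<in>K. c i * U i \<omega>)) = (CLINT \<omega>|M. iexp (S \<omega>)) * (CLINT \<omega>|M. iexp (T \<omega>))"
      unfolding 1 using mem_char[OF add_mem[OF ST]] mem_char[OF ST(1)] mem_char[OF ST(2)] sq
      by (simp add: exp_add[symmetric] of_real_mult[symmetric] add_divide_distrib del: of_real_mult of_real_add)
    also have "\<dots> = (\<integral>\<omega>. (\<integral>\<omega>'. iexp (S \<omega>) * iexp (T \<omega>') \<partial>M) \<partial>M)"
      by simp
    also have "\<dots> = (\<integral>p. iexp (S (fst p)) * iexp (T (snd p)) \<partial>(M \<Otimes>\<^sub>M M))"
    proof -
      have "integrable (M \<Otimes>\<^sub>M M) (\<lambda>p. iexp (S (fst p)) * iexp (T (snd p)))"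
        by (rule MM.integrable_const_bound[where B=1]) (auto simp: norm_mult)
      from MM.integral_fst'[OF this] show ?thesis by simp
    qed
    also have "\<dots> = (CLINT p|M \<Otimes>\<^sub>M M. iexp (\<Sum>i\<in>K. c i * U' i p))"
      unfolding 2 by (simp add: exp_add algebra_simps)
    finally show "(CLINT \<omega>|M. iexp (\<Sum>i\<in>K. c i * U i \<omega>)) = (CLINT p|M \<Otimes>\<^sub>M M. iexp (\<Sum>i\<in>K. c i * U' i p))" .
  qed (use Um U'm prob_space_axioms MM.prob_space_axioms in auto)
  \<comment> \<open>The sum type indexes both families at once; \<open>E\<close> is the event
    expressed for paths over the disjoint union.\<close>
  define E where "E = {f \<in> space (PiM (I <+> J) (\<lambda>_. borel :: real measure)). (\<lambda>i\<in>I. f (Inl i)) \<in> P \<and> (\<lambda>j\<in>J. f (Inr j)) \<in> Q}"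
  have E: "E \<in> sets (PiM (I <+> J) (\<lambda>_. borel))"
  proof -
    have [measurable]: "(\<lambda>f. \<lambda>i\<in>I. f (Inl i)) \<in> PiM (I <+> J) (\<lambda>_. borel :: real measure) \<rightarrow>\<^sub>M PiM I (\<lambda>_. borel)"
      "(\<lambda>f. \<lambda>i\<in>J. f (Inr i)) \<in> PiM (I <+> J) (\<lambda>_. borel :: real measure) \<rightarrow>\<^sub>M PiM J (\<lambda>_. borel)"
      by (intro measurable_restrict measurable_component_singleton; auto)+
    show ?thesis unfolding E_def using P Q by measurable
  qed
  have rU: "(\<lambda>\<omega>. \<lambda>i\<in>I <+> J. U i \<omega>) \<in> M \<rightarrow>\<^sub>M PiM (I <+> J) (\<lambda>_. borel)"
    using Um by (intro measurable_restrict) auto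
  have rU': "(\<lambda>\<omega>. \<lambda>i\<in>I <+> J. U' i \<omega>) \<in> M \<Otimes>\<^sub>M M \<rightarrow>\<^sub>M PiM (I <+> J) (\<lambda>_. borel)"
    using U'm by (intro measurable_restrict) auto
  have eI: "(\<lambda>i\<in>I. (\<lambda>k\<in>I <+> J. U k \<omega>) (Inl i)) = (\<lambda>i\<in>I. X i \<omega>)" "(\<lambda>i\<in>J. (\<lambda>k\<in>I <+> J. U k \<omega>) (Inr i)) = (\<lambda>i\<in>J. Y i \<omega>)" for \<omega>
    by (rule restrict_ext, auto simp: U_def)+
  have eI': "(\<lambda>i\<in>I. (\<lambda>k\<in>I <+> J. U' k p) (Inl i)) = (\<lambda>i\<in>I. X i (fst p))" "(\<lambda>i\<in>J. (\<lambda>k\<in>I <+> J. U' k p) (Inr i)) = (\<lambda>i\<in>J. Y i (snd p))" for p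
    by (rule restrict_ext, auto simp: U'_def split_beta)+
  have XI: "(\<lambda>\<omega>. \<lambda>i\<in>I. X i \<omega>) \<in> M \<rightarrow>\<^sub>M PiM I (\<lambda>_. borel)" by (intro measurable_restrict) auto
  have YJ: "(\<lambda>\<omega>. \<lambda>i\<in>J. Y i \<omega>) \<in> M \<rightarrow>\<^sub>M PiM J (\<lambda>_. borel)" by (intro measurable_restrict) auto
  define A where "A = {\<omega>\<in>space M. (\<lambda>i\<in>I. X i \<omega>) \<in> P}"
  define B where "B = {\<omega>\<in>space M. (\<lambda>i\<in>J. Y i \<omega>) \<in> Q}"
  have A: "A \<in> sets M" using measurable_sets[OF XI P] unfolding A_def by (simp add: vimage_def Int_def conj_commute)
  have B: "B \<in> sets M" using measurable_sets[OF YJ Q] unfolding B_def by (simp add: vimage_def Int_def conj_commute)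
  have "prob {\<omega>\<in>space M. (\<lambda>i\<in>I. X i \<omega>) \<in> P \<and> (\<lambda>j\<in>J. Y j \<omega>) \<in> Q} = measure (distr M (PiM (I <+> J) (\<lambda>_. borel)) (\<lambda>\<omega>. \<lambda>i\<in>I <+> J. U i \<omega>)) E"
    by (subst measure_distr[OF rU E], rule arg_cong[where f=prob])
       (use measurable_space[OF rU] in \<open>auto simp: E_def eI simp del: restrict_apply\<close>)
  also have "\<dots> = measure (M \<Otimes>\<^sub>M M) (A \<times> B)"
    unfolding D by (subst measure_distr[OF rU' E], rule arg_cong[where f="measure (M \<Otimes>\<^sub>M M)"])
      (use measurable_space[OF rU'] in \<open>auto simp: E_def eI' A_def B_def space_pair_measure simp del: restrict_apply\<close>)
  also have "\<dots> = prob A * prob B"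
    using A B by (simp add: measure_def emeasure_pair_measure_Times enn2real_mult)
  finally show ?thesis unfolding A_def B_def .
qed

section \<open>Gaussian processes and the Gaussian spaces they generate\<close>

definition linear_span :: "'i set \<Rightarrow> ('i \<Rightarrow> 'a \<Rightarrow> real) \<Rightarrow> ('a \<Rightarrow> real) set"
  where "linear_span I X = {\<lambda>\<omega>. \<Sum>t\<in>J. c t * X t \<omega> | J c. finite J \<and> J \<subseteq> I}"

lemma linear_spanE:
  assumes "S \<in> linear_span I X"
  obtains J c where "finite J" "J \<subseteq> I" "S = (\<lambda>\<omega>. \<Sum>t\<in>J. c t * X t \<omega>)"
  using assms unfolding linear_span_def by blast

lemma linear_span_base: "t \<in> I \<Longrightarrow> X t \<in> linear_span I X"
  unfolding linear_span_def by (rule CollectI, rule exI[of _ "{t}"], rule exI[of _ "\<lambda>_. 1"]) auto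

lemma linear_span_add:
  assumes "S \<in> linear_span I X" "T \<in> linear_span I X"
  shows "(\<lambda>\<omega>. S \<omega> + T \<omega>) \<in> linear_span I X"
proof -
  obtain J c where J: "finite J" "J \<subseteq> I" "S = (\<lambda>\<omega>. \<Sum>t\<in>J. c t * X t \<omega>)"
    using assms(1) unfolding linear_span_def by blast
  obtain K d where K: "finite K" "K \<subseteq> I" "T = (\<lambda>\<omega>. \<Sum>t\<in>K. d t * X t \<omega>)"
    using assms(2) unfolding linear_span_def by blast
  define e where "e t = (if t \<in> J then c t else 0) + (if t \<in> K then d t else 0)" for t
  have "S \<omega> + T \<omega> = (\<Sum>t\<in>J \<union> K. e t * X t \<omega>)" for \<omega>
  proof -
    have "S \<omega> = (\<Sum>t\<in>J \<union> K. (if t \<in> J then c t else 0) * X t \<omega>)"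
      unfolding J(3) by (rule sum.mono_neutral_cong_left) (use J K in auto)
    moreover have "T \<omega> = (\<Sum>t\<in>J \<union> K. (if t \<in> K then d t else 0) * X t \<omega>)"
      unfolding K(3) by (rule sum.mono_neutral_cong_left) (use J K in auto)
    ultimately show ?thesis by (simp add: e_def sum.distrib distrib_right)
  qed
  then have "(\<lambda>\<omega>. S \<omega> + T \<omega>) = (\<lambda>\<omega>. \<Sum>t\<in>J \<union> K. e t * X t \<omega>)" by auto
  then show ?thesis unfolding linear_span_def using J K by blast
qed

lemma linear_span_scale:
  assumes "S \<in> linear_span I X"
  shows "(\<lambda>\<omega>. a * S \<omega>) \<in> linear_span I X"
proof -
  obtain J c where J: "finite J" "J \<subseteq> I" "S = (\<lambda>\<omega>. \<Sum>t\<in>J. c t * X t \<omega>)"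
    using assms(1) unfolding linear_span_def by blast
  have "(\<lambda>\<omega>. a * S \<omega>) = (\<lambda>\<omega>. \<Sum>t\<in>J. (a * c t) * X t \<omega>)"
    unfolding J(3) by (auto simp: sum_distrib_left mult.assoc)
  then show ?thesis unfolding linear_span_def using J 
    by (intro CollectI exI[of _ J] exI[of _ "\<lambda>t. a * c t"]) simp
qed

lemma (in prob_space) gaussian_rv_centered:
  assumes "gaussian_rv M L"
  shows "integrable M L" "integrable M (\<lambda>\<omega>. (L \<omega> - expectation L)\<^sup>2)"
    "(CLINT \<omega>|M. iexp (L \<omega> - expectation L)) = of_real (exp (- expectation (\<lambda>\<omega>. (L \<omega> - expectation L)\<^sup>2) / 2))"
proof -
  have L[measurable]: "L \<in> borel_measurable M" using assms unfolding gaussian_rv_def by simp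
  have "integrable M L \<and> integrable M (\<lambda>\<omega>. (L \<omega> - expectation L)\<^sup>2) \<and>
    (CLINT \<omega>|M. iexp (L \<omega> - expectation L)) = of_real (exp (- expectation (\<lambda>\<omega>. (L \<omega> - expectation L)\<^sup>2) / 2))"
    using assms unfolding gaussian_rv_def
  proof (elim conjE disjE exE)
    fix \<mu> assume ae: "AE \<omega> in M. L \<omega> = \<mu>"
    have iL: "integrable M L"
      by (rule integrable_cong_AE_imp[of M "\<lambda>_. \<mu>"]) (use ae in auto)
    have "expectation L = expectation (\<lambda>_. \<mu>)"
      by (rule integral_cong_AE) (use ae in auto)
    then have eL: "expectation L = \<mu>" by (simp add: prob_space)
    have ae2: "AE \<omega> in M. (L \<omega> - \<mu>)\<^sup>2 = 0" using ae by eventually_elim simp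
    have i2: "integrable M (\<lambda>\<omega>. (L \<omega> - \<mu>)\<^sup>2)" 
      by (rule integrable_cong_AE_imp[of M "\<lambda>_. 0"]) (use ae2 in auto)
    have "expectation (\<lambda>\<omega>. (L \<omega> - \<mu>)\<^sup>2) = expectation (\<lambda>_. 0)" 
      by (rule integral_cong_AE) (use ae2 in auto)
    then have e2: "expectation (\<lambda>\<omega>. (L \<omega> - \<mu>)\<^sup>2) = 0" by simp
    have ae3: "AE \<omega> in M. iexp (L \<omega> - \<mu>) = 1" using ae by eventually_elim simp
    have "(CLINT \<omega>|M. iexp (L \<omega> - \<mu>)) = (CLINT \<omega>|M. 1)"
      by (rule integral_cong_AE) (use ae3 in auto)
    then have "(CLINT \<omega>|M. iexp (L \<omega> - \<mu>)) = 1" by (simp add: prob_space)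
    then show ?thesis unfolding eL using iL i2 e2 by simp
  next
    fix \<mu> \<sigma> :: real assume s: "0 < \<sigma>" and D: "distributed M lborel L (\<lambda>x. ennreal (normal_density \<mu> \<sigma> x))"
    have eL: "expectation L = \<mu>" by (rule normal_distributed_expectation[OF s D])
    have "integrable lborel (\<lambda>x. normal_density \<mu> \<sigma> x *\<^sub>R x)"
      using integrable_normal_moment_nz_1[OF s] by simp
    then have iL: "integrable M L"
      using distributed_integrable[OF D, of "\<lambda>x. x"] by (simp)
    have i2: "integrable M (\<lambda>\<omega>. (L \<omega> - expectation L)\<^sup>2)"
      using distributed_integrable[OF D, of "\<lambda>x. (x - \<mu>)\<^sup>2"] integrable_normal_moment[OF s, of \<mu> 2] eL by simp
    have e2: "expectation (\<lambda>\<omega>. (L \<omega> - expectation L)\<^sup>2) = \<sigma>\<^sup>2"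
      using normal_distributed_variance[OF s D] by simp
    have D1: "distributed M lborel (\<lambda>\<omega>. (L \<omega> - \<mu>) / \<sigma>) std_normal_density"
      using normal_standard_normal_convert[OF s] D by simp
    have "(CLINT \<omega>|M. iexp (L \<omega> - \<mu>)) = (CLINT \<omega>|M. iexp (\<sigma> * ((L \<omega> - \<mu>) / \<sigma>)))"
      using s by simp
    also have "\<dots> = (CLINT x|distr M lborel (\<lambda>\<omega>. (L \<omega> - \<mu>) / \<sigma>). iexp (\<sigma> * x))"
      by (subst integral_distr) auto
    also have "\<dots> = char std_normal_distribution \<sigma>"
      unfolding char_def using D1 by (simp add: distributed_def)
    also have "\<dots> = of_real (exp (- (\<sigma>^2) / 2))" unfolding char_std_normal_distribution by simp
    finally show ?thesis using iL i2 e2 eL by simp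
  qed
  then show "integrable M L" "integrable M (\<lambda>\<omega>. (L \<omega> - expectation L)\<^sup>2)"
    "(CLINT \<omega>|M. iexp (L \<omega> - expectation L)) = of_real (exp (- expectation (\<lambda>\<omega>. (L \<omega> - expectation L)\<^sup>2) / 2))"
    by auto
qed

text \<open>Passing to the span of the centred coordinates reduces identities of laws and
  independence to computations with covariances.\<close>

lemma gaussian_process_space:
  assumes "prob_space M" and G: "gaussian_process M I m k X"
  shows "gaussian_space M (linear_span I (\<lambda>t \<omega>. X t \<omega> - m t))"
proof -
  interpret prob_space M by fact
  have lin: "gaussian_rv M (\<lambda>\<omega>. \<Sum>t\<in>J. c t * X t \<omega>)" if "finite J" "J \<subseteq> I" for J c
    using G that unfolding gaussian_process_def by auto
  have mean: "expectation (X t) = m t" if "t \<in> I" for t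
    using G that unfolding gaussian_process_def by auto
  have g: "gaussian_rv M (X t)" if "t \<in> I" for t
    using lin[of "{t}" "\<lambda>_. 1"] that by simp
  have int: "integrable M (X t)" if "t \<in> I" for t using gaussian_rv_centered(1)[OF g[OF that]] .
  have main: "S \<in> borel_measurable M \<and> integrable M (\<lambda>\<omega>. (S \<omega>)\<^sup>2) \<and> expectation S = 0 \<and>
     (CLINT \<omega>|M. iexp (S \<omega>)) = of_real (exp (- expectation (\<lambda>\<omega>. (S \<omega>)\<^sup>2) / 2))"
    if "S \<in> linear_span I (\<lambda>t \<omega>. X t \<omega> - m t)" for S
  proof -
    from that obtain J c where J: "finite J" "J \<subseteq> I" "S = (\<lambda>\<omega>. \<Sum>t\<in>J. c t * (X t \<omega> - m t))"
      by (rule linear_spanE)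
    define L where "L \<omega> = (\<Sum>t\<in>J. c t * X t \<omega>)" for \<omega>
    have gL: "gaussian_rv M L" using lin[OF J(1,2), of c] by (simp only: L_def[abs_def])
    have eL: "expectation L = (\<Sum>t\<in>J. c t * m t)"
    proof -
      have "expectation L = (\<Sum>t\<in>J. expectation (\<lambda>\<omega>. c t * X t \<omega>))"
        unfolding L_def by (rule Bochner_Integration.integral_sum) (use J(2) int in blast)
      also have "\<dots> = (\<Sum>t\<in>J. c t * m t)"
        by (rule sum.cong) (use J(2) mean in auto)
      finally show ?thesis .
    qed
    have S: "S = (\<lambda>\<omega>. L \<omega> - expectation L)"
      unfolding J(3) eL L_def by (auto simp: sum_subtractf right_diff_distrib)
    have [measurable]: "L \<in> borel_measurable M" using gL unfolding gaussian_rv_def by simp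
    show ?thesis unfolding S using gaussian_rv_centered[OF gL] by (simp add: prob_space)
  qed
  show ?thesis
  proof (unfold_locales, goal_cases)
    case 1 show ?case unfolding linear_span_def by (rule CollectI, rule exI[of _ "{}"]) auto
  next case (2 S T) then show ?case by (rule linear_span_add)
  next case (3 S c) then show ?case by (rule linear_span_scale)
  next case (4 S) then show ?case using main by blast
  next case (5 S) then show ?case using main by blast
  next case (6 S) then show ?case using main by blast
  next case (7 S) then show ?case using main by blast
  qed
qed

section \<open>Brownian bridges and cyclic shifts\<close>

text \<open>Rounding down makes the approximation one-sided, which suits left continuous paths. The
  clamp keeps the point in [0, 1] for every real \<open>s\<close>, since the path space has no
  coordinates elsewhere.\<close>

definition dyadic_below :: "nat \<Rightarrow> real \<Rightarrow> real"
  where "dyadic_below n s = real_of_int \<lfloor>2 ^ n * max 0 (min 1 s)\<rfloor> / 2 ^ n"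

text \<open>Depends measurably on a path in the product space, and returns the path itself if it is left continuous.\<close>

definition regularize :: "(real \<Rightarrow> real) \<Rightarrow> real \<Rightarrow> real"
  where "regularize f s = lim (\<lambda>n. f (dyadic_below n s))"

lemma dyadic_below_bounds:
  "0 \<le> dyadic_below n s" "dyadic_below n s \<le> 1" 
  "s \<in> {0..1} \<Longrightarrow> dyadic_below n s \<le> s" "s \<in> {0..1} \<Longrightarrow> s - 1 / 2 ^ n \<le> dyadic_below n s"
proof -
  define c where "c = max 0 (min 1 s)"
  have c: "0 \<le> c" "c \<le> 1" "s \<in> {0..1} \<Longrightarrow> c = s" unfolding c_def by auto
  have le: "dyadic_below n s \<le> c"
    unfolding dyadic_below_def c_def[symmetric] by (simp add: field_simps)
  have "(2 ^ n * c - 1) / 2 ^ n \<le> real_of_int \<lfloor>2 ^ n * c\<rfloor> / 2 ^ n"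
    by (rule divide_right_mono) (linarith, simp)
  then have ge: "c - 1 / 2 ^ n \<le> dyadic_below n s"
    unfolding dyadic_below_def c_def[symmetric] by (simp add: diff_divide_distrib)
  show "0 \<le> dyadic_below n s" unfolding dyadic_below_def by simp
  show "dyadic_below n s \<le> 1" using le c by simp
  show "s \<in> {0..1} \<Longrightarrow> dyadic_below n s \<le> s" using le c by simp
  show "s \<in> {0..1} \<Longrightarrow> s - 1 / 2 ^ n \<le> dyadic_below n s" using ge c by simp
qed

lemma dyadic_below_tendsto:
  assumes "s \<in> {0..1}" shows "(\<lambda>n. dyadic_below n s) \<longlonglongrightarrow> s"
proof (rule tendsto_sandwich[of "\<lambda>n. s - 1 / 2 ^ n" _ _ "\<lambda>_. s"])
  have "(\<lambda>n. s - (1/2) ^ n) \<longlonglongrightarrow> s - 0"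
    by (intro tendsto_intros LIMSEQ_power_zero) auto
  then show "(\<lambda>n. s - 1 / 2 ^ n) \<longlonglongrightarrow> s" by (simp add: power_one_over)
qed (use dyadic_below_bounds assms in auto)

lemma regularize_eq:
  assumes s: "s \<in> {0..1}" and f: "continuous (at s within {0..s}) f"
  shows "regularize f s = f s"
  unfolding regularize_def
proof (rule limI)
  show "(\<lambda>n. f (dyadic_below n s)) \<longlonglongrightarrow> f s"
    using continuous_within_tendsto_compose'[OF f _ dyadic_below_tendsto[OF s]] dyadic_below_bounds s
    by auto
qed

lemma regularize_continuous:
  assumes "s \<in> {0..1}" and f: "continuous_on {0..1} f"
  shows "regularize f s = f s"
proof (rule regularize_eq[OF assms(1)])
  show "continuous (at s within {0..s}) f"
  proof (rule continuous_within_subset)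
    show "continuous (at s within {0..1}) f"
      using assms unfolding continuous_on_eq_continuous_within by blast
    show "{0..s} \<subseteq> {0..1}" using assms(1) by simp
  qed
qed

text \<open>The dyadic point takes countably many values, and for each of them evaluation is a fixed
  coordinate projection; joint measurability survives the limit. Plain evaluation is not jointly
  measurable on the product space.\<close>

lemma measurable_regularize[measurable]:
  "(\<lambda>p. regularize (fst p) (snd p)) \<in> borel_measurable (path_space {0..1} \<Otimes>\<^sub>M borel)"
proof -
  have "(\<lambda>p. fst p (dyadic_below n (snd p))) \<in> borel_measurable (path_space {0..1} \<Otimes>\<^sub>M borel)" for n
  proof -
    define I where "I = {k::int. real_of_int k / 2 ^ n \<in> {0..1}}"
    have "(\<lambda>p. (\<lambda>k p. fst p (real_of_int k / 2 ^ n)) (\<lfloor>2 ^ n * max 0 (min 1 (snd p :: real))\<rfloor>) p) \<in> borel_measurable (path_space {0..1} \<Otimes>\<^sub>M borel)"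
    proof (rule measurable_compose_countable'[where I=I])
      fix k assume "k \<in> I"
      then have [measurable]: "(\<lambda>f. f (real_of_int k / 2 ^ n)) \<in> borel_measurable (path_space {0..1})"
        unfolding I_def by (intro measurable_component_singleton) auto
      show "(\<lambda>p. fst p (real_of_int k / 2 ^ n)) \<in> borel_measurable (path_space {0..1} \<Otimes>\<^sub>M borel)"
        by measurable
    next
      have 1: "(\<lambda>p :: (real \<Rightarrow> real) \<times> real. \<lfloor>2 ^ n * max 0 (min 1 (snd p))\<rfloor>) \<in> path_space {0..1} \<Otimes>\<^sub>M borel \<rightarrow>\<^sub>M count_space UNIV"
        by (rule measurable_compose[OF _ measurable_real_floor]) measurable
      have 2: "\<lfloor>2 ^ n * max 0 (min 1 (snd p))\<rfloor> \<in> I" for p :: "(real \<Rightarrow> real) \<times> real"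
        using dyadic_below_bounds(1,2)[of n "snd p"] unfolding I_def dyadic_below_def by auto
      show "(\<lambda>p :: (real \<Rightarrow> real) \<times> real. \<lfloor>2 ^ n * max 0 (min 1 (snd p))\<rfloor>) \<in> path_space {0..1} \<Otimes>\<^sub>M borel \<rightarrow>\<^sub>M count_space I"
        using measurable_restrict_space2[OF _ 1, of I] 2 by (simp add: restrict_count_space Pi_iff)
    qed (auto intro: countable_subset[OF subset_UNIV])
    then show ?thesis unfolding dyadic_below_def by simp
  qed
  then show ?thesis
    unfolding regularize_def by (intro borel_measurable_lim_metric)
qed

lemma measurable_regularize'[measurable (raw)]:
  assumes "f \<in> K \<rightarrow>\<^sub>M path_space {0..1}" "s \<in> borel_measurable K"
  shows "(\<lambda>p. regularize (f p) (s p)) \<in> borel_measurable K"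
  using measurable_compose[OF measurable_Pair[OF assms] measurable_regularize] by simp

section \<open>Occupation time below zero and its uniform law\<close>

definition below :: "(real \<Rightarrow> real) \<Rightarrow> real"
  where "below f = measure lborel {s\<in>{0..1}. f s < 0}"

lemma measure_unit_interval_measurable:
  assumes [measurable]: "Measurable.pred (K \<Otimes>\<^sub>M borel) (\<lambda>p. P (fst p) (snd p))"
  shows "(\<lambda>p. measure lborel {s\<in>{0..1::real}. P p s}) \<in> borel_measurable K"
proof -
  define Q where "Q = {p \<in> space (K \<Otimes>\<^sub>M borel). snd p \<in> {0..1::real} \<and> P (fst p) (snd p)}"
  have "Q \<in> sets (K \<Otimes>\<^sub>M borel)" unfolding Q_def by measurable
  then have Q: "Q \<in> sets (K \<Otimes>\<^sub>M lborel)" by (simp cong: sets_pair_measure_cong)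
  have "(\<lambda>p. emeasure lborel (Pair p -` Q)) \<in> borel_measurable K"
    using Q by (rule sigma_finite_measure.measurable_emeasure_Pair[OF lborel.sigma_finite_measure_axioms])
  then have "(\<lambda>p. enn2real (emeasure lborel (Pair p -` Q))) \<in> borel_measurable K" by simp
  moreover have "Pair p -` Q = {s\<in>{0..1}. P p s}" if "p \<in> space K" for p
    using that by (auto simp: Q_def space_pair_measure)
  ultimately show ?thesis
    unfolding measure_def by (subst measurable_cong[where g="\<lambda>p. enn2real (emeasure lborel (Pair p -` Q))"]) auto
qed

lemma measurable_below_regularize[measurable (raw)]:
  assumes [measurable]: "f \<in> K \<rightarrow>\<^sub>M path_space {0..1}"
  shows "(\<lambda>p. below (regularize (f p))) \<in> borel_measurable K"
  unfolding below_def by (rule measure_unit_interval_measurable) measurable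

lemma below_cong: "(\<And>s. s \<in> {0..1} \<Longrightarrow> f s = g s) \<Longrightarrow> below f = below g"
  unfolding below_def by (rule arg_cong[where f="measure lborel"]) auto

lemma below_nonneg: "0 \<le> below f" unfolding below_def by simp

text \<open>The probability integral transform. Without atoms the distribution function is
  continuous and takes every level in (0, 1).\<close>

lemma (in real_distribution) cdf_uniform:
  assumes atomless: "\<And>c. measure M {c} = 0" and a: "0 < a" "a < 1"
  shows "measure M {c. cdf M c \<le> a} = a"
proof -
  have cont: "isCont (cdf M) c" for c using isCont_cdf atomless by simp
  have ex: "\<exists>c. cdf M c = d" if d: "0 < d" "d < 1" for d
  proof -
    have "eventually (\<lambda>c. cdf M c < d) at_bot" using cdf_lim_at_bot d by (auto dest: order_tendstoD)
    then obtain l where l: "cdf M l < d" by (auto simp: eventually_at_bot_linorder)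
    have "eventually (\<lambda>c. cdf M c > d) at_top" using cdf_lim_at_top_prob d by (auto dest: order_tendstoD)
    then obtain r where r: "cdf M r > d" by (auto simp: eventually_at_top_linorder)
    have "l \<le> r" using l r cdf_nondecreasing[of r l] by linarith
    then show ?thesis using IVT'[of "cdf M" l d r] l r cont by (auto simp: continuous_at_imp_continuous_on)
  qed
  have "cdf M \<in> borel_measurable borel"
    by (rule borel_measurable_mono) (auto simp: mono_def cdf_nondecreasing)
  then have S: "{c. cdf M c \<le> a} \<in> events" by simp
  obtain c where c: "cdf M c = a" using ex a by blast
  have "measure M {..c} \<le> measure M {c. cdf M c \<le> a}"
    using c cdf_nondecreasing[of _ c] S by (intro finite_measure_mono) auto
  then have ge: "a \<le> measure M {c. cdf M c \<le> a}" using c by (simp add: cdf_def)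
  \<comment> \<open>The distribution function may be constant to the right of \<open>c\<close>, so
    the sublevel set is enclosed in half-lines belonging to strictly higher levels.\<close>
  have "measure M {c. cdf M c \<le> a} \<le> d" if d: "a < d" for d
  proof (cases "d < 1")
    case True
    then obtain e where e: "cdf M e = d" using ex a d by force
    have "measure M {c. cdf M c \<le> a} \<le> measure M {..e}"
    proof (rule finite_measure_mono, safe)
      fix x assume x: "cdf M x \<le> a"
      show "x \<le> e" using cdf_nondecreasing[of e x] x e d by linarith
    qed simp
    then show ?thesis using e by (simp add: cdf_def)
  next
    case False
    then show ?thesis using prob_le_1[of "{c. cdf M c \<le> a}"] by linarith
  qed
  then have "measure M {c. cdf M c \<le> a} \<le> a" by (rule dense_ge)
  then show ?thesis using ge by simp
qed

text \<open>Continuity holds at every sample point, whereas the end values are 0 only almost surely,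
  as a consequence of the covariance.\<close>

locale bridge_space = gaussian_space M V for M :: "'a measure" and V +
  fixes \<beta> :: "real \<Rightarrow> 'a \<Rightarrow> real"
  assumes bridge_mem: "\<And>s. s \<in> {0..1} \<Longrightarrow> \<beta> s \<in> V"
    and bridge_cov: "\<And>s t. s \<in> {0..1} \<Longrightarrow> t \<in> {0..1} \<Longrightarrow> expectation (\<lambda>\<omega>. \<beta> s \<omega> * \<beta> t \<omega>) = min s t - s * t"
    and bridge_continuous: "\<And>\<omega>. \<omega> \<in> space M \<Longrightarrow> continuous_on {0..1} (\<lambda>s. \<beta> s \<omega>)"

lemma brownian_bridge_space:
  assumes "brownian_bridge M 1 0 0 \<beta>"
  shows "\<exists>V. bridge_space M V \<beta>"
proof -
  have c: "continuous_process M {0..1} \<beta>" and g: "gaussian_process M {0..1} (\<lambda>t. 0) (\<lambda>s t. min s t - s * t) \<beta>"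
    using assms unfolding brownian_bridge_def by auto
  have M: "prob_space M" using c unfolding continuous_process_def by simp
  interpret gaussian_space M "linear_span {0..1} (\<lambda>t \<omega>. \<beta> t \<omega> - 0)"
    by (rule gaussian_process_space[OF M g])
  have "bridge_space M (linear_span {0..1} (\<lambda>t \<omega>. \<beta> t \<omega> - 0)) \<beta>"
  proof (unfold_locales, goal_cases)
    case (1 s) then show ?case using linear_span_base[of s "{0..1}" "\<lambda>t \<omega>. \<beta> t \<omega> - 0"] by simp
  next
    case (2 s t) then show ?case using g unfolding gaussian_process_def by simp
  next
    case (3 \<omega>) then show ?case using c unfolding continuous_process_def by simp
  qed
  then show ?thesis ..
qed

context bridge_space
begin

abbreviation "bpath \<equiv> path_of {0..1} \<beta>"

lemma bridge_measurable: "s \<in> {0..1} \<Longrightarrow> \<beta> s \<in> borel_measurable M"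
  using bridge_mem mem_measurable by blast

lemma measurable_bpath[measurable]: "bpath \<in> M \<rightarrow>\<^sub>M path_space {0..1}"
  unfolding path_of_def using bridge_measurable by (intro measurable_restrict) auto

lemma regularize_bpath: 
  assumes "\<omega> \<in> space M" "s \<in> {0..1}"
  shows "regularize (bpath \<omega>) s = \<beta> s \<omega>"
proof -
  have "continuous_on {0..1} (bpath \<omega>)"
    by (rule continuous_on_eq[OF bridge_continuous[OF assms(1)]]) (simp add: path_of_def)
  then show ?thesis using assms by (subst regularize_continuous) (auto simp: path_of_def)
qed

lemma bridge_cov': 
  assumes "s \<in> {0..1}" "t \<in> {0..1}"
  shows "expectation (\<lambda>\<omega>. \<beta> s \<omega> * \<beta> t \<omega>) = min s t - s * t" "integrable M (\<lambda>\<omega>. \<beta> s \<omega> * \<beta> t \<omega>)"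
  using bridge_cov mem_prod_integrable bridge_mem assms by auto

lemma bridge_diff_neq:
  assumes "s \<in> {0<..<1}" "t \<in> {0<..<1}" "s \<noteq> t"
  shows "AE \<omega> in M. \<beta> s \<omega> \<noteq> \<beta> t \<omega>"
proof -
  have e: "expectation (\<lambda>\<omega>. (\<beta> s \<omega> - \<beta> t \<omega>)\<^sup>2) = 
     expectation (\<lambda>\<omega>. \<beta> s \<omega> * \<beta> s \<omega> + \<beta> t \<omega> * \<beta> t \<omega> - 2 * (\<beta> s \<omega> * \<beta> t \<omega>))"
    by (simp add: power2_eq_square algebra_simps)
  also have "\<dots> = (s - s * s) + (t - t * t) - 2 * (min s t - s * t)"
    using assms by (simp add: bridge_cov')
  also have "\<dots> = \<bar>s - t\<bar> * (1 - \<bar>s - t\<bar>)"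
    by (cases "s \<le> t") (simp_all add: min_def algebra_simps)
  also have "\<dots> > 0" using assms by (intro mult_pos_pos) auto
  finally have "AE \<omega> in M. \<beta> s \<omega> - \<beta> t \<omega> \<noteq> 0"
    using assms by (intro mem_prob_eq diff_mem bridge_mem) auto
  then show ?thesis by auto
qed

lemma bridge_neq:
  assumes "s \<in> {0<..<1}" shows "AE \<omega> in M. \<beta> s \<omega> \<noteq> c"
proof (rule mem_prob_eq)
  have "expectation (\<lambda>\<omega>. (\<beta> s \<omega>)\<^sup>2) = s * (1 - s)"
    using bridge_cov'(1)[of s s] assms by (simp add: power2_eq_square algebra_simps)
  also have "\<dots> > 0" using assms by auto
  finally show "0 < expectation (\<lambda>\<omega>. (\<beta> s \<omega>)\<^sup>2)" .
qed (use assms bridge_mem in auto)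

lemma AE_bridge_zero: "AE \<omega> in M. \<beta> 0 \<omega> = 0 \<and> \<beta> 1 \<omega> = 0"
proof -
  have "AE \<omega> in M. \<beta> 0 \<omega> = 0" by (rule mem_zero_AE) (use bridge_mem bridge_cov[of 0 0] in \<open>auto simp: power2_eq_square\<close>)
  moreover have "AE \<omega> in M. \<beta> 1 \<omega> = 0" by (rule mem_zero_AE) (use bridge_mem bridge_cov[of 1 1] in \<open>auto simp: power2_eq_square\<close>)
  ultimately show ?thesis by auto
qed

text \<open>At each fixed interior time the law is Gaussian with positive variance; Fubini turns
  this into a statement about almost every time of almost every path. The level may depend on time
  so that bridges with drift are covered.\<close>

lemma AE_level_null:
  assumes [measurable]: "c \<in> borel_measurable borel"
  shows "AE \<omega> in M. AE s in lborel. s \<in> {0<..<1} \<longrightarrow> \<beta> s \<omega> \<noteq> c s"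
proof -
  interpret pair_sigma_finite lborel M ..
  have *: "AE s in lborel. AE \<omega> in M. s \<in> {0<..<1} \<longrightarrow> regularize (bpath \<omega>) s \<noteq> c s"
  proof (rule AE_I2)
    fix s :: real
    show "AE \<omega> in M. s \<in> {0<..<1} \<longrightarrow> regularize (bpath \<omega>) s \<noteq> c s"
    proof (cases "s \<in> {0<..<1}")
      case True
      from bridge_neq[OF this, of "c s"] AE_space show ?thesis 
        by eventually_elim (use True in \<open>auto simp: regularize_bpath\<close>)
    qed (rule AE_I2, blast)
  qed
  have "AE \<omega> in M. AE s in lborel. s \<in> {0<..<1} \<longrightarrow> regularize (bpath \<omega>) s \<noteq> c s"
    by (rule AE_commute[THEN iffD1, OF _ *]) measurable
  then show ?thesis using AE_space
  proof eventually_elim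
    case (elim \<omega>)
    then show ?case by (elim eventually_mono) (auto simp: regularize_bpath)
  qed
qed

text \<open>Uncountably many levels are excluded simultaneously by comparing two times: almost
  surely, almost all pairs of times carry different values.\<close>

lemma AE_no_atoms: "AE \<omega> in M. \<forall>c. AE s in lborel. s \<in> {0<..<1} \<longrightarrow> \<beta> s \<omega> \<noteq> c"
proof -
  interpret LLM: pair_sigma_finite "lborel \<Otimes>\<^sub>M lborel :: (real \<times> real) measure" M 
    by (intro pair_sigma_finite.intro sigma_finite_measure_axioms) (metis lborel_prod lborel.sigma_finite_measure_axioms)
  let ?P = "\<lambda>p \<omega>. fst p \<in> {0<..<1} \<and> snd p \<in> {0<..<1} \<and> fst p \<noteq> snd p \<longrightarrow> regularize (bpath \<omega>) (fst p) \<noteq> regularize (bpath \<omega>) (snd p)"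
  have *: "AE p in lborel \<Otimes>\<^sub>M lborel. AE \<omega> in M. ?P p \<omega>"
  proof (rule AE_I2)
    fix p :: "real \<times> real"
    show "AE \<omega> in M. ?P p \<omega>"
    proof (cases "fst p \<in> {0<..<1} \<and> snd p \<in> {0<..<1} \<and> fst p \<noteq> snd p")
      case True
      then have "AE \<omega> in M. \<beta> (fst p) \<omega> \<noteq> \<beta> (snd p) \<omega>" by (intro bridge_diff_neq) auto
      from this AE_space show ?thesis by eventually_elim (use True in \<open>auto simp: regularize_bpath\<close>)
    qed (rule AE_I2, blast)
  qed
  have "AE \<omega> in M. AE p in lborel \<Otimes>\<^sub>M lborel. ?P p \<omega>"
    by (rule LLM.AE_commute[THEN iffD1, OF _ *]) measurable
  then show ?thesis using AE_space
  proof eventually_elim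
    case (elim \<omega>)
    have "AE s in lborel. AE t in lborel. ?P (s, t) \<omega>"
      by (rule lborel_pair.AE_pair) (use elim in auto)
    then have ae: "AE s in lborel. AE t in lborel. s \<in> {0<..<1} \<and> t \<in> {0<..<1} \<and> s \<noteq> t \<longrightarrow> \<beta> s \<omega> \<noteq> \<beta> t \<omega>"
    proof eventually_elim
      case (elim s)
      then show ?case by (elim eventually_mono) (use \<open>\<omega> \<in> space M\<close> in \<open>auto simp: regularize_bpath\<close>)
    qed
    show ?case
    proof
      fix c
      show "AE s in lborel. s \<in> {0<..<1} \<longrightarrow> \<beta> s \<omega> \<noteq> c"
      \<comment> \<open>Call \<open>s\<close> good if almost every other time carries a different
        value. A level attained at a good \<open>s\<close> is attained almost nowhere else; a level
        attained at no good time is confined to the null set of bad times.\<close>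
      proof (cases "\<exists>s\<in>{0<..<1}. \<beta> s \<omega> = c \<and> (AE t in lborel. s \<in> {0<..<1} \<and> t \<in> {0<..<1} \<and> s \<noteq> t \<longrightarrow> \<beta> s \<omega> \<noteq> \<beta> t \<omega>)")
        case True
        then obtain s where s: "s \<in> {0<..<1}" "\<beta> s \<omega> = c" "AE t in lborel. s \<in> {0<..<1} \<and> t \<in> {0<..<1} \<and> s \<noteq> t \<longrightarrow> \<beta> s \<omega> \<noteq> \<beta> t \<omega>" by blast
        have "AE t in lborel. t \<noteq> s" by (rule AE_lborel_singleton)
        then show ?thesis using s(3) by eventually_elim (use s(1,2) in auto)
      next
        case False
        show ?thesis using ae by eventually_elim (use False in blast)
      qed
    qed
  qed
qed

text \<open>The value taken at time \<open>1 - v\<close> makes the shifted path left continuous even when \<open>\<beta> 0\<close> and \<open>\<beta> 1\<close>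
  differ (which they may on a null set).\<close>

definition cyclic_shift :: "real \<Rightarrow> real \<Rightarrow> 'a \<Rightarrow> real"
  where "cyclic_shift v s \<omega> = \<beta> (if s + v \<le> 1 then s + v else s + v - 1) \<omega> - \<beta> v \<omega>"

text \<open>The bridge closes up to a loop with stationary increments, so restarting it at
  \<open>v\<close> leaves the covariance unchanged, and the covariance determines the law.\<close>

lemma cyclic_shift_law:
  assumes v: "v \<in> {0<..<1}"
  shows "distr M (path_space {0..1}) (path_of {0..1} (cyclic_shift v)) = distr M (path_space {0..1}) bpath"
  unfolding path_of_def
proof (rule gaussian_path_law_unique)
  show "gaussian_space M V" "gaussian_space M V" by (rule gaussian_space_axioms)+
  define r where "r s = (if s + v \<le> 1 then s + v else s + v - 1)" for s
  have r: "r s \<in> {0..1}" if "s \<in> {0..1}" for s using that v unfolding r_def by auto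
  have cs: "cyclic_shift v s = (\<lambda>\<omega>. \<beta> (r s) \<omega> - \<beta> v \<omega>)" for s
    unfolding cyclic_shift_def r_def by auto
  have vI: "v \<in> {0..1}" using v by auto
  show "cyclic_shift v s \<in> V" if "s \<in> {0..1}" for s
    unfolding cs by (intro diff_mem bridge_mem r that vI)
  show "\<beta> s \<in> V" if "s \<in> {0..1}" for s using that by (rule bridge_mem)
  fix s t :: real assume s: "s \<in> {0..1}" and t: "t \<in> {0..1}"
  note B = bridge_mem[OF r[OF s]] bridge_mem[OF vI] bridge_mem[OF r[OF t]] bridge_mem[OF vI]
  have "expectation (\<lambda>\<omega>. cyclic_shift v s \<omega> * cyclic_shift v t \<omega>) = 
    (min (r s) (r t) - r s * r t) - (min (r s) v - r s * v) - (min v (r t) - v * r t) + (min v v - v * v)"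
    unfolding cs expectation_diff_mult_diff[OF B]
    by (simp only: bridge_cov r[OF s] r[OF t] vI)
  also have "\<dots> = (min (r s) (r t) - r s * r t) - (min (r s) v - r s * v) - (min (r t) v - r t * v) + (v - v * v)"
    by (simp only: min.commute[of v "r t"] mult.commute[of v "r t"] min.idem)
  \<comment> \<open>\<open>r\<close> rotates the time circle by \<open>v\<close>; the four cases
    record which of \<open>s\<close> and \<open>t\<close> wrap around.\<close>
  also have "\<dots> = min s t - s * t"
  proof -
    have r1: "r p = p + v" if "p + v \<le> 1" for p using that by (simp add: r_def)
    have r2: "r p = p + v - 1" if "\<not> p + v \<le> 1" for p using that by (simp add: r_def)
    have b: "0 \<le> s" "s \<le> 1" "0 \<le> t" "t \<le> 1" "0 < v" "v < 1" using s t v by simp_all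
    have m: "min (r p) v = (if p + v \<le> 1 then v else p + v - 1)" if "0 \<le> p" "p \<le> 1" for p
      using that b r1[of p] r2[of p] by (cases "p + v \<le> 1") (simp_all add: min_def)
    have m1: "min (r s) (r t) = min s t + v" if "s + v \<le> 1" "t + v \<le> 1"
      using r1[OF that(1)] r1[OF that(2)] by linarith
    have m2: "min (r s) (r t) = min s t + v - 1" if "\<not> s + v \<le> 1" "\<not> t + v \<le> 1"
      using r2[OF that(1)] r2[OF that(2)] by linarith
    have m3: "min (r s) (r t) = t + v - 1" "min s t = s" if "s + v \<le> 1" "\<not> t + v \<le> 1"
      using r1[OF that(1)] r2[OF that(2)] that b by linarith+
    have m4: "min (r s) (r t) = s + v - 1" "min s t = t" if "\<not> s + v \<le> 1" "t + v \<le> 1"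
      using r2[OF that(1)] r1[OF that(2)] that b by linarith+
    show ?thesis
    proof (cases "s + v \<le> 1"; cases "t + v \<le> 1")
      assume c: "s + v \<le> 1" "t + v \<le> 1"
      show ?thesis unfolding m[OF b(1,2)] m[OF b(3,4)] m1[OF c] unfolding r1[OF c(1)] r1[OF c(2)] using c by (simp add: algebra_simps)
    next
      assume c: "s + v \<le> 1" "\<not> t + v \<le> 1"
      show ?thesis unfolding m[OF b(1,2)] m[OF b(3,4)] m3[OF c] unfolding r1[OF c(1)] r2[OF c(2)] using c by (simp add: algebra_simps)
    next
      assume c: "\<not> s + v \<le> 1" "t + v \<le> 1"
      show ?thesis unfolding m[OF b(1,2)] m[OF b(3,4)] m4[OF c] unfolding r2[OF c(1)] r1[OF c(2)] using c by (simp add: algebra_simps)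
    next
      assume c: "\<not> s + v \<le> 1" "\<not> t + v \<le> 1"
      show ?thesis unfolding m[OF b(1,2)] m[OF b(3,4)] m2[OF c] unfolding r2[OF c(1)] r2[OF c(2)] using c by (simp add: algebra_simps)
    qed
  qed
  also have "\<dots> = expectation (\<lambda>\<omega>. \<beta> s \<omega> * \<beta> t \<omega>)" using s t by (simp add: bridge_cov')
  finally show "expectation (\<lambda>\<omega>. cyclic_shift v s \<omega> * cyclic_shift v t \<omega>) = expectation (\<lambda>\<omega>. \<beta> s \<omega> * \<beta> t \<omega>)" .
qed

lemma regularize_cyclic_shift:
  assumes v: "v \<in> {0<..<1}" and \<omega>: "\<omega> \<in> space M" and s: "s \<in> {0..1}"
  shows "regularize (path_of {0..1} (cyclic_shift v) \<omega>) s = cyclic_shift v s \<omega>"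
proof -
  have cont: "continuous_on {0..1} (\<lambda>s. \<beta> s \<omega>)" using bridge_continuous[OF \<omega>] .
  have "continuous (at s within {0..s}) (\<lambda>s. cyclic_shift v s \<omega>)"
  proof (cases "s + v \<le> 1")
    case True
    have "continuous_on {0..s} (\<lambda>s. \<beta> (s + v) \<omega> - \<beta> v \<omega>)"
      by (intro continuous_intros continuous_on_compose2[OF cont]) (use s v True in auto)
    then have "continuous_on {0..s} (\<lambda>s. cyclic_shift v s \<omega>)"
      by (rule continuous_on_eq) (use True in \<open>auto simp: cyclic_shift_def\<close>)
    then show ?thesis using s by (auto simp: continuous_on_eq_continuous_within)
  next
    case False
    have "continuous_on {1-v<..s} (\<lambda>s. \<beta> (s + v - 1) \<omega> - \<beta> v \<omega>)"
      by (intro continuous_intros continuous_on_compose2[OF cont]) (use s v False in auto)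
    then have "continuous_on {1-v<..s} (\<lambda>s. cyclic_shift v s \<omega>)"
      by (rule continuous_on_eq) (use False in \<open>auto simp: cyclic_shift_def\<close>)
    then have "continuous (at s within {1-v<..s}) (\<lambda>s. cyclic_shift v s \<omega>)" 
      using False by (auto simp: continuous_on_eq_continuous_within)
    \<comment> \<open>For \<open>s > 1 - v\<close> the left filter at \<open>s\<close> does not see
      the times up to \<open>1 - v\<close>, where the other branch of the shift is in force.\<close>
    moreover have "at s within {1-v<..s} = at s within {0..s}"
    proof (rule at_within_nhd)
      show "s \<in> {1-v<..}" using False by simp
      have "{1-v<..s} \<inter> {1-v<..} = {0..s} \<inter> {1-v<..}"
      proof (rule set_eqI)
        fix r
        have "v < 1" using v by simp
        then have "1 - v < r \<Longrightarrow> 0 \<le> r" by linarith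
        then show "r \<in> {1-v<..s} \<inter> {1-v<..} \<longleftrightarrow> r \<in> {0..s} \<inter> {1-v<..}"
          unfolding Int_iff greaterThanAtMost_iff greaterThan_iff atLeastAtMost_iff by blast
      qed
      then show "{1-v<..s} \<inter> {1-v<..} - {s} = {0..s} \<inter> {1-v<..} - {s}" by (rule arg_cong)
    qed simp
    ultimately show ?thesis by (simp only: continuous_within)
  qed
  then have c: "continuous (at s within {0..s}) (path_of {0..1} (cyclic_shift v) \<omega>)"
  proof (rule continuous_transform_within[of _ _ _ 1])
    fix r assume "r \<in> {0..s}"
    then show "cyclic_shift v r \<omega> = path_of {0..1} (cyclic_shift v) \<omega> r"
      using s by (simp add: path_of_def)
  qed (use s in simp_all)
  have "path_of {0..1} (cyclic_shift v) \<omega> s = cyclic_shift v s \<omega>"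
    using s by (simp add: path_of_def)
  then show ?thesis by (simp only: regularize_eq[OF s c])
qed

lemma sublevel_measurable:
  assumes \<omega>: "\<omega> \<in> space M"
  shows "{s\<in>{0..1}. \<beta> s \<omega> < c} \<in> sets borel"
proof -
  have "{s\<in>{0..1}. regularize (bpath \<omega>) s < c} \<in> sets borel"
  proof -
    have [measurable]: "(\<lambda>s. regularize (bpath \<omega>) s) \<in> borel_measurable borel"
      by (rule measurable_regularize') (use measurable_space[OF measurable_bpath \<omega>] in simp_all)
    show ?thesis by measurable
  qed
  also have "{s\<in>{0..1}. regularize (bpath \<omega>) s < c} = {s\<in>{0..1}. \<beta> s \<omega> < c}"
    using \<omega> by (auto simp: regularize_bpath)
  finally show ?thesis .
qed

text \<open>Rotation preserves Lebesgue measure, hence the time that the shifted path spends below 0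
  is the rank of the value at \<open>v\<close> among all values of the original path.\<close>

lemma below_cyclic_shift:
  assumes v: "v \<in> {0<..<1}" and \<omega>: "\<omega> \<in> space M"
  shows "below (regularize (path_of {0..1} (cyclic_shift v) \<omega>)) = measure lborel {s\<in>{0<..<1}. \<beta> s \<omega> < \<beta> v \<omega>}"
proof -
  define P where "P s \<longleftrightarrow> \<beta> s \<omega> < \<beta> v \<omega>" for s
  define A where "A = {s\<in>{v..1}. P s}"
  define B where "B = {s\<in>{0<..v}. P s}"
  have Pm: "{s\<in>{0..1}. P s} \<in> sets borel" unfolding P_def by (rule sublevel_measurable[OF \<omega>])
  have AB: "A = {s\<in>{0..1}. P s} \<inter> {v..1}" "B = {s\<in>{0..1}. P s} \<inter> {0<..v}" using v by (auto simp: A_def B_def)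
  then have [measurable]: "A \<in> sets borel" "B \<in> sets borel" using Pm by auto
  have nv: "v \<notin> A" "v \<notin> B" by (auto simp: A_def B_def P_def)
  have mt: "(\<lambda>s. c + s) ` E \<in> sets borel" if [measurable]: "E \<in> sets borel" for c :: real and E
  proof -
    have "(\<lambda>s. c + s) ` E = {s. s - c \<in> E}" by (auto intro!: image_eqI[of _ _ "_ - c"])
    also have "\<dots> \<in> sets borel" by measurable
    finally show ?thesis .
  qed
  have tr: "measure lborel ((\<lambda>s. c + s) ` E) = measure lborel E" if "E \<in> sets borel" for c :: real and E
    using measure_translation[of c E] measure_completion[of _ lborel] mt[OF that, of c] that by simp
  have fm: "E \<in> fmeasurable lborel" if "E \<in> sets borel" "E \<subseteq> {-1..2}" for E :: "real set"
    by (rule fmeasurableI2[of "{-1..2}"]) (use that in \<open>auto intro!: fmeasurableI\<close>)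
  have e1: "below (regularize (path_of {0..1} (cyclic_shift v) \<omega>)) = measure lborel {s\<in>{0..1}. cyclic_shift v s \<omega> < 0}"
    unfolding below_def by (rule arg_cong[where f="measure lborel"]) (use regularize_cyclic_shift[OF v \<omega>] in auto)
  have e2: "{s\<in>{0..1}. cyclic_shift v s \<omega> < 0} = (\<lambda>s. -v + s) ` A \<union> (\<lambda>s. (1-v) + s) ` B"
  proof (rule set_eqI)
    fix s
    have 1: "s \<in> (\<lambda>s. -v + s) ` A \<longleftrightarrow> s + v \<in> A"
    proof
      assume "s + v \<in> A" then show "s \<in> (\<lambda>s. -v + s) ` A" by (intro image_eqI[of _ _ "s + v"]) auto
    qed auto
    have 2: "s \<in> (\<lambda>s. (1-v) + s) ` B \<longleftrightarrow> s + v - 1 \<in> B"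
    proof
      assume "s + v - 1 \<in> B" then show "s \<in> (\<lambda>s. (1-v) + s) ` B" by (intro image_eqI[of _ _ "s + v - 1"]) auto
    qed auto
    show "s \<in> {s\<in>{0..1}. cyclic_shift v s \<omega> < 0} \<longleftrightarrow> s \<in> (\<lambda>s. -v + s) ` A \<union> (\<lambda>s. (1-v) + s) ` B"
      unfolding Un_iff 1 2 using v by (auto simp: A_def B_def P_def cyclic_shift_def)
  qed
  have subAB: "A \<subseteq> {0..1}" "B \<subseteq> {0..1}" using AB by blast+
  have e3: "measure lborel ((\<lambda>s. -v + s) ` A \<union> (\<lambda>s. (1-v) + s) ` B) = measure lborel ((\<lambda>s. -v + s) ` A) + measure lborel ((\<lambda>s. (1-v) + s) ` B)"
  proof (rule measure_Un_AE)
    show "AE x in lborel. x \<notin> (\<lambda>s. -v + s) ` A \<or> x \<notin> (\<lambda>s. (1-v) + s) ` B"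
      using v by (intro AE_I2) (auto simp: A_def B_def)
    show "(\<lambda>s. -v + s) ` A \<in> fmeasurable lborel" 
      by (intro fm mt) (use v subAB in auto)
    show "(\<lambda>s. (1-v) + s) ` B \<in> fmeasurable lborel" 
      by (intro fm mt) (use v subAB in auto)
  qed
  have e4: "measure lborel (A \<union> B) = measure lborel A + measure lborel B"
  proof (rule measure_Un_AE)
    show "AE x in lborel. x \<notin> A \<or> x \<notin> B"
      using nv by (intro AE_I2) (auto simp: A_def B_def)
    show "A \<in> fmeasurable lborel" by (intro fm) (use subAB in auto)
    show "B \<in> fmeasurable lborel" by (intro fm) (use subAB in auto)
  qed
  have e5: "measure lborel (A \<union> B) = measure lborel {s\<in>{0<..<1}. P s}"
  proof (rule measure_eq_AE)
    have "AE x in lborel. x \<noteq> (1::real)" by (rule AE_lborel_singleton)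
    then show "AE x in lborel. (x \<in> A \<union> B) = (x \<in> {s \<in> {0<..<1}. P s})"
      by eventually_elim (use v in \<open>auto simp: A_def B_def\<close>)
    have "{s\<in>{0<..<1}. P s} = {s\<in>{0..1}. P s} \<inter> {0<..<1}" by auto
    then show "{s\<in>{0<..<1}. P s} \<in> sets lborel" using Pm by auto
  qed simp
  have t: "measure lborel ((\<lambda>s. -v + s) ` A) = measure lborel A" "measure lborel ((\<lambda>s. (1-v) + s) ` B) = measure lborel B"
    by (rule tr; fact)+
  show ?thesis unfolding e1 e2 e3 t e4[symmetric] e5 P_def by (rule refl)
qed

text \<open>The occupation time has the law of the rank of \<open>\<beta> v\<close>, whatever
  \<open>v\<close> is. Let \<open>v\<close> be uniform and independent of the path, and fix the path
  instead: the rank is then the distribution function of the atomless occupation measure evaluated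
  at one of its own samples, and such a value is uniform.\<close>

theorem below_bridge_uniform:
  assumes a: "0 < a" "a < 1"
  shows "prob {\<omega>\<in>space M. below (\<lambda>s. \<beta> s \<omega>) \<le> a} = a"
proof -
  define U where "U = uniform_measure lborel {0<..<1::real}"
  interpret U: prob_space U unfolding U_def by (rule prob_space_uniform_measure) auto
  have sU[measurable_cong, simp]: "sets U = sets borel" unfolding U_def by auto
  have spU[simp]: "space U = UNIV" unfolding U_def by auto
  have UM: "pair_sigma_finite U M"
    by (intro pair_sigma_finite.intro U.sigma_finite_measure_axioms sigma_finite_measure_axioms)
  define G where "G \<omega> v = measure lborel {s\<in>{0..1}. s \<in> {0<..<1} \<and> regularize (bpath \<omega>) s < regularize (bpath \<omega>) v}" for \<omega> v
  have Gm[measurable]: "(\<lambda>p. G (fst p) (snd p)) \<in> borel_measurable (M \<Otimes>\<^sub>M borel)"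
    unfolding G_def by (rule measure_unit_interval_measurable) measurable
  have Geq: "G \<omega> v = measure lborel {s\<in>{0<..<1}. \<beta> s \<omega> < \<beta> v \<omega>}" if "\<omega> \<in> space M" "v \<in> {0<..<1}" for \<omega> v
    unfolding G_def using that by (intro arg_cong[where f="measure lborel"]) (auto simp: regularize_bpath)
  define S where "S = {f\<in>space (path_space {0..1}). below (regularize f) \<le> a}"
  have S: "S \<in> sets (path_space {0..1})" unfolding S_def by measurable
  have b0: "prob {\<omega>\<in>space M. below (\<lambda>s. \<beta> s \<omega>) \<le> a} = measure (distr M (path_space {0..1}) bpath) S"
  proof -
    have "below (\<lambda>s. \<beta> s \<omega>) = below (regularize (bpath \<omega>))" if "\<omega> \<in> space M" for \<omega>
      by (rule below_cong) (use that in \<open>auto simp: regularize_bpath\<close>)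
    then have "{\<omega> \<in> space M. below (\<lambda>s. \<beta> s \<omega>) \<le> a} = bpath -` S \<inter> space M"
      unfolding S_def using measurable_space[OF measurable_bpath] by auto
    then show ?thesis by (simp add: measure_distr[OF measurable_bpath S])
  qed
  \<comment> \<open>The left side does not depend on \<open>v\<close>, which is what permits
    averaging over \<open>v\<close> afterwards.\<close>
  have eqv: "prob {\<omega>\<in>space M. below (\<lambda>s. \<beta> s \<omega>) \<le> a} = prob {\<omega>\<in>space M. G \<omega> v \<le> a}" if v: "v \<in> {0<..<1}" for v
  proof -
    have "cyclic_shift v s \<in> borel_measurable M" if "s \<in> {0..1}" for s
      unfolding cyclic_shift_def using that v by (intro borel_measurable_diff bridge_measurable) auto
    then have m: "path_of {0..1} (cyclic_shift v) \<in> M \<rightarrow>\<^sub>M path_space {0..1}"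
      unfolding path_of_def by (intro measurable_restrict) auto
    have "{\<omega>\<in>space M. G \<omega> v \<le> a} = path_of {0..1} (cyclic_shift v) -` S \<inter> space M"
    proof -
      have "below (regularize (path_of {0..1} (cyclic_shift v) \<omega>)) = G \<omega> v" if "\<omega> \<in> space M" for \<omega>
        by (simp only: below_cyclic_shift[OF v that] Geq[OF that v])
      then show ?thesis unfolding S_def using measurable_space[OF m] by auto
    qed
    then show ?thesis unfolding b0 cyclic_shift_law[OF v, symmetric] by (simp add: measure_distr[OF m S])
  qed
  have UA: "AE v in U. v \<in> {0<..<1}" unfolding U_def by (intro AE_uniform_measureI) auto
  have inner: "AE \<omega> in M. measure U {v\<in>space U. G \<omega> v \<le> a} = a"
    using AE_no_atoms AE_space
  proof eventually_elim
    case (elim \<omega>)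
    define f where "f s = regularize (bpath \<omega>) s" for s
    have [measurable]: "f \<in> borel_measurable borel" unfolding f_def using elim(2) by measurable
    then have fU: "f \<in> U \<rightarrow>\<^sub>M borel" by (simp only: measurable_cong_sets[OF sU refl])
    have feq: "f s = \<beta> s \<omega>" if "s \<in> {0<..<1}" for s unfolding f_def using that elim(2) by (simp add: regularize_bpath)
    define D where "D = distr U borel f"
    interpret D: real_distribution D unfolding D_def by (rule U.real_distribution_distr) (rule fU)
    have mU: "measure U A = measure lborel ({0<..<1} \<inter> A)" if "A \<in> sets borel" for A
      unfolding U_def using that by (subst measure_uniform_measure) auto
    have mD: "measure D A = measure lborel ({0<..<1} \<inter> f -` A)" if "A \<in> sets borel" for A
      unfolding D_def by (subst measure_distr[OF fU]) (use that in \<open>auto intro!: mU measurable_sets_borel[of f borel]\<close>)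
    have atom: "measure D {c} = 0" for c
    proof -
      have ae: "AE s in lborel. s \<notin> {0<..<1} \<inter> f -` {c}"
        using elim(1)[rule_format, of c] by eventually_elim (auto simp: feq)
      have "{0<..<1} \<inter> f -` {c} \<in> sets lborel" using measurable_sets_borel[of f borel "{c}"] by auto
      from AE_iff_null_sets[OF this] ae have "measure lborel ({0<..<1} \<inter> f -` {c}) = 0" by (simp add: measure_eq_0_null_sets)
      then show ?thesis by (simp add: mD)
    qed
    \<comment> \<open>\<open>G\<close> counts strictly smaller values and the distribution function
      weakly smaller ones; the absence of atoms reconciles them.\<close>
    have cdfG: "G \<omega> v = cdf D (f v)" for v
    proof -
      have "{..f v} = {..<f v} \<union> {f v}" by auto
      then have "cdf D (f v) = measure D ({..<f v} \<union> {f v})" by (simp add: cdf_def)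
      also have "\<dots> = measure D {..<f v} + measure D {f v}"
        by (rule D.finite_measure_Union) auto
      also have "\<dots> = measure lborel ({0<..<1} \<inter> f -` {..<f v})" using atom[of "f v"] mD[of "{..<f v}"] by simp
      also have "{0<..<1} \<inter> f -` {..<f v} = {s\<in>{0..1}. s \<in> {0<..<1} \<and> f s < f v}" by auto
      also have "measure lborel \<dots> = G \<omega> v" unfolding G_def f_def by (rule refl)
      finally show ?thesis by (rule sym)
    qed
    have T: "{c. cdf D c \<le> a} \<in> sets borel"
    proof -
      have "cdf D \<in> borel_measurable borel"
        by (rule borel_measurable_mono) (auto simp: mono_def D.cdf_nondecreasing)
      then show ?thesis by simp
    qed
    have "measure U {v\<in>space U. G \<omega> v \<le> a} = measure U (f -` {c. cdf D c \<le> a} \<inter> space U)"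
      by (rule arg_cong[where f="measure U"]) (auto simp: cdfG)
    also have "\<dots> = measure D {c. cdf D c \<le> a}" 
      unfolding D_def[symmetric] using measure_distr[OF fU, of "{c. cdf D c \<le> a}"] T by (simp only: D_def[symmetric])
    also have "\<dots> = a" by (rule D.cdf_uniform[OF atom a])
    finally show ?case .
  qed
  define p where "p = prob {\<omega>\<in>space M. below (\<lambda>s. \<beta> s \<omega>) \<le> a}"
  have Gm1: "(\<lambda>\<omega>. G \<omega> v) \<in> borel_measurable M" for v
    using measurable_compose[OF _ Gm, of "\<lambda>\<omega>. (\<omega>, v)" M] by simp
  have Gm2: "(\<lambda>v. G \<omega> v) \<in> borel_measurable U" if "\<omega> \<in> space M" for \<omega>
  proof -
    have "(\<lambda>v. G \<omega> v) \<in> borel_measurable borel"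
      using measurable_compose[OF _ Gm, of "\<lambda>v. (\<omega>, v)" borel] that by simp
    then show ?thesis by (simp only: measurable_cong_sets[OF sU refl])
  qed
  \<comment> \<open>Fubini exchanges averaging over the path with \<open>v\<close> fixed for
    averaging over \<open>v\<close> with the path fixed.\<close>
  have "ennreal p = (\<integral>\<^sup>+v. ennreal p \<partial>U)" using U.emeasure_space_1 by simp
  also have "\<dots> = (\<integral>\<^sup>+v. (\<integral>\<^sup>+\<omega>. of_bool (G \<omega> v \<le> a) \<partial>M) \<partial>U)"
  proof (rule nn_integral_cong_AE)
    show "AE v in U. ennreal p = (\<integral>\<^sup>+\<omega>. of_bool (G \<omega> v \<le> a) \<partial>M)"
      using UA
    proof eventually_elim
      case (elim v)
      have "(\<integral>\<^sup>+\<omega>. of_bool (G \<omega> v \<le> a) \<partial>M) = (\<integral>\<^sup>+\<omega>. indicator {\<omega>\<in>space M. G \<omega> v \<le> a} \<omega> \<partial>M)"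
        by (rule nn_integral_cong) (simp add: indicator_def)
      also have "\<dots> = emeasure M {\<omega>\<in>space M. G \<omega> v \<le> a}"
        using Gm1 by (intro nn_integral_indicator) simp
      finally show "ennreal p = (\<integral>\<^sup>+\<omega>. of_bool (G \<omega> v \<le> a) \<partial>M)"
        unfolding p_def eqv[OF elim] by (simp add: emeasure_eq_measure)
    qed
  qed
  also have "\<dots> = (\<integral>\<^sup>+\<omega>. (\<integral>\<^sup>+v. of_bool (G \<omega> v \<le> a) \<partial>U) \<partial>M)"
  proof -
    have "(\<lambda>q. G (snd q) (fst q)) \<in> borel_measurable (U \<Otimes>\<^sub>M M)"
      using measurable_compose[OF _ Gm, of "\<lambda>q. (snd q, fst q)" "U \<Otimes>\<^sub>M M"] by simp
    then have "(\<lambda>(v, \<omega>). of_bool (G \<omega> v \<le> a) :: ennreal) \<in> borel_measurable (U \<Otimes>\<^sub>M M)"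
      by (simp add: split_beta)
    from pair_sigma_finite.Fubini'[OF UM this] show ?thesis by (rule sym)
  qed
  also have "\<dots> = (\<integral>\<^sup>+\<omega>. ennreal a \<partial>M)"
  proof (rule nn_integral_cong_AE)
    show "AE \<omega> in M. (\<integral>\<^sup>+v. of_bool (G \<omega> v \<le> a) \<partial>U) = ennreal a"
      using inner AE_space
    proof eventually_elim
      case (elim \<omega>)
      have "(\<integral>\<^sup>+v. of_bool (G \<omega> v \<le> a) \<partial>U) = (\<integral>\<^sup>+v. indicator {v\<in>space U. G \<omega> v \<le> a} v \<partial>U)"
        by (rule nn_integral_cong) (simp add: indicator_def)
      also have "\<dots> = emeasure U {v\<in>space U. G \<omega> v \<le> a}"
        using Gm2[OF elim(2)] by (intro nn_integral_indicator) simp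
      finally show "(\<integral>\<^sup>+v. of_bool (G \<omega> v \<le> a) \<partial>U) = ennreal a" using elim(1) by (simp only: U.emeasure_eq_measure)
    qed
  qed
  also have "\<dots> = ennreal a" by (simp add: emeasure_space_1)
  finally have "ennreal p = ennreal a" .
  then show ?thesis using a unfolding p_def by simp
qed

lemma below_bpath: "\<omega> \<in> space M \<Longrightarrow> below (\<lambda>s. \<beta> s \<omega>) = below (regularize (bpath \<omega>))"
  by (rule below_cong) (simp only: regularize_bpath)

lemma below_bridge_measurable: "(\<lambda>\<omega>. below (\<lambda>s. \<beta> s \<omega>)) \<in> borel_measurable M"
proof -
  have "(\<lambda>\<omega>. below (regularize (bpath \<omega>))) \<in> borel_measurable M" by measurable
  then show ?thesis by (rule measurable_cong[THEN iffD2, rotated]) (rule below_bpath)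
qed

lemma below_bridge_uniform':
  assumes a: "a < 1"
  shows "prob {\<omega>\<in>space M. below (\<lambda>s. \<beta> s \<omega>) \<le> a} = max 0 a"
proof (cases "0 < a")
  case True then show ?thesis using below_bridge_uniform a by simp
next
  case False
  \<comment> \<open>Levels at or below 0 are dominated by the uniform probabilities of arbitrarily
    small positive levels.\<close>
  have "prob {\<omega>\<in>space M. below (\<lambda>s. \<beta> s \<omega>) \<le> a} \<le> 0"
  proof (rule dense_ge)
    fix d :: real assume d: "0 < d"
    define e where "e = min d (1/2)"
    have "prob {\<omega>\<in>space M. below (\<lambda>s. \<beta> s \<omega>) \<le> a} \<le> prob {\<omega>\<in>space M. below (\<lambda>s. \<beta> s \<omega>) \<le> e}"
      using False d below_bridge_measurable by (intro finite_measure_mono) (auto simp: e_def)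
    also have "\<dots> = e" using d by (intro below_bridge_uniform) (auto simp: e_def)
    finally show "prob {\<omega>\<in>space M. below (\<lambda>s. \<beta> s \<omega>) \<le> a} \<le> d" by (simp add: e_def)
  qed
  then show ?thesis using False by (simp add: measure_le_0_iff)
qed

end

section \<open>Hitting times and the Markov property\<close>

lemma bridge_space_law:
  assumes "bridge_space M V \<beta>" "bridge_space M' V' \<beta>'"
  shows "distr M (path_space {0..1}) (path_of {0..1} \<beta>) = distr M' (path_space {0..1}) (path_of {0..1} \<beta>')"
proof -
  interpret A: bridge_space M V \<beta> by fact
  interpret B: bridge_space M' V' \<beta>' by fact
  show ?thesis unfolding path_of_def
  proof (rule gaussian_path_law_unique)
    show "gaussian_space M V" by (rule A.gaussian_space_axioms)
    show "gaussian_space M' V'" by (rule B.gaussian_space_axioms)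
  qed (simp_all only: A.bridge_mem B.bridge_mem A.bridge_cov B.bridge_cov)
qed

lemma bridge_space_prob:
  assumes A: "bridge_space M V \<beta>" and B: "bridge_space M' V' \<beta>'" and Q: "Q \<in> sets (path_space {0..1})"
  shows "measure M {\<omega>\<in>space M. path_of {0..1} \<beta> \<omega> \<in> Q} = measure M' {\<omega>\<in>space M'. path_of {0..1} \<beta>' \<omega> \<in> Q}"
proof -
  interpret A: bridge_space M V \<beta> by fact
  interpret B: bridge_space M' V' \<beta>' by fact
  have "{\<omega>\<in>space M. path_of {0..1} \<beta> \<omega> \<in> Q} = path_of {0..1} \<beta> -` Q \<inter> space M" by blast
  moreover have "{\<omega>\<in>space M'. path_of {0..1} \<beta>' \<omega> \<in> Q} = path_of {0..1} \<beta>' -` Q \<inter> space M'" by blast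
  moreover have "measure (distr M (path_space {0..1}) (path_of {0..1} \<beta>)) Q = measure (distr M' (path_space {0..1}) (path_of {0..1} \<beta>')) Q"
    by (simp only: bridge_space_law[OF A B])
  ultimately show ?thesis
    using measure_distr[OF A.measurable_bpath Q] measure_distr[OF B.measurable_bpath Q] by simp
qed

lemma measure_affine:
  assumes S: "S \<in> sets borel" and c: "0 < c"
  shows "measure lborel S = c * measure lborel {w::real. t + c * w \<in> S}"
proof -
  have m: "(\<lambda>x. indicator S x :: ennreal) \<in> borel_measurable borel" using S by simp
  have S': "{w. t + c * w \<in> S} \<in> sets borel"
    using measurable_sets_borel[of "\<lambda>w. t + c * w" borel S] S by (simp add: vimage_def)
  have "emeasure lborel S = (\<integral>\<^sup>+x. indicator S x \<partial>lborel)" using S by simp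
  also have "\<dots> = ennreal c * (\<integral>\<^sup>+x. indicator S (t + c * x) \<partial>lborel)"
    using nn_integral_real_affine[OF m, of c t] c by simp
  also have "(\<integral>\<^sup>+x. indicator S (t + c * x) \<partial>lborel) = (\<integral>\<^sup>+x. indicator {w. t + c * w \<in> S} x \<partial>lborel)"
    by (rule nn_integral_cong) (simp add: indicator_def)
  also have "\<dots> = emeasure lborel {w. t + c * w \<in> S}" using S' by simp
  finally show ?thesis unfolding measure_def using c by (simp add: enn2real_mult)
qed

definition hit :: "(real \<Rightarrow> real) \<Rightarrow> real"
  where "hit f = Inf {r\<in>{0..1}. f r \<le> 0 \<or> r = 1}"

lemma hit_bounds: "0 \<le> hit f" "hit f \<le> 1"
proof -
  have 1: "1 \<in> {r\<in>{0..1}. f r \<le> 0 \<or> r = 1}" by simp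
  show "0 \<le> hit f" unfolding hit_def by (rule cInf_greatest) (use 1 in blast, simp)
  show "hit f \<le> 1" unfolding hit_def by (rule cInf_lower[OF 1]) (rule bdd_belowI[of _ 0], simp)
qed

lemma hit_cong: "(\<And>r. r \<in> {0..1} \<Longrightarrow> f r = g r) \<Longrightarrow> hit f = hit g"
  unfolding hit_def by (rule arg_cong[where f=Inf]) auto

lemma hit_le: "r \<in> {0..1} \<Longrightarrow> f r \<le> 0 \<Longrightarrow> hit f \<le> r"
  unfolding hit_def by (rule cInf_lower) (simp, rule bdd_belowI[of _ 0], simp)

lemma before_hit: "0 \<le> r \<Longrightarrow> r < hit f \<Longrightarrow> 0 < f r"
  using hit_le[of r f] hit_bounds(2)[of f] by force

lemma hit_attained:
  assumes f: "continuous_on {0..1} f" and h: "hit f < 1"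
  shows "f (hit f) \<le> 0"
proof -
  define S where "S = {r\<in>{0..1}. f r \<le> 0 \<or> r = 1}"
  have "{r\<in>{0..1}. f r \<le> 0} = {0..1} \<inter> f -` {..0}" by auto
  moreover have "closed ({0..1} \<inter> f -` {..0})"
    by (rule continuous_closed_preimage[OF f]) simp_all
  ultimately have "closed ({r\<in>{0..1}. f r \<le> 0} \<union> {1})" by (intro closed_Un) simp_all
  moreover have "S = {r\<in>{0..1}. f r \<le> 0} \<union> {1}" unfolding S_def by auto
  ultimately have "closed S" by simp
  moreover have "S \<noteq> {}" unfolding S_def by force
  moreover have "bdd_below S" unfolding S_def by (rule bdd_belowI[of _ 0]) simp
  ultimately have "Inf S \<in> S" by (rule closed_contains_Inf[rotated 2])
  then show ?thesis using h unfolding hit_def S_def by simp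
qed

lemma hit_zero:
  assumes f: "continuous_on {0..1} f" and h: "hit f < 1" and f0: "0 < f 0"
  shows "f (hit f) = 0"
proof (rule antisym)
  show "f (hit f) \<le> 0" by (rule hit_attained[OF f h])
  have hp: "0 < hit f"
    using hit_attained[OF f h] f0 hit_bounds(1)[of f] by (cases "hit f = 0") auto
  show "0 \<le> f (hit f)"
  proof (rule ccontr)
    assume neg: "\<not> 0 \<le> f (hit f)"
    have "continuous_on {0..hit f} f" by (rule continuous_on_subset[OF f]) (use hit_bounds in auto)
    then obtain r where r: "0 \<le> r" "r \<le> hit f" "f r = 0"
      using IVT2'[of f "hit f" 0 0] neg f0 hp by auto
    then show False using before_hit[of r f] neg by (cases "r = hit f") auto
  qed
qed

text \<open>On continuous functions this countable condition says that \<open>f\<close> is nonpositive somewhere on \<open>[0, t]\<close>.\<close>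

definition hit_by :: "real \<Rightarrow> (real \<Rightarrow> real) \<Rightarrow> bool"
  where "hit_by t f \<longleftrightarrow> (\<forall>m::nat. \<exists>q\<in>\<rat> \<inter> {0..t}. f q < 1 / real (Suc m))"

text \<open>A continuous function that is positive on the compact interval has a positive minimum
  there; conversely, rationals close to a point with nonpositive value have values below every
  positive bound.\<close>

lemma hit_by_iff:
  assumes f: "continuous_on {0..t} f"
  shows "hit_by t f \<longleftrightarrow> (\<exists>r\<in>{0..t}. f r \<le> 0)"
proof
  assume H: "hit_by t f"
  show "\<exists>r\<in>{0..t}. f r \<le> 0"
  proof (rule ccontr)
    assume "\<not> (\<exists>r\<in>{0..t}. f r \<le> 0)"
    then have pos: "\<And>r. r \<in> {0..t} \<Longrightarrow> 0 < f r" by force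
    have ne: "{0..t} \<noteq> {}" using H unfolding hit_by_def by blast
    obtain x where x: "x \<in> {0..t}" "\<And>y. y \<in> {0..t} \<Longrightarrow> f x \<le> f y"
      using continuous_attains_inf[OF compact_Icc ne f] by blast
    obtain m where m: "1 / real (Suc m) < f x"
      using pos[OF x(1)] nat_approx_posE by metis
    obtain q where "q \<in> {0..t}" "f q < 1 / real (Suc m)" using H unfolding hit_by_def by blast
    then show False using x(2)[of q] m by linarith
  qed
next
  assume "\<exists>r\<in>{0..t}. f r \<le> 0"
  then obtain r where r: "r \<in> {0..t}" "f r \<le> 0" by blast
  show "hit_by t f" unfolding hit_by_def
  proof
    fix m
    show "\<exists>q\<in>\<rat> \<inter> {0..t}. f q < 1 / real (Suc m)"
    \<comment> \<open>A degenerate interval leaves no room for the density of the rationals; there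
      the point 0 is itself rational.\<close>
    proof (cases "t = 0")
      case True
      then have "r = 0" using r by simp
      moreover have "0 < 1 / real (Suc m)" by simp
      ultimately have "f 0 < 1 / real (Suc m)" using r(2) by (simp only:)
      then show ?thesis using True by (intro bexI[of _ 0]) simp_all
    next
      case False
      then have t: "0 < t" using r by simp
      have "0 < 1 / real (Suc m)" by simp
      with f r(1) obtain d where d: "0 < d" "\<And>x. x \<in> {0..t} \<Longrightarrow> dist x r < d \<Longrightarrow> dist (f x) (f r) < 1 / real (Suc m)"
        unfolding continuous_on_iff by meson
      have "max 0 (r - d) < min t (r + d)" using t d r by auto
      then obtain q where q: "max 0 (r - d) < of_rat q" "of_rat q < min t (r + d)" using of_rat_dense by blast
      have "of_rat q \<in> {0..t}" "dist (of_rat q) r < d" using q by (auto simp: dist_real_def)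
      then have "dist (f (of_rat q)) (f r) < 1 / real (Suc m)" by (rule d(2))
      then have "f (of_rat q) < 1 / real (Suc m)" using r(2) by (simp add: dist_real_def)
      then show ?thesis using \<open>of_rat q \<in> {0..t}\<close> by (intro bexI[of _ "of_rat q"]) auto
    qed
  qed
qed

text \<open>The restriction to \<open>t < 1\<close> is forced by \<open>hit\<close>, which does not
  exceed 1 even for positive functions.\<close>

lemma hit_by_hit:
  assumes f: "continuous_on {0..1} f" and t: "t < 1"
  shows "hit_by t f \<longleftrightarrow> hit f \<le> t"
proof -
  have f': "continuous_on {0..t} f" by (rule continuous_on_subset[OF f]) (use t in auto)
  have "(\<exists>r\<in>{0..t}. f r \<le> 0) \<longleftrightarrow> hit f \<le> t"
  proof
    assume "\<exists>r\<in>{0..t}. f r \<le> 0"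
    then obtain r where "r \<in> {0..t}" "f r \<le> 0" by blast
    then show "hit f \<le> t" using hit_le[of r f] t by auto
  next
    assume h: "hit f \<le> t"
    then have "f (hit f) \<le> 0" using hit_attained[OF f] t by simp
    then show "\<exists>r\<in>{0..t}. f r \<le> 0" using h hit_bounds(1)[of f] by (intro bexI[of _ "hit f"]) auto
  qed
  then show ?thesis using hit_by_iff[OF f'] by simp
qed

lemma hit_by_measurable:
  assumes "t \<le> u" "\<And>q. q \<in> {0..u} \<Longrightarrow> (\<lambda>p. F p q) \<in> borel_measurable K"
  shows "Measurable.pred K (\<lambda>p. hit_by t (F p))"
  unfolding hit_by_def pred_def
proof (intro sets.sets_Collect_countable_All sets.sets_Collect_countable_Ex')
  show "countable (\<rat> \<inter> {0..t})" using countable_rat by (rule countable_Int1)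
  fix m :: nat and q :: real assume "q \<in> \<rat> \<inter> {0..t}"
  then have [measurable]: "(\<lambda>p. F p q) \<in> borel_measurable K" using assms by auto
  show "{p \<in> space K. F p q < 1 / real (Suc m)} \<in> sets K" by measurable
qed

text \<open>Rounding is upwards because then the event that the rounded hitting time equals
  \<open>t\<close> is decided by the path up to \<open>t\<close>; rounding down would look into the
  future.\<close>

definition dyadic_above :: "nat \<Rightarrow> real \<Rightarrow> real"
  where "dyadic_above n s = real_of_int \<lceil>2 ^ n * s\<rceil> / 2 ^ n"

lemma dyadic_above_bounds: "s \<le> dyadic_above n s" "dyadic_above n s \<le> s + 1 / 2 ^ n"
proof -
  have "2 ^ n * s \<le> real_of_int \<lceil>2 ^ n * s\<rceil>" by (rule le_of_int_ceiling)
  then have "2 ^ n * s / 2 ^ n \<le> real_of_int \<lceil>2 ^ n * s\<rceil> / 2 ^ n" by (rule divide_right_mono) simp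
  then show "s \<le> dyadic_above n s" unfolding dyadic_above_def by simp
  have "real_of_int \<lceil>2 ^ n * s\<rceil> \<le> 2 ^ n * s + 1" by linarith
  then have "real_of_int \<lceil>2 ^ n * s\<rceil> / 2 ^ n \<le> (2 ^ n * s + 1) / 2 ^ n" by (rule divide_right_mono) simp
  then show "dyadic_above n s \<le> s + 1 / 2 ^ n" unfolding dyadic_above_def by (simp add: add_divide_distrib)
qed

lemma dyadic_above_le_1: "s \<le> 1 \<Longrightarrow> dyadic_above n s \<le> 1"
proof -
  assume "s \<le> 1"
  then have "2 ^ n * s \<le> of_int (2 ^ n)" by simp
  then have "\<lceil>2 ^ n * s\<rceil> \<le> 2 ^ n" by (rule ceiling_le)
  then have "real_of_int \<lceil>2 ^ n * s\<rceil> \<le> 2 ^ n" by (metis of_int_le_iff of_int_numeral of_int_power)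
  then show ?thesis unfolding dyadic_above_def by simp
qed

lemma dyadic_above_tendsto: "(\<lambda>n. dyadic_above n s) \<longlonglongrightarrow> s"
proof (rule tendsto_sandwich[of "\<lambda>_. s" _ _ "\<lambda>n. s + 1 / 2 ^ n"])
  have "(\<lambda>n. s + (1/2) ^ n) \<longlonglongrightarrow> s + 0"
    by (intro tendsto_intros LIMSEQ_power_zero) auto
  then show "(\<lambda>n. s + 1 / 2 ^ n) \<longlonglongrightarrow> s" by (simp add: power_one_over)
qed (simp_all add: dyadic_above_bounds)

lemma dyadic_above_eq_iff:
  "dyadic_above n s = real k / 2 ^ n \<longleftrightarrow> s \<le> real k / 2 ^ n \<and> \<not> s \<le> real k / 2 ^ n - 1 / 2 ^ n"
proof -
  have "dyadic_above n s = real k / 2 ^ n \<longleftrightarrow> real_of_int \<lceil>2 ^ n * s\<rceil> = real_of_int (int k)"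
    unfolding dyadic_above_def by simp
  also have "\<dots> \<longleftrightarrow> \<lceil>2 ^ n * s\<rceil> = int k" by (rule of_int_eq_iff)
  also have "\<dots> \<longleftrightarrow> real k - 1 < 2 ^ n * s \<and> 2 ^ n * s \<le> real k"
    by (simp add: ceiling_eq_iff)
  also have "2 ^ n * s \<le> real k \<longleftrightarrow> s \<le> real k / 2 ^ n" by (simp add: pos_le_divide_eq mult.commute)
  also have "real k - 1 < 2 ^ n * s \<longleftrightarrow> (real k - 1) / 2 ^ n < s" by (simp add: pos_divide_less_eq mult.commute)
  finally show ?thesis by (auto simp: diff_divide_distrib)
qed

lemma dyadic_above_cases:
  assumes s: "0 \<le> s" "s \<le> 1"
  shows "(\<exists>k<2 ^ n. dyadic_above n s = real k / 2 ^ n) \<or> dyadic_above n s = 1"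
proof -
  have "0 \<le> \<lceil>2 ^ n * s\<rceil>" using s by (simp add: order_less_le_trans[of "-1" 0])
  then obtain k where k: "\<lceil>2 ^ n * s\<rceil> = int k" using nonneg_int_cases by blast
  then have e: "dyadic_above n s = real k / 2 ^ n" unfolding dyadic_above_def by simp
  then have "real k / 2 ^ n \<le> 1" using dyadic_above_le_1[OF s(2), of n] by simp
  then have "real k \<le> 2 ^ n" by simp
  then have "k \<le> 2 ^ n" by (metis of_nat_le_iff of_nat_numeral of_nat_power)
  then show ?thesis using e by (cases "k = 2 ^ n") auto
qed

section \<open>The Markov property of the bridge\<close>

context bridge_space
begin

text \<open>The remainder of the bridge after \<open>t\<close>, with the chord from
  \<open>\<beta> t\<close> down to 0 removed and brought to unit length by Brownian scaling.\<close>

definition post :: "real \<Rightarrow> real \<Rightarrow> 'a \<Rightarrow> real"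
  where "post t w \<omega> = (\<beta> (t + w * (1 - t)) \<omega> - (1 - w) * \<beta> t \<omega>) / sqrt (1 - t)"

lemma neg_bridge: "bridge_space M V (\<lambda>s \<omega>. - \<beta> s \<omega>)"
proof (unfold_locales, goal_cases)
  case (1 s) then show ?case using scale_mem[OF bridge_mem[OF 1], of "-1"] by simp
next
  case (2 s t) then show ?case using bridge_cov[OF 2] by simp
next
  case (3 \<omega>) show ?case by (rule continuous_on_minus[OF bridge_continuous[OF 3]])
qed

lemma expectation_mult_scaled:
  fixes S T :: "'a \<Rightarrow> real"
  shows
  "expectation (\<lambda>\<omega>. S \<omega> * (c * T \<omega>)) = c * expectation (\<lambda>\<omega>. S \<omega> * T \<omega>)"
  "expectation (\<lambda>\<omega>. (c * S \<omega>) * T \<omega>) = c * expectation (\<lambda>\<omega>. S \<omega> * T \<omega>)"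
proof -
  have "S \<omega> * (c * T \<omega>) = c * (S \<omega> * T \<omega>)" "(c * S \<omega>) * T \<omega> = c * (S \<omega> * T \<omega>)" for \<omega> by simp_all
  then show "expectation (\<lambda>\<omega>. S \<omega> * (c * T \<omega>)) = c * expectation (\<lambda>\<omega>. S \<omega> * T \<omega>)"
    "expectation (\<lambda>\<omega>. (c * S \<omega>) * T \<omega>) = c * expectation (\<lambda>\<omega>. S \<omega> * T \<omega>)"
    by (simp_all only: integral_mult_right_zero)
qed

lemma post_time:
  fixes t w :: real
  assumes t: "0 \<le> t" "t < 1" and w: "w \<in> {0..1}"
  shows "t + w * (1 - t) \<in> {0..1}" "t \<le> t + w * (1 - t)" "t + w * (1 - t) \<le> 1"
proof -
  have "0 \<le> w * (1 - t)" using t w by simp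
  moreover have "w * (1 - t) \<le> 1 * (1 - t)" using t w by (intro mult_right_mono) auto
  ultimately have "t + 0 \<le> t + w * (1 - t)" "t + w * (1 - t) \<le> t + 1 * (1 - t)"
    by (simp_all only: add_le_cancel_left)
  then show "t \<le> t + w * (1 - t)" "t + w * (1 - t) \<le> 1" by simp_all
  then show "t + w * (1 - t) \<in> {0..1}" using t by simp
qed

lemma post_alt: "post t w = (\<lambda>\<omega>. (1 / sqrt (1 - t)) * (\<beta> (t + w * (1 - t)) \<omega> - (1 - w) * \<beta> t \<omega>))"
  unfolding post_def by auto

lemma post_mem:
  assumes t: "0 \<le> t" "t < 1" and w: "w \<in> {0..1}"
  shows "post t w \<in> V"
  unfolding post_alt
  by (intro scale_mem diff_mem bridge_mem post_time[OF t w]) (use t in auto)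

text \<open>A sign \<open>\<sigma>\<close> with square 1 is carried along so that the time below and
  the time above 0 after a hit are treated by one argument.\<close>

lemma post_bridge:
  assumes t: "0 \<le> t" "t < 1" and \<sigma>: "\<sigma> * \<sigma> = 1"
  shows "bridge_space M V (\<lambda>w \<omega>. \<sigma> * post t w \<omega>)"
proof (unfold_locales, goal_cases)
  case (1 w) then show ?case by (intro scale_mem post_mem t)
next
  case (2 w w')
  define p where "p = t + w * (1 - t)"
  define p' where "p' = t + w' * (1 - t)"
  have tI: "t \<in> {0..1}" using t by auto
  have pI: "p \<in> {0..1}" "p' \<in> {0..1}" and tp: "t \<le> p" "t \<le> p'" unfolding p_def p'_def using post_time[OF t] 2 by auto
  have minp: "min p p' = t + min w w' * (1 - t)"
    unfolding p_def p'_def using t by (cases "w \<le> w'") (auto simp: min_def mult_right_mono)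
  note B = bridge_mem[OF pI(1)] scale_mem[OF bridge_mem[OF tI], of "1 - w"] bridge_mem[OF pI(2)] scale_mem[OF bridge_mem[OF tI], of "1 - w'"]
  have "expectation (\<lambda>\<omega>. (\<sigma> * post t w \<omega>) * (\<sigma> * post t w' \<omega>)) = \<sigma> * \<sigma> * expectation (\<lambda>\<omega>. post t w \<omega> * post t w' \<omega>)"
    by (simp only: expectation_mult_scaled)
  also have "\<dots> = (1 / sqrt (1 - t)) * ((1 / sqrt (1 - t)) * 
      expectation (\<lambda>\<omega>. (\<beta> p \<omega> - (1 - w) * \<beta> t \<omega>) * (\<beta> p' \<omega> - (1 - w') * \<beta> t \<omega>)))"
    unfolding \<sigma> post_alt p_def[symmetric] p'_def[symmetric] by (simp only: expectation_mult_scaled mult_1)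
  also have "\<dots> = (1 / (1 - t)) * expectation (\<lambda>\<omega>. (\<beta> p \<omega> - (1 - w) * \<beta> t \<omega>) * (\<beta> p' \<omega> - (1 - w') * \<beta> t \<omega>))"
    using t by (simp add: mult.assoc[symmetric])
  also have "expectation (\<lambda>\<omega>. (\<beta> p \<omega> - (1 - w) * \<beta> t \<omega>) * (\<beta> p' \<omega> - (1 - w') * \<beta> t \<omega>)) = 
     (min p p' - p * p') - (1 - w') * (min p t - p * t) - (1 - w) * (min t p' - t * p') + (1 - w) * ((1 - w') * (min t t - t * t))"
    unfolding expectation_diff_mult_diff[OF B] by (simp only: expectation_mult_scaled bridge_cov pI tI) (simp add: mult.left_commute)
  also have "\<dots> = (t + min w w' * (1 - t) - p * p') - (1 - w') * (t - p * t) - (1 - w) * (t - t * p') + (1 - w) * ((1 - w') * (t - t * t))"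
    unfolding minp using tp by (simp add: min_absorb1 min_absorb2)
  also have "\<dots> = (1 - t) * (min w w' - w * w')"
    unfolding p_def p'_def by (simp add: algebra_simps)
  finally show ?case using t by simp
next
  case (3 \<omega>)
  have "continuous_on {0..1} (\<lambda>w. \<beta> (t + w * (1 - t)) \<omega>)"
    by (rule continuous_on_compose2[OF bridge_continuous[OF 3]]) (auto intro!: continuous_intros post_time[OF t])
  then show ?case unfolding post_def by (intro continuous_intros) (use t in auto)
qed

text \<open>Vanishing covariance suffices in a Gaussian space: subtracting the chord removes exactly
  the part of the future that is predictable from \<open>\<beta> t\<close>.\<close>

lemma post_independent:
  assumes t: "0 \<le> t" "t < 1" and P: "P \<in> sets (path_space {0..t})" and Q: "Q \<in> sets (path_space {0..1})"
  shows "prob {\<omega>\<in>space M. path_of {0..t} \<beta> \<omega> \<in> P \<and> path_of {0..1} (\<lambda>w \<omega>. \<sigma> * post t w \<omega>) \<omega> \<in> Q} =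
    prob {\<omega>\<in>space M. path_of {0..t} \<beta> \<omega> \<in> P} * prob {\<omega>\<in>space M. path_of {0..1} (\<lambda>w \<omega>. \<sigma> * post t w \<omega>) \<omega> \<in> Q}"
  unfolding path_of_def
proof (rule uncorrelated_imp_independent[OF _ _ _ P Q])
  show "\<beta> s \<in> V" if "s \<in> {0..t}" for s using that t by (intro bridge_mem) auto
  show "(\<lambda>\<omega>. \<sigma> * post t w \<omega>) \<in> V" if "w \<in> {0..1}" for w by (intro scale_mem post_mem t that)
  fix s w :: real assume s: "s \<in> {0..t}" and w: "w \<in> {0..1}"
  define p where "p = t + w * (1 - t)"
  have I: "s \<in> {0..1}" "t \<in> {0..1}" "p \<in> {0..1}" and le: "s \<le> t" "s \<le> p" using s t post_time[OF t w] unfolding p_def by auto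
  note B = bridge_mem[OF I(1)] zero_mem bridge_mem[OF I(3)] scale_mem[OF bridge_mem[OF I(2)], of "1 - w"]
  have "expectation (\<lambda>\<omega>. \<beta> s \<omega> * (\<sigma> * post t w \<omega>)) = \<sigma> * ((1 / sqrt (1 - t)) * expectation (\<lambda>\<omega>. (\<beta> s \<omega> - 0) * (\<beta> p \<omega> - (1 - w) * \<beta> t \<omega>)))"
    unfolding post_alt p_def[symmetric] by (simp only: expectation_mult_scaled diff_0_right)
  also have "expectation (\<lambda>\<omega>. (\<beta> s \<omega> - 0) * (\<beta> p \<omega> - (1 - w) * \<beta> t \<omega>)) = (min s p - s * p) - (1 - w) * (min s t - s * t)"
    unfolding expectation_diff_mult_diff[OF B] by (simp only: expectation_mult_scaled bridge_cov I) simp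
  also have "\<dots> = 0" using le unfolding p_def by (simp add: min_absorb1 algebra_simps)
  finally show "expectation (\<lambda>\<omega>. \<beta> s \<omega> * (\<sigma> * post t w \<omega>)) = 0" by simp
qed

text \<open>For a time with finitely many relevant values, each decided by the past, the Markov
  property follows by summing over the values. The target event \<open>Q\<close> may depend on the
  value.\<close>

lemma markov_discrete:
  assumes G: "finite G" "G \<subseteq> {0..<1}" and \<sigma>: "\<sigma> * \<sigma> = 1"
    and past: "\<And>t. t \<in> G \<Longrightarrow> \<exists>P\<in>sets (path_space {0..t}). \<forall>\<omega>\<in>space M. \<tau> \<omega> = t \<longleftrightarrow> path_of {0..t} \<beta> \<omega> \<in> P"
    and Q: "\<And>t. t \<in> G \<Longrightarrow> Q t \<in> sets (path_space {0..1})"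
  shows "prob {\<omega>\<in>space M. \<tau> \<omega> \<in> G \<and> path_of {0..1} (\<lambda>w \<omega>'. \<sigma> * post (\<tau> \<omega>) w \<omega>') \<omega> \<in> Q (\<tau> \<omega>)} =
    (\<Sum>t\<in>G. prob {\<omega>\<in>space M. \<tau> \<omega> = t} * prob {\<omega>\<in>space M. bpath \<omega> \<in> Q t})"
proof -
  define E where "E t = {\<omega>\<in>space M. \<tau> \<omega> = t \<and> path_of {0..1} (\<lambda>w \<omega>'. \<sigma> * post t w \<omega>') \<omega> \<in> Q t}" for t
  have E: "E t \<in> events \<and> prob (E t) = prob {\<omega>\<in>space M. \<tau> \<omega> = t} * prob {\<omega>\<in>space M. bpath \<omega> \<in> Q t}" if tG: "t \<in> G" for t
  proof -
    have t: "0 \<le> t" "t < 1" using tG G by auto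
    obtain P where P: "P \<in> sets (path_space {0..t})" "\<And>\<omega>. \<omega> \<in> space M \<Longrightarrow> \<tau> \<omega> = t \<longleftrightarrow> path_of {0..t} \<beta> \<omega> \<in> P"
      using past[OF tG] by blast
    interpret B: bridge_space M V "\<lambda>w \<omega>. \<sigma> * post t w \<omega>" by (rule post_bridge[OF t \<sigma>])
    have mp: "path_of {0..t} \<beta> \<in> M \<rightarrow>\<^sub>M path_space {0..t}"
      unfolding path_of_def using t by (intro measurable_restrict bridge_measurable) auto
    have Ee: "E t = {\<omega>\<in>space M. path_of {0..t} \<beta> \<omega> \<in> P \<and> path_of {0..1} (\<lambda>w \<omega>'. \<sigma> * post t w \<omega>') \<omega> \<in> Q t}"
      unfolding E_def using P(2) by blast
    have "E t = (path_of {0..t} \<beta> -` P \<inter> space M) \<inter> (path_of {0..1} (\<lambda>w \<omega>'. \<sigma> * post t w \<omega>') -` Q t \<inter> space M)"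
      unfolding Ee by blast
    then have 1: "E t \<in> events" using measurable_sets[OF mp P(1)] measurable_sets[OF B.measurable_bpath Q[OF tG]] by simp
    have eq: "{\<omega>\<in>space M. \<tau> \<omega> = t} = {\<omega>\<in>space M. path_of {0..t} \<beta> \<omega> \<in> P}" using P(2) by blast
    have "prob (E t) = prob {\<omega>\<in>space M. \<tau> \<omega> = t} * prob {\<omega>\<in>space M. path_of {0..1} (\<lambda>w \<omega>'. \<sigma> * post t w \<omega>') \<omega> \<in> Q t}"
      unfolding Ee eq by (rule post_independent[OF t P(1) Q[OF tG]])
    moreover have "prob {\<omega>\<in>space M. path_of {0..1} (\<lambda>w \<omega>'. \<sigma> * post t w \<omega>') \<omega> \<in> Q t} = prob {\<omega>\<in>space M. bpath \<omega> \<in> Q t}"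
      by (rule bridge_space_prob[OF B.bridge_space_axioms bridge_space_axioms Q[OF tG]])
    ultimately show ?thesis using 1 by simp
  qed
  have "{\<omega>\<in>space M. \<tau> \<omega> \<in> G \<and> path_of {0..1} (\<lambda>w \<omega>'. \<sigma> * post (\<tau> \<omega>) w \<omega>') \<omega> \<in> Q (\<tau> \<omega>)} = (\<Union>t\<in>G. E t)"
    unfolding E_def by blast
  moreover have "prob (\<Union>t\<in>G. E t) = (\<Sum>t\<in>G. prob (E t))"
    by (rule finite_measure_finite_Union[OF G(1)]) (use E in \<open>auto simp: disjoint_family_on_def E_def\<close>)
  ultimately show ?thesis using E by (simp cong: sum.cong)
qed

end

lemma Icc_less_measurable:
  assumes h: "continuous_on {0..1::real} h"
  shows "{r\<in>{0..1}. h r < (c::real)} \<in> sets borel"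
proof -
  have "closed ({0..1} \<inter> h -` {c..})" by (rule continuous_closed_preimage[OF h]) simp_all
  then have "{0..1} - ({0..1} \<inter> h -` {c..}) \<in> sets borel" by (intro sets.Diff borel_closed) simp_all
  moreover have "{r\<in>{0..1}. h r < c} = {0..1} - ({0..1} \<inter> h -` {c..})" by auto
  ultimately show ?thesis by simp
qed

lemma hit_by_cong:
  assumes "\<And>r. r \<in> {0..t} \<Longrightarrow> f r = g r" shows "hit_by t f \<longleftrightarrow> hit_by t g"
  unfolding hit_by_def by (intro all_cong1 bex_cong refl) (use assms in simp)

text \<open>The subtracted term is the chord from the value at \<open>t\<close> to 0 at time 1.
  Applied to a bridge path with \<open>t < 1\<close>, this is \<open>1 - t\<close> times the
  occupation time of the normalised remainder after \<open>t\<close>.\<close>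

definition tail_below :: "real \<Rightarrow> (real \<Rightarrow> real) \<Rightarrow> real \<Rightarrow> real"
  where "tail_below \<sigma> f t = measure lborel {r\<in>{0..1}. t \<le> r \<and> \<sigma> * (f r - f t * ((1 - r) / (1 - t))) < 0}"

lemma tail_set_measurable:
  assumes f: "continuous_on {0..1} f"
  shows "{r\<in>{0..1::real}. t \<le> r \<and> \<sigma> * (f r - c * ((1 - r) / d)) < (0::real)} \<in> sets borel"
proof -
  have cont: "continuous_on {0..1} (\<lambda>r. \<sigma> * (f r - c * ((1 - r) * inverse d)))"
    by (intro continuous_on_mult continuous_on_diff continuous_on_const continuous_on_id f)
  have "{t..} \<in> sets (borel :: real measure)" by simp
  from sets.Int[OF Icc_less_measurable[OF cont, of 0] this]
  have "{r\<in>{0..1}. \<sigma> * (f r - c * ((1 - r) / d)) < 0} \<inter> {t..} \<in> sets borel"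
    unfolding divide_inverse .
  moreover have "{r\<in>{0..1}. t \<le> r \<and> \<sigma> * (f r - c * ((1 - r) / d)) < 0} = {r\<in>{0..1}. \<sigma> * (f r - c * ((1 - r) / d)) < 0} \<inter> {t..}"
    by (rule set_eqI) (simp only: mem_Collect_eq Int_iff atLeast_iff conj_ac)
  ultimately show ?thesis by (simp only:)
qed

lemma measure_tendsto_Icc:
  assumes S: "\<And>n. S n \<in> sets borel" "\<And>n. S n \<subseteq> {0..1}" and L: "L \<in> sets borel" "L \<subseteq> {0..1}"
    and lim: "AE r in lborel. eventually (\<lambda>n. r \<in> S n \<longleftrightarrow> r \<in> L) sequentially"
  shows "(\<lambda>n. measure lborel (S n)) \<longlonglongrightarrow> measure lborel (L :: real set)"
proof -
  have "(\<lambda>n. LINT r|lborel. indicator (S n) r) \<longlonglongrightarrow> (LINT r|lborel. indicator L r :: real)"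
  proof (rule integral_dominated_convergence[where w="indicator {0..1::real}"])
    show "AE r in lborel. (\<lambda>n. indicator (S n) r) \<longlonglongrightarrow> (indicator L r :: real)"
      using lim
    proof eventually_elim
      case (elim r)
      then have "eventually (\<lambda>n. indicator (S n) r = (indicator L r :: real)) sequentially"
        by (rule eventually_mono) (simp add: indicator_def)
      then show ?case by (rule tendsto_eventually)
    qed
    show "AE r in lborel. norm (indicator (S n) r :: real) \<le> indicator {0..1} r" for n
      by (rule AE_I2) (use S(2)[of n] in \<open>auto simp: indicator_def\<close>)
    show "integrable lborel (indicator {0..1::real} :: real \<Rightarrow> real)"
      by (rule integrable_real_indicator) simp_all
  qed (use S L in simp_all)
  then show ?thesis using S L by simp
qed

text \<open>Dominated convergence: at almost every \<open>r > T\<close> the chord tends to 0 because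
  \<open>f T = 0\<close>, and since \<open>f r\<close> is nonzero the sign is eventually the right
  one. Approximation from above ensures that times before \<open>T\<close> never enter.\<close>

lemma tail_below_tendsto:
  assumes f: "continuous_on {0..1} f" and T: "0 \<le> T" "T \<le> 1" and fT: "T < 1 \<Longrightarrow> f T = 0"
    and Tn: "\<And>n. T \<le> Tn n" "\<And>n. Tn n \<le> 1" "Tn \<longlonglongrightarrow> T"
    and null: "AE r in lborel. r \<in> {0<..<1} \<longrightarrow> f r \<noteq> 0" and \<sigma>: "\<sigma> \<noteq> 0"
  shows "(\<lambda>n. tail_below \<sigma> f (Tn n)) \<longlonglongrightarrow> measure lborel {r\<in>{0..1}. T \<le> r \<and> \<sigma> * f r < 0}"
  unfolding tail_below_def
proof (rule measure_tendsto_Icc)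
  show "{r\<in>{0..1}. Tn n \<le> r \<and> \<sigma> * (f r - f (Tn n) * ((1 - r) / (1 - Tn n))) < 0} \<in> sets borel" for n
    by (rule tail_set_measurable[OF f])
  show "{r\<in>{0..1}. T \<le> r \<and> \<sigma> * f r < 0} \<in> sets borel"
    using tail_set_measurable[OF f, of T \<sigma> 0 1] by simp
  have "AE r in lborel. r \<noteq> (0::real)" "AE r in lborel. r \<noteq> (1::real)" "AE r in lborel. r \<noteq> T"
    by (rule AE_lborel_singleton)+
  then show "AE r in lborel. \<forall>\<^sub>F n in sequentially. (r \<in> {r\<in>{0..1}. Tn n \<le> r \<and> \<sigma> * (f r - f (Tn n) * ((1 - r) / (1 - Tn n))) < 0})
      \<longleftrightarrow> r \<in> {r\<in>{0..1}. T \<le> r \<and> \<sigma> * f r < 0}"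
    using null
  proof eventually_elim
    case (elim r)
    show ?case
    proof (cases "r \<in> {0..1} \<and> T < r")
      case False
      then have "\<not> (r \<in> {0..1} \<and> T \<le> r)" using elim(3) by auto
      then have "\<not> (r \<in> {0..1} \<and> Tn n \<le> r)" for n using Tn(1)[of n] by auto
      then show ?thesis using \<open>\<not> (r \<in> {0..1} \<and> T \<le> r)\<close> by (intro always_eventually allI) blast
    next
      case True
      then have r: "0 < r" "r < 1" "T < r" using elim by auto
      then have fr: "f r \<noteq> 0" using elim by simp
      have T1: "T < 1" using r by simp
      have fTn: "(\<lambda>n. f (Tn n)) \<longlonglongrightarrow> f T"
      proof (rule continuous_on_tendsto_compose[OF f Tn(3)])
        show "T \<in> {0..1}" using T by simp
        have "Tn n \<in> {0..1}" for n using order_trans[OF T(1) Tn(1)] Tn(2) by simp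
        then show "\<forall>\<^sub>F n in sequentially. Tn n \<in> {0..1}" by (intro always_eventually allI)
      qed
      have "(\<lambda>n. (1 - r) / (1 - Tn n)) \<longlonglongrightarrow> (1 - r) / (1 - T)"
        by (rule tendsto_divide[OF tendsto_const tendsto_diff[OF tendsto_const Tn(3)]]) (use T1 in simp)
      then have "(\<lambda>n. \<sigma> * (f r - f (Tn n) * ((1 - r) / (1 - Tn n)))) \<longlonglongrightarrow> \<sigma> * (f r - f T * ((1 - r) / (1 - T)))"
        by (intro tendsto_mult tendsto_diff tendsto_const fTn)
      then have lim: "(\<lambda>n. \<sigma> * (f r - f (Tn n) * ((1 - r) / (1 - Tn n)))) \<longlonglongrightarrow> \<sigma> * f r"
        using fT[OF T1] by simp
      have ev: "\<forall>\<^sub>F n in sequentially. Tn n < r" using order_tendstoD(2)[OF Tn(3) r(3)] .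
      show ?thesis
      proof (cases "\<sigma> * f r < 0")
        case True
        have "\<forall>\<^sub>F n in sequentially. \<sigma> * (f r - f (Tn n) * ((1 - r) / (1 - Tn n))) < 0"
          using order_tendstoD(2)[OF lim True] .
        with ev show ?thesis by eventually_elim (use r True in simp)
      next
        case False
        moreover have "\<sigma> * f r \<noteq> 0" using fr \<sigma> by simp
        ultimately have "0 < \<sigma> * f r" by linarith
        from order_tendstoD(1)[OF lim this]
        show ?thesis by eventually_elim (use False in simp)
      qed
    qed
  qed
qed blast+

text \<open>Almost sure convergence implies convergence in probability, and shifting the level by
  \<open>d\<close> traps the limit between \<open>F (v - d)\<close> and \<open>F (v + d)\<close>.
  The bound \<open>bnd\<close> reflects that the distribution functions of the approximants are
  given only below it.\<close>

lemma (in prob_space) AE_tendsto_prob_le: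
  fixes X :: "'a \<Rightarrow> real"
  assumes Xm[measurable]: "\<And>n. Xn n \<in> borel_measurable M" "X \<in> borel_measurable M"
    and ae: "AE \<omega> in M. (\<lambda>n. Xn n \<omega>) \<longlonglongrightarrow> X \<omega>"
    and F: "\<And>c. c < bnd \<Longrightarrow> (\<lambda>n. prob {\<omega>\<in>space M. Xn n \<omega> \<le> c}) \<longlonglongrightarrow> F c"
    and v: "v < bnd" "isCont F v"
  shows "prob {\<omega>\<in>space M. X \<omega> \<le> v} = F v"
proof -
  have dev: "(\<lambda>n. prob {\<omega>\<in>space M. d < \<bar>Xn n \<omega> - X \<omega>\<bar>}) \<longlonglongrightarrow> 0" if d: "0 < d" for d
  proof -
    have "(\<lambda>n. expectation (indicator {\<omega>\<in>space M. d < \<bar>Xn n \<omega> - X \<omega>\<bar>})) \<longlonglongrightarrow> expectation (\<lambda>_. 0 :: real)"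
    proof (rule integral_dominated_convergence[where w="\<lambda>_. 1"])
      show "AE \<omega> in M. (\<lambda>n. indicator {\<omega>\<in>space M. d < \<bar>Xn n \<omega> - X \<omega>\<bar>} \<omega>) \<longlonglongrightarrow> (0::real)"
        using ae
      proof eventually_elim
        case (elim \<omega>)
        have "\<forall>\<^sub>F n in sequentially. dist (Xn n \<omega>) (X \<omega>) < d" by (rule tendstoD[OF elim d])
        then have "\<forall>\<^sub>F n in sequentially. indicator {\<omega>\<in>space M. d < \<bar>Xn n \<omega> - X \<omega>\<bar>} \<omega> = (0::real)"
          by eventually_elim (simp add: dist_real_def)
        then show ?case by (rule tendsto_eventually)
      qed
      show "AE \<omega> in M. norm (indicator {\<omega>\<in>space M. d < \<bar>Xn n \<omega> - X \<omega>\<bar>} \<omega> :: real) \<le> 1" for n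
        by (rule AE_I2) (simp add: indicator_def)
    qed simp_all
    then show ?thesis by simp
  qed
  have up: "prob {\<omega>\<in>space M. X \<omega> \<le> v} \<le> F (v + d)" if d: "0 < d" "v + d < bnd" for d
  proof (rule LIMSEQ_le_const)
    show "(\<lambda>n. prob {\<omega>\<in>space M. Xn n \<omega> \<le> v + d} + prob {\<omega>\<in>space M. d < \<bar>Xn n \<omega> - X \<omega>\<bar>}) \<longlonglongrightarrow> F (v + d)"
      using tendsto_add[OF F[OF d(2)] dev[OF d(1)]] by simp
    have "prob {\<omega>\<in>space M. X \<omega> \<le> v} \<le> prob {\<omega>\<in>space M. Xn n \<omega> \<le> v + d} + prob {\<omega>\<in>space M. d < \<bar>Xn n \<omega> - X \<omega>\<bar>}" for n
    proof -
      have "prob {\<omega>\<in>space M. X \<omega> \<le> v} \<le> prob ({\<omega>\<in>space M. Xn n \<omega> \<le> v + d} \<union> {\<omega>\<in>space M. d < \<bar>Xn n \<omega> - X \<omega>\<bar>})"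
        by (rule finite_measure_mono) auto
      also have "\<dots> \<le> prob {\<omega>\<in>space M. Xn n \<omega> \<le> v + d} + prob {\<omega>\<in>space M. d < \<bar>Xn n \<omega> - X \<omega>\<bar>}"
        by (rule measure_Un_le) measurable
      finally show ?thesis .
    qed
    then show "\<exists>N. \<forall>n\<ge>N. prob {\<omega>\<in>space M. X \<omega> \<le> v} \<le> prob {\<omega>\<in>space M. Xn n \<omega> \<le> v + d} + prob {\<omega>\<in>space M. d < \<bar>Xn n \<omega> - X \<omega>\<bar>}" by blast
  qed
  have lo: "F (v - d) \<le> prob {\<omega>\<in>space M. X \<omega> \<le> v}" if d: "0 < d" for d
  proof (rule LIMSEQ_le_const2)
    have "v - d < bnd" using d v by simp
    from tendsto_diff[OF F[OF this] dev[OF d]]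
    show "(\<lambda>n. prob {\<omega>\<in>space M. Xn n \<omega> \<le> v - d} - prob {\<omega>\<in>space M. d < \<bar>Xn n \<omega> - X \<omega>\<bar>}) \<longlonglongrightarrow> F (v - d)" by simp
    have "prob {\<omega>\<in>space M. Xn n \<omega> \<le> v - d} - prob {\<omega>\<in>space M. d < \<bar>Xn n \<omega> - X \<omega>\<bar>} \<le> prob {\<omega>\<in>space M. X \<omega> \<le> v}" for n
    proof -
      have "prob {\<omega>\<in>space M. Xn n \<omega> \<le> v - d} \<le> prob ({\<omega>\<in>space M. X \<omega> \<le> v} \<union> {\<omega>\<in>space M. d < \<bar>Xn n \<omega> - X \<omega>\<bar>})"
        by (rule finite_measure_mono) auto
      also have "\<dots> \<le> prob {\<omega>\<in>space M. X \<omega> \<le> v} + prob {\<omega>\<in>space M. d < \<bar>Xn n \<omega> - X \<omega>\<bar>}"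
        by (rule measure_Un_le) measurable
      finally show ?thesis by simp
    qed
    then show "\<exists>N. \<forall>n\<ge>N. prob {\<omega>\<in>space M. Xn n \<omega> \<le> v - d} - prob {\<omega>\<in>space M. d < \<bar>Xn n \<omega> - X \<omega>\<bar>} \<le> prob {\<omega>\<in>space M. X \<omega> \<le> v}" by blast
  qed
  \<comment> \<open>Shifts tending to 0, small enough for \<open>v + e k\<close> to stay below
    \<open>bnd\<close>.\<close>
  define e where "e k = (bnd - v) / 2 / real (Suc k)" for k
  have e: "0 < e k" "v + e k < bnd" for k
  proof -
    show "0 < e k" unfolding e_def using v by simp
    have "e k \<le> (bnd - v) / 2 / 1" unfolding e_def by (rule divide_left_mono) (use v in simp_all)
    then show "v + e k < bnd" using v by simp
  qed
  have e0: "e \<longlonglongrightarrow> 0" unfolding e_def by (rule LIMSEQ_Suc[OF lim_const_over_n])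
  have "(\<lambda>k. F (v + e k)) \<longlonglongrightarrow> F v"
    using tendsto_add[OF tendsto_const[of v] e0] by (intro isCont_tendsto_compose[OF v(2)]) simp
  moreover have "(\<lambda>k. F (v - e k)) \<longlonglongrightarrow> F v"
    using tendsto_diff[OF tendsto_const[of v] e0] by (intro isCont_tendsto_compose[OF v(2)]) simp
  ultimately show ?thesis
    using LIMSEQ_le_const[of "\<lambda>k. F (v + e k)" "F v" "prob {\<omega>\<in>space M. X \<omega> \<le> v}"] up[OF e]
      LIMSEQ_le_const2[of "\<lambda>k. F (v - e k)" "F v" "prob {\<omega>\<in>space M. X \<omega> \<le> v}"] lo[OF e(1)]
    by (intro antisym) blast+
qed

context bridge_space
begin

text \<open>A bridge from \<open>a\<close> to \<open>0\<close>; regularization makes it jointly measurable.\<close>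

definition drifted :: "real \<Rightarrow> 'a \<Rightarrow> real \<Rightarrow> real"
  where "drifted a \<omega> r = regularize (bpath \<omega>) r + a * (1 - r)"

definition hitT :: "real \<Rightarrow> 'a \<Rightarrow> real"
  where "hitT a \<omega> = hit (drifted a \<omega>)"

lemma drifted_eq: "\<omega> \<in> space M \<Longrightarrow> r \<in> {0..1} \<Longrightarrow> drifted a \<omega> r = \<beta> r \<omega> + a * (1 - r)"
  unfolding drifted_def by (simp only: regularize_bpath)

lemma drifted_measurable[measurable (raw)]:
  assumes [measurable]: "f \<in> K \<rightarrow>\<^sub>M M" "g \<in> borel_measurable K"
  shows "(\<lambda>p. drifted a (f p) (g p)) \<in> borel_measurable K"
  unfolding drifted_def by measurable

lemma drifted_continuous: "\<omega> \<in> space M \<Longrightarrow> continuous_on {0..1} (drifted a \<omega>)"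
proof -
  assume w: "\<omega> \<in> space M"
  have "continuous_on {0..1} (\<lambda>r. \<beta> r \<omega> + a * (1 - r))"
    by (intro continuous_intros bridge_continuous w)
  then show ?thesis by (rule continuous_on_eq) (simp only: drifted_eq[OF w])
qed

text \<open>This is the dependence on the past that \<open>markov_discrete\<close> asks of the
  dyadic hitting times. On [0, t] the drift is a deterministic shift, and \<open>hit_by\<close>
  reads only rational times there.\<close>

lemma hitT_past:
  assumes t: "0 \<le> t" "t < 1" "t' \<le> t"
  shows "\<exists>P\<in>sets (path_space {0..t}). \<forall>\<omega>\<in>space M. (hitT a \<omega> \<le> t \<and> \<not> hitT a \<omega> \<le> t') \<longleftrightarrow> path_of {0..t} \<beta> \<omega> \<in> P"
proof
  define P where "P = {f\<in>space (path_space {0..t}). hit_by t (\<lambda>r. f r + a * (1 - r)) \<and> \<not> hit_by t' (\<lambda>r. f r + a * (1 - r))}"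
  have m: "Measurable.pred (path_space {0..t}) (\<lambda>f. hit_by s (\<lambda>r. f r + a * (1 - r)))" if "s \<le> t" for s
    by (rule hit_by_measurable[OF that]) (auto intro!: borel_measurable_add measurable_component_singleton)
  note [measurable] = m[OF order_refl] m[OF t(3)]
  show "P \<in> sets (path_space {0..t})" unfolding P_def by measurable
  show "\<forall>\<omega>\<in>space M. (hitT a \<omega> \<le> t \<and> \<not> hitT a \<omega> \<le> t') \<longleftrightarrow> path_of {0..t} \<beta> \<omega> \<in> P"
  proof
    fix \<omega> assume w: "\<omega> \<in> space M"
    have "hit_by s (\<lambda>r. path_of {0..t} \<beta> \<omega> r + a * (1 - r)) \<longleftrightarrow> hitT a \<omega> \<le> s" if s: "s \<le> t" for s
    proof -
      have "hit_by s (\<lambda>r. path_of {0..t} \<beta> \<omega> r + a * (1 - r)) \<longleftrightarrow> hit_by s (drifted a \<omega>)"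
      proof (rule hit_by_cong)
        fix r assume "r \<in> {0..s}"
        then have "r \<in> {0..t}" "r \<in> {0..1}" using s t by auto
        then show "path_of {0..t} \<beta> \<omega> r + a * (1 - r) = drifted a \<omega> r"
          using drifted_eq[OF w] by (simp add: path_of_def)
      qed
      also have "\<dots> \<longleftrightarrow> hitT a \<omega> \<le> s"
        unfolding hitT_def by (rule hit_by_hit[OF drifted_continuous[OF w]]) (use s t in simp)
      finally show ?thesis .
    qed
    moreover have "path_of {0..t} \<beta> \<omega> \<in> space (path_space {0..t})"
      by (simp add: path_of_def space_PiM)
    ultimately show "(hitT a \<omega> \<le> t \<and> \<not> hitT a \<omega> \<le> t') \<longleftrightarrow> path_of {0..t} \<beta> \<omega> \<in> P"
      unfolding P_def using t(3) by simp
  qed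
qed

lemma hitT_measurable[measurable]: "hitT a \<in> borel_measurable M"
proof (rule borel_measurableI_le)
  fix t
  show "{\<omega>\<in>space M. hitT a \<omega> \<le> t} \<in> events"
  proof (cases "t < 1")
    case True
    have "Measurable.pred M (\<lambda>\<omega>. hit_by t (drifted a \<omega>))"
      by (rule hit_by_measurable[of t 1]) (use True in auto)
    moreover have "{\<omega>\<in>space M. hitT a \<omega> \<le> t} = {\<omega>\<in>space M. hit_by t (drifted a \<omega>)}"
      unfolding hitT_def using hit_by_hit[OF drifted_continuous True] by blast
    ultimately show ?thesis by simp
  next
    case False
    then have "{\<omega>\<in>space M. hitT a \<omega> \<le> t} = space M"
      unfolding hitT_def by (auto intro: order_trans[OF hit_bounds(2)])
    then show ?thesis by simp
  qed
qed

lemma hitT_bounds: "0 \<le> hitT a \<omega>" "hitT a \<omega> \<le> 1"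
  unfolding hitT_def by (rule hit_bounds)+

abbreviation "dhit n a \<omega> \<equiv> dyadic_above n (hitT a \<omega>)"

lemma dhit_bounds: "0 \<le> dhit n a \<omega>" "hitT a \<omega> \<le> dhit n a \<omega>" "dhit n a \<omega> \<le> 1"
proof -
  show "hitT a \<omega> \<le> dhit n a \<omega>" by (rule dyadic_above_bounds)
  then show "0 \<le> dhit n a \<omega>" using hitT_bounds(1)[of a \<omega>] by linarith
  show "dhit n a \<omega> \<le> 1" by (rule dyadic_above_le_1[OF hitT_bounds(2)])
qed

lemma dhit_measurable[measurable]: "(\<lambda>\<omega>. dhit n a \<omega>) \<in> borel_measurable M"
  unfolding dyadic_above_def by measurable

text \<open>The strong Markov property at the rounded hitting time, by summation over its dyadic
  values. The value 1 is excluded, since no path remains after it.\<close>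

lemma markov_hit:
  assumes \<sigma>: "\<sigma> * \<sigma> = 1" and Q: "\<And>t. 0 \<le> t \<Longrightarrow> t < 1 \<Longrightarrow> Q t \<in> sets (path_space {0..1})"
    and \<pi>: "\<And>t. 0 \<le> t \<Longrightarrow> t < 1 \<Longrightarrow> prob {\<omega>\<in>space M. bpath \<omega> \<in> Q t} = \<pi> t"
  shows "prob {\<omega>\<in>space M. dhit n a \<omega> < 1 \<and> path_of {0..1} (\<lambda>w \<omega>'. \<sigma> * post (dhit n a \<omega>) w \<omega>') \<omega> \<in> Q (dhit n a \<omega>)} =
    expectation (\<lambda>\<omega>. if dhit n a \<omega> < 1 then \<pi> (dhit n a \<omega>) else 0)"
proof -
  define G where "G = (\<lambda>k. real k / 2 ^ n) ` {..<2 ^ n}"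
  have G: "finite G" "G \<subseteq> {0..<1}"
  proof -
    show "finite G" unfolding G_def by simp
    have "real k / 2 ^ n < 1" if "k < 2 ^ n" for k
    proof -
      have "real k < real (2 ^ n)" using that by (simp only: of_nat_less_iff)
      then show ?thesis by simp
    qed
    then show "G \<subseteq> {0..<1}" unfolding G_def by auto
  qed
  have inG: "dhit n a \<omega> \<in> G \<longleftrightarrow> dhit n a \<omega> < 1" for \<omega>
    using dyadic_above_cases[OF hitT_bounds[of a \<omega>], of n] G unfolding G_def by auto
  have past: "\<exists>P\<in>sets (path_space {0..t}). \<forall>\<omega>\<in>space M. dhit n a \<omega> = t \<longleftrightarrow> path_of {0..t} \<beta> \<omega> \<in> P" if "t \<in> G" for t
  proof -
    from that obtain k where k: "t = real k / 2 ^ n" unfolding G_def by blast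
    have t: "0 \<le> t" "t < 1" using that G by auto
    have "dhit n a \<omega> = t \<longleftrightarrow> hitT a \<omega> \<le> t \<and> \<not> hitT a \<omega> \<le> t - 1 / 2 ^ n" for \<omega>
      unfolding k by (rule dyadic_above_eq_iff)
    then show ?thesis using hitT_past[OF t, of "t - 1 / 2 ^ n" a] by simp
  qed
  have m[measurable]: "{\<omega>\<in>space M. dhit n a \<omega> = t} \<in> events" for t by measurable
  have "prob {\<omega>\<in>space M. dhit n a \<omega> < 1 \<and> path_of {0..1} (\<lambda>w \<omega>'. \<sigma> * post (dhit n a \<omega>) w \<omega>') \<omega> \<in> Q (dhit n a \<omega>)} =
     (\<Sum>t\<in>G. prob {\<omega>\<in>space M. dhit n a \<omega> = t} * prob {\<omega>\<in>space M. bpath \<omega> \<in> Q t})"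
    unfolding inG[symmetric] by (rule markov_discrete[OF G \<sigma> past]) (use Q G in auto)
  also have "\<dots> = (\<Sum>t\<in>G. expectation (\<lambda>\<omega>. indicator {\<omega>\<in>space M. dhit n a \<omega> = t} \<omega> * \<pi> t))"
    by (rule sum.cong) (use \<pi> G in auto)
  also have "\<dots> = expectation (\<lambda>\<omega>. \<Sum>t\<in>G. indicator {\<omega>\<in>space M. dhit n a \<omega> = t} \<omega> * \<pi> t)"
    by (rule Bochner_Integration.integral_sum[symmetric])
       (intro integrable_mult_left integrable_real_indicator m, simp add: emeasure_eq_measure)
  also have "\<dots> = expectation (\<lambda>\<omega>. if dhit n a \<omega> < 1 then \<pi> (dhit n a \<omega>) else 0)"
  proof (rule Bochner_Integration.integral_cong[OF refl])
    fix \<omega> assume w: "\<omega> \<in> space M"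
    have "(\<Sum>t\<in>G. indicator {\<omega>\<in>space M. dhit n a \<omega> = t} \<omega> * \<pi> t) = (\<Sum>t\<in>G. if dhit n a \<omega> = t then \<pi> t else 0)"
      by (rule sum.cong) (use w in \<open>simp_all add: indicator_def\<close>)
    also have "\<dots> = (if dhit n a \<omega> \<in> G then \<pi> (dhit n a \<omega>) else 0)" using G(1) by (rule sum.delta')
    finally show "(\<Sum>t\<in>G. indicator {\<omega>\<in>space M. dhit n a \<omega> = t} \<omega> * \<pi> t) = (if dhit n a \<omega> < 1 then \<pi> (dhit n a \<omega>) else 0)"
      unfolding inG .
  qed
  finally show ?thesis .
qed

text \<open>The drift \<open>a * (1 - r)\<close> is linear and vanishes at 1, hence coincides with
  its own chord and cancels; only the bridge part remains.\<close>

lemma post_sign: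
  assumes t: "0 \<le> t" "t < 1" and w: "w \<in> {0..1}" and \<omega>: "\<omega> \<in> space M"
  shows "\<sigma> * post t w \<omega> < 0 \<longleftrightarrow> \<sigma> * (drifted a \<omega> (t + (1 - t) * w) - drifted a \<omega> t * ((1 - (t + (1 - t) * w)) / (1 - t))) < 0"
proof -
  have r: "t + (1 - t) * w \<in> {0..1}" using post_time(1)[OF t w] by (simp only: mult.commute)
  have tI: "t \<in> {0..1}" using t by simp
  have "1 - (t + (1 - t) * w) = (1 - t) * (1 - w)" by (simp add: algebra_simps)
  then have q: "(1 - (t + (1 - t) * w)) / (1 - t) = 1 - w" using t by simp
  have "drifted a \<omega> (t + (1 - t) * w) - drifted a \<omega> t * (1 - w) = \<beta> (t + w * (1 - t)) \<omega> - (1 - w) * \<beta> t \<omega>"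
    unfolding drifted_eq[OF \<omega> r] drifted_eq[OF \<omega> tI] by (simp add: algebra_simps)
  then show ?thesis unfolding q post_def using t by (simp add: divide_less_0_iff)
qed

lemma post_occupation:
  assumes t: "0 \<le> t" "t < 1" and \<omega>: "\<omega> \<in> space M"
  shows "(1 - t) * below (\<lambda>w. \<sigma> * post t w \<omega>) = tail_below \<sigma> (drifted a \<omega>) t"
proof -
  define S where "S = {r\<in>{0..1}. t \<le> r \<and> \<sigma> * (drifted a \<omega> r - drifted a \<omega> t * ((1 - r) / (1 - t))) < 0}"
  have S: "S \<in> sets borel" unfolding S_def by (rule tail_set_measurable[OF drifted_continuous[OF \<omega>]])
  have t1: "0 < 1 - t" using t by simp
  have "{w. t + (1 - t) * w \<in> S} = {w\<in>{0..1}. \<sigma> * post t w \<omega> < 0}"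
  proof (rule set_eqI)
    fix w
    have "t + (1 - t) * w \<in> {0..1} \<and> t \<le> t + (1 - t) * w \<longleftrightarrow> w \<in> {0..1}"
    proof
      assume "t + (1 - t) * w \<in> {0..1} \<and> t \<le> t + (1 - t) * w"
      then have "0 \<le> (1 - t) * w" "(1 - t) * w \<le> (1 - t) * 1" by simp_all
      then show "w \<in> {0..1}" using t1 by (simp add: zero_le_mult_iff)
    next
      assume "w \<in> {0..1}"
      from post_time[OF t this] show "t + (1 - t) * w \<in> {0..1} \<and> t \<le> t + (1 - t) * w" by (simp add: mult.commute)
    qed
    then show "w \<in> {w. t + (1 - t) * w \<in> S} \<longleftrightarrow> w \<in> {w\<in>{0..1}. \<sigma> * post t w \<omega> < 0}"
      unfolding S_def mem_Collect_eq using post_sign[OF t _ \<omega>, of w \<sigma> a] by blast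
  qed
  then show ?thesis using measure_affine[OF S t1, of t] unfolding below_def tail_below_def S_def[symmetric] by simp
qed

end

text \<open>For \<open>t < 1\<close> this is the probability that
  \<open>t + (1 - t) * U \<le> v\<close> with \<open>U\<close> uniform on [0, 1]. At
  \<open>t = 1\<close> division by zero makes it 0.\<close>

definition ramp :: "real \<Rightarrow> real \<Rightarrow> real"
  where "ramp v t = min 1 (max 0 ((v - t) / (1 - t)))"

lemma ramp_bounds: "0 \<le> ramp v t" "ramp v t \<le> 1"
  unfolding ramp_def by simp_all

lemma ramp_measurable[measurable]: "(\<lambda>t. ramp v t) \<in> borel_measurable borel"
  unfolding ramp_def by measurable

lemma ramp_eq:
  assumes v: "v < 1" and t: "t \<le> 1"
  shows "ramp v t = (if t < 1 then max 0 ((v - t) / (1 - t)) else 0)"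
proof (cases "t < 1")
  case True
  have "(v - t) / (1 - t) \<le> 1" using True v by (simp add: divide_le_eq)
  then show ?thesis unfolding ramp_def using True by (simp add: min_absorb2)
next
  case False
  then have "t = 1" using t by simp
  then show ?thesis unfolding ramp_def by simp
qed

lemma ramp_isCont: "isCont (\<lambda>v. ramp v t) v"
  unfolding ramp_def divide_inverse by (intro continuous_intros)

text \<open>\<open>ramp v\<close> can jump at 1. Approximation from above avoids the jump, as it
  leaves only the constant sequence when \<open>T = 1\<close>.\<close>

lemma ramp_tendsto:
  assumes T: "T \<le> 1" and Tn: "\<And>n. T \<le> Tn n" "\<And>n. Tn n \<le> 1" "Tn \<longlonglongrightarrow> T"
  shows "(\<lambda>n. ramp v (Tn n)) \<longlonglongrightarrow> ramp v T"
proof (cases "T < 1")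
  case True
  have "(\<lambda>n. (v - Tn n) / (1 - Tn n)) \<longlonglongrightarrow> (v - T) / (1 - T)"
    by (rule tendsto_divide[OF tendsto_diff[OF tendsto_const Tn(3)] tendsto_diff[OF tendsto_const Tn(3)]]) (use True in simp)
  then show ?thesis unfolding ramp_def by (intro tendsto_min tendsto_max tendsto_const)
next
  case False
  then have "T = 1" using T by simp
  then have "Tn n = 1" for n using Tn(1)[of n] Tn(2)[of n] by simp
  then show ?thesis using \<open>T = 1\<close> by simp
qed

lemma (in prob_space) prob_tendsto:
  assumes A: "\<And>n. A n \<in> events" "B \<in> events"
    and lim: "AE \<omega> in M. eventually (\<lambda>n. \<omega> \<in> A n \<longleftrightarrow> \<omega> \<in> B) sequentially"
  shows "(\<lambda>n. prob (A n)) \<longlonglongrightarrow> prob B"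
proof -
  have "(\<lambda>n. expectation (indicator (A n))) \<longlonglongrightarrow> expectation (indicator B :: 'a \<Rightarrow> real)"
  proof (rule integral_dominated_convergence[where w="\<lambda>_. 1"])
    show "AE \<omega> in M. (\<lambda>n. indicator (A n) \<omega>) \<longlonglongrightarrow> (indicator B \<omega> :: real)"
      using lim
    proof eventually_elim
      case (elim \<omega>)
      then have "eventually (\<lambda>n. indicator (A n) \<omega> = (indicator B \<omega> :: real)) sequentially"
        by (rule eventually_mono) (simp add: indicator_def)
      then show ?case by (rule tendsto_eventually)
    qed
    show "AE \<omega> in M. norm (indicator (A n) \<omega> :: real) \<le> 1" for n
      by (rule AE_I2) (simp add: indicator_def)
  qed (use A in simp_all)
  then show ?thesis using A by (simp add: Int_absorb2 sets.sets_into_space)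
qed

section \<open>First zero of the drifted bridge and occupation time after it\<close>

context bridge_space
begin

lemma AE_drifted_good:
  "AE \<omega> in M. \<beta> 0 \<omega> = 0 \<and> \<beta> 1 \<omega> = 0 \<and> (AE r in lborel. r \<in> {0<..<1} \<longrightarrow> drifted a \<omega> r \<noteq> 0)"
proof -
  have "(\<lambda>s. - a * (1 - s)) \<in> borel_measurable borel" by measurable
  from AE_bridge_zero AE_level_null[OF this] AE_space show ?thesis
  proof eventually_elim
    case (elim \<omega>)
    have "AE r in lborel. r \<in> {0<..<1} \<longrightarrow> drifted a \<omega> r \<noteq> 0"
      using elim(2)
    proof (rule eventually_mono, intro impI)
      fix r assume *: "r \<in> {0<..<1} \<longrightarrow> \<beta> r \<omega> \<noteq> - a * (1 - r)" and r: "r \<in> {0<..<1}"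
      have "r \<in> {0..1}" using r by simp
      from drifted_eq[OF elim(3) this, of a] * r show "drifted a \<omega> r \<noteq> 0" by auto
    qed
    then show ?case using elim(1) by blast
  qed
qed

lemma drifted_hit_zero:
  assumes "\<omega> \<in> space M" "\<beta> 0 \<omega> = 0" "0 < a" "hitT a \<omega> < 1"
  shows "drifted a \<omega> (hitT a \<omega>) = 0"
  unfolding hitT_def
proof (rule hit_zero[OF drifted_continuous[OF assms(1)]])
  show "hit (drifted a \<omega>) < 1" using assms(4) unfolding hitT_def .
  show "0 < drifted a \<omega> 0" using drifted_eq[OF assms(1), of 0 a] assms by simp
qed

lemma below_post:
  assumes t: "0 \<le> t" "t < 1" and \<sigma>: "\<sigma> * \<sigma> = 1" and \<omega>: "\<omega> \<in> space M"
  shows "below (regularize (path_of {0..1} (\<lambda>w \<omega>'. \<sigma> * post t w \<omega>') \<omega>)) = below (\<lambda>w. \<sigma> * post t w \<omega>)"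
proof -
  interpret B: bridge_space M V "\<lambda>w \<omega>. \<sigma> * post t w \<omega>" by (rule post_bridge[OF t \<sigma>])
  show ?thesis by (rule B.below_bpath[OF \<omega>, symmetric])
qed

lemma dhit_tendsto: "(\<lambda>n. dhit n a \<omega>) \<longlonglongrightarrow> hitT a \<omega>"
  by (rule dyadic_above_tendsto)

lemma tail_below_measurable:
  "(\<lambda>\<omega>. tail_below \<sigma> (drifted a \<omega>) (dhit n a \<omega>)) \<in> borel_measurable M"
  unfolding tail_below_def by (rule measure_unit_interval_measurable) measurable

lemma hit_tail_measurable:
  "(\<lambda>\<omega>. measure lborel {r\<in>{0..1}. hitT a \<omega> \<le> r \<and> \<sigma> * drifted a \<omega> r < 0}) \<in> borel_measurable M"
  by (rule measure_unit_interval_measurable) measurable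

text \<open>After its first zero the path is a bridge from 0 to 0 of length
  \<open>1 - hitT a \<omega>\<close>, whose time below 0, or above 0 according to
  \<open>\<sigma>\<close>, is uniform. At the rounded hitting times this is
  \<open>markov_hit\<close> with the chord subtracted; the rounding is removed in the limit.\<close>

lemma hit_occupation_law:
  assumes a: "0 < a" and \<sigma>: "\<sigma> * \<sigma> = 1" and v: "v < 1"
  shows "prob {\<omega>\<in>space M. hitT a \<omega> + measure lborel {r\<in>{0..1}. hitT a \<omega> \<le> r \<and> \<sigma> * drifted a \<omega> r < 0} \<le> v} =
    expectation (\<lambda>\<omega>. ramp v (hitT a \<omega>))"
proof (rule AE_tendsto_prob_le[where bnd=1 and v=v and F="\<lambda>c. expectation (\<lambda>\<omega>. ramp c (hitT a \<omega>))"
      and Xn="\<lambda>n \<omega>. dhit n a \<omega> + tail_below \<sigma> (drifted a \<omega>) (dhit n a \<omega>)"])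
  have \<sigma>0: "\<sigma> \<noteq> 0" using \<sigma> by auto
  show "(\<lambda>\<omega>. dhit n a \<omega> + tail_below \<sigma> (drifted a \<omega>) (dhit n a \<omega>)) \<in> borel_measurable M" for n
    by (intro borel_measurable_add dhit_measurable tail_below_measurable)
  show "(\<lambda>\<omega>. hitT a \<omega> + measure lborel {r\<in>{0..1}. hitT a \<omega> \<le> r \<and> \<sigma> * drifted a \<omega> r < 0}) \<in> borel_measurable M"
    by (intro borel_measurable_add hitT_measurable hit_tail_measurable)
  show "AE \<omega> in M. (\<lambda>n. dhit n a \<omega> + tail_below \<sigma> (drifted a \<omega>) (dhit n a \<omega>)) \<longlonglongrightarrow>
      hitT a \<omega> + measure lborel {r\<in>{0..1}. hitT a \<omega> \<le> r \<and> \<sigma> * drifted a \<omega> r < 0}"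
    using AE_drifted_good[of a] AE_space
  proof eventually_elim
    case (elim \<omega>)
    have "(\<lambda>n. tail_below \<sigma> (drifted a \<omega>) (dhit n a \<omega>)) \<longlonglongrightarrow> measure lborel {r\<in>{0..1}. hitT a \<omega> \<le> r \<and> \<sigma> * drifted a \<omega> r < 0}"
    proof (rule tail_below_tendsto[OF drifted_continuous[OF elim(2)] hitT_bounds])
      show "drifted a \<omega> (hitT a \<omega>) = 0" if "hitT a \<omega> < 1"
        by (rule drifted_hit_zero[OF elim(2) _ a that]) (use elim in blast)
      show "AE r in lborel. r \<in> {0<..<1} \<longrightarrow> drifted a \<omega> r \<noteq> 0" using elim(1) by blast
    qed (rule dhit_bounds dhit_tendsto \<sigma>0)+
    then show ?case by (rule tendsto_add[OF dhit_tendsto])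
  qed
  show "v < 1" by (rule v)
  \<comment> \<open>\<open>AE_tendsto_prob_le\<close> varies the level, so the limiting distribution
    function has to be continuous in it.\<close>
  show "isCont (\<lambda>c. expectation (\<lambda>\<omega>. ramp c (hitT a \<omega>))) v"
    unfolding continuous_at_sequentially comp_def
  proof (intro allI impI)
    fix c :: "nat \<Rightarrow> real" assume c: "c \<longlonglongrightarrow> v"
    show "(\<lambda>n. expectation (\<lambda>\<omega>. ramp (c n) (hitT a \<omega>))) \<longlonglongrightarrow> expectation (\<lambda>\<omega>. ramp v (hitT a \<omega>))"
    proof (rule integral_dominated_convergence[where w="\<lambda>_. 1"])
      show "AE \<omega> in M. (\<lambda>n. ramp (c n) (hitT a \<omega>)) \<longlonglongrightarrow> ramp v (hitT a \<omega>)"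
        by (intro AE_I2 isCont_tendsto_compose[OF ramp_isCont c])
      show "AE \<omega> in M. norm (ramp (c n) (hitT a \<omega>)) \<le> 1" for n
        by (intro AE_I2) (simp add: ramp_bounds abs_of_nonneg)
    qed simp_all
  qed
  fix c :: real assume c: "c < 1"
  have lim: "(\<lambda>n. expectation (\<lambda>\<omega>. ramp c (dhit n a \<omega>))) \<longlonglongrightarrow> expectation (\<lambda>\<omega>. ramp c (hitT a \<omega>))"
  proof (rule integral_dominated_convergence[where w="\<lambda>_. 1"])
    show "AE \<omega> in M. (\<lambda>n. ramp c (dhit n a \<omega>)) \<longlonglongrightarrow> ramp c (hitT a \<omega>)"
      by (intro AE_I2 ramp_tendsto hitT_bounds dhit_bounds dhit_tendsto)
    show "AE \<omega> in M. norm (ramp c (dhit n a \<omega>)) \<le> 1" for n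
      by (intro AE_I2) (simp add: ramp_bounds abs_of_nonneg)
    show "(\<lambda>\<omega>. ramp c (hitT a \<omega>)) \<in> borel_measurable M" by measurable
    show "(\<lambda>\<omega>. ramp c (dhit n a \<omega>)) \<in> borel_measurable M" for n
      by (rule measurable_compose[OF dhit_measurable ramp_measurable])
  qed simp
  \<comment> \<open>At rounded times the formula is exact: on the value \<open>t\<close> the event
    asks the uniform occupation time of the remainder to be at most
    \<open>(c - t) / (1 - t)\<close>.\<close>
  have eq: "prob {\<omega>\<in>space M. dhit n a \<omega> + tail_below \<sigma> (drifted a \<omega>) (dhit n a \<omega>) \<le> c} = expectation (\<lambda>\<omega>. ramp c (dhit n a \<omega>))" for n
  proof -
    define Q where "Q t = {f\<in>space (path_space {0..1}). below (regularize f) \<le> (c - t) / (1 - t)}" for t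
    have Q: "Q t \<in> sets (path_space {0..1})" for t unfolding Q_def by measurable
    have pi: "prob {\<omega>\<in>space M. bpath \<omega> \<in> Q t} = max 0 ((c - t) / (1 - t))" if t: "0 \<le> t" "t < 1" for t
    proof -
      have "{\<omega>\<in>space M. bpath \<omega> \<in> Q t} = {\<omega>\<in>space M. below (\<lambda>s. \<beta> s \<omega>) \<le> (c - t) / (1 - t)}"
        unfolding Q_def using measurable_space[OF measurable_bpath] below_bpath by auto
      moreover have "(c - t) / (1 - t) < 1" using t c by (simp add: divide_less_eq)
      ultimately show ?thesis using below_bridge_uniform' by simp
    qed
    have "{\<omega>\<in>space M. dhit n a \<omega> + tail_below \<sigma> (drifted a \<omega>) (dhit n a \<omega>) \<le> c} =
       {\<omega>\<in>space M. dhit n a \<omega> < 1 \<and> path_of {0..1} (\<lambda>w \<omega>'. \<sigma> * post (dhit n a \<omega>) w \<omega>') \<omega> \<in> Q (dhit n a \<omega>)}"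
    proof (rule Collect_cong, rule conj_cong[OF refl])
      fix \<omega> assume w: "\<omega> \<in> space M"
      define t where "t = dhit n a \<omega>"
      have t: "0 \<le> t" "t \<le> 1" unfolding t_def using dhit_bounds by auto
      have tb: "0 \<le> tail_below \<sigma> (drifted a \<omega>) t" unfolding tail_below_def by simp
      have "t + tail_below \<sigma> (drifted a \<omega>) t \<le> c \<longleftrightarrow> t < 1 \<and> path_of {0..1} (\<lambda>w \<omega>'. \<sigma> * post t w \<omega>') \<omega> \<in> Q t"
      proof (cases "t < 1")
        case False
        then show ?thesis using t tb c by simp
      next
        case True
        have sp: "path_of {0..1} (\<lambda>w \<omega>'. \<sigma> * post t w \<omega>') \<omega> \<in> space (path_space {0..1})"
          by (simp add: path_of_def space_PiM)
        have "t + tail_below \<sigma> (drifted a \<omega>) t \<le> c \<longleftrightarrow> (1 - t) * below (\<lambda>w. \<sigma> * post t w \<omega>) \<le> c - t"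
          unfolding post_occupation[OF t(1) True w, of \<sigma> a] by linarith
        also have "\<dots> \<longleftrightarrow> below (\<lambda>w. \<sigma> * post t w \<omega>) \<le> (c - t) / (1 - t)"
          using True by (simp add: pos_le_divide_eq mult.commute)
        finally show ?thesis unfolding Q_def mem_Collect_eq below_post[OF t(1) True \<sigma> w] using True sp by blast
      qed
      then show "(dhit n a \<omega> + tail_below \<sigma> (drifted a \<omega>) (dhit n a \<omega>) \<le> c) =
         (dhit n a \<omega> < 1 \<and> path_of {0..1} (\<lambda>w \<omega>'. \<sigma> * post (dhit n a \<omega>) w \<omega>') \<omega> \<in> Q (dhit n a \<omega>))"
        unfolding t_def .
    qed
    then have "prob {\<omega>\<in>space M. dhit n a \<omega> + tail_below \<sigma> (drifted a \<omega>) (dhit n a \<omega>) \<le> c} =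
       expectation (\<lambda>\<omega>. if dhit n a \<omega> < 1 then max 0 ((c - dhit n a \<omega>) / (1 - dhit n a \<omega>)) else 0)"
      using markov_hit[OF \<sigma> Q pi] by (simp only:)
    also have "\<dots> = expectation (\<lambda>\<omega>. ramp c (dhit n a \<omega>))"
      by (simp only: ramp_eq[OF c dhit_bounds(3)])
    finally show ?thesis .
  qed
  show "(\<lambda>n. prob {\<omega>\<in>space M. dhit n a \<omega> + tail_below \<sigma> (drifted a \<omega>) (dhit n a \<omega>) \<le> c}) \<longlonglongrightarrow> expectation (\<lambda>\<omega>. ramp c (hitT a \<omega>))"
    unfolding eq by (rule lim)
qed

lemma bridge_negative_half:
  assumes w: "w \<in> {0<..<1}"
  shows "prob {\<omega>\<in>space M. \<beta> w \<omega> < 0} = 1 / 2"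
proof -
  interpret N: bridge_space M V "\<lambda>s \<omega>. - \<beta> s \<omega>" by (rule neg_bridge)
  have wI: "w \<in> {0..1}" using w by simp
  define Q where "Q = {f\<in>space (path_space {0..1}). f w < 0}"
  have [measurable]: "(\<lambda>f. f w) \<in> borel_measurable (path_space {0..1})"
    using wI by (rule measurable_component_singleton)
  have Q: "Q \<in> sets (path_space {0..1})" unfolding Q_def by measurable
  have [measurable]: "\<beta> w \<in> borel_measurable M" using wI by (rule bridge_measurable)
  have 1: "{\<omega>\<in>space M. path_of {0..1} \<beta> \<omega> \<in> Q} = {\<omega>\<in>space M. \<beta> w \<omega> < 0}"
    unfolding Q_def using wI by (auto simp: path_of_def space_PiM)
  have 2: "{\<omega>\<in>space M. path_of {0..1} (\<lambda>s \<omega>. - \<beta> s \<omega>) \<omega> \<in> Q} = {\<omega>\<in>space M. 0 < \<beta> w \<omega>}"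
    unfolding Q_def using wI by (auto simp: path_of_def space_PiM)
  have eq: "prob {\<omega>\<in>space M. \<beta> w \<omega> < 0} = prob {\<omega>\<in>space M. 0 < \<beta> w \<omega>}"
    using bridge_space_prob[OF bridge_space_axioms N.bridge_space_axioms Q] unfolding 1 2 .
  have "prob {\<omega>\<in>space M. 0 < \<beta> w \<omega>} = prob {\<omega>\<in>space M. \<not> \<beta> w \<omega> < 0}"
  proof (rule finite_measure_eq_AE)
    show "AE \<omega> in M. (\<omega> \<in> {\<omega>\<in>space M. 0 < \<beta> w \<omega>}) = (\<omega> \<in> {\<omega>\<in>space M. \<not> \<beta> w \<omega> < 0})"
      using bridge_neq[OF w, of 0] by eventually_elim auto
  qed simp_all
  also have "\<dots> = 1 - prob {\<omega>\<in>space M. \<beta> w \<omega> < 0}" by (rule prob_neg) simp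
  finally show ?thesis using eq by simp
qed

text \<open>The reflection principle: after its first zero the bridge is at time \<open>s\<close>
  equally likely to be on either side of 0, and a negative value at \<open>s\<close> forces an
  earlier zero. Rounded hitting times supply the Markov property, and the rounding disappears in the
  limit.\<close>

lemma hit_before:
  assumes a: "0 < a" and s: "s \<in> {0<..<1}"
  shows "prob {\<omega>\<in>space M. hitT a \<omega> < s} = 2 * prob {\<omega>\<in>space M. drifted a \<omega> s < 0}"
proof -
  have sI: "s \<in> {0..1}" "0 < s" "s < 1" using s by simp_all
  have [measurable]: "(\<lambda>\<omega>. drifted a \<omega> s) \<in> borel_measurable M" by measurable
  define Q where "Q t = {f\<in>space (path_space {0..1}). t < s \<and> f ((s - t) / (1 - t)) < 0}" for t
  have wI: "(s - t) / (1 - t) \<in> {0<..<1}" if "0 \<le> t" "t < s" for t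
    using that sI by (simp add: divide_less_eq)
  have Q: "Q t \<in> sets (path_space {0..1})" if t: "0 \<le> t" "t < 1" for t
  proof (cases "t < s")
    case True
    have [measurable]: "(\<lambda>f. f ((s - t) / (1 - t))) \<in> borel_measurable (path_space {0..1})"
      using wI[OF t(1) True] by (intro measurable_component_singleton) simp
    show ?thesis unfolding Q_def by measurable
  next
    case False then show ?thesis unfolding Q_def by simp
  qed
  have pi: "prob {\<omega>\<in>space M. bpath \<omega> \<in> Q t} = (if t < s then 1 / 2 else 0)" if t: "0 \<le> t" "t < 1" for t
  proof (cases "t < s")
    case True
    have "{\<omega>\<in>space M. bpath \<omega> \<in> Q t} = {\<omega>\<in>space M. \<beta> ((s - t) / (1 - t)) \<omega> < 0}"
      unfolding Q_def using wI[OF t(1) True] True by (auto simp: path_of_def space_PiM)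
    then show ?thesis using bridge_negative_half[OF wI[OF t(1) True]] True by simp
  next
    case False then show ?thesis unfolding Q_def by simp
  qed
  \<comment> \<open>At the rounded time the path is not exactly 0, so its value at \<open>s\<close>
    is compared with the chord from there instead of with 0.\<close>
  define E where "E n = {\<omega>\<in>space M. dhit n a \<omega> < s \<and> drifted a \<omega> s - drifted a \<omega> (dhit n a \<omega>) * ((1 - s) / (1 - dhit n a \<omega>)) < 0}" for n
  have Em: "E n \<in> events" for n unfolding E_def by measurable
  have En: "E n = {\<omega>\<in>space M. dhit n a \<omega> < 1 \<and> path_of {0..1} (\<lambda>w \<omega>'. 1 * post (dhit n a \<omega>) w \<omega>') \<omega> \<in> Q (dhit n a \<omega>)}" for n
    unfolding E_def
  proof (rule Collect_cong, rule conj_cong[OF refl])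
    fix \<omega> assume w: "\<omega> \<in> space M"
    define t where "t = dhit n a \<omega>"
    have t: "0 \<le> t" unfolding t_def by (rule dhit_bounds)
    have "t < s \<and> drifted a \<omega> s - drifted a \<omega> t * ((1 - s) / (1 - t)) < 0 \<longleftrightarrow> t < 1 \<and> path_of {0..1} (\<lambda>w \<omega>'. 1 * post t w \<omega>') \<omega> \<in> Q t"
    proof (cases "t < s")
      case False then show ?thesis unfolding Q_def by simp
    next
      case True
      have t1: "t < 1" using True sI by simp
      have wi: "(s - t) / (1 - t) \<in> {0..1}" using wI[OF t True] by simp
      have st: "t + (1 - t) * ((s - t) / (1 - t)) = s" using t1 by simp
      have "path_of {0..1} (\<lambda>w \<omega>'. 1 * post t w \<omega>') \<omega> \<in> Q t \<longleftrightarrow> 1 * post t ((s - t) / (1 - t)) \<omega> < 0"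
        unfolding Q_def using wi True by (simp add: path_of_def space_PiM)
      also have "\<dots> \<longleftrightarrow> 1 * (drifted a \<omega> s - drifted a \<omega> t * ((1 - s) / (1 - t))) < 0"
        using post_sign[OF t t1 wi w, of 1 a] unfolding st .
      finally show ?thesis using True t1 by simp
    qed
    then show "(dhit n a \<omega> < s \<and> drifted a \<omega> s - drifted a \<omega> (dhit n a \<omega>) * ((1 - s) / (1 - dhit n a \<omega>)) < 0) =
      (dhit n a \<omega> < 1 \<and> path_of {0..1} (\<lambda>w \<omega>'. 1 * post (dhit n a \<omega>) w \<omega>') \<omega> \<in> Q (dhit n a \<omega>))"
      unfolding t_def .
  qed
  have pE: "prob (E n) = 1 / 2 * prob {\<omega>\<in>space M. dhit n a \<omega> < s}" for n
  proof -
    have "prob (E n) = expectation (\<lambda>\<omega>. if dhit n a \<omega> < 1 then (if dhit n a \<omega> < s then 1 / 2 else 0) else 0)"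
      unfolding En by (rule markov_hit) (use Q pi in simp_all)
    also have "\<dots> = expectation (\<lambda>\<omega>. 1 / 2 * indicator {\<omega>\<in>space M. dhit n a \<omega> < s} \<omega>)"
      by (rule Bochner_Integration.integral_cong) (use sI in \<open>auto simp: indicator_def\<close>)
    also have "\<dots> = 1 / 2 * expectation (indicator {\<omega>\<in>space M. dhit n a \<omega> < s})"
      by (rule integral_mult_right_zero)
    also have "\<dots> = 1 / 2 * prob {\<omega>\<in>space M. dhit n a \<omega> < s}"
      by (simp add: Int_absorb2)
    finally show ?thesis .
  qed
  have ev1: "eventually (\<lambda>n. dhit n a \<omega> < s \<longleftrightarrow> hitT a \<omega> < s) sequentially" for \<omega>
  proof (cases "hitT a \<omega> < s")
    case True
    from order_tendstoD(2)[OF dhit_tendsto True] show ?thesis by eventually_elim (use True in simp)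
  next
    case False
    then have "\<not> dhit n a \<omega> < s" for n using dhit_bounds(2)[of a \<omega> n] by linarith
    then show ?thesis using False by simp
  qed
  have lim1: "(\<lambda>n. prob {\<omega>\<in>space M. dhit n a \<omega> < s}) \<longlonglongrightarrow> prob {\<omega>\<in>space M. hitT a \<omega> < s}"
  proof (rule prob_tendsto)
    show "AE \<omega> in M. \<forall>\<^sub>F n in sequentially. (\<omega> \<in> {\<omega>\<in>space M. dhit n a \<omega> < s}) = (\<omega> \<in> {\<omega>\<in>space M. hitT a \<omega> < s})"
      using ev1 by (intro AE_I2) (simp add: eventually_mono)
  qed measurable
  have drift: "AE \<omega> in M. drifted a \<omega> s \<noteq> 0"
    using bridge_neq[OF s, of "- a * (1 - s)"] AE_space
    by eventually_elim (use drifted_eq[OF _ sI(1), of _ a] in auto)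
  have lim2: "(\<lambda>n. prob (E n)) \<longlonglongrightarrow> prob {\<omega>\<in>space M. hitT a \<omega> < s \<and> drifted a \<omega> s < 0}"
  proof (rule prob_tendsto[OF Em])
    show "AE \<omega> in M. \<forall>\<^sub>F n in sequentially. (\<omega> \<in> E n) = (\<omega> \<in> {\<omega>\<in>space M. hitT a \<omega> < s \<and> drifted a \<omega> s < 0})"
      using drift AE_bridge_zero AE_space
    proof eventually_elim
      case (elim \<omega>)
      show ?case
      proof (cases "hitT a \<omega> < s")
        case False
        then have "\<not> dhit n a \<omega> < s" for n using dhit_bounds(2)[of a \<omega> n] by linarith
        then show ?thesis using False unfolding E_def by simp
      next
        case True
        then have T1: "hitT a \<omega> < 1" using sI by simp
        have z: "drifted a \<omega> (hitT a \<omega>) = 0" by (rule drifted_hit_zero[OF elim(3) _ a T1]) (use elim(2) in simp)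
        have dI: "dhit n a \<omega> \<in> {0..1}" for n by (simp add: dhit_bounds)
        have c: "(\<lambda>n. drifted a \<omega> (dhit n a \<omega>)) \<longlonglongrightarrow> drifted a \<omega> (hitT a \<omega>)"
          by (rule continuous_on_tendsto_compose[OF drifted_continuous[OF elim(3)] dhit_tendsto])
             (use hitT_bounds[of a \<omega>] dI in simp_all)
        have "(\<lambda>n. (1 - s) / (1 - dhit n a \<omega>)) \<longlonglongrightarrow> (1 - s) / (1 - hitT a \<omega>)"
          by (rule tendsto_divide[OF tendsto_const tendsto_diff[OF tendsto_const dhit_tendsto]]) (use T1 in simp)
        then have "(\<lambda>n. drifted a \<omega> s - drifted a \<omega> (dhit n a \<omega>) * ((1 - s) / (1 - dhit n a \<omega>))) \<longlonglongrightarrow>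
            drifted a \<omega> s - drifted a \<omega> (hitT a \<omega>) * ((1 - s) / (1 - hitT a \<omega>))"
          by (intro tendsto_diff tendsto_mult tendsto_const c)
        then have lim: "(\<lambda>n. drifted a \<omega> s - drifted a \<omega> (dhit n a \<omega>) * ((1 - s) / (1 - dhit n a \<omega>))) \<longlonglongrightarrow> drifted a \<omega> s"
          unfolding z by simp
        have e1: "\<forall>\<^sub>F n in sequentially. dhit n a \<omega> < s" using order_tendstoD(2)[OF dhit_tendsto True] .
        show ?thesis
        proof (cases "drifted a \<omega> s < 0")
          case neg: True
          from order_tendstoD(2)[OF lim neg] e1 show ?thesis
            by eventually_elim (use neg True elim(3) in \<open>simp add: E_def\<close>)
        next
          case False
          then have "0 < drifted a \<omega> s" using elim(1) by simp
          from order_tendstoD(1)[OF lim this] show ?thesis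
            by eventually_elim (use False in \<open>simp add: E_def\<close>)
        qed
      qed
    qed
  qed measurable
  have "prob {\<omega>\<in>space M. hitT a \<omega> < s \<and> drifted a \<omega> s < 0} = 1 / 2 * prob {\<omega>\<in>space M. hitT a \<omega> < s}"
    using tendsto_mult_left[OF lim1, of "1 / 2"] lim2 unfolding pE by (rule LIMSEQ_unique[rotated])
  moreover have "prob {\<omega>\<in>space M. hitT a \<omega> < s \<and> drifted a \<omega> s < 0} = prob {\<omega>\<in>space M. drifted a \<omega> s < 0}"
  proof (rule finite_measure_eq_AE)
    show "AE \<omega> in M. (\<omega> \<in> {\<omega>\<in>space M. hitT a \<omega> < s \<and> drifted a \<omega> s < 0}) = (\<omega> \<in> {\<omega>\<in>space M. drifted a \<omega> s < 0})"
      using AE_bridge_zero AE_space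
    proof eventually_elim
      case (elim \<omega>)
      have "hitT a \<omega> < s" if neg: "drifted a \<omega> s < 0"
      proof -
        have "hitT a \<omega> \<le> s" unfolding hitT_def by (rule hit_le) (use sI neg in simp_all)
        moreover have "hitT a \<omega> \<noteq> s"
        proof
          assume e: "hitT a \<omega> = s"
          have "drifted a \<omega> (hitT a \<omega>) = 0"
            by (rule drifted_hit_zero[OF elim(2) _ a]) (use elim(1) e sI in simp_all)
          then show False using neg e by simp
        qed
        ultimately show ?thesis by simp
      qed
      then show ?case by blast
    qed
  qed measurable
  ultimately show ?thesis by simp
qed

end

section \<open>The occupation identity\<close>

text \<open>One-sided limits of the primitive at the ends admit integrable singularities such as
  that of \<open>1 / sqrt x\<close> at 0.\<close>

lemma nn_integral_FTC_open:
  fixes f F :: "real \<Rightarrow> real"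
  assumes ab: "a < b" and F: "\<And>x. a < x \<Longrightarrow> x < b \<Longrightarrow> DERIV F x :> f x"
    and f: "\<And>x. a < x \<Longrightarrow> x < b \<Longrightarrow> isCont f x" and nn: "\<And>x. a < x \<Longrightarrow> x < b \<Longrightarrow> 0 \<le> f x"
    and A: "(F \<longlongrightarrow> A) (at_right a)" and B: "(F \<longlongrightarrow> B) (at_left b)"
  shows "(\<integral>\<^sup>+x. ennreal (f x) * indicator {a<..<b} x \<partial>lborel) = ennreal (B - A)"
proof -
  have ab': "ereal a < ereal b" using ab by simp
  have A': "((F \<circ> real_of_ereal) \<longlongrightarrow> A) (at_right (ereal a))" using A by (simp add: ereal_tendsto_simps1)
  have B': "((F \<circ> real_of_ereal) \<longlongrightarrow> B) (at_left (ereal b))" using B by (simp add: ereal_tendsto_simps1)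
  have F': "\<And>x. ereal a < ereal x \<Longrightarrow> ereal x < ereal b \<Longrightarrow> DERIV F x :> f x"
    using F by (simp only: less_ereal.simps)
  have f': "\<And>x. ereal a < ereal x \<Longrightarrow> ereal x < ereal b \<Longrightarrow> isCont f x"
    using f by (simp only: less_ereal.simps)
  have nn': "AE x in lborel. ereal a < ereal x \<longrightarrow> ereal x < ereal b \<longrightarrow> 0 \<le> f x"
    using nn by (intro AE_I2 impI) (simp only: less_ereal.simps)
  note ftc = interval_integral_FTC_nonneg[OF ab' F' f' nn' A' B']
  have int: "set_integrable lborel {a<..<b} f" using ftc(1) by (simp only: einterval_eq)
  have "(LBINT x=ereal a..ereal b. f x) = B - A" by (rule ftc(2))
  then have eq: "(LINT x:{a<..<b}|lborel. f x) = B - A"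
    using ab by (simp add: interval_lebesgue_integral_def einterval_eq)
  have "(\<integral>\<^sup>+x. ennreal (f x) * indicator {a<..<b} x \<partial>lborel) = (\<integral>\<^sup>+x. ennreal (indicator {a<..<b} x *\<^sub>R f x) \<partial>lborel)"
    by (rule nn_integral_cong) (simp add: indicator_def)
  also have "\<dots> = ennreal (LINT x|lborel. indicator {a<..<b} x *\<^sub>R f x)"
    by (rule nn_integral_eq_integral) (use int nn in \<open>simp_all add: set_integrable_def indicator_def\<close>)
  finally show ?thesis using eq unfolding set_lebesgue_integral_def by simp
qed

lemma sqrt_tendsto_0: "((\<lambda>x. 2 * sqrt x) \<longlongrightarrow> 0) (at_right 0)"
proof -
  have "isCont (\<lambda>x. 2 * sqrt x) 0" by (intro continuous_intros isCont_real_sqrt)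
  then show ?thesis by (simp add: isCont_def filterlim_at_split)
qed

lemma nn_integral_inverse_sqrt:
  assumes c: "0 < c"
  shows "(\<integral>\<^sup>+x. ennreal (1 / sqrt x) * indicator {0<..<c} x \<partial>lborel) = ennreal (2 * sqrt c)"
proof -
  have "(\<integral>\<^sup>+x. ennreal (1 / sqrt x) * indicator {0<..<c} x \<partial>lborel) = ennreal (2 * sqrt c - 0)"
  proof (rule nn_integral_FTC_open[OF c])
    show "DERIV (\<lambda>x. 2 * sqrt x) x :> 1 / sqrt x" if "0 < x" for x
      using that by (auto intro!: derivative_eq_intros simp: field_simps)
    show "isCont (\<lambda>x. 1 / sqrt x) x" if "0 < x" for x
      using that by (intro continuous_intros isCont_real_sqrt) simp
    show "((\<lambda>x. 2 * sqrt x) \<longlongrightarrow> 0) (at_right 0)" by (rule sqrt_tendsto_0)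
    have "isCont (\<lambda>x. 2 * sqrt x) c" by (intro continuous_intros isCont_real_sqrt)
    then show "((\<lambda>x. 2 * sqrt x) \<longlongrightarrow> 2 * sqrt c) (at_left c)"
      unfolding isCont_def by (rule tendsto_within_subset) simp
  qed simp
  then show ?thesis by simp
qed

text \<open>The source of the factor 2: for positive \<open>c\<close> the interval below
  \<open>c\<close> and the tail \<open>c / (x * sqrt x)\<close> above it contribute
  \<open>2 * sqrt c\<close> each.\<close>

lemma nn_integral_truncated_inverse_sqrt:
  "(\<integral>\<^sup>+x. ennreal (1 / sqrt x * min 1 (max 0 (c / x))) * indicator {0<..} x \<partial>lborel) =
    2 * (\<integral>\<^sup>+x. ennreal (1 / sqrt x) * (indicator {0<..} x * indicator {..<c} x) \<partial>lborel)"
proof (cases "0 < c")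
  case False
  have 1: "(\<integral>\<^sup>+x. ennreal (1 / sqrt x * min 1 (max 0 (c / x))) * indicator {0<..} x \<partial>lborel) = (\<integral>\<^sup>+(x::real). 0 \<partial>lborel)"
  proof (rule nn_integral_cong)
    fix x :: real
    show "ennreal (1 / sqrt x * min 1 (max 0 (c / x))) * indicator {0<..} x = 0"
    proof (cases "0 < x")
      case True
      then have "c / x \<le> 0" using False by (simp add: divide_le_0_iff)
      then have "max 0 (c / x) = 0" by simp
      then show ?thesis by simp
    qed simp
  qed
  have 2: "(\<integral>\<^sup>+x. ennreal (1 / sqrt x) * (indicator {0<..} x * indicator {..<c} x) \<partial>lborel) = (\<integral>\<^sup>+(x::real). 0 \<partial>lborel)"
    by (rule nn_integral_cong) (use False in \<open>simp add: indicator_def\<close>)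
  show ?thesis unfolding 1 2 by simp
next
  case c: True
  define g where "g x = (if 0 < x then c / (x * sqrt x) else 0)" for x
  have gm: "g \<in> borel_measurable borel" unfolding g_def by measurable
  have tail: "(\<integral>\<^sup>+x. ennreal (g x) * indicator {c..} x \<partial>lborel) = ennreal (0 - (- 2 * c / sqrt c))"
  proof (rule nn_integral_FTC_atLeast[where F="\<lambda>x. - 2 * c / sqrt x" and T=0, OF gm])
    show "DERIV (\<lambda>x. - 2 * c / sqrt x) x :> g x" if x: "c \<le> x" for x
    proof -
      have xp: "0 < x" using c x by simp
      have "DERIV (\<lambda>x. - 2 * c / sqrt x) x :> - (- 2 * c * (inverse (sqrt x) / 2)) / (sqrt x * sqrt x)"
        using xp by (auto intro!: derivative_eq_intros)
      moreover have "- (- 2 * c * (inverse (sqrt x) / 2)) / (sqrt x * sqrt x) = g x"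
        using xp by (simp add: g_def field_simps)
      ultimately show ?thesis by simp
    qed
    show "0 \<le> g x" if "c \<le> x" for x using c that by (simp add: g_def)
    show "((\<lambda>x. - 2 * c / sqrt x) \<longlongrightarrow> 0) at_top"
      by (intro tendsto_divide_0[OF tendsto_const] filterlim_at_top_imp_at_infinity sqrt_at_top)
  qed
  have cc: "2 * c / sqrt c = 2 * sqrt c"
  proof -
    have "c / sqrt c = sqrt c" using c by (intro real_div_sqrt) simp
    then show ?thesis by (simp only: times_divide_eq_right[symmetric])
  qed
  have ae: "AE x in lborel. ennreal (1 / sqrt x * min 1 (max 0 (c / x))) * indicator {0<..} x =
      ennreal (1 / sqrt x) * indicator {0<..<c} x + ennreal (g x) * indicator {c..} x"
  proof (rule AE_I2)
    fix x :: real
    consider "x \<le> 0" | "0 < x" "x < c" | "c \<le> x" by linarith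
    then show "ennreal (1 / sqrt x * min 1 (max 0 (c / x))) * indicator {0<..} x =
      ennreal (1 / sqrt x) * indicator {0<..<c} x + ennreal (g x) * indicator {c..} x"
    proof cases
      case 1 then show ?thesis using c by (simp add: indicator_def)
    next
      case 2
      then have "1 \<le> c / x" by simp
      then have "min 1 (max 0 (c / x)) = 1" by simp
      then show ?thesis using 2 by (simp add: indicator_def)
    next
      case 3
      then have "c / x \<le> 1" "0 \<le> c / x" "0 < x" using c by simp_all
      then have "min 1 (max 0 (c / x)) = c / x" by simp
      then show ?thesis using 3 \<open>0 < x\<close> by (simp add: indicator_def g_def mult.commute)
    qed
  qed
  have m1: "(\<lambda>x. ennreal (1 / sqrt x) * indicator {0<..<c} x) \<in> borel_measurable lborel" by measurable
  have m2: "(\<lambda>x. ennreal (g x) * indicator {c..} x) \<in> borel_measurable lborel" using gm by measurable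
  have "(\<integral>\<^sup>+x. ennreal (1 / sqrt x * min 1 (max 0 (c / x))) * indicator {0<..} x \<partial>lborel) =
      ennreal (2 * sqrt c) + ennreal (2 * sqrt c)"
    unfolding nn_integral_cong_AE[OF ae] nn_integral_add[OF m1 m2] nn_integral_inverse_sqrt[OF c] tail
    by (simp add: cc)
  moreover have "(\<integral>\<^sup>+x. ennreal (1 / sqrt x) * (indicator {0<..} x * indicator {..<c} x) \<partial>lborel) = ennreal (2 * sqrt c)"
    unfolding nn_integral_inverse_sqrt[OF c, symmetric]
    by (rule nn_integral_cong) (simp add: indicator_def)
  ultimately show ?thesis by (simp only: mult_2)
qed

section \<open>The density of the first zero\<close>

lemma cdf_std_normal_has_derivative:
  "(cdf std_normal_distribution has_real_derivative std_normal_density x) (at x)"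
proof -
  interpret N: real_distribution std_normal_distribution by (rule real_dist_normal_dist)
  \<comment> \<open>The base point \<open>x - 1\<close> only has to lie to the left of
    \<open>x\<close>; the derivative is then that of a primitive on a compact interval.\<close>
  define I where "I y = integral {x - 1..y} std_normal_density" for y
  have cont: "continuous_on S std_normal_density" for S
    unfolding normal_density_def by (intro continuous_intros) simp
  have eq: "cdf std_normal_distribution y = cdf std_normal_distribution (x - 1) + I y" if y: "x - 1 < y" for y
  proof -
    have "integrable lborel std_normal_density" by simp
    then have si: "set_integrable lborel {x - 1..y} std_normal_density"
      unfolding set_integrable_def by (intro integrable_mult_indicator) simp_all
    have "cdf std_normal_distribution y - cdf std_normal_distribution (x - 1) = measure std_normal_distribution {x - 1<..y}"
      using y by (rule N.cdf_diff_eq)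
    also have "\<dots> = (LINT z|std_normal_distribution. indicator {x - 1<..y} z)" by simp
    also have "\<dots> = (LINT z|lborel. std_normal_density z *\<^sub>R indicator {x - 1<..y} z)"
      by (subst integral_density) simp_all
    also have "\<dots> = (LINT z|lborel. indicator {x - 1..y} z *\<^sub>R std_normal_density z)"
    proof (rule integral_cong_AE)
      have "AE z in lborel. z \<noteq> x - 1" by (rule AE_lborel_singleton)
      then show "AE z in lborel. std_normal_density z *\<^sub>R indicator {x - 1<..y} z = indicator {x - 1..y} z *\<^sub>R std_normal_density z"
        by eventually_elim (simp add: indicator_def)
    qed simp_all
    also have "\<dots> = I y" using set_borel_integral_eq_integral(2)[OF si] unfolding set_lebesgue_integral_def I_def .
    finally show ?thesis by simp
  qed
  have "(I has_real_derivative std_normal_density x) (at x within {x - 1..x + 1})"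
    unfolding I_def by (rule integral_has_real_derivative[OF cont]) simp
  then have "(I has_real_derivative std_normal_density x) (at x)"
    by (simp add: at_within_Icc_at)
  then have d: "((\<lambda>y. cdf std_normal_distribution (x - 1) + I y) has_real_derivative std_normal_density x) (at x)"
    by (auto intro!: derivative_eq_intros)
  show ?thesis
  proof (rule has_field_derivative_transform_within_open[OF d])
    show "open {x - 1<..}" by simp
    show "x \<in> {x - 1<..}" by simp
    show "cdf std_normal_distribution (x - 1) + I y = cdf std_normal_distribution y" if "y \<in> {x - 1<..}" for y
      using eq[of y] that by simp
  qed
qed

lemma std_normal_atom: "measure std_normal_distribution {c} = 0"
proof -
  interpret N: real_distribution std_normal_distribution by (rule real_dist_normal_dist)
  have "isCont (cdf std_normal_distribution) c"
    by (rule DERIV_isCont[OF cdf_std_normal_has_derivative])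
  then show ?thesis using N.isCont_cdf by simp
qed

lemma cdf_std_normal_0: "cdf std_normal_distribution 0 = 1 / 2"
proof -
  interpret N: real_distribution std_normal_distribution by (rule real_dist_normal_dist)
  have "distributed std_normal_distribution lborel (\<lambda>x. x) std_normal_density"
    unfolding distributed_def by (auto simp: distr_id2)
  then have "distributed std_normal_distribution lborel (\<lambda>x. 0 + (-1) * x) (normal_density (0 + (-1) * 0) (\<bar>-1\<bar> * 1))"
    by (rule N.normal_density_affine) simp_all
  then have D: "distr std_normal_distribution lborel (\<lambda>x. - x) = std_normal_distribution"
    by (simp add: distributed_def)
  have "measure std_normal_distribution {..0} = measure (distr std_normal_distribution lborel (\<lambda>x. - x)) {..0}"
    unfolding D ..
  also have "\<dots> = measure std_normal_distribution {0..}"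
    by (subst measure_distr) (auto intro!: arg_cong[where f="measure std_normal_distribution"])
  also have "\<dots> = measure std_normal_distribution ({0<..} \<union> {0})"
    by (rule arg_cong[where f="measure std_normal_distribution"]) auto
  also have "\<dots> = measure std_normal_distribution {0<..} + measure std_normal_distribution {0}"
    by (rule N.finite_measure_Union) simp_all
  also have "\<dots> = measure std_normal_distribution (space std_normal_distribution - {..0})"
    unfolding std_normal_atom by (auto intro!: arg_cong[where f="measure std_normal_distribution"])
  also have "\<dots> = 1 - measure std_normal_distribution {..0}" by (rule N.prob_compl) simp
  finally show ?thesis unfolding cdf_def by simp
qed

text \<open>For positive \<open>a\<close> this is the density of the first zero of a bridge of unit
  length from \<open>a\<close> to 0; the formula is the derivative of
  \<open>hit_cdf a\<close>.\<close>

definition hit_kernel :: "real \<Rightarrow> real \<Rightarrow> real"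
  where "hit_kernel a s = (if 0 < s \<and> s < 1 then
    a * exp (- (a\<^sup>2 * (1 - s) / (2 * s))) / (sqrt (2 * pi) * s\<^sup>2 * sqrt ((1 - s) / s)) else 0)"

lemma hit_kernel_measurable[measurable (raw)]:
  assumes [measurable]: "f \<in> borel_measurable K" "g \<in> borel_measurable K"
  shows "(\<lambda>x. hit_kernel (f x) (g x)) \<in> borel_measurable K"
  unfolding hit_kernel_def by measurable

text \<open>Twice the probability that a bridge from \<open>a\<close> to 0 is negative at
  \<open>s\<close>, where it is normal with mean \<open>a * (1 - s)\<close> and variance
  \<open>s * (1 - s)\<close>. By reflection this is the distribution function of the first zero for
  positive \<open>a\<close>.\<close>

definition hit_cdf :: "real \<Rightarrow> real \<Rightarrow> real"
  where "hit_cdf a s = 2 * cdf std_normal_distribution (- a * sqrt ((1 - s) / s))"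

lemma hit_cdf_deriv:
  assumes s: "0 < s" "s < 1"
  shows "DERIV (hit_cdf a) s :> hit_kernel a s"
proof -
  define q where "q = sqrt ((1 - s) / s)"
  have q: "0 < q" "q * q = (1 - s) / s" unfolding q_def using s by simp_all
  have p: "0 < (1 - s) / s" using s by simp
  have "DERIV (\<lambda>s. (1 - s) / s) s :> ((0 - 1) * s - (1 - s) * 1) / (s * s)"
    using s by (intro DERIV_divide DERIV_diff DERIV_const DERIV_ident) simp
  moreover have "((0 - 1) * s - (1 - s) * 1) / (s * s) = - 1 / s\<^sup>2" by (simp add: power2_eq_square)
  ultimately have "DERIV (\<lambda>s. (1 - s) / s) s :> - 1 / s\<^sup>2" by simp
  from DERIV_chain2[OF DERIV_real_sqrt[OF p] this]
  have "DERIV (\<lambda>s. sqrt ((1 - s) / s)) s :> inverse q / 2 * (- 1 / s\<^sup>2)" unfolding q_def .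
  from DERIV_cmult[OF this, of "- a"]
  have "DERIV (\<lambda>s. - a * sqrt ((1 - s) / s)) s :> - a * (inverse q / 2 * (- 1 / s\<^sup>2))" .
  from DERIV_cmult[OF DERIV_chain2[OF cdf_std_normal_has_derivative this], of 2]
  have d: "DERIV (hit_cdf a) s :> 2 * (std_normal_density (- a * q) * (- a * (inverse q / 2 * (- 1 / s\<^sup>2))))"
    unfolding hit_cdf_def[abs_def] q_def .
  have "std_normal_density (- a * q) = exp (- (a\<^sup>2 * (1 - s) / (2 * s))) / sqrt (2 * pi)"
  proof -
    have "(- a * q)\<^sup>2 = a\<^sup>2 * ((1 - s) / s)" using q(2) by (simp add: power2_eq_square algebra_simps)
    then show ?thesis unfolding std_normal_density_def by simp
  qed
  then have "2 * (std_normal_density (- a * q) * (- a * (inverse q / 2 * (- 1 / s\<^sup>2)))) = hit_kernel a s"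
    unfolding hit_kernel_def q_def[symmetric] using s q(1) by (simp add: field_simps)
  then show ?thesis using d by simp
qed

lemma hit_kernel_nonneg: "0 \<le> a \<Longrightarrow> 0 \<le> hit_kernel a s"
  unfolding hit_kernel_def by simp

lemma hit_kernel_isCont:
  assumes s: "0 < s" "s < 1"
  shows "isCont (hit_kernel a) s"
proof -
  have "isCont (\<lambda>s. a * exp (- (a\<^sup>2 * (1 - s) / (2 * s))) / (sqrt (2 * pi) * s\<^sup>2 * sqrt ((1 - s) / s))) s"
    using s by (intro continuous_intros isCont_real_sqrt) simp_all
  moreover have "\<forall>\<^sub>F r in nhds s. a * exp (- (a\<^sup>2 * (1 - r) / (2 * r))) / (sqrt (2 * pi) * r\<^sup>2 * sqrt ((1 - r) / r)) = hit_kernel a r"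
  proof -
    have "\<forall>\<^sub>F r in nhds s. r \<in> {0<..<1}" using s by (intro eventually_nhds_in_open) simp_all
    then show ?thesis by eventually_elim (simp add: hit_kernel_def)
  qed
  ultimately show ?thesis by (subst isCont_cong[symmetric])
qed

lemma hit_cdf_at_0:
  assumes a: "0 < a"
  shows "(hit_cdf a \<longlongrightarrow> 0) (at_right 0)"
proof -
  interpret N: real_distribution std_normal_distribution by (rule real_dist_normal_dist)
  have "filterlim (\<lambda>s::real. - a * sqrt ((1 - s) / s)) at_bot (at_right 0)"
    using a by real_asymp
  from filterlim_compose[OF N.cdf_lim_at_bot this]
  have "((\<lambda>s. 2 * cdf std_normal_distribution (- a * sqrt ((1 - s) / s))) \<longlongrightarrow> 2 * 0) (at_right 0)"
    by (rule tendsto_mult_left)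
  then show ?thesis unfolding hit_cdf_def[abs_def] by simp
qed

lemma hit_cdf_at_1: "(hit_cdf a \<longlongrightarrow> 1) (at_left 1)"
proof -
  have "isCont (\<lambda>s::real. - a * sqrt ((1 - s) / s)) 1"
    by (intro continuous_intros isCont_real_sqrt) simp
  from isCont_o2[OF this DERIV_isCont[OF cdf_std_normal_has_derivative]]
  have "isCont (\<lambda>s. 2 * cdf std_normal_distribution (- a * sqrt ((1 - s) / s))) 1"
    by (rule continuous_mult[OF continuous_const])
  then have "(hit_cdf a \<longlongrightarrow> hit_cdf a 1) (at_left 1)"
    unfolding hit_cdf_def[abs_def] isCont_def by (rule tendsto_within_subset) simp
  moreover have "hit_cdf a 1 = 1" unfolding hit_cdf_def by (simp add: cdf_std_normal_0)
  ultimately show ?thesis by simp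
qed

lemma hit_kernel_integral:
  assumes a: "0 < a"
  shows "0 < s \<Longrightarrow> s < 1 \<Longrightarrow> (\<integral>\<^sup>+r. ennreal (hit_kernel a r) * indicator {..s} r \<partial>lborel) = ennreal (hit_cdf a s)"
    and "(\<integral>\<^sup>+r. ennreal (hit_kernel a r) \<partial>lborel) = 1"
proof -
  assume s: "0 < s" "s < 1"
  have "(\<integral>\<^sup>+r. ennreal (hit_kernel a r) * indicator {..s} r \<partial>lborel) = (\<integral>\<^sup>+r. ennreal (hit_kernel a r) * indicator {0<..<s} r \<partial>lborel)"
  proof (rule nn_integral_cong_AE)
    have "AE r in lborel. r \<noteq> s" by (rule AE_lborel_singleton)
    then show "AE r in lborel. ennreal (hit_kernel a r) * indicator {..s} r = ennreal (hit_kernel a r) * indicator {0<..<s} r"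
      by eventually_elim (simp add: indicator_def hit_kernel_def)
  qed
  also have "\<dots> = ennreal (hit_cdf a s - 0)"
  proof (rule nn_integral_FTC_open[OF s(1)])
    show "(hit_cdf a \<longlongrightarrow> 0) (at_right 0)" by (rule hit_cdf_at_0[OF a])
    have "isCont (hit_cdf a) s" by (rule DERIV_isCont[OF hit_cdf_deriv[OF s]])
    then show "(hit_cdf a \<longlongrightarrow> hit_cdf a s) (at_left s)"
      unfolding isCont_def by (rule tendsto_within_subset) simp
    fix x assume x: "0 < x" "x < s"
    then have "x < 1" using s by simp
    then show "DERIV (hit_cdf a) x :> hit_kernel a x" "isCont (hit_kernel a) x"
      using hit_cdf_deriv[OF x(1)] hit_kernel_isCont[OF x(1)] by blast+
    show "0 \<le> hit_kernel a x" using a by (intro hit_kernel_nonneg) simp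
  qed
  finally show "(\<integral>\<^sup>+r. ennreal (hit_kernel a r) * indicator {..s} r \<partial>lborel) = ennreal (hit_cdf a s)" by simp
next
  have "(\<integral>\<^sup>+r. ennreal (hit_kernel a r) \<partial>lborel) = (\<integral>\<^sup>+r. ennreal (hit_kernel a r) * indicator {0<..<1} r \<partial>lborel)"
    by (rule nn_integral_cong) (simp add: indicator_def hit_kernel_def)
  also have "\<dots> = ennreal (1 - 0)"
  proof (rule nn_integral_FTC_open[OF _ _ _ _ hit_cdf_at_0[OF a] hit_cdf_at_1])
    fix x :: real assume x: "0 < x" "x < 1"
    show "DERIV (hit_cdf a) x :> hit_kernel a x" by (rule hit_cdf_deriv[OF x])
    show "isCont (hit_kernel a) x" by (rule hit_kernel_isCont[OF x])
    show "0 \<le> hit_kernel a x" using a by (intro hit_kernel_nonneg) simp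
  qed simp
  finally show "(\<integral>\<^sup>+r. ennreal (hit_kernel a r) \<partial>lborel) = 1" by simp
qed

context bridge_space
begin

lemma drifted_negative_prob:
  assumes s: "s \<in> {0<..<1}"
  shows "2 * prob {\<omega>\<in>space M. drifted a \<omega> s < 0} = hit_cdf a s"
proof -
  have sI: "s \<in> {0..1}" "0 < s" "s < 1" using s by simp_all
  define d where "d = sqrt (s * (1 - s))"
  have d: "0 < d" "d\<^sup>2 = s * (1 - s)" unfolding d_def using sI by simp_all
  have "expectation (\<lambda>\<omega>. (\<beta> s \<omega>)\<^sup>2) = d\<^sup>2"
    using bridge_cov[OF sI(1) sI(1)] unfolding d(2) by (simp add: power2_eq_square algebra_simps)
  then have "distributed M lborel (\<beta> s) (normal_density 0 d)"
    by (rule mem_distributed[OF bridge_mem[OF sI(1)] d(1)])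
  then have "distributed M lborel (\<lambda>\<omega>. (\<beta> s \<omega> - 0) / d) std_normal_density"
    using normal_standard_normal_convert[OF d(1)] by simp
  then have D: "distr M lborel (\<lambda>\<omega>. \<beta> s \<omega> / d) = std_normal_distribution" and
    m: "(\<lambda>\<omega>. \<beta> s \<omega> / d) \<in> borel_measurable M" by (simp_all add: distributed_def)
  define c where "c = - a * (1 - s) / d"
  have c: "c = - a * sqrt ((1 - s) / s)"
  proof -
    have "(1 - s) / d = sqrt ((1 - s) / s)"
    proof -
      have "(1 - s) = sqrt (1 - s) * sqrt (1 - s)" using sI by simp
      then have "(1 - s) / d = (sqrt (1 - s) * sqrt (1 - s)) / (sqrt s * sqrt (1 - s))"
        unfolding d_def real_sqrt_mult by simp
      also have "\<dots> = sqrt (1 - s) / sqrt s"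
        by (rule nonzero_mult_divide_mult_cancel_right) (use sI in simp)
      finally show ?thesis by (simp add: real_sqrt_divide)
    qed
    then show ?thesis unfolding c_def by (metis times_divide_eq_right)
  qed
  interpret N: real_distribution std_normal_distribution by (rule real_dist_normal_dist)
  have "{\<omega>\<in>space M. drifted a \<omega> s < 0} = (\<lambda>\<omega>. \<beta> s \<omega> / d) -` {..<c} \<inter> space M"
  proof -
    have "drifted a \<omega> s < 0 \<longleftrightarrow> \<beta> s \<omega> / d < c" if "\<omega> \<in> space M" for \<omega>
    proof -
      have "\<beta> s \<omega> / d < c \<longleftrightarrow> \<beta> s \<omega> < - a * (1 - s)"
        unfolding c_def using d(1) by (simp only: divide_less_cancel) auto
      then show ?thesis unfolding drifted_eq[OF that sI(1)] by linarith
    qed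
    then show ?thesis by auto
  qed
  then have "prob {\<omega>\<in>space M. drifted a \<omega> s < 0} = measure (distr M lborel (\<lambda>\<omega>. \<beta> s \<omega> / d)) {..<c}"
    using m by (simp add: measure_distr)
  also have "\<dots> = measure std_normal_distribution {..<c} + measure std_normal_distribution {c}"
    unfolding D std_normal_atom by simp
  also have "\<dots> = measure std_normal_distribution ({..<c} \<union> {c})"
    by (rule N.finite_measure_Union[symmetric]) simp_all
  also have "{..<c} \<union> {c} = {..c}" by auto
  finally show ?thesis unfolding hit_cdf_def cdf_def c by simp
qed

text \<open>The reflection formula concerns strict inequalities at levels in (0, 1). Right limits
  convert it into the distribution function, and at 0 they exclude an atom.\<close>

lemma hit_distributed:
  assumes a: "0 < a"
  shows "distributed M lborel (hitT a) (hit_kernel a)"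
proof (rule distributedI_borel_atMost[where g="\<lambda>x. if x \<le> 0 then 0 else if x < 1 then hit_cdf a x else 1"])
  have lt: "prob {\<omega>\<in>space M. hitT a \<omega> < s} = hit_cdf a s" if "s \<in> {0<..<1}" for s
    using hit_before[OF a that] drifted_negative_prob[OF that] by simp
  have le: "prob {\<omega>\<in>space M. hitT a \<omega> \<le> x} \<le> hit_cdf a s" if "x < s" "0 < s" "s < 1" for x s
  proof -
    have "prob {\<omega>\<in>space M. hitT a \<omega> \<le> x} \<le> prob {\<omega>\<in>space M. hitT a \<omega> < s}"
      by (rule finite_measure_mono) (use that in auto)
    then show ?thesis using lt that by simp
  qed
  fix x :: real
  have "(\<integral>\<^sup>+r. ennreal (hit_kernel a r) * indicator {..x} r \<partial>lborel) = ennreal (if x \<le> 0 then 0 else if x < 1 then hit_cdf a x else 1)"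
  proof -
    consider "x \<le> 0" | "0 < x" "x < 1" | "1 \<le> x" by linarith
    then show ?thesis
    proof cases
      case 1
      have "(\<integral>\<^sup>+r. ennreal (hit_kernel a r) * indicator {..x} r \<partial>lborel) = (\<integral>\<^sup>+(r::real). 0 \<partial>lborel)"
        by (rule nn_integral_cong) (use 1 in \<open>simp add: indicator_def hit_kernel_def\<close>)
      then show ?thesis using 1 by simp
    next
      case 2 then show ?thesis using hit_kernel_integral(1)[OF a] by simp
    next
      case 3
      have "(\<integral>\<^sup>+r. ennreal (hit_kernel a r) * indicator {..x} r \<partial>lborel) = (\<integral>\<^sup>+r. ennreal (hit_kernel a r) \<partial>lborel)"
        by (rule nn_integral_cong) (use 3 in \<open>simp add: indicator_def hit_kernel_def\<close>)
      then show ?thesis using 3 hit_kernel_integral(2)[OF a] by simp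
    qed
  qed
  moreover have "(\<integral>\<^sup>+r. ennreal (hit_kernel a r * indicator {..x} r) \<partial>lborel) = (\<integral>\<^sup>+r. ennreal (hit_kernel a r) * indicator {..x} r \<partial>lborel)"
    by (rule nn_integral_cong) (simp add: indicator_def)
  ultimately show "(\<integral>\<^sup>+r. ennreal (hit_kernel a r * indicator {..x} r) \<partial>lborel) = ennreal (if x \<le> 0 then 0 else if x < 1 then hit_cdf a x else 1)"
    by (simp only:)
  have "prob {\<omega>\<in>space M. hitT a \<omega> \<le> x} = (if x \<le> 0 then 0 else if x < 1 then hit_cdf a x else 1)"
  proof -
    consider "x \<le> 0" | "0 < x" "x < 1" | "1 \<le> x" by linarith
    then show ?thesis
    proof cases
      case 1
      have "prob {\<omega>\<in>space M. hitT a \<omega> \<le> x} \<le> 0"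
      proof (rule tendsto_lowerbound[OF hit_cdf_at_0[OF a]])
        have "\<forall>\<^sub>F s in at_right 0. s \<in> {0<..<1::real}" by (rule eventually_at_right_real) simp
        then show "\<forall>\<^sub>F s in at_right 0. prob {\<omega>\<in>space M. hitT a \<omega> \<le> x} \<le> hit_cdf a s"
          by eventually_elim (use 1 le[of x] in simp)
      qed simp
      then show ?thesis using 1 by (simp add: measure_le_0_iff)
    next
      case 2
      have "isCont (hit_cdf a) x" by (rule DERIV_isCont[OF hit_cdf_deriv[OF 2]])
      then have c: "(hit_cdf a \<longlongrightarrow> hit_cdf a x) (at_right x)"
        unfolding isCont_def by (rule tendsto_within_subset) simp
      have "prob {\<omega>\<in>space M. hitT a \<omega> \<le> x} \<le> hit_cdf a x"
      proof (rule tendsto_lowerbound[OF c])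
        have "\<forall>\<^sub>F s in at_right x. s \<in> {x<..<1::real}" using 2 by (intro eventually_at_right_real) simp
        then show "\<forall>\<^sub>F s in at_right x. prob {\<omega>\<in>space M. hitT a \<omega> \<le> x} \<le> hit_cdf a s"
          by eventually_elim (use 2 le[of x] in simp)
      qed simp
      moreover have "hit_cdf a x \<le> prob {\<omega>\<in>space M. hitT a \<omega> \<le> x}"
      proof -
        have "prob {\<omega>\<in>space M. hitT a \<omega> < x} \<le> prob {\<omega>\<in>space M. hitT a \<omega> \<le> x}"
          by (rule finite_measure_mono) auto
        then show ?thesis using lt[of x] 2 by simp
      qed
      ultimately show ?thesis using 2 by simp
    next
      case 3
      have "{\<omega>\<in>space M. hitT a \<omega> \<le> x} = space M" using hitT_bounds(2)[of a] 3 by (auto intro: order_trans)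
      then show ?thesis using 3 by (simp add: prob_space)
    qed
  qed
  then show "emeasure M {\<omega>\<in>space M. hitT a \<omega> \<le> x} = ennreal (if x \<le> 0 then 0 else if x < 1 then hit_cdf a x else 1)"
    by (simp only: emeasure_eq_measure)
qed (use a in \<open>simp_all add: hit_kernel_nonneg\<close>)

lemma AE_hit_less_1:
  assumes a: "0 < a" shows "AE \<omega> in M. hitT a \<omega> < 1"
proof -
  have "AE x in density lborel (\<lambda>x. ennreal (hit_kernel a x)). x < 1"
    by (subst AE_density) (simp_all add: hit_kernel_def)
  then have "AE x in distr M lborel (hitT a). x < 1"
    by (simp only: distributed_distr_eq_density[OF hit_distributed[OF a]])
  then show ?thesis by (subst (asm) AE_distr_iff) simp_all
qed

text \<open>For v \<ge> 1 the event is certain, since the first zero plus the occupation time after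
  it cannot exceed 1, and \<open>ramp\<close> equals 1 outside the null event that the hitting time
  is 1.\<close>

lemma hit_occupation_law_all:
  assumes a: "0 < a" and \<sigma>: "\<sigma> * \<sigma> = 1"
  shows "emeasure M {\<omega>\<in>space M. hitT a \<omega> + measure lborel {r\<in>{0..1}. hitT a \<omega> \<le> r \<and> \<sigma> * drifted a \<omega> r < 0} \<le> v} =
    (\<integral>\<^sup>+r. ennreal (hit_kernel a r) * ennreal (ramp v r) \<partial>lborel)"
proof -
  have "prob {\<omega>\<in>space M. hitT a \<omega> + measure lborel {r\<in>{0..1}. hitT a \<omega> \<le> r \<and> \<sigma> * drifted a \<omega> r < 0} \<le> v} =
    expectation (\<lambda>\<omega>. ramp v (hitT a \<omega>))"
  proof (cases "v < 1")
    case True show ?thesis by (rule hit_occupation_law[OF a \<sigma> True])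
  next
    case False
    have le: "hitT a \<omega> + measure lborel {r\<in>{0..1}. hitT a \<omega> \<le> r \<and> \<sigma> * drifted a \<omega> r < 0} \<le> v" for \<omega>
    proof -
      define B where "B = {r\<in>{0..1}. hitT a \<omega> \<le> r \<and> \<sigma> * drifted a \<omega> r < 0}"
      have sub: "B \<subseteq> {hitT a \<omega>..1}" unfolding B_def by (rule subsetI) simp
      have "measure lborel B \<le> measure lborel {hitT a \<omega>..1}"
      \<comment> \<open>The bound is wanted at every sample point; should the set fail to be
        measurable, its \<open>measure\<close> is 0 by convention.\<close>
      proof (cases "B \<in> sets lborel")
        case True
        show ?thesis by (rule measure_mono_fmeasurable[OF sub True]) (rule fmeasurableI, simp, cases "hitT a \<omega> \<le> 1", simp_all)
      next
        case False
        show ?thesis unfolding measure_notin_sets[OF False] by (rule measure_nonneg)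
      qed
      also have "\<dots> = 1 - hitT a \<omega>" using hitT_bounds(2)[of a \<omega>] by simp
      finally show ?thesis using False unfolding B_def by linarith
    qed
    have "expectation (\<lambda>\<omega>. ramp v (hitT a \<omega>)) = expectation (\<lambda>_. 1)"
    proof (rule integral_cong_AE)
      show "AE \<omega> in M. ramp v (hitT a \<omega>) = 1"
        using AE_hit_less_1[OF a]
      proof eventually_elim
        case (elim \<omega>)
        have "1 \<le> (v - hitT a \<omega>) / (1 - hitT a \<omega>)" using elim False by (simp add: le_divide_eq)
        then show ?case unfolding ramp_def by simp
      qed
    qed simp_all
    then show ?thesis using le by (simp add: prob_space)
  qed
  then have "emeasure M {\<omega>\<in>space M. hitT a \<omega> + measure lborel {r\<in>{0..1}. hitT a \<omega> \<le> r \<and> \<sigma> * drifted a \<omega> r < 0} \<le> v} =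
    ennreal (expectation (\<lambda>\<omega>. ramp v (hitT a \<omega>)))" by (simp only: emeasure_eq_measure)
  also have "\<dots> = (\<integral>\<^sup>+\<omega>. ennreal (ramp v (hitT a \<omega>)) \<partial>M)"
  proof (rule nn_integral_eq_integral[symmetric])
    show "integrable M (\<lambda>\<omega>. ramp v (hitT a \<omega>))"
      by (rule integrable_const_bound[where B=1]) (simp_all add: ramp_bounds abs_of_nonneg)
  qed (simp add: ramp_bounds)
  also have "\<dots> = (\<integral>\<^sup>+r. ennreal (hit_kernel a r) * ennreal (ramp v r) \<partial>lborel)"
    by (rule distributed_nn_integral[OF hit_distributed[OF a], symmetric]) simp
  finally show ?thesis .
qed

end

text \<open>The Gaussian transition density from \<open>y\<close> to 0 in time \<open>t\<close>,
  without the constant \<open>1 / sqrt (2 * pi)\<close>.\<close>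

definition weight :: "real \<Rightarrow> real \<Rightarrow> real"
  where "weight y t = exp (- (y\<^sup>2 / (2 * t))) / sqrt t"

lemma weight_nonneg: "0 < t \<Longrightarrow> 0 \<le> weight y t"
  unfolding weight_def by simp

lemma weight_measurable[measurable]: "weight y \<in> borel_measurable borel"
  unfolding weight_def by measurable

text \<open>For positive \<open>y\<close>, the density of the first passage time of Brownian motion
  from \<open>y\<close> to 0.\<close>

definition entrance :: "real \<Rightarrow> real \<Rightarrow> real"
  where "entrance y s = y * exp (- (y\<^sup>2 / (2 * s))) / (sqrt (2 * pi) * s * sqrt s)"

lemma entrance_measurable[measurable]: "entrance y \<in> borel_measurable borel"
  unfolding entrance_def by measurable

text \<open>First-passage decomposition of the transition density: 0 is reached at time
  \<open>s\<close>, and the return to 0 after the remaining \<open>x - s\<close> carries the weight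
  \<open>1 / sqrt (x - s)\<close>. The factor \<open>1 / x\<close> is the Jacobian of passing from
  the unit interval to length \<open>x\<close>.\<close>

lemma weight_hit_kernel:
  assumes x: "0 < x" and y: "0 < y"
  shows "weight y x * (1 / x) * hit_kernel (y / sqrt x) (s / x) =
    (if 0 < s \<and> s < x then entrance y s * (1 / sqrt (x - s)) else 0)"
proof (cases "0 < s \<and> s < x")
  case False
  then have "\<not> (0 < s / x \<and> s / x < 1)" using x by (auto simp: zero_less_divide_iff divide_less_eq)
  then have "hit_kernel (y / sqrt x) (s / x) = 0" unfolding hit_kernel_def by (simp only: if_False)
  then show ?thesis by (simp only: False if_False mult_zero_right)
next
  case True
  define A where "A = sqrt x"
  define S where "S = sqrt s"
  define R where "R = sqrt (x - s)"
  have pos: "0 < A" "0 < S" "0 < R" unfolding A_def S_def R_def using x True by simp_all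
  have sq: "x = A * A" "s = S * S" unfolding A_def S_def using x True by simp_all
  have c: "0 < s / x \<and> s / x < 1" using x True by simp
  have e1: "sqrt ((1 - s / x) / (s / x)) = R / S"
  proof -
    have "(1 - s / x) / (s / x) = (x - s) / s" using x True by (simp add: field_simps)
    then show ?thesis unfolding R_def S_def by (simp add: real_sqrt_divide)
  qed
  have e2: "exp (- (y\<^sup>2 / (2 * x))) * exp (- ((y / sqrt x)\<^sup>2 * (1 - s / x) / (2 * (s / x)))) = exp (- (y\<^sup>2 / (2 * s)))"
  proof -
    have "- (y\<^sup>2 / (2 * x)) + - ((y / sqrt x)\<^sup>2 * (1 - s / x) / (2 * (s / x))) = - (y\<^sup>2 / (2 * s))"
      using x True by (simp add: power_divide field_simps)
    then show ?thesis by (simp only: exp_add[symmetric])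
  qed
  have "weight y x * (1 / x) * hit_kernel (y / sqrt x) (s / x) =
     (exp (- (y\<^sup>2 / (2 * x))) * exp (- ((y / sqrt x)\<^sup>2 * (1 - s / x) / (2 * (s / x))))) *
      ((1 / A) * (1 / x) * ((y / A) / (sqrt (2 * pi) * (s / x)\<^sup>2 * (R / S))))"
    unfolding weight_def hit_kernel_def e1 A_def[symmetric] by (simp add: c)
  also have "(1 / A) * (1 / x) * ((y / A) / (sqrt (2 * pi) * (s / x)\<^sup>2 * (R / S))) = y / (sqrt (2 * pi) * s * S) * (1 / R)"
    unfolding sq using pos by (simp add: field_simps power2_eq_square)
  also have "exp (- (y\<^sup>2 / (2 * x))) * exp (- ((y / sqrt x)\<^sup>2 * (1 - s / x) / (2 * (s / x)))) = exp (- (y\<^sup>2 / (2 * s)))" by (rule e2)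
  also have "exp (- (y\<^sup>2 / (2 * s))) * (y / (sqrt (2 * pi) * s * S) * (1 / R)) = entrance y s * (1 / sqrt (x - s))"
    unfolding entrance_def S_def R_def by simp
  finally show ?thesis using True by simp
qed

text \<open>Decomposing at the hitting time of \<open>0\<close>, and using that a bridge from \<open>0\<close> to \<open>0\<close> of length \<open>l\<close>
  spends a uniform time below \<open>0\<close>, turns both sides of the occupation identity into integrals over
  \<open>s\<close> and \<open>l = x - s\<close>.\<close>

lemma kernel_split:
  assumes y: "0 < y" and h: "h \<in> borel_measurable borel" "\<And>r. 0 \<le> h r"
    and x: "0 < x"
  shows "ennreal (weight y x) * (\<integral>\<^sup>+r. ennreal (hit_kernel (y / sqrt x) r) * ennreal (h r) \<partial>lborel) =
    (\<integral>\<^sup>+s. ennreal (entrance y s) * (indicator {0<..} s * indicator {..<x} s * ennreal (1 / sqrt (x - s) * h (s / x))) \<partial>lborel)"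
proof -
  have [measurable]: "h \<in> borel_measurable borel" by (rule h)
  have wn: "0 \<le> weight y x" using x by (rule weight_nonneg)
  have "(\<integral>\<^sup>+r. ennreal (hit_kernel (y / sqrt x) r) * ennreal (h r) \<partial>lborel) =
     ennreal \<bar>1 / x\<bar> * (\<integral>\<^sup>+s. ennreal (hit_kernel (y / sqrt x) (0 + (1 / x) * s)) * ennreal (h (0 + (1 / x) * s)) \<partial>lborel)"
    by (rule nn_integral_real_affine) (use x in simp_all)
  then have i: "(\<integral>\<^sup>+r. ennreal (hit_kernel (y / sqrt x) r) * ennreal (h r) \<partial>lborel) =
     ennreal (1 / x) * (\<integral>\<^sup>+s. ennreal (hit_kernel (y / sqrt x) (s / x)) * ennreal (h (s / x)) \<partial>lborel)"
    using x by simp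
  have em: "ennreal (weight y x * (1 / x)) = ennreal (weight y x) * ennreal (1 / x)"
    by (rule ennreal_mult[OF wn]) (use x in simp)
  have "ennreal (weight y x) * (\<integral>\<^sup>+r. ennreal (hit_kernel (y / sqrt x) r) * ennreal (h r) \<partial>lborel) =
     ennreal (weight y x * (1 / x)) * (\<integral>\<^sup>+s. ennreal (hit_kernel (y / sqrt x) (s / x)) * ennreal (h (s / x)) \<partial>lborel)"
    by (simp only: i em mult.assoc)
  also have "\<dots> = (\<integral>\<^sup>+s. ennreal (weight y x * (1 / x)) * (ennreal (hit_kernel (y / sqrt x) (s / x)) * ennreal (h (s / x))) \<partial>lborel)"
    by (rule nn_integral_cmult[symmetric]) measurable
  also have "\<dots> = (\<integral>\<^sup>+s. ennreal (entrance y s) * (indicator {0<..} s * indicator {..<x} s * ennreal (1 / sqrt (x - s) * h (s / x))) \<partial>lborel)"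
  proof (rule nn_integral_cong)
    fix s :: real
    have kn: "0 \<le> hit_kernel (y / sqrt x) (s / x)" using x y by (intro hit_kernel_nonneg) simp
    have "ennreal (weight y x * (1 / x)) * (ennreal (hit_kernel (y / sqrt x) (s / x)) * ennreal (h (s / x))) =
       ennreal (weight y x * (1 / x) * hit_kernel (y / sqrt x) (s / x) * h (s / x))"
      using x wn kn h(2) by (simp add: ennreal_mult[symmetric] mult.assoc)
    also have "\<dots> = ennreal ((if 0 < s \<and> s < x then entrance y s * (1 / sqrt (x - s)) else 0) * h (s / x))"
      by (simp only: weight_hit_kernel[OF x y])
    also have "\<dots> = ennreal (entrance y s) * (indicator {0<..} s * indicator {..<x} s * ennreal (1 / sqrt (x - s) * h (s / x)))"
    proof (cases "0 < s \<and> s < x")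
      case True
      have "0 \<le> entrance y s" unfolding entrance_def using True y by simp
      then show ?thesis using True h(2)[of "s / x"] by (simp add: ennreal_mult[symmetric] mult.assoc)
    next
      case False then show ?thesis by (auto simp: indicator_def)
    qed
    finally show "ennreal (weight y x * (1 / x)) * (ennreal (hit_kernel (y / sqrt x) (s / x)) * ennreal (h (s / x))) =
      ennreal (entrance y s) * (indicator {0<..} s * indicator {..<x} s * ennreal (1 / sqrt (x - s) * h (s / x)))" .
  qed
  finally show ?thesis .
qed

text \<open>Fubini brings the integral over the length inside. Shifted by \<open>s\<close>, it is
  the case of a start at 0 with \<open>u - s\<close> in place of \<open>u\<close>, which yields the
  factor 2. The first-passage decomposition read backwards then restores the weight.\<close>

lemma occupation_identity:
  assumes y: "0 < y" and u: "0 \<le> u"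
  shows "(\<integral>\<^sup>+x. indicator {0<..} x * (ennreal (weight y x) * (\<integral>\<^sup>+r. ennreal (hit_kernel (y / sqrt x) r) * ennreal (ramp (u / x) r) \<partial>lborel)) \<partial>lborel)
    = 2 * (\<integral>\<^sup>+x. indicator {0<..} x * indicator {..<u} x * ennreal (weight y x) \<partial>lborel)"
proof -
  \<comment> \<open>\<open>J\<close> vanishes at nonpositive arguments: a first zero after time
    \<open>u\<close> contributes nothing.\<close>
  define J where "J c = (\<integral>\<^sup>+x. ennreal (1 / sqrt x) * (indicator {0<..} x * indicator {..<c} x) \<partial>lborel)" for c :: real
  have shift: "(\<integral>\<^sup>+x. g (x - s) \<partial>lborel) = (\<integral>\<^sup>+x. g x \<partial>lborel)" if [measurable]: "g \<in> borel_measurable borel" for g :: "real \<Rightarrow> ennreal" and s :: real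
    using nn_integral_real_affine[of g 1 "- s"] by simp
  have "(\<integral>\<^sup>+x. indicator {0<..} x * (ennreal (weight y x) * (\<integral>\<^sup>+r. ennreal (hit_kernel (y / sqrt x) r) * ennreal (ramp (u / x) r) \<partial>lborel)) \<partial>lborel)
    = (\<integral>\<^sup>+x. (\<integral>\<^sup>+s. ennreal (entrance y s) * (indicator {0<..} s * (indicator {0<..} (x - s) * ennreal (1 / sqrt (x - s) * min 1 (max 0 ((u - s) / (x - s)))))) \<partial>lborel) \<partial>lborel)"
  proof (rule nn_integral_cong)
    fix x :: real
    show "indicator {0<..} x * (ennreal (weight y x) * (\<integral>\<^sup>+r. ennreal (hit_kernel (y / sqrt x) r) * ennreal (ramp (u / x) r) \<partial>lborel))
      = (\<integral>\<^sup>+s. ennreal (entrance y s) * (indicator {0<..} s * (indicator {0<..} (x - s) * ennreal (1 / sqrt (x - s) * min 1 (max 0 ((u - s) / (x - s)))))) \<partial>lborel)"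
    proof (cases "0 < x")
      case True
      have "ramp (u / x) (s / x) = min 1 (max 0 ((u - s) / (x - s)))" if "s < x" for s
      proof -
        have "(u / x - s / x) / (1 - s / x) = ((u - s) / x) / ((x - s) / x)" using True by (simp add: diff_divide_distrib)
        also have "\<dots> = (u - s) / (x - s)" using True by simp
        finally show ?thesis unfolding ramp_def by simp
      qed
      then have "(\<integral>\<^sup>+s. ennreal (entrance y s) * (indicator {0<..} s * indicator {..<x} s * ennreal (1 / sqrt (x - s) * ramp (u / x) (s / x))) \<partial>lborel) =
         (\<integral>\<^sup>+s. ennreal (entrance y s) * (indicator {0<..} s * (indicator {0<..} (x - s) * ennreal (1 / sqrt (x - s) * min 1 (max 0 ((u - s) / (x - s)))))) \<partial>lborel)"
        by (intro nn_integral_cong) (simp add: indicator_def)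
      then show ?thesis using kernel_split[OF y ramp_measurable ramp_bounds(1) True, of "u / x"] True by simp
    next
      case False
      have "(\<integral>\<^sup>+s. ennreal (entrance y s) * (indicator {0<..} s * (indicator {0<..} (x - s) * ennreal (1 / sqrt (x - s) * min 1 (max 0 ((u - s) / (x - s)))))) \<partial>lborel) = (\<integral>\<^sup>+(s::real). 0 \<partial>lborel)"
        by (rule nn_integral_cong) (use False in \<open>simp add: indicator_def\<close>)
      then show ?thesis using False by simp
    qed
  qed
  also have "\<dots> = (\<integral>\<^sup>+s. (\<integral>\<^sup>+x. ennreal (entrance y s) * (indicator {0<..} s * (indicator {0<..} (x - s) * ennreal (1 / sqrt (x - s) * min 1 (max 0 ((u - s) / (x - s)))))) \<partial>lborel) \<partial>lborel)"
    by (rule lborel_pair.Fubini') measurable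
  also have "\<dots> = (\<integral>\<^sup>+s. ennreal (entrance y s) * (indicator {0<..} s * (2 * J (u - s))) \<partial>lborel)"
  proof (rule nn_integral_cong)
    fix s :: real
    define g where "g x = indicator {0<..} x * ennreal (1 / sqrt x * min 1 (max 0 ((u - s) / x)))" for x :: real
    have gm[measurable]: "g \<in> borel_measurable borel" unfolding g_def by measurable
    have "(\<integral>\<^sup>+x. ennreal (entrance y s) * (indicator {0<..} s * (indicator {0<..} (x - s) * ennreal (1 / sqrt (x - s) * min 1 (max 0 ((u - s) / (x - s)))))) \<partial>lborel)
       = (\<integral>\<^sup>+x. (ennreal (entrance y s) * indicator {0<..} s) * g (x - s) \<partial>lborel)"
      unfolding g_def by (simp only: mult.assoc)
    also have "\<dots> = (ennreal (entrance y s) * indicator {0<..} s) * (\<integral>\<^sup>+x. g (x - s) \<partial>lborel)"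
      by (rule nn_integral_cmult) measurable
    also have "(\<integral>\<^sup>+x. g (x - s) \<partial>lborel) = (\<integral>\<^sup>+x. g x \<partial>lborel)" by (rule shift[OF gm])
    also have "\<dots> = 2 * J (u - s)"
      unfolding g_def J_def nn_integral_truncated_inverse_sqrt[symmetric] by (simp only: mult.commute)
    finally show "(\<integral>\<^sup>+x. ennreal (entrance y s) * (indicator {0<..} s * (indicator {0<..} (x - s) * ennreal (1 / sqrt (x - s) * min 1 (max 0 ((u - s) / (x - s)))))) \<partial>lborel)
      = ennreal (entrance y s) * (indicator {0<..} s * (2 * J (u - s)))" by (simp only: mult.assoc)
  qed
  also have "\<dots> = 2 * (\<integral>\<^sup>+s. ennreal (entrance y s) * (indicator {0<..} s * J (u - s)) \<partial>lborel)"
  proof -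
    have Jm: "(\<lambda>s. J (u - s)) \<in> borel_measurable borel"
    proof -
      have "J (u - s) = (\<integral>\<^sup>+x. ennreal (1 / sqrt x) * (indicator {0<..} x * (if x < u - s then 1 else 0)) \<partial>lborel)" for s
        unfolding J_def by (rule nn_integral_cong) (simp add: indicator_def)
      then show ?thesis by (simp only:) measurable
    qed
    have "(\<integral>\<^sup>+s. ennreal (entrance y s) * (indicator {0<..} s * (2 * J (u - s))) \<partial>lborel) = (\<integral>\<^sup>+s. 2 * (ennreal (entrance y s) * (indicator {0<..} s * J (u - s))) \<partial>lborel)"
      by (simp only: mult.left_commute)
    also have "\<dots> = 2 * (\<integral>\<^sup>+s. ennreal (entrance y s) * (indicator {0<..} s * J (u - s)) \<partial>lborel)"
      by (rule nn_integral_cmult) (use Jm in measurable)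
    finally show ?thesis .
  qed
  also have "(\<integral>\<^sup>+s. ennreal (entrance y s) * (indicator {0<..} s * J (u - s)) \<partial>lborel) =
     (\<integral>\<^sup>+s. (\<integral>\<^sup>+x. ennreal (entrance y s) * (indicator {0<..} s * (indicator {0<..} (x - s) * indicator {..<u} x * ennreal (1 / sqrt (x - s)))) \<partial>lborel) \<partial>lborel)"
  proof (rule nn_integral_cong)
    fix s :: real
    define g where "g x = ennreal (1 / sqrt x) * (indicator {0<..} x * indicator {..<u - s} x)" for x :: real
    have gm[measurable]: "g \<in> borel_measurable borel" unfolding g_def by measurable
    have "ennreal (entrance y s) * (indicator {0<..} s * J (u - s)) = (ennreal (entrance y s) * indicator {0<..} s) * (\<integral>\<^sup>+x. g (x - s) \<partial>lborel)"
      unfolding shift[OF gm] unfolding J_def g_def by (simp only: mult.assoc)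
    also have "\<dots> = (\<integral>\<^sup>+x. (ennreal (entrance y s) * indicator {0<..} s) * g (x - s) \<partial>lborel)"
      by (rule nn_integral_cmult[symmetric]) measurable
    also have "\<dots> = (\<integral>\<^sup>+x. ennreal (entrance y s) * (indicator {0<..} s * (indicator {0<..} (x - s) * indicator {..<u} x * ennreal (1 / sqrt (x - s)))) \<partial>lborel)"
      by (rule nn_integral_cong) (simp add: g_def indicator_def)
    finally show "ennreal (entrance y s) * (indicator {0<..} s * J (u - s)) =
      (\<integral>\<^sup>+x. ennreal (entrance y s) * (indicator {0<..} s * (indicator {0<..} (x - s) * indicator {..<u} x * ennreal (1 / sqrt (x - s)))) \<partial>lborel)" .
  qed
  also have "\<dots> = (\<integral>\<^sup>+x. (\<integral>\<^sup>+s. ennreal (entrance y s) * (indicator {0<..} s * (indicator {0<..} (x - s) * indicator {..<u} x * ennreal (1 / sqrt (x - s)))) \<partial>lborel) \<partial>lborel)"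
    by (rule lborel_pair.Fubini'[symmetric]) measurable
  also have "\<dots> = (\<integral>\<^sup>+x. indicator {0<..} x * indicator {..<u} x * ennreal (weight y x) \<partial>lborel)"
  proof (rule nn_integral_cong)
    fix x :: real
    show "(\<integral>\<^sup>+s. ennreal (entrance y s) * (indicator {0<..} s * (indicator {0<..} (x - s) * indicator {..<u} x * ennreal (1 / sqrt (x - s)))) \<partial>lborel) =
      indicator {0<..} x * indicator {..<u} x * ennreal (weight y x)"
    proof (cases "0 < x \<and> x < u")
      case True
      have "(\<integral>\<^sup>+s. ennreal (entrance y s) * (indicator {0<..} s * (indicator {0<..} (x - s) * indicator {..<u} x * ennreal (1 / sqrt (x - s)))) \<partial>lborel) =
        (\<integral>\<^sup>+s. ennreal (entrance y s) * (indicator {0<..} s * indicator {..<x} s * ennreal (1 / sqrt (x - s) * 1)) \<partial>lborel)"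
        by (rule nn_integral_cong) (use True in \<open>simp add: indicator_def\<close>)
      \<comment> \<open>\<open>kernel_split\<close> read from right to left with the constant
        function 1; the density of the first zero has total mass 1.\<close>
      also have "\<dots> = ennreal (weight y x) * (\<integral>\<^sup>+r. ennreal (hit_kernel (y / sqrt x) r) * ennreal 1 \<partial>lborel)"
        by (rule kernel_split[OF y, where h="\<lambda>_. 1", symmetric]) (use True in simp_all)
      also have "(\<integral>\<^sup>+r. ennreal (hit_kernel (y / sqrt x) r) * ennreal 1 \<partial>lborel) = 1"
        using hit_kernel_integral(2)[of "y / sqrt x"] y True by simp
      finally show ?thesis using True by simp
    next
      case False
      have "(\<integral>\<^sup>+s. ennreal (entrance y s) * (indicator {0<..} s * (indicator {0<..} (x - s) * indicator {..<u} x * ennreal (1 / sqrt (x - s)))) \<partial>lborel) = (\<integral>\<^sup>+(s::real). 0 \<partial>lborel)"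
        by (rule nn_integral_cong) (use False in \<open>auto simp: indicator_def\<close>)
      then show ?thesis using False by (auto simp: indicator_def)
    qed
  qed
  finally show ?thesis .
qed

lemma hit_scale: "0 < c \<Longrightarrow> hit (\<lambda>r. c * f r) = hit f"
  unfolding hit_def by (simp add: mult_le_0_iff)

lemma below_scale: "0 < c \<Longrightarrow> below (\<lambda>r. c * f r) = below f"
  unfolding below_def by (simp add: mult_less_0_iff)

text \<open>The path of \<open>scaled_bridge\<close> in unit time, so that the interval of
  definition does not vary with the length \<open>x\<close>.\<close>

definition unscaled :: "real \<Rightarrow> real \<Rightarrow> (real \<Rightarrow> real) \<Rightarrow> real \<Rightarrow> real"
  where "unscaled y x f r = sqrt x * f r + y * (1 - r)"

text \<open>The sum of the hitting time and the time below 0 for the whole process when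
  \<open>g\<close> takes the value \<open>x\<close>; \<open>path_decomposition\<close> establishes
  this for continuous paths.\<close>

definition total :: "real \<Rightarrow> real \<Rightarrow> (real \<Rightarrow> real) \<Rightarrow> real"
  where "total y x f = x * (hit (unscaled y x f) + below (unscaled y x f))"

lemma total_cong: "(\<And>r. r \<in> {0..1} \<Longrightarrow> f r = g r) \<Longrightarrow> total y x f = total y x g"
  unfolding total_def by (intro arg_cong2[where f="(*)"] arg_cong2[where f="(+)"] refl hit_cong below_cong) (simp_all add: unscaled_def)

text \<open>Before its first nonpositive value the path is positive, so all time below 0 comes
  afterwards. The positive factor \<open>sqrt x\<close> affects no sign.\<close>

lemma total_continuous_pos:
  assumes x: "0 < x" and y: "0 < y" and f: "continuous_on {0..1} f"
    and d: "\<And>r. r \<in> {0..1} \<Longrightarrow> d r = f r + y / sqrt x * (1 - r)"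
  shows "total y x f = x * (hit d + measure lborel {r\<in>{0..1}. hit d \<le> r \<and> 1 * d r < 0})"
proof -
  have sx: "0 < sqrt x" using x by simp
  define q where "q = y / sqrt x"
  have q: "y = sqrt x * q" unfolding q_def using sx by simp
  have e: "unscaled y x f r = sqrt x * d r" if "r \<in> {0..1}" for r
    unfolding unscaled_def d[OF that] q_def[symmetric] by (subst q) (simp add: algebra_simps)
  have 1: "hit (unscaled y x f) = hit d"
    by (rule trans[OF hit_cong hit_scale[OF sx]]) (rule e)
  have 2: "below (unscaled y x f) = below d"
    by (rule trans[OF below_cong below_scale[OF sx]]) (rule e)
  have "{r\<in>{0..1}. d r < 0} = {r\<in>{0..1}. hit d \<le> r \<and> 1 * d r < 0}"
    using hit_le[of _ d] by force
  then show ?thesis unfolding total_def 1 2 unfolding below_def by simp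
qed

text \<open>A path starting below 0 has hitting time 0, but the whole stretch before its first zero
  counts as time below 0. The sum therefore has the same form as for a positive start, with
  \<open>d\<close> the reflected path.\<close>

lemma total_continuous_neg:
  assumes x: "0 < x" and y: "y < 0" and f: "continuous_on {0..1} f" "f 0 = 0"
    and d: "\<And>r. r \<in> {0..1} \<Longrightarrow> d r = - f r + (- y) / sqrt x * (1 - r)"
    and dc: "continuous_on {0..1} d"
  shows "total y x f = x * (hit d + measure lborel {r\<in>{0..1}. hit d \<le> r \<and> (-1) * d r < 0})"
proof -
  have sx: "0 < sqrt x" using x by simp
  define q where "q = (- y) / sqrt x"
  have q: "y = - (sqrt x * q)" unfolding q_def using sx by simp
  have e: "unscaled y x f r = sqrt x * (- d r)" if "r \<in> {0..1}" for r
    unfolding unscaled_def d[OF that] q_def[symmetric] by (subst q) (simp add: algebra_simps)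
  have "hit (unscaled y x f) \<le> 0" by (rule hit_le) (use f(2) y in \<open>simp_all add: unscaled_def\<close>)
  then have 1: "hit (unscaled y x f) = 0" using hit_bounds(1)[of "unscaled y x f"] by simp
  have 2: "below (unscaled y x f) = below (\<lambda>r. - d r)"
    by (rule trans[OF below_cong below_scale[OF sx]]) (rule e)
  define B where "B = {r\<in>{0..1}. hit d \<le> r \<and> (-1) * d r < 0}"
  have Bm: "B \<in> sets borel"
    unfolding B_def using tail_set_measurable[OF dc, of "hit d" "-1" 0 1] by simp
  have "{r\<in>{0..1}. - d r < 0} = {0..<hit d} \<union> B"
    using before_hit[of _ d] hit_bounds[of d] unfolding B_def by (auto simp: not_le)
  moreover have "measure lborel ({0..<hit d} \<union> B) = measure lborel {0..<hit d} + measure lborel B"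
  proof (rule measure_Un_AE)
    show "AE r in lborel. r \<notin> {0..<hit d} \<or> r \<notin> B" by (rule AE_I2) (simp add: B_def)
    show "{0..<hit d} \<in> fmeasurable lborel" by (rule fmeasurableI) (use hit_bounds(1)[of d] in simp_all)
    show "B \<in> fmeasurable lborel"
    proof (rule fmeasurableI2)
      show "{0..1::real} \<in> fmeasurable lborel" by (rule fmeasurableI) simp_all
      show "B \<subseteq> {0..1}" unfolding B_def by blast
      show "B \<in> sets lborel" using Bm by simp
    qed
  qed
  moreover have "measure lborel {0..<hit d} = hit d" using hit_bounds(1)[of d] by simp
  ultimately have "below (\<lambda>r. - d r) = hit d + measure lborel B" unfolding below_def by simp
  then show ?thesis unfolding total_def 1 2 B_def by simp
qed

text \<open>A version of the hitting time that is measurable on the whole path space.\<close>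

definition hit_time_measure :: "(real \<Rightarrow> real) \<Rightarrow> real"
  where "hit_time_measure f = measure lborel {s\<in>{0..1}. \<not> hit_by s f}"

text \<open>On a continuous path the times without a hit so far form an interval that ends at the
  hitting time, apart from the single point 1, where \<open>hit\<close> and \<open>hit_by\<close>
  may disagree.\<close>

lemma hit_time_measure_eq:
  assumes f: "continuous_on {0..1} f"
  shows "hit_time_measure f = hit f"
proof -
  have eq: "s \<in> {s\<in>{0..1}. \<not> hit_by s f} \<longleftrightarrow> s \<in> {0..<hit f}" if "s \<noteq> 1" for s
  proof (cases "s < 1")
    case True
    then show ?thesis using hit_by_hit[OF f True] by (simp add: not_le conj_commute)
  next
    case False
    then have "s \<notin> {0..1}" "s \<notin> {0..<hit f}" using that hit_bounds(2)[of f] by simp_all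
    then show ?thesis by blast
  qed
  have h1: "1 \<notin> {0..<hit f}" using hit_bounds(2)[of f] by simp
  have "{s\<in>{0..1}. \<not> hit_by s f} = {0..<hit f} \<or> {s\<in>{0..1}. \<not> hit_by s f} = insert 1 {0..<hit f}"
  proof (cases "1 \<in> {s\<in>{0..1}. \<not> hit_by s f}")
    case True
    have "{s\<in>{0..1}. \<not> hit_by s f} = insert 1 {0..<hit f}"
    proof (rule set_eqI)
      fix s show "s \<in> {s\<in>{0..1}. \<not> hit_by s f} \<longleftrightarrow> s \<in> insert 1 {0..<hit f}"
        using True eq[of s] by (cases "s = 1") (simp_all only: insert_iff simp_thms)
    qed
    then show ?thesis by (rule disjI2)
  next
    case False
    have "{s\<in>{0..1}. \<not> hit_by s f} = {0..<hit f}"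
    proof (rule set_eqI)
      fix s show "s \<in> {s\<in>{0..1}. \<not> hit_by s f} \<longleftrightarrow> s \<in> {0..<hit f}"
        using False h1 eq[of s] by (cases "s = 1") (simp_all only: simp_thms)
    qed
    then show ?thesis by (rule disjI1)
  qed
  moreover have "measure lborel (insert 1 {0..<hit f}) = measure lborel {0..<hit f}"
  proof (rule measure_eq_AE)
    have "AE s in lborel. s \<noteq> (1::real)" by (rule AE_lborel_singleton)
    then show "AE s in lborel. (s \<in> insert 1 {0..<hit f}) = (s \<in> {0..<hit f})" by eventually_elim simp
  qed simp_all
  moreover have "measure lborel {0..<hit f} = hit f" using hit_bounds(1)[of f] by simp
  ultimately show ?thesis unfolding hit_time_measure_def by (elim disjE) simp_all
qed

definition path_total :: "real \<Rightarrow> real \<Rightarrow> (real \<Rightarrow> real) \<Rightarrow> real"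
  where "path_total y x f = x * (hit_time_measure (unscaled y x (regularize f)) + below (unscaled y x (regularize f)))"

lemma unscaled_continuous: "continuous_on {0..1} f \<Longrightarrow> continuous_on {0..1} (unscaled y x f)"
  unfolding unscaled_def by (intro continuous_on_add continuous_on_mult continuous_on_diff continuous_on_const continuous_on_id)

lemma path_total_eq:
  assumes f: "continuous_on {0..1} f"
  shows "path_total y x f = total y x f"
proof -
  have e: "regularize f r = f r" if "r \<in> {0..1}" for r by (rule regularize_continuous[OF that f])
  have c: "continuous_on {0..1} (regularize f)"
    by (rule continuous_on_eq[OF f]) (simp only: e)
  have "path_total y x f = total y x (regularize f)"
    unfolding path_total_def total_def hit_time_measure_eq[OF unscaled_continuous[OF c]] by (rule refl)
  also have "\<dots> = total y x f" by (rule total_cong) (rule e)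
  finally show ?thesis .
qed

lemma unscaled_regularize_measurable:
  assumes [measurable]: "X \<in> borel_measurable K" "F \<in> K \<rightarrow>\<^sub>M path_space {0..1}" "R \<in> borel_measurable K"
  shows "(\<lambda>p. unscaled y (X p) (regularize (F p)) (R p)) \<in> borel_measurable K"
  unfolding unscaled_def by measurable

lemma path_total_measurable:
  assumes [measurable]: "X \<in> borel_measurable K" "F \<in> K \<rightarrow>\<^sub>M path_space {0..1}"
  shows "(\<lambda>p. path_total y (X p) (F p)) \<in> borel_measurable K"
proof -
  note [measurable] = unscaled_regularize_measurable
  \<comment> \<open>Imposing \<open>q \<le> s\<close> on a fixed countable set of rationals makes
    the condition jointly measurable in the path and \<open>s\<close>; with \<open>{0..s}\<close>
    the index set itself would vary.\<close>
  have hb: "hit_by s f \<longleftrightarrow> (\<forall>m::nat. \<exists>q\<in>\<rat> \<inter> {0..1}. q \<le> s \<and> f q < 1 / real (Suc m))" if "s \<in> {0..1}" for s f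
    unfolding hit_by_def using that by (intro all_cong1) auto
  have "{p \<in> space (K \<Otimes>\<^sub>M borel). \<forall>m::nat. \<exists>q\<in>\<rat> \<inter> {0..1}. q \<le> snd p \<and> unscaled y (X (fst p)) (regularize (F (fst p))) q < 1 / real (Suc m)} \<in> sets (K \<Otimes>\<^sub>M borel)"
  proof (intro sets.sets_Collect_countable_All sets.sets_Collect_countable_Ex')
    show "countable (\<rat> \<inter> {0..1})" using countable_rat by (rule countable_Int1)
    fix m :: nat and q :: real
    show "{p \<in> space (K \<Otimes>\<^sub>M borel). q \<le> snd p \<and> unscaled y (X (fst p)) (regularize (F (fst p))) q < 1 / real (Suc m)} \<in> sets (K \<Otimes>\<^sub>M borel)"
      by measurable
  qed
  then have [measurable]: "Measurable.pred (K \<Otimes>\<^sub>M borel) (\<lambda>p. \<forall>m::nat. \<exists>q\<in>\<rat> \<inter> {0..1}. q \<le> snd p \<and> unscaled y (X (fst p)) (regularize (F (fst p))) q < 1 / real (Suc m))"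
    unfolding pred_def .
  have 1: "(\<lambda>p. hit_time_measure (unscaled y (X p) (regularize (F p)))) \<in> borel_measurable K"
  proof -
    have "{s\<in>{0..1}. \<not> hit_by s (unscaled y (X p) (regularize (F p)))} =
       {s\<in>{0..1}. \<not> (\<forall>m::nat. \<exists>q\<in>\<rat> \<inter> {0..1}. q \<le> s \<and> unscaled y (X p) (regularize (F p)) q < 1 / real (Suc m))}" for p
      by (rule Collect_cong, rule conj_cong[OF refl]) (simp only: hb)
    then show ?thesis unfolding hit_time_measure_def
      by (simp only:) (rule measure_unit_interval_measurable, measurable)
  qed
  have 2: "(\<lambda>p. below (unscaled y (X p) (regularize (F p)))) \<in> borel_measurable K"
    unfolding below_def by (rule measure_unit_interval_measurable) measurable
  show ?thesis unfolding path_total_def by (intro borel_measurable_times borel_measurable_add assms 1 2)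
qed

section \<open>Law of the total time for the unconditioned bridge\<close>

context bridge_space
begin

lemma bpath_continuous: "\<omega> \<in> space M \<Longrightarrow> continuous_on {0..1} (bpath \<omega>)"
  by (rule continuous_on_eq[OF bridge_continuous]) (simp_all add: path_of_def)

lemma path_total_bpath_measurable: "(\<lambda>\<omega>. path_total y x (bpath \<omega>)) \<in> borel_measurable M"
  by (intro path_total_measurable measurable_bpath borel_measurable_const)

lemma path_total_law_pos:
  assumes x: "0 < x" and y: "0 < y"
  shows "emeasure M {\<omega>\<in>space M. path_total y x (bpath \<omega>) \<le> u} =
    (\<integral>\<^sup>+r. ennreal (hit_kernel (y / sqrt x) r) * ennreal (ramp (u / x) r) \<partial>lborel)"
proof -
  have a: "0 < y / sqrt x" using x y by simp
  have "{\<omega>\<in>space M. path_total y x (bpath \<omega>) \<le> u} =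
    {\<omega>\<in>space M. hitT (y / sqrt x) \<omega> + measure lborel {r\<in>{0..1}. hitT (y / sqrt x) \<omega> \<le> r \<and> 1 * drifted (y / sqrt x) \<omega> r < 0} \<le> u / x}"
  proof (rule Collect_cong, rule conj_cong[OF refl])
    fix \<omega> assume w: "\<omega> \<in> space M"
    have d: "drifted (y / sqrt x) \<omega> r = bpath \<omega> r + y / sqrt x * (1 - r)" if "r \<in> {0..1}" for r
      unfolding drifted_eq[OF w that] using that by (simp add: path_of_def)
    have "path_total y x (bpath \<omega>) = x * (hitT (y / sqrt x) \<omega> + measure lborel {r\<in>{0..1}. hitT (y / sqrt x) \<omega> \<le> r \<and> 1 * drifted (y / sqrt x) \<omega> r < 0})"
      unfolding path_total_eq[OF bpath_continuous[OF w]] hitT_def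
      by (rule total_continuous_pos[OF x y bpath_continuous[OF w] d])
    then show "path_total y x (bpath \<omega>) \<le> u \<longleftrightarrow> hitT (y / sqrt x) \<omega> + measure lborel {r\<in>{0..1}. hitT (y / sqrt x) \<omega> \<le> r \<and> 1 * drifted (y / sqrt x) \<omega> r < 0} \<le> u / x"
      using x by (simp only: pos_le_divide_eq mult.commute)
  qed
  then show ?thesis using hit_occupation_law_all[OF a, of 1 "u / x"] by simp
qed

lemma path_total_law_neg:
  assumes x: "0 < x" and y: "y < 0"
  shows "emeasure M {\<omega>\<in>space M. path_total y x (bpath \<omega>) \<le> u} =
    (\<integral>\<^sup>+r. ennreal (hit_kernel ((- y) / sqrt x) r) * ennreal (ramp (u / x) r) \<partial>lborel)"
proof -
  interpret N: bridge_space M V "\<lambda>s \<omega>. - \<beta> s \<omega>" by (rule neg_bridge)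
  define a where "a = (- y) / sqrt x"
  have a: "0 < a" unfolding a_def by (rule divide_pos_pos) (use x y in simp_all)
  define H where "H \<omega> = N.hitT a \<omega> + measure lborel {r\<in>{0..1}. N.hitT a \<omega> \<le> r \<and> (-1) * N.drifted a \<omega> r < 0}" for \<omega>
  have Hm: "H \<in> borel_measurable M"
    unfolding H_def by (intro borel_measurable_add N.hitT_measurable N.hit_tail_measurable)
  have "emeasure M {\<omega>\<in>space M. path_total y x (bpath \<omega>) \<le> u} = emeasure M {\<omega>\<in>space M. H \<omega> \<le> u / x}"
  proof (rule emeasure_eq_AE)
    show "AE \<omega> in M. (\<omega> \<in> {\<omega>\<in>space M. path_total y x (bpath \<omega>) \<le> u}) = (\<omega> \<in> {\<omega>\<in>space M. H \<omega> \<le> u / x})"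
      using AE_bridge_zero AE_space
    proof eventually_elim
      case (elim \<omega>)
      have d: "N.drifted a \<omega> r = - bpath \<omega> r + (- y) / sqrt x * (1 - r)" if "r \<in> {0..1}" for r
        unfolding N.drifted_eq[OF elim(2) that] a_def using that by (simp add: path_of_def)
      have b0: "bpath \<omega> 0 = 0" using elim(1) by (simp add: path_of_def)
      have "path_total y x (bpath \<omega>) = x * H \<omega>"
        unfolding path_total_eq[OF bpath_continuous[OF elim(2)]] N.hitT_def H_def
        by (rule total_continuous_neg[OF x y bpath_continuous[OF elim(2)] b0 d N.drifted_continuous[OF elim(2)]])
      then have "path_total y x (bpath \<omega>) \<le> u \<longleftrightarrow> H \<omega> \<le> u / x"
        using x by (simp only: pos_le_divide_eq mult.commute)
      then show ?case by simp
    qed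
  qed (use path_total_bpath_measurable[of y x] Hm in simp_all)
  then show ?thesis using N.hit_occupation_law_all[OF a, of "-1" "u / x"] unfolding H_def a_def by simp
qed

text \<open>For a start at 0 the hitting time vanishes almost surely, so only the uniform occupation
  time remains.\<close>

lemma path_total_law_zero:
  assumes x: "0 < x" and u: "0 \<le> u"
  shows "emeasure M {\<omega>\<in>space M. path_total 0 x (bpath \<omega>) \<le> u} = ennreal (min 1 (max 0 (u / x)))"
proof -
  have sx: "0 < sqrt x" using x by simp
  have "emeasure M {\<omega>\<in>space M. path_total 0 x (bpath \<omega>) \<le> u} = emeasure M {\<omega>\<in>space M. below (\<lambda>s. \<beta> s \<omega>) \<le> u / x}"
  proof (rule emeasure_eq_AE)
    show "AE \<omega> in M. (\<omega> \<in> {\<omega>\<in>space M. path_total 0 x (bpath \<omega>) \<le> u}) = (\<omega> \<in> {\<omega>\<in>space M. below (\<lambda>s. \<beta> s \<omega>) \<le> u / x})"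
      using AE_bridge_zero AE_space
    proof eventually_elim
      case (elim \<omega>)
      have e: "unscaled 0 x (bpath \<omega>) r = sqrt x * \<beta> r \<omega>" if "r \<in> {0..1}" for r
        using that by (simp add: unscaled_def path_of_def)
      have "hit (unscaled 0 x (bpath \<omega>)) \<le> 0" by (rule hit_le) (use e[of 0] elim(1) in simp_all)
      then have 1: "hit (unscaled 0 x (bpath \<omega>)) = 0" using hit_bounds(1)[of "unscaled 0 x (bpath \<omega>)"] by simp
      have 2: "below (unscaled 0 x (bpath \<omega>)) = below (\<lambda>s. \<beta> s \<omega>)"
        by (rule trans[OF below_cong below_scale[OF sx]]) (rule e)
      have "path_total 0 x (bpath \<omega>) = x * below (\<lambda>s. \<beta> s \<omega>)"
        unfolding path_total_eq[OF bpath_continuous[OF elim(2)]] total_def 1 2 by simp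
      then have "path_total 0 x (bpath \<omega>) \<le> u \<longleftrightarrow> below (\<lambda>s. \<beta> s \<omega>) \<le> u / x"
        using x by (simp only: pos_le_divide_eq mult.commute)
      then show ?case by simp
    qed
  qed (use path_total_bpath_measurable[of 0 x] below_bridge_measurable in simp_all)
  also have "\<dots> = ennreal (min 1 (max 0 (u / x)))"
  proof (cases "u / x < 1")
    case True
    then show ?thesis using below_bridge_uniform'[OF True] by (simp add: emeasure_eq_measure min_absorb2)
  next
    case False
    have "below (\<lambda>s. \<beta> s \<omega>) \<le> u / x" if w: "\<omega> \<in> space M" for \<omega>
    proof -
      have "below (\<lambda>s. \<beta> s \<omega>) \<le> measure lborel {0..1::real}"
        unfolding below_def
        by (rule measure_mono_fmeasurable) (use sublevel_measurable[OF w, of 0] in \<open>auto intro: fmeasurableI\<close>)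
      then show ?thesis using False by simp
    qed
    then have "{\<omega>\<in>space M. below (\<lambda>s. \<beta> s \<omega>) \<le> u / x} = space M" by blast
    then show ?thesis using False by (simp add: emeasure_space_1)
  qed
  finally show ?thesis .
qed

text \<open>The three starting positions merge here. For \<open>y = 0\<close> the truncated square
  root integral applies directly; otherwise the occupation identity is used with the absolute value
  of \<open>y\<close>, since \<open>weight\<close> depends on \<open>y\<close> only through its
  square.\<close>

theorem path_total_integral:
  assumes u: "0 \<le> u"
  shows "(\<integral>\<^sup>+x. indicator {0<..} x * (ennreal (weight y x) * emeasure M {\<omega>\<in>space M. path_total y x (bpath \<omega>) \<le> u}) \<partial>lborel)
    = 2 * (\<integral>\<^sup>+x. indicator {0<..} x * indicator {..<u} x * ennreal (weight y x) \<partial>lborel)"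
proof -
  consider "y = 0" | "0 < y" | "y < 0" by linarith
  then show ?thesis
  proof cases
    case 1
    have "(\<integral>\<^sup>+x. indicator {0<..} x * (ennreal (weight y x) * emeasure M {\<omega>\<in>space M. path_total y x (bpath \<omega>) \<le> u}) \<partial>lborel)
      = (\<integral>\<^sup>+x. ennreal (1 / sqrt x * min 1 (max 0 (u / x))) * indicator {0<..} x \<partial>lborel)"
    proof (rule nn_integral_cong)
      fix x :: real
      show "indicator {0<..} x * (ennreal (weight y x) * emeasure M {\<omega>\<in>space M. path_total y x (bpath \<omega>) \<le> u}) =
        ennreal (1 / sqrt x * min 1 (max 0 (u / x))) * indicator {0<..} x"
      proof (cases "0 < x")
        case True
        have "weight y x = 1 / sqrt x" unfolding 1 weight_def by simp
        moreover have "ennreal (1 / sqrt x * min 1 (max 0 (u / x))) = ennreal (1 / sqrt x) * ennreal (min 1 (max 0 (u / x)))"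
          by (rule ennreal_mult) (use True in simp_all)
        ultimately show ?thesis using path_total_law_zero[OF True u] 1 True by (simp add: indicator_def)
      qed simp
    qed
    also have "\<dots> = 2 * (\<integral>\<^sup>+x. ennreal (1 / sqrt x) * (indicator {0<..} x * indicator {..<u} x) \<partial>lborel)"
      by (rule nn_integral_truncated_inverse_sqrt)
    also have "(\<integral>\<^sup>+x. ennreal (1 / sqrt x) * (indicator {0<..} x * indicator {..<u} x) \<partial>lborel) =
        (\<integral>\<^sup>+x. indicator {0<..} x * indicator {..<u} x * ennreal (weight y x) \<partial>lborel)"
      by (rule nn_integral_cong) (simp add: 1 weight_def mult.commute)
    finally show ?thesis .
  next
    case 2
    have "(\<integral>\<^sup>+x. indicator {0<..} x * (ennreal (weight y x) * emeasure M {\<omega>\<in>space M. path_total y x (bpath \<omega>) \<le> u}) \<partial>lborel) =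
      (\<integral>\<^sup>+x. indicator {0<..} x * (ennreal (weight y x) * (\<integral>\<^sup>+r. ennreal (hit_kernel (y / sqrt x) r) * ennreal (ramp (u / x) r) \<partial>lborel)) \<partial>lborel)"
      by (rule nn_integral_cong) (use path_total_law_pos[OF _ 2] in \<open>simp add: indicator_def\<close>)
    then show ?thesis using occupation_identity[OF 2 u] by (simp only:)
  next
    case 3
    then have ny: "0 < - y" by simp
    have w: "weight y x = weight (- y) x" for x unfolding weight_def by simp
    have "(\<integral>\<^sup>+x. indicator {0<..} x * (ennreal (weight y x) * emeasure M {\<omega>\<in>space M. path_total y x (bpath \<omega>) \<le> u}) \<partial>lborel) =
      (\<integral>\<^sup>+x. indicator {0<..} x * (ennreal (weight (- y) x) * (\<integral>\<^sup>+r. ennreal (hit_kernel ((- y) / sqrt x) r) * ennreal (ramp (u / x) r) \<partial>lborel)) \<partial>lborel)"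
      by (rule nn_integral_cong) (use path_total_law_neg[OF _ 3] w in \<open>simp add: indicator_def\<close>)
    then show ?thesis using occupation_identity[OF ny u] by (simp only: w)
  qed
qed

end

section \<open>Three-dimensional Bessel processes\<close>

lemma brownian_motion_space:
  assumes "brownian_motion M a W"
  shows "gaussian_space M (linear_span {0..} (\<lambda>t \<omega>. W t \<omega> - a))"
    and "\<And>s t. 0 \<le> s \<Longrightarrow> 0 \<le> t \<Longrightarrow> (LINT \<omega>|M. (W s \<omega> - a) * (W t \<omega> - a)) = min s t"
proof -
  have c: "prob_space M" and g: "gaussian_process M {0..} (\<lambda>_. a) min W"
    using assms unfolding brownian_motion_def continuous_process_def by auto
  show "gaussian_space M (linear_span {0..} (\<lambda>t \<omega>. W t \<omega> - a))"
    using gaussian_process_space[OF c g] .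
  show "\<And>s t. 0 \<le> s \<Longrightarrow> 0 \<le> t \<Longrightarrow> (LINT \<omega>|M. (W s \<omega> - a) * (W t \<omega> - a)) = min s t"
    using g unfolding gaussian_process_def by simp
qed

text \<open>Equality of laws carries over only those path properties that are events of the product
  space, whence the measurability hypothesis on \<open>P\<close>.\<close>

lemma path_law_AE:
  assumes m: "path_of I X \<in> M \<rightarrow>\<^sub>M path_space I" "path_of I X' \<in> M' \<rightarrow>\<^sub>M path_space I"
    and eq: "path_law M I X = path_law M' I X'" and P: "Measurable.pred (path_space I) P"
    and ae: "AE \<omega> in M'. P (path_of I X' \<omega>)"
  shows "AE \<omega> in M. P (path_of I X \<omega>)"
proof -
  have "AE f in path_law M' I X'. P f"
    unfolding path_law_def using ae P by (subst AE_distr_iff[OF m(2)]) (simp_all add: pred_def)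
  then have "AE f in path_law M I X. P f" by (simp only: eq)
  then show ?thesis
    unfolding path_law_def using P by (subst (asm) AE_distr_iff[OF m(1)]) (simp_all add: pred_def)
qed

lemma continuous_process_path_measurable:
  assumes "continuous_process M I X"
  shows "path_of I X \<in> M \<rightarrow>\<^sub>M path_space I"
  unfolding path_of_def using assms unfolding continuous_process_def by (intro measurable_restrict) auto

locale brownian3 =
  fixes M :: "'a measure" and v :: "real ^ 3" and W :: "real \<Rightarrow> 'a \<Rightarrow> real ^ 3"
  assumes W: "brownian_motion3 M v W"
begin

lemma comp: "brownian_motion M (v $ i) (\<lambda>t \<omega>. W t \<omega> $ i)"
  using W unfolding brownian_motion3_def by blast

lemma indep: "prob_space.indep_vars M (\<lambda>_. path_space {0..}) (\<lambda>i. path_of {0..} (\<lambda>t \<omega>. W t \<omega> $ i)) UNIV"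
  using W unfolding brownian_motion3_def by blast

definition comp_space :: "3 \<Rightarrow> ('a \<Rightarrow> real) set"
  where "comp_space i = linear_span {0..} (\<lambda>t \<omega>. W t \<omega> $ i - v $ i)"

lemma comp_gaussian: "gaussian_space M (comp_space i)"
  unfolding comp_space_def by (rule brownian_motion_space(1)[OF comp])

sublocale prob_space M
  using comp_gaussian[of undefined] by (rule gaussian_space.axioms(1))

lemma comp_measurable: "0 \<le> t \<Longrightarrow> (\<lambda>\<omega>. W t \<omega> $ i) \<in> borel_measurable M"
  using comp[of i] unfolding brownian_motion_def continuous_process_def by simp

lemma norm_measurable:
  assumes "0 \<le> t" shows "(\<lambda>\<omega>. norm (W t \<omega>)) \<in> borel_measurable M"
proof -
  have [measurable]: "(\<lambda>\<omega>. W t \<omega> $ i) \<in> borel_measurable M" for i by (rule comp_measurable[OF assms])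
  show ?thesis unfolding norm_vec_def L2_set_def by measurable
qed

text \<open>Each \<open>comp_space\<close> is Gaussian by itself. Increments have to be independent
  of the past of all three coordinates together, so one Gaussian space containing every coordinate
  is required; independence of the coordinates makes these sums Gaussian.\<close>

definition full_space :: "('a \<Rightarrow> real) set"
  where "full_space = {\<lambda>\<omega>. \<Sum>i\<in>UNIV. S i \<omega> | S. \<forall>i. S i \<in> comp_space i}"

lemma comp_space_factor:
  assumes "S \<in> comp_space i"
  shows "\<exists>\<phi>\<in>borel_measurable (path_space {0..}). \<forall>\<omega>. S \<omega> = \<phi> (path_of {0..} (\<lambda>t \<omega>. W t \<omega> $ i) \<omega>)"
proof -
  obtain J c where J: "finite J" "J \<subseteq> {0..}" "S = (\<lambda>\<omega>. \<Sum>t\<in>J. c t * (W t \<omega> $ i - v $ i))"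
    using assms unfolding comp_space_def by (rule linear_spanE)
  show ?thesis
  proof (rule bexI)
    show "\<forall>\<omega>. S \<omega> = (\<lambda>f. \<Sum>t\<in>J. c t * (f t - v $ i)) (path_of {0..} (\<lambda>t \<omega>. W t \<omega> $ i) \<omega>)"
    proof
      fix \<omega>
      show "S \<omega> = (\<lambda>f. \<Sum>t\<in>J. c t * (f t - v $ i)) (path_of {0..} (\<lambda>t \<omega>. W t \<omega> $ i) \<omega>)"
        unfolding J(3) path_of_def by (rule sum.cong) (use J(2) in auto)
    qed
    have "(\<lambda>f. f t) \<in> borel_measurable (path_space {0..})" if "t \<in> J" for t
      using that J(2) by (intro measurable_component_singleton) auto
    then show "(\<lambda>f. \<Sum>t\<in>J. c t * (f t - v $ i)) \<in> borel_measurable (path_space {0..})"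
      by (intro borel_measurable_sum borel_measurable_times borel_measurable_diff borel_measurable_const)
  qed
qed

lemma comp_space_indep:
  assumes S: "\<And>i. S i \<in> comp_space i"
  shows "indep_vars (\<lambda>_. borel) S UNIV"
proof -
  have "\<forall>i. \<exists>\<phi>. \<phi> \<in> borel_measurable (path_space {0..}) \<and> (\<forall>\<omega>. S i \<omega> = \<phi> (path_of {0..} (\<lambda>t \<omega>. W t \<omega> $ i) \<omega>))"
    using comp_space_factor[OF S] by blast
  then obtain \<phi> where \<phi>: "\<And>i. \<phi> i \<in> borel_measurable (path_space {0..})"
    "\<And>i \<omega>. S i \<omega> = \<phi> i (path_of {0..} (\<lambda>t \<omega>. W t \<omega> $ i) \<omega>)" by metis
  have "S = (\<lambda>i \<omega>. \<phi> i (path_of {0..} (\<lambda>t \<omega>. W t \<omega> $ i) \<omega>))" using \<phi>(2) by blast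
  then show ?thesis using indep_vars_compose2[OF indep, of \<phi>] \<phi>(1) by simp
qed

lemma comp_space_cross:
  assumes "i \<noteq> j" "S \<in> comp_space i" "T \<in> comp_space j"
  shows "expectation (\<lambda>\<omega>. S \<omega> * T \<omega>) = 0" "integrable M (\<lambda>\<omega>. S \<omega> * T \<omega>)"
proof -
  interpret I: gaussian_space M "comp_space i" by (rule comp_gaussian)
  interpret J: gaussian_space M "comp_space j" by (rule comp_gaussian)
  \<comment> \<open>The third coordinate is padded with 0, a member of every component space, so
    that the joint independence of all coordinates applies.\<close>
  define U where "U k = (if k = i then S else if k = j then T else (\<lambda>_. 0))" for k
  have "U k \<in> comp_space k" for k
    using assms gaussian_space.zero_mem[OF comp_gaussian] unfolding U_def by auto
  then have ind: "indep_vars (\<lambda>_. borel) U UNIV" by (rule comp_space_indep)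
  have ij: "{i, j} \<subseteq> UNIV" by simp
  have "indep_vars (\<lambda>_. borel) U {i, j}" by (rule indep_vars_subset[OF ind ij])
  moreover have "integrable M (U k)" if "k \<in> {i, j}" for k
    using that assms(1) I.mem_integrable[OF assms(2)] J.mem_integrable[OF assms(3)] by (auto simp: U_def)
  moreover have "(\<Prod>k\<in>{i, j}. U k \<omega>) = S \<omega> * T \<omega>" for \<omega> using assms(1) by (simp add: U_def)
  moreover have "expectation (U i) = 0" using I.mem_mean[OF assms(2)] by (simp add: U_def)
  ultimately show "expectation (\<lambda>\<omega>. S \<omega> * T \<omega>) = 0" "integrable M (\<lambda>\<omega>. S \<omega> * T \<omega>)"
    using indep_vars_lebesgue_integral[of "{i, j}" U] indep_vars_integrable[of "{i, j}" U] assms(1) by simp_all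
qed

text \<open>The characteristic function of a sum of independent variables is the product of theirs,
  and the variances add because the cross terms vanish.\<close>

lemma full_gaussian: "gaussian_space M full_space"
proof -
  have z: "(\<lambda>_. 0) \<in> comp_space i" for i by (rule gaussian_space.zero_mem[OF comp_gaussian])
  have main: "T \<in> borel_measurable M \<and> integrable M (\<lambda>\<omega>. (T \<omega>)\<^sup>2) \<and> expectation T = 0 \<and>
      (CLINT \<omega>|M. iexp (T \<omega>)) = of_real (exp (- expectation (\<lambda>\<omega>. (T \<omega>)\<^sup>2) / 2))" if T: "T \<in> full_space" for T
  proof -
    from T obtain S where S: "T = (\<lambda>\<omega>. \<Sum>i\<in>UNIV. S i \<omega>)" "\<And>i. S i \<in> comp_space i"
      unfolding full_space_def by blast
    note G = gaussian_space.mem_measurable[OF comp_gaussian S(2)] gaussian_space.mem_integrable[OF comp_gaussian S(2)]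
      gaussian_space.mem_square_integrable[OF comp_gaussian S(2)] gaussian_space.mem_mean[OF comp_gaussian S(2)]
      gaussian_space.mem_char[OF comp_gaussian S(2)]
    have ind: "indep_vars (\<lambda>_. borel) S UNIV" by (rule comp_space_indep[OF S(2)])
    have int: "integrable M (\<lambda>\<omega>. S i \<omega> * S j \<omega>)" for i j
      using comp_space_cross(2)[OF _ S(2) S(2), of i j] G(3)[of i] by (cases "i = j") (simp_all add: power2_eq_square)
    have sq: "(T \<omega>)\<^sup>2 = (\<Sum>i\<in>UNIV. \<Sum>j\<in>UNIV. S i \<omega> * S j \<omega>)" for \<omega>
      unfolding S(1) by (simp only: power2_eq_square sum_product)
    have 1: "T \<in> borel_measurable M" unfolding S(1) using G(1) by (intro borel_measurable_sum)
    have 2: "integrable M (\<lambda>\<omega>. (T \<omega>)\<^sup>2)" unfolding sq using int by (intro Bochner_Integration.integrable_sum)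
    have 3: "expectation T = 0" unfolding S(1) using G(2,4) by (simp add: Bochner_Integration.integral_sum)
    have "expectation (\<lambda>\<omega>. (T \<omega>)\<^sup>2) = (\<Sum>i\<in>UNIV. \<Sum>j\<in>UNIV. expectation (\<lambda>\<omega>. S i \<omega> * S j \<omega>))"
      unfolding sq using int by (simp add: Bochner_Integration.integral_sum)
    also have "\<dots> = (\<Sum>i\<in>UNIV. \<Sum>j\<in>UNIV. if i = j then expectation (\<lambda>\<omega>. (S i \<omega>)\<^sup>2) else 0)"
      using comp_space_cross(1)[OF _ S(2) S(2)] by (intro sum.cong refl) (simp add: power2_eq_square)
    also have "\<dots> = (\<Sum>i\<in>UNIV. expectation (\<lambda>\<omega>. (S i \<omega>)\<^sup>2))" by simp
    finally have v: "expectation (\<lambda>\<omega>. (T \<omega>)\<^sup>2) = (\<Sum>i\<in>UNIV. expectation (\<lambda>\<omega>. (S i \<omega>)\<^sup>2))" .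
    have "(CLINT \<omega>|M. iexp (T \<omega>)) = char (distr M borel (\<lambda>\<omega>. \<Sum>i\<in>UNIV. S i \<omega>)) 1"
      unfolding char_def using 1 unfolding S(1) by (subst integral_distr) simp_all
    also have "\<dots> = (\<Prod>i\<in>UNIV. char (distr M borel (S i)) 1)"
      by (rule char_distr_sum[OF ind])
    also have "\<dots> = (\<Prod>i\<in>UNIV. of_real (exp (- expectation (\<lambda>\<omega>. (S i \<omega>)\<^sup>2) / 2)))"
    proof (rule prod.cong[OF refl])
      fix i
      have "char (distr M borel (S i)) 1 = (CLINT \<omega>|M. iexp (S i \<omega>))"
        unfolding char_def using G(1)[of i] by (subst integral_distr) simp_all
      then show "char (distr M borel (S i)) 1 = of_real (exp (- expectation (\<lambda>\<omega>. (S i \<omega>)\<^sup>2) / 2))" using G(5) by simp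
    qed
    also have "\<dots> = of_real (exp (\<Sum>i\<in>UNIV. - expectation (\<lambda>\<omega>. (S i \<omega>)\<^sup>2) / 2))"
      by (simp only: of_real_prod[symmetric] exp_sum[OF finite_class.finite_UNIV])
    also have "(\<Sum>i\<in>UNIV. - expectation (\<lambda>\<omega>. (S i \<omega>)\<^sup>2) / 2) = - expectation (\<lambda>\<omega>. (T \<omega>)\<^sup>2) / 2"
      unfolding v by (simp only: sum_divide_distrib[symmetric] sum_negf)
    finally show ?thesis using 1 2 3 by blast
  qed
  show ?thesis
  proof (unfold_locales, goal_cases)
    case 1 show ?case unfolding full_space_def by (rule CollectI, rule exI[of _ "\<lambda>_ _. 0"]) (simp add: z)
  next
    case (2 S T)
    then obtain A B where A: "S = (\<lambda>\<omega>. \<Sum>i\<in>UNIV. A i \<omega>)" "\<And>i. A i \<in> comp_space i" and B: "T = (\<lambda>\<omega>. \<Sum>i\<in>UNIV. B i \<omega>)" "\<And>i. B i \<in> comp_space i"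
      unfolding full_space_def by blast
    show ?case unfolding full_space_def A B
      by (rule CollectI, rule exI[of _ "\<lambda>i \<omega>. A i \<omega> + B i \<omega>"])
         (simp add: sum.distrib gaussian_space.add_mem[OF comp_gaussian] A B)
  next
    case (3 S c)
    then obtain A where A: "S = (\<lambda>\<omega>. \<Sum>i\<in>UNIV. A i \<omega>)" "\<And>i. A i \<in> comp_space i"
      unfolding full_space_def by blast
    show ?case unfolding full_space_def A
      by (rule CollectI, rule exI[of _ "\<lambda>i \<omega>. c * A i \<omega>"])
         (simp add: sum_distrib_left gaussian_space.scale_mem[OF comp_gaussian] A)
  next case (4 S) then show ?case using main by blast
  next case (5 S) then show ?case using main by blast
  next case (6 S) then show ?case using main by blast
  next case (7 S) then show ?case using main by blast
  qed
qed

lemma comp_subset_full: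
  assumes "S \<in> comp_space i" shows "S \<in> full_space"
proof -
  have "(\<Sum>j\<in>UNIV. (if j = i then S else (\<lambda>_. 0)) \<omega>) = S \<omega>" for \<omega>
  proof -
    have "(\<Sum>j\<in>UNIV. (if j = i then S else (\<lambda>_. 0)) \<omega>) = (\<Sum>j\<in>UNIV. if j = i then S \<omega> else 0)"
      by (rule sum.cong) simp_all
    then show ?thesis by simp
  qed
  then have "S = (\<lambda>\<omega>. \<Sum>j\<in>UNIV. (if j = i then S else (\<lambda>_. 0)) \<omega>)" by (rule ext[OF sym])
  moreover have "\<forall>j. (if j = i then S else (\<lambda>_. 0)) \<in> comp_space j"
    using assms gaussian_space.zero_mem[OF comp_gaussian] by simp
  ultimately show ?thesis unfolding full_space_def
    by (intro CollectI exI[of _ "\<lambda>j. if j = i then S else (\<lambda>_. 0)"] conjI)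
qed

lemma centered_mem: "0 \<le> t \<Longrightarrow> (\<lambda>\<omega>. W t \<omega> $ i - v $ i) \<in> comp_space i"
  unfolding comp_space_def by (rule linear_span_base) simp

lemma comp_cov: "0 \<le> s \<Longrightarrow> 0 \<le> t \<Longrightarrow> expectation (\<lambda>\<omega>. (W s \<omega> $ i - v $ i) * (W t \<omega> $ i - v $ i)) = min s t"
  by (rule brownian_motion_space(2)[OF comp])

lemma start_AE: "AE \<omega> in M. W 0 \<omega> = v"
proof -
  have "AE \<omega> in M. W 0 \<omega> $ i - v $ i = 0" for i
    by (rule gaussian_space.mem_zero_AE[OF comp_gaussian centered_mem]) (use comp_cov[of 0 0 i] in \<open>simp_all add: power2_eq_square\<close>)
  then have "AE \<omega> in M. \<forall>i\<in>UNIV. W 0 \<omega> $ i - v $ i = 0"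
    by (intro AE_finite_allI) simp_all
  then show ?thesis by eventually_elim (simp add: vec_eq_iff)
qed

lemma increment_mem:
  assumes "0 \<le> s" "0 \<le> t" shows "(\<lambda>\<omega>. W t \<omega> $ i - W s \<omega> $ i) \<in> comp_space i"
  using gaussian_space.diff_mem[OF comp_gaussian centered_mem[OF assms(2)] centered_mem[OF assms(1)], of i] by simp

lemma increment_cov:
  assumes "0 \<le> r" "r \<le> s" "s \<le> t"
  shows "expectation (\<lambda>\<omega>. (W r \<omega> $ i - v $ i) * (W t \<omega> $ j - W s \<omega> $ j)) = 0"
proof (cases "i = j")
  case False
  show ?thesis by (rule comp_space_cross(1)[OF False centered_mem increment_mem]) (use assms in simp_all)
next
  case True
  note D = gaussian_space.expectation_diff_mult_diff[OF comp_gaussian centered_mem gaussian_space.zero_mem[OF comp_gaussian] centered_mem centered_mem, of r t s i]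
  have "expectation (\<lambda>\<omega>. (W r \<omega> $ i - v $ i - 0) * ((W t \<omega> $ i - v $ i) - (W s \<omega> $ i - v $ i))) = min r t - min r s"
    using D assms comp_cov[of r t i] comp_cov[of r s i] by simp
  then show ?thesis using assms True by (simp add: min_absorb1)
qed

lemma increment_square:
  assumes "0 \<le> s" "s \<le> t"
  shows "expectation (\<lambda>\<omega>. (W t \<omega> $ i - W s \<omega> $ i)\<^sup>2) = t - s"
proof -
  note D = gaussian_space.expectation_diff_mult_diff[OF comp_gaussian centered_mem centered_mem centered_mem centered_mem, of t s t s i]
  have "expectation (\<lambda>\<omega>. ((W t \<omega> $ i - v $ i) - (W s \<omega> $ i - v $ i)) * ((W t \<omega> $ i - v $ i) - (W s \<omega> $ i - v $ i))) = t - s"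
    using D assms comp_cov[of t t i] comp_cov[of t s i] comp_cov[of s t i] comp_cov[of s s i] by (simp add: min_absorb1 min_absorb2)
  then show ?thesis by (simp add: power2_eq_square)
qed

text \<open>Markov's inequality for the squared norm, whose mean is \<open>3 * (t - s)\<close>, one
  share for each coordinate. The factor 6 brings the excluded probability down to 1/2.\<close>

lemma increment_small:
  assumes s: "0 \<le> s" "s \<le> t" and e: "0 < e" "6 * (t - s) \<le> e\<^sup>2"
  shows "1 / 2 \<le> prob {\<omega>\<in>space M. norm (W t \<omega> - W s \<omega>) < e}"
proof -
  have t: "0 \<le> t" using s by simp
  have sqi: "integrable M (\<lambda>\<omega>. (W t \<omega> $ i - W s \<omega> $ i)\<^sup>2)" for i
    by (rule gaussian_space.mem_square_integrable[OF comp_gaussian increment_mem[OF s(1) t]])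
  have nsq: "(norm (W t \<omega> - W s \<omega>))\<^sup>2 = (\<Sum>i\<in>UNIV. (W t \<omega> $ i - W s \<omega> $ i)\<^sup>2)" for \<omega>
    unfolding norm_vec_def L2_set_def by (simp add: sum_nonneg)
  have ex: "expectation (\<lambda>\<omega>. (norm (W t \<omega> - W s \<omega>))\<^sup>2) = 3 * (t - s)"
    unfolding nsq using sqi increment_square[OF s] by (simp add: Bochner_Integration.integral_sum)
  have int: "integrable M (\<lambda>\<omega>. (norm (W t \<omega> - W s \<omega>))\<^sup>2)" unfolding nsq using sqi by (intro Bochner_Integration.integrable_sum)
  have "prob {\<omega>\<in>space M. e\<^sup>2 \<le> (norm (W t \<omega> - W s \<omega>))\<^sup>2} \<le> expectation (\<lambda>\<omega>. (norm (W t \<omega> - W s \<omega>))\<^sup>2) / e\<^sup>2"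
    by (rule integral_Markov_inequality_measure[OF int, where A="space M"]) (use e in simp_all)
  also have "\<dots> \<le> 1 / 2" unfolding ex using e by (simp add: divide_le_eq)
  finally have le: "prob {\<omega>\<in>space M. e\<^sup>2 \<le> (norm (W t \<omega> - W s \<omega>))\<^sup>2} \<le> 1 / 2" .
  have m: "{\<omega>\<in>space M. e\<^sup>2 \<le> (norm (W t \<omega> - W s \<omega>))\<^sup>2} \<in> events"
    using borel_measurable_integrable[OF int] by measurable
  have "{\<omega>\<in>space M. norm (W t \<omega> - W s \<omega>) < e} = space M - {\<omega>\<in>space M. e\<^sup>2 \<le> (norm (W t \<omega> - W s \<omega>))\<^sup>2}"
  proof -
    have "norm (W t \<omega> - W s \<omega>) < e \<longleftrightarrow> \<not> e\<^sup>2 \<le> (norm (W t \<omega> - W s \<omega>))\<^sup>2" for \<omega>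
      using power_mono_iff[of e "norm (W t \<omega> - W s \<omega>)" 2] e(1) by (simp add: not_le)
    then show ?thesis by blast
  qed
  then show ?thesis using prob_compl[OF m] le by simp
qed

lemma comp_small:
  assumes t: "0 < t" and K: "0 \<le> K" "\<And>x. \<bar>x + v $ i\<bar> < d \<Longrightarrow> normal_density 0 (sqrt t) x \<le> K" and d: "0 < d"
  shows "prob {\<omega>\<in>space M. \<bar>W t \<omega> $ i\<bar> < d} \<le> 2 * d * K"
proof -
  define S where "S \<omega> = W t \<omega> $ i - v $ i" for \<omega>
  have S: "S \<in> comp_space i" using centered_mem[of t i] t by (simp add: S_def[abs_def])
  have D: "distributed M lborel S (normal_density 0 (sqrt t))"
    by (rule gaussian_space.mem_distributed[OF comp_gaussian S])
       (use t comp_cov[of t t i] in \<open>simp_all add: S_def power2_eq_square\<close>)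
  define A where "A = {- v $ i - d<..<- v $ i + d}"
  have [measurable]: "A \<in> sets borel" unfolding A_def by simp
  have "{\<omega>\<in>space M. \<bar>W t \<omega> $ i\<bar> < d} = S -` A \<inter> space M"
    unfolding S_def A_def by (auto simp: abs_less_iff)
  then have "emeasure M {\<omega>\<in>space M. \<bar>W t \<omega> $ i\<bar> < d} = (\<integral>\<^sup>+x. ennreal (normal_density 0 (sqrt t) x) * indicator A x \<partial>lborel)"
    using distributed_emeasure[OF D, of A] by simp
  also have "\<dots> \<le> (\<integral>\<^sup>+x. ennreal K * indicator A x \<partial>lborel)"
  proof (rule nn_integral_mono)
    fix x :: real
    show "ennreal (normal_density 0 (sqrt t) x) * indicator A x \<le> ennreal K * indicator A x"
    proof (cases "x \<in> A")
      case True
      then have "\<bar>x + v $ i\<bar> < d" unfolding A_def by (simp add: abs_less_iff)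
      then show ?thesis using K(2)[of x] True by (simp add: ennreal_leI)
    qed simp
  qed
  also have "\<dots> = ennreal K * ennreal (2 * d)"
    unfolding A_def using d by (subst nn_integral_cmult_indicator) simp_all
  also have "\<dots> = ennreal (2 * d * K)" using K d by (simp add: ennreal_mult[symmetric] mult.commute)
  finally have "ennreal (prob {\<omega>\<in>space M. \<bar>W t \<omega> $ i\<bar> < d}) \<le> ennreal (2 * d * K)" by (simp only: emeasure_eq_measure)
  then show ?thesis using K d by (subst (asm) ennreal_le_iff) simp_all
qed

lemma density_le: "0 < t \<Longrightarrow> normal_density 0 (sqrt t) x \<le> 1 / sqrt t * exp (- (x\<^sup>2 / (2 * t)))"
proof -
  assume t: "0 < t"
  have "sqrt t \<le> sqrt (2 * pi * t)" using t pi_gt3 by (intro real_sqrt_le_mono) simp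
  then have "1 / sqrt (2 * pi * t) \<le> 1 / sqrt t" using t by (intro divide_left_mono) simp_all
  then have "1 / sqrt (2 * pi * t) * exp (- (x\<^sup>2 / (2 * t))) \<le> 1 / sqrt t * exp (- (x\<^sup>2 / (2 * t)))"
    by (rule mult_right_mono) simp
  then show ?thesis unfolding normal_density_def using t by simp
qed

text \<open>The three coordinates contribute at most \<open>2 * d / sqrt t\<close> each, which is
  cubic in \<open>d\<close> but singular as \<open>t\<close> tends to 0. The start is away from 0 in
  coordinate \<open>i\<close>, and the Gaussian factor of that coordinate supplies the square of
  \<open>t\<close>, which removes the singularity.\<close>

lemma norm_small:
  assumes t: "0 < t" "t \<le> 2" and i: "v $ i \<noteq> 0" and d: "0 < d" "2 * d \<le> \<bar>v $ i\<bar>"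
  shows "prob {\<omega>\<in>space M. norm (W t \<omega>) < d} \<le> 2048 / (v $ i) ^ 4 * d ^ 3"
proof -
  define p where "p j = prob {\<omega>\<in>space M. \<bar>W t \<omega> $ j\<bar> < d}" for j
  have st: "0 < sqrt t" using t by simp
  have v4: "0 < (v $ i) ^ 4" using i by (simp add: zero_less_power_eq)
  have 1: "p j \<le> 2 * d * (1 / sqrt t)" for j
    unfolding p_def
  proof (rule comp_small[OF t(1) _ _ d(1)])
    fix x
    have "1 / sqrt t * exp (- (x\<^sup>2 / (2 * t))) \<le> 1 / sqrt t * 1"
      using t(1) by (intro mult_left_mono) simp_all
    then show "normal_density 0 (sqrt t) x \<le> 1 / sqrt t" using density_le[OF t(1), of x] by linarith
  qed (use t in simp)
  have 2: "p i \<le> 2 * d * (1 / sqrt t * (128 * t\<^sup>2 / (v $ i) ^ 4))"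
    unfolding p_def
  proof (rule comp_small[OF t(1) _ _ d(1)])
    show "0 \<le> 1 / sqrt t * (128 * t\<^sup>2 / (v $ i) ^ 4)" using t(1) v4 by simp
    fix x assume "\<bar>x + v $ i\<bar> < d"
    then have "\<bar>v $ i\<bar> / 2 \<le> \<bar>x\<bar>" using d(2) by linarith
    then have "(\<bar>v $ i\<bar> / 2)\<^sup>2 \<le> \<bar>x\<bar>\<^sup>2" by (rule power_mono) simp
    then have sq: "(v $ i)\<^sup>2 / 4 \<le> x\<^sup>2" by (simp add: power_divide)
    define r where "r = (v $ i)\<^sup>2 / (8 * t)"
    have r: "0 < r" unfolding r_def using t(1) i by simp
    have "r \<le> x\<^sup>2 / (2 * t)" unfolding r_def using sq t(1) by (simp add: field_simps)
    then have "exp (- (x\<^sup>2 / (2 * t))) \<le> exp (- r)" by simp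
    \<comment> \<open>A polynomial bound is enough: as \<open>r\<close> is proportional to
      \<open>1 / t\<close>, it yields the square of \<open>t\<close>, which outweighs the three
      factors \<open>1 / sqrt t\<close>.\<close>
    also have "exp (- r) \<le> 2 / r\<^sup>2"
    proof -
      have "r\<^sup>2 / 2 \<le> exp r" using exp_lower_Taylor_quadratic[of r] r by linarith
      then have "1 / exp r \<le> 1 / (r\<^sup>2 / 2)" using r by (intro divide_left_mono) simp_all
      then show ?thesis by (simp add: exp_minus inverse_eq_divide)
    qed
    also have "2 / r\<^sup>2 = 128 * t\<^sup>2 / (v $ i) ^ 4"
      unfolding r_def using t(1) i by (simp add: power_divide power_mult_distrib power2_eq_square power4_eq_xxxx)
    finally have "1 / sqrt t * exp (- (x\<^sup>2 / (2 * t))) \<le> 1 / sqrt t * (128 * t\<^sup>2 / (v $ i) ^ 4)"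
      using t(1) by (intro mult_left_mono) simp_all
    then show "normal_density 0 (sqrt t) x \<le> 1 / sqrt t * (128 * t\<^sup>2 / (v $ i) ^ 4)"
      using density_le[OF t(1), of x] by linarith
  qed
  define A where "A j = {- v $ j - d<..<- v $ j + d}" for j
  have t0: "0 \<le> t" using t(1) by simp
  have e: "{\<omega>\<in>space M. \<bar>W t \<omega> $ j\<bar> < d} = (\<lambda>\<omega>. W t \<omega> $ j - v $ j) -` A j \<inter> space M" for j
    unfolding A_def by (auto simp: abs_less_iff)
  have ind: "indep_vars (\<lambda>_. borel) (\<lambda>j \<omega>. W t \<omega> $ j - v $ j) UNIV"
    by (rule comp_space_indep[OF centered_mem[OF t0]])
  have ev: "{\<omega>\<in>space M. \<bar>W t \<omega> $ j\<bar> < d} \<in> events" for j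
    using comp_measurable[OF t0, of j] by measurable
  have "prob {\<omega>\<in>space M. norm (W t \<omega>) < d} \<le> prob (\<Inter>j\<in>UNIV. {\<omega>\<in>space M. \<bar>W t \<omega> $ j\<bar> < d})"
  proof (rule finite_measure_mono)
    show "{\<omega>\<in>space M. norm (W t \<omega>) < d} \<subseteq> (\<Inter>j\<in>UNIV. {\<omega>\<in>space M. \<bar>W t \<omega> $ j\<bar> < d})"
      using component_le_norm_cart order_le_less_trans by fast
    show "(\<Inter>j\<in>UNIV. {\<omega>\<in>space M. \<bar>W t \<omega> $ j\<bar> < d}) \<in> events"
      by (rule sets.finite_INT) (use ev in simp_all)
  qed
  also have "\<dots> = (\<Prod>j\<in>UNIV. p j)"
    unfolding p_def e by (rule indep_varsD[OF ind]) (simp_all add: A_def)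
  also have "\<dots> = p i * (\<Prod>j\<in>UNIV - {i}. p j)" by (rule prod.remove) simp_all
  also have "(\<Prod>j\<in>UNIV - {i}. p j) \<le> (\<Prod>j\<in>UNIV - {i}. 2 * d * (1 / sqrt t))"
    by (rule prod_mono) (use 1 in \<open>simp add: p_def\<close>)
  also have "(\<Prod>j\<in>UNIV - {i}. 2 * d * (1 / sqrt t)) = (2 * d * (1 / sqrt t))\<^sup>2"
    by (simp add: card_Diff_singleton)
  finally have "prob {\<omega>\<in>space M. norm (W t \<omega>) < d} \<le> p i * (2 * d * (1 / sqrt t))\<^sup>2"
    by (simp add: mult_left_mono p_def)
  also have "\<dots> \<le> 2 * d * (1 / sqrt t * (128 * t\<^sup>2 / (v $ i) ^ 4)) * (2 * d * (1 / sqrt t))\<^sup>2"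
    by (rule mult_right_mono[OF 2]) simp
  also have "\<dots> = 1024 * d ^ 3 * sqrt t / (v $ i) ^ 4"
  proof -
    have "2 * d * (1 / r * (128 * (r\<^sup>2)\<^sup>2 / V)) * (2 * d * (1 / r))\<^sup>2 = 1024 * d ^ 3 * r / V" if "0 < r" "0 < V" for r V :: real
      using that by (simp add: field_simps power2_eq_square power3_eq_cube)
    from this[OF st v4] show ?thesis using t(1) by simp
  qed
  \<comment> \<open>Bounding \<open>sqrt t\<close> by 2 turns 1024 into 2048.\<close>
  also have "1024 * d ^ 3 * sqrt t / (v $ i) ^ 4 \<le> 1024 * d ^ 3 * 2 / (v $ i) ^ 4"
  proof -
    have "sqrt t \<le> sqrt 4" using t(2) by (intro real_sqrt_le_mono) simp
    then have "sqrt t \<le> 2" by simp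
    then show ?thesis using v4 d(1) by (intro divide_right_mono mult_left_mono) simp_all
  qed
  finally show ?thesis by simp
qed

text \<open>Restricting to a grid turns the entry time into a discrete one, with one event for each
  step; these events are disjoint.\<close>

definition first_entry :: "real \<Rightarrow> nat \<Rightarrow> nat \<Rightarrow> 'a set"
  where "first_entry e n k = {\<omega>\<in>space M. norm (W (real k / real n) \<omega>) < e \<and> (\<forall>j\<in>{..<k}. e \<le> norm (W (real j / real n) \<omega>))}"

lemma first_entry_event: "first_entry e n k \<in> events"
proof -
  have [measurable]: "(\<lambda>\<omega>. norm (W (real j / real n) \<omega>)) \<in> borel_measurable M" for j
    by (rule norm_measurable) simp
  show ?thesis unfolding first_entry_def by measurable
qed

lemma first_entry_disjoint: "disjoint_family (first_entry e n)"
proof (unfold disjoint_family_on_def, intro ballI impI)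
  have F: False if "\<omega> \<in> first_entry e n k" "\<omega> \<in> first_entry e n l" "k < l" for \<omega> and k l :: nat
  proof -
    from that(2,3) have "e \<le> norm (W (real k / real n) \<omega>)" unfolding first_entry_def by simp
    moreover from that(1) have "norm (W (real k / real n) \<omega>) < e" unfolding first_entry_def by simp
    ultimately show False by linarith
  qed
  fix k l :: nat assume "k \<noteq> l"
  then have "k < l \<or> l < k" by linarith
  then show "first_entry e n k \<inter> first_entry e n l = {}" using F by blast
qed

text \<open>Entry at step \<open>k\<close> is a condition on the positions at grid times up to
  \<open>k / n\<close>, and later increments are uncorrelated with these in every pair of
  coordinates. Joint Gaussianity upgrades this to independence.\<close>

lemma first_entry_indep:
  assumes t: "real k / real n \<le> t"
  shows "prob {\<omega>\<in>space M. \<omega> \<in> first_entry e n k \<and> norm (W t \<omega> - W (real k / real n) \<omega>) < e} =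
    prob (first_entry e n k) * prob {\<omega>\<in>space M. norm (W t \<omega> - W (real k / real n) \<omega>) < e}"
proof -
  define I where "I = {..k} \<times> (UNIV :: 3 set)"
  define X where "X p \<omega> = W (real (fst p) / real n) \<omega> $ snd p - v $ snd p" for p :: "nat \<times> 3" and \<omega>
  define Y where "Y i \<omega> = W t \<omega> $ i - W (real k / real n) \<omega> $ i" for i \<omega>
  define \<phi> where "\<phi> j x = sqrt (\<Sum>i\<in>UNIV. (norm (x (j, i) + v $ i))\<^sup>2)" for j :: nat and x :: "nat \<times> 3 \<Rightarrow> real"
  define \<psi> where "\<psi> x = sqrt (\<Sum>i\<in>UNIV. (norm (x i))\<^sup>2)" for x :: "3 \<Rightarrow> real"
  define P where "P = {x\<in>space (PiM I (\<lambda>_. borel)). \<phi> k x < e \<and> (\<forall>j\<in>{..<k}. e \<le> \<phi> j x)}"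
  define Q where "Q = {x\<in>space (PiM UNIV (\<lambda>_. borel)). \<psi> x < e}"
  have t0: "0 \<le> real k / real n" "0 \<le> t" using t by (simp, meson divide_nonneg_nonneg of_nat_0_le_iff order_trans)
  have \<phi>m: "\<phi> j \<in> borel_measurable (PiM I (\<lambda>_. borel))" if "j \<le> k" for j
  proof -
    have [measurable]: "(\<lambda>x. x (j, i)) \<in> borel_measurable (PiM I (\<lambda>_. borel))" for i
      by (rule measurable_component_singleton) (use that in \<open>simp add: I_def\<close>)
    show ?thesis unfolding \<phi>_def by measurable
  qed
  have \<psi>m: "\<psi> \<in> borel_measurable (PiM UNIV (\<lambda>_. borel))"
  proof -
    have [measurable]: "(\<lambda>x. x i) \<in> borel_measurable (PiM UNIV (\<lambda>_. borel :: real measure))" for i :: 3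
      by (rule measurable_component_singleton) simp
    show ?thesis unfolding \<psi>_def by measurable
  qed
  have P: "P \<in> sets (PiM I (\<lambda>_. borel))"
    unfolding P_def
  proof (intro sets.sets_Collect_conj sets.sets_Collect_countable_All')
    show "{x\<in>space (PiM I (\<lambda>_. borel)). \<phi> k x < e} \<in> sets (PiM I (\<lambda>_. borel))"
      using \<phi>m[of k] by measurable
    fix j assume "j \<in> {..<k}"
    then have "\<phi> j \<in> borel_measurable (PiM I (\<lambda>_. borel))" by (intro \<phi>m) simp
    then show "{x\<in>space (PiM I (\<lambda>_. borel)). e \<le> \<phi> j x} \<in> sets (PiM I (\<lambda>_. borel))" by measurable
  qed simp_all
  have Q: "Q \<in> sets (PiM UNIV (\<lambda>_. borel))" unfolding Q_def using \<psi>m by measurable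
  have \<phi>X: "\<phi> j (\<lambda>p\<in>I. X p \<omega>) = norm (W (real j / real n) \<omega>)" if "j \<le> k" for j \<omega>
    unfolding \<phi>_def norm_vec_def L2_set_def using that by (simp add: I_def X_def)
  have \<psi>Y: "\<psi> (\<lambda>i\<in>UNIV. Y i \<omega>) = norm (W t \<omega> - W (real k / real n) \<omega>)" for \<omega>
    unfolding \<psi>_def norm_vec_def L2_set_def by (simp add: Y_def)
  have sP: "(\<lambda>p\<in>I. X p \<omega>) \<in> space (PiM I (\<lambda>_. borel))" for \<omega>
    by (simp add: space_PiM)
  have sQ: "(\<lambda>i\<in>UNIV. Y i \<omega>) \<in> space (PiM UNIV (\<lambda>_. borel))" for \<omega> by (simp add: space_PiM)
  have PX: "(\<lambda>p\<in>I. X p \<omega>) \<in> P \<longleftrightarrow> norm (W (real k / real n) \<omega>) < e \<and> (\<forall>j\<in>{..<k}. e \<le> norm (W (real j / real n) \<omega>))" for \<omega>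
  proof -
    have "(\<forall>j\<in>{..<k}. e \<le> \<phi> j (\<lambda>p\<in>I. X p \<omega>)) \<longleftrightarrow> (\<forall>j\<in>{..<k}. e \<le> norm (W (real j / real n) \<omega>))"
      by (rule ball_cong[OF refl]) (simp only: lessThan_iff \<phi>X less_imp_le)
    then show ?thesis unfolding P_def using sP[of \<omega>] \<phi>X[of k \<omega>] by simp
  qed
  have QY: "(\<lambda>i\<in>UNIV. Y i \<omega>) \<in> Q \<longleftrightarrow> norm (W t \<omega> - W (real k / real n) \<omega>) < e" for \<omega>
    unfolding Q_def using sQ[of \<omega>] \<psi>Y[of \<omega>] by simp
  have "prob {\<omega>\<in>space M. (\<lambda>p\<in>I. X p \<omega>) \<in> P \<and> (\<lambda>i\<in>UNIV. Y i \<omega>) \<in> Q} =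
    prob {\<omega>\<in>space M. (\<lambda>p\<in>I. X p \<omega>) \<in> P} * prob {\<omega>\<in>space M. (\<lambda>i\<in>UNIV. Y i \<omega>) \<in> Q}"
  proof (rule gaussian_space.uncorrelated_imp_independent[OF full_gaussian _ _ _ P Q])
    show "X p \<in> full_space" if "p \<in> I" for p
      unfolding X_def by (rule comp_subset_full[OF centered_mem]) simp
    show "Y i \<in> full_space" if "i \<in> UNIV" for i
      unfolding Y_def by (rule comp_subset_full[OF increment_mem]) (use t0 in simp_all)
    show "expectation (\<lambda>\<omega>. X p \<omega> * Y i \<omega>) = 0" if "p \<in> I" "i \<in> UNIV" for p i
      unfolding X_def Y_def
      by (rule increment_cov) (use that t in \<open>auto simp: I_def divide_right_mono\<close>)
  qed
  then show ?thesis unfolding PX QY first_entry_def by (simp only: mem_Collect_eq conj_assoc conj_absorb conj_left_absorb)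
qed

lemma first_entry_bound:
  assumes t: "real k / real n \<le> t" "t \<le> real k / real n + e\<^sup>2 / 6" and e: "0 < e"
  shows "prob (first_entry e n k) / 2 \<le> prob (first_entry e n k \<inter> {\<omega>\<in>space M. norm (W t \<omega>) < 2 * e})"
proof -
  have k0: "0 \<le> real k / real n" by simp
  have t0: "0 \<le> t" using k0 t(1) by linarith
  have "prob (first_entry e n k) * (1 / 2) \<le> prob (first_entry e n k) * prob {\<omega>\<in>space M. norm (W t \<omega> - W (real k / real n) \<omega>) < e}"
    by (rule mult_left_mono[OF increment_small[OF k0 t(1) e]]) (use t(2) in simp_all)
  also have "\<dots> = prob {\<omega>\<in>space M. \<omega> \<in> first_entry e n k \<and> norm (W t \<omega> - W (real k / real n) \<omega>) < e}"
    by (rule first_entry_indep[OF t(1), symmetric])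
  also have "\<dots> \<le> prob (first_entry e n k \<inter> {\<omega>\<in>space M. norm (W t \<omega>) < 2 * e})"
  proof (rule finite_measure_mono)
    show "{\<omega>\<in>space M. \<omega> \<in> first_entry e n k \<and> norm (W t \<omega> - W (real k / real n) \<omega>) < e} \<subseteq> first_entry e n k \<inter> {\<omega>\<in>space M. norm (W t \<omega>) < 2 * e}"
    proof
      fix \<omega> assume *: "\<omega> \<in> {\<omega>\<in>space M. \<omega> \<in> first_entry e n k \<and> norm (W t \<omega> - W (real k / real n) \<omega>) < e}"
      then have "norm (W (real k / real n) \<omega>) < e" unfolding first_entry_def by simp
      then have "norm (W t \<omega>) < 2 * e"
        using * norm_triangle_sub[of "W t \<omega>" "W (real k / real n) \<omega>"] by simp
      then show "\<omega> \<in> first_entry e n k \<inter> {\<omega>\<in>space M. norm (W t \<omega>) < 2 * e}" using * by simp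
    qed
    show "first_entry e n k \<inter> {\<omega>\<in>space M. norm (W t \<omega>) < 2 * e} \<in> events"
      using first_entry_event[of e n k] norm_measurable[OF t0] by measurable
  qed
  finally show ?thesis by simp
qed

text \<open>Once in the ball of radius \<open>e\<close>, the process is likely to stay in the ball of radius \<open>2 e\<close> for a time of order
  \<open>e\<^sup>2\<close>, whereas the expected time spent there is of order \<open>e\<^sup>3\<close>.\<close>

lemma grid_entry_bound:
  assumes n: "0 < n" and i: "v $ i \<noteq> 0" and e: "0 < e" "4 * e \<le> \<bar>v $ i\<bar>" "e \<le> 1"
  shows "prob {\<omega>\<in>space M. \<exists>k\<in>{..n}. norm (W (real k / real n) \<omega>) < e} \<le> 393216 / (v $ i) ^ 4 * e"
proof -
  define K where "K = 2048 / (v $ i) ^ 4 * (2 * e) ^ 3"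
  have v4: "0 < (v $ i) ^ 4" using i by (simp add: zero_less_power_eq)
  have K0: "0 \<le> K" unfolding K_def using v4 e(1) by simp
  \<comment> \<open>The time span for which \<open>increment_small\<close> guarantees a displacement
    below \<open>e\<close> with probability at least 1/2.\<close>
  define h where "h = e\<^sup>2 / 6"
  have h: "0 < h" "h \<le> 1" unfolding h_def using e power_le_one[of e 2] by auto
  define J where "J k = {real k / real n<..real k / real n + h}" for k
  define p where "p k = prob (first_entry e n k)" for k
  have J: "J k \<subseteq> {0<..2}" if "k \<le> n" for k
  proof
    fix t assume t: "t \<in> J k"
    have "real k / real n \<le> 1" "0 \<le> real k / real n" using that n by simp_all
    moreover have "real k / real n < t" "t \<le> real k / real n + h" using t by (simp_all add: J_def)
    ultimately have "0 < t" "t \<le> 2" using h(2) by linarith+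
    then show "t \<in> {0<..2}" by simp
  qed
  \<comment> \<open>At a fixed time \<open>t\<close> the first-entry events are disjoint, so their
    intersections with the event of being in the ball of radius \<open>2 * e\<close> have total
    probability at most that of the ball. Integration over \<open>t\<close> later turns each
    indicator into the length \<open>h\<close>.\<close>
  have pt: "(\<Sum>k\<le>n. p k / 2 * indicator (J k) t) \<le> K * indicator {0<..2} t" for t :: real
  proof (cases "t \<in> {0<..2}")
    case False
    then have "indicator (J k) t = (0::real)" if "k \<le> n" for k using J[OF that] by (auto simp: indicator_def)
    then have "(\<Sum>k\<le>n. p k / 2 * indicator (J k) t) = 0" by (intro sum.neutral) simp
    then show ?thesis using False by simp
  next
    case True
    define E where "E = {\<omega>\<in>space M. norm (W t \<omega>) < 2 * e}"
    have [measurable]: "(\<lambda>\<omega>. norm (W t \<omega>)) \<in> borel_measurable M" by (rule norm_measurable) (use True in simp)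
    have E: "E \<in> events" unfolding E_def by measurable
    have "(\<Sum>k\<le>n. p k / 2 * indicator (J k) t) \<le> (\<Sum>k\<le>n. prob (first_entry e n k \<inter> E))"
    proof (rule sum_mono)
      fix k
      show "p k / 2 * indicator (J k) t \<le> prob (first_entry e n k \<inter> E)"
        using first_entry_bound[of k n t e] e(1) unfolding p_def E_def J_def h_def by (simp add: indicator_def)
    qed
    also have "\<dots> = prob (\<Union>k\<in>{..n}. first_entry e n k \<inter> E)"
    proof (rule finite_measure_finite_Union[symmetric])
      show "(\<lambda>k. first_entry e n k \<inter> E) ` {..n} \<subseteq> events" using first_entry_event E by blast
      show "disjoint_family_on (\<lambda>k. first_entry e n k \<inter> E) {..n}"
        using first_entry_disjoint[of e n] unfolding disjoint_family_on_def by blast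
    qed simp
    also have "\<dots> \<le> prob E" by (rule finite_measure_mono[OF _ E]) blast
    also have "\<dots> \<le> K" unfolding E_def K_def by (rule norm_small) (use True i e in simp_all)
    finally show ?thesis using True by simp
  qed
  have "(\<Sum>k\<le>n. ennreal (p k / 2) * ennreal h) = (\<Sum>k\<le>n. \<integral>\<^sup>+t. ennreal (p k / 2) * indicator (J k) t \<partial>lborel)"
    using h(1) by (intro sum.cong refl) (simp add: J_def nn_integral_cmult_indicator)
  also have "\<dots> = (\<integral>\<^sup>+t. (\<Sum>k\<le>n. ennreal (p k / 2) * indicator (J k) t) \<partial>lborel)"
    by (rule nn_integral_sum[symmetric]) (simp add: J_def)
  also have "\<dots> \<le> (\<integral>\<^sup>+(t::real). ennreal K * indicator {0<..2} t \<partial>lborel)"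
  proof (rule nn_integral_mono)
    fix t :: real
    have "(\<Sum>k\<le>n. ennreal (p k / 2) * indicator (J k) t) = (\<Sum>k\<le>n. ennreal (p k / 2 * indicator (J k) t))"
      by (intro sum.cong refl) (simp add: indicator_def)
    also have "\<dots> = ennreal (\<Sum>k\<le>n. p k / 2 * indicator (J k) t)" by (rule sum_ennreal) (simp add: p_def)
    also have "\<dots> \<le> ennreal (K * indicator {0<..2} t)" by (rule ennreal_leI[OF pt])
    also have "\<dots> = ennreal K * indicator {0<..2} t" by (simp add: indicator_def)
    finally show "(\<Sum>k\<le>n. ennreal (p k / 2) * indicator (J k) t) \<le> ennreal K * indicator {0<..2} t" .
  qed
  also have "\<dots> = ennreal K * ennreal 2" by (subst nn_integral_cmult_indicator) simp_all
  also have "\<dots> = ennreal (K * 2)" using K0 by (simp add: ennreal_mult)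
  also have "(\<Sum>k\<le>n. ennreal (p k / 2) * ennreal h) = (\<Sum>k\<le>n. ennreal (p k / 2 * h))"
    by (intro sum.cong refl ennreal_mult[symmetric]) (use h(1) in \<open>simp_all add: p_def\<close>)
  also have "\<dots> = ennreal (\<Sum>k\<le>n. p k / 2 * h)" using h(1) by (intro sum_ennreal) (simp add: p_def)
  finally have "(\<Sum>k\<le>n. p k / 2 * h) \<le> K * 2" using K0 by (subst (asm) ennreal_le_iff) simp_all
  moreover have "(\<Sum>k\<le>n. p k) * (h / 2) = (\<Sum>k\<le>n. p k / 2 * h)"
    unfolding sum_distrib_right by (intro sum.cong refl) simp
  ultimately have "(\<Sum>k\<le>n. p k) * (h / 2) \<le> K * 2" by simp
  then have s: "(\<Sum>k\<le>n. p k) \<le> K * 4 / h" using h(1) by (simp add: field_simps)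
  have "prob {\<omega>\<in>space M. \<exists>k\<in>{..n}. norm (W (real k / real n) \<omega>) < e} \<le> prob (\<Union>k\<in>{..n}. first_entry e n k)"
  proof (rule finite_measure_mono)
    show "{\<omega>\<in>space M. \<exists>k\<in>{..n}. norm (W (real k / real n) \<omega>) < e} \<subseteq> (\<Union>k\<in>{..n}. first_entry e n k)"
    proof
      fix \<omega> assume *: "\<omega> \<in> {\<omega>\<in>space M. \<exists>k\<in>{..n}. norm (W (real k / real n) \<omega>) < e}"
      define k where "k = (LEAST k. norm (W (real k / real n) \<omega>) < e)"
      from * obtain l where l: "l \<le> n" "norm (W (real l / real n) \<omega>) < e" by auto
      have "norm (W (real k / real n) \<omega>) < e" unfolding k_def by (rule LeastI[of "\<lambda>k. norm (W (real k / real n) \<omega>) < e", OF l(2)])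
      moreover have "k \<le> n" using Least_le[of "\<lambda>k. norm (W (real k / real n) \<omega>) < e", OF l(2)] l(1) unfolding k_def by simp
      moreover have "\<forall>j\<in>{..<k}. e \<le> norm (W (real j / real n) \<omega>)"
        using not_less_Least[of _ "\<lambda>k. norm (W (real k / real n) \<omega>) < e"] unfolding k_def by (simp add: not_less)
      ultimately show "\<omega> \<in> (\<Union>k\<in>{..n}. first_entry e n k)" using * unfolding first_entry_def by blast
    qed
    show "(\<Union>k\<in>{..n}. first_entry e n k) \<in> events" using first_entry_event by (intro sets.finite_UN) simp_all
  qed
  also have "\<dots> \<le> (\<Sum>k\<le>n. p k)" unfolding p_def
    by (rule finite_measure_subadditive_finite) (use first_entry_event in auto)
  also have "\<dots> \<le> K * 4 / h" by (rule s)
  \<comment> \<open>The constant is 2048 * 8 * 4 * 6: the small ball estimate at radius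
    \<open>2 * e\<close>, the factor 4 from the time range of length 2 and the probability 1/2, and
    6 from \<open>h\<close>.\<close>
  also have "\<dots> = 393216 / (v $ i) ^ 4 * e"
    unfolding K_def h_def using e(1) v4 by (simp add: field_simps power2_eq_square power3_eq_cube)
  finally show ?thesis .
qed

text \<open>The grids of mesh 1/m! are nested and exhaust the rationals of the unit interval, so the
  bound, which is uniform in the grid, passes to the limit by continuity of the measure.\<close>

lemma rational_entry_bound:
  assumes i: "v $ i \<noteq> 0" and e: "0 < e" "4 * e \<le> \<bar>v $ i\<bar>" "e \<le> 1"
  shows "prob {\<omega>\<in>space M. \<exists>q\<in>\<rat> \<inter> {0..1}. norm (W q \<omega>) < e} \<le> 393216 / (v $ i) ^ 4 * e"
proof -
  define G where "G m = {\<omega>\<in>space M. \<exists>k\<in>{..fact m}. norm (W (real k / real (fact m)) \<omega>) < e}" for m :: nat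
  have G: "G m \<in> events" for m
  proof -
    have [measurable]: "(\<lambda>\<omega>. norm (W (real k / real (fact m)) \<omega>)) \<in> borel_measurable M" for k by (rule norm_measurable) simp
    show ?thesis unfolding G_def by measurable
  qed
  have inc: "incseq G"
  proof (rule incseq_SucI, rule subsetI)
    fix m \<omega> assume "\<omega> \<in> G m"
    then obtain k where k: "\<omega> \<in> space M" "k \<le> fact m" "norm (W (real k / real (fact m)) \<omega>) < e" unfolding G_def by auto
    have "real (Suc m * k) / real (fact (Suc m)) = real k / real (fact m)"
      by (simp only: fact_Suc of_nat_mult of_nat_id) (rule mult_divide_mult_cancel_left, simp)
    moreover have "Suc m * k \<le> fact (Suc m)" using k(2) by (simp only: fact_Suc of_nat_id mult_le_mono2)
    ultimately show "\<omega> \<in> G (Suc m)" unfolding G_def using k by (intro CollectI conjI bexI[of _ "Suc m * k"]) simp_all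
  qed
  have U: "{\<omega>\<in>space M. \<exists>q\<in>\<rat> \<inter> {0..1}. norm (W q \<omega>) < e} = (\<Union>m. G m)"
  proof (intro equalityI subsetI)
    fix \<omega> assume "\<omega> \<in> {\<omega>\<in>space M. \<exists>q\<in>\<rat> \<inter> {0..1}. norm (W q \<omega>) < e}"
    then obtain q where q: "\<omega> \<in> space M" "q \<in> \<rat>" "0 \<le> q" "q \<le> 1" "norm (W q \<omega>) < e" by auto
    obtain a b :: nat where ab: "b \<noteq> 0" "\<bar>q\<bar> = real a / real b" by (rule Rats_abs_nat_div_natE[OF q(2)])
    have "b dvd fact b" by (rule dvd_fact) (use ab in simp_all)
    then obtain c where c: "fact b = b * c" by (rule dvdE)
    then have c0: "c \<noteq> 0" using fact_nonzero[of b, where ?'a=nat] by (intro notI) simp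
    have qe: "q = real (a * c) / real (fact b)" using ab q(3) c0 unfolding c by simp
    then have "real (a * c) \<le> real (fact b)" using q(4) by (simp add: divide_le_eq)
    then have "a * c \<le> fact b" by (simp only: of_nat_le_iff)
    then have "\<omega> \<in> G b" unfolding G_def using q(1,5) unfolding qe by (intro CollectI conjI bexI[of _ "a * c"]) simp_all
    then show "\<omega> \<in> (\<Union>m. G m)" by blast
  next
    fix \<omega> assume "\<omega> \<in> (\<Union>m. G m)"
    then obtain m k where k: "\<omega> \<in> space M" "k \<le> fact m" "norm (W (real k / real (fact m)) \<omega>) < e" unfolding G_def by auto
    have "real k \<le> real (fact m)" using k(2) by (simp only: of_nat_le_iff)
    then have "real k / real (fact m) \<in> {0..1}" by (simp add: divide_le_eq)
    moreover have "real k / real (fact m) \<in> \<rat>" by (intro Rats_divide Rats_of_nat)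
    ultimately have "real k / real (fact m) \<in> \<rat> \<inter> {0..1}" by blast
    then show "\<omega> \<in> {\<omega>\<in>space M. \<exists>q\<in>\<rat> \<inter> {0..1}. norm (W q \<omega>) < e}" using k by blast
  qed
  have "(\<lambda>m. prob (G m)) \<longlonglongrightarrow> prob (\<Union>m. G m)"
    by (rule finite_Lim_measure_incseq) (use G inc in auto)
  moreover have "prob (G m) \<le> 393216 / (v $ i) ^ 4 * e" for m
    unfolding G_def by (rule grid_entry_bound[OF _ i e]) simp
  ultimately show ?thesis unfolding U by (intro LIMSEQ_le_const2) auto
qed

text \<open>Coming within \<open>e\<close> of 0 at a rational time has probability of order
  \<open>e\<close>, and \<open>hit_by\<close> asks for it at every radius
  \<open>1 / real (Suc m)\<close>.\<close>

lemma AE_not_hit: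
  assumes "v \<noteq> 0"
  shows "AE \<omega> in M. \<not> hit_by 1 (\<lambda>t. norm (W t \<omega>))"
proof -
  obtain i where i: "v $ i \<noteq> 0" using assms by (auto simp: vec_eq_iff)
  have "Measurable.pred M (\<lambda>\<omega>. hit_by 1 (\<lambda>t. norm (W t \<omega>)))"
    by (rule hit_by_measurable[of 1 1]) (use norm_measurable in simp_all)
  then have H: "{\<omega>\<in>space M. hit_by 1 (\<lambda>t. norm (W t \<omega>))} \<in> events" by (simp add: pred_def)
  define C where "C = 393216 / (v $ i) ^ 4"
  have C: "0 \<le> C" unfolding C_def by simp
  have le: "prob {\<omega>\<in>space M. hit_by 1 (\<lambda>t. norm (W t \<omega>))} \<le> C * (1 / real (Suc m))" if m: "4 / \<bar>v $ i\<bar> \<le> real (Suc m)" for m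
  proof -
    have meas: "{\<omega>\<in>space M. \<exists>q\<in>\<rat> \<inter> {0..1}. norm (W q \<omega>) < 1 / real (Suc m)} \<in> events"
    proof (rule sets.sets_Collect_countable_Ex')
      show "countable (\<rat> \<inter> {0..1})" using countable_rat by (rule countable_Int1)
      fix q :: real assume "q \<in> \<rat> \<inter> {0..1}"
      then have [measurable]: "(\<lambda>\<omega>. norm (W q \<omega>)) \<in> borel_measurable M" by (intro norm_measurable) simp
      show "{\<omega>\<in>space M. norm (W q \<omega>) < 1 / real (Suc m)} \<in> events" by measurable
    qed
    have "prob {\<omega>\<in>space M. hit_by 1 (\<lambda>t. norm (W t \<omega>))} \<le> prob {\<omega>\<in>space M. \<exists>q\<in>\<rat> \<inter> {0..1}. norm (W q \<omega>) < 1 / real (Suc m)}"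
      by (rule finite_measure_mono[OF _ meas]) (unfold hit_by_def, blast)
    also have "\<dots> \<le> C * (1 / real (Suc m))" unfolding C_def
      by (rule rational_entry_bound[OF i]) (use m i in \<open>simp_all add: field_simps\<close>)
    finally show ?thesis .
  qed
  have "(\<lambda>m. C * (1 / real (Suc m))) \<longlonglongrightarrow> C * 0"
    by (intro tendsto_mult tendsto_const LIMSEQ_Suc[OF lim_1_over_n])
  moreover obtain m0 where m0: "4 / \<bar>v $ i\<bar> \<le> real m0" using real_arch_simple by blast
  ultimately have "prob {\<omega>\<in>space M. hit_by 1 (\<lambda>t. norm (W t \<omega>))} \<le> C * 0"
  proof (elim LIMSEQ_le_const)
    show "\<exists>N. \<forall>m\<ge>N. prob {\<omega>\<in>space M. hit_by 1 (\<lambda>t. norm (W t \<omega>))} \<le> C * (1 / real (Suc m))"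
    proof (intro exI[of _ m0] allI impI le)
      fix m assume "m0 \<le> m"
      then have "real m0 \<le> real (Suc m)" by simp
      then show "4 / \<bar>v $ i\<bar> \<le> real (Suc m)" using m0 by linarith
    qed
  qed
  then have "prob {\<omega>\<in>space M. hit_by 1 (\<lambda>t. norm (W t \<omega>))} = 0" by (simp add: measure_le_0_iff)
  then show ?thesis using H by (subst AE_iff_measurable[OF H]) (simp_all add: emeasure_eq_measure)
qed

end

text \<open>\<open>hit_by 1\<close> is an event of the path space, so its failure passes from the
  norm of the Brownian motion to \<open>Y\<close> through equality of laws; continuity of
  \<open>Y\<close> then turns it into positivity.\<close>

lemma bessel_positive:
  assumes Y: "bessel3 M y Y" and y: "0 < y"
  shows "AE \<omega> in M. \<forall>t\<in>{0..1}. 0 < Y t \<omega>"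
proof -
  obtain N :: "real measure" and v W where BW: "continuous_process M {0..} Y" "norm v = y" "brownian_motion3 N v W"
    "path_law M {0..} Y = path_law N {0..} (\<lambda>t \<omega>. norm (W t \<omega>))"
    using Y unfolding bessel3_def by blast
  interpret brownian3 N v W by unfold_locales (rule BW(3))
  have v: "v \<noteq> 0" using BW(2) y by auto
  have c: "hit_by 1 (path_of {0..} U \<omega>) \<longleftrightarrow> hit_by 1 (\<lambda>t. U t \<omega>)" for U :: "real \<Rightarrow> 'c \<Rightarrow> real" and \<omega>
    unfolding hit_by_def path_of_def by (intro all_cong1 bex_cong refl) simp
  have "AE \<omega> in M. \<not> hit_by 1 (path_of {0..} Y \<omega>)"
  proof (rule path_law_AE[OF continuous_process_path_measurable[OF BW(1)] _ BW(4), where P="\<lambda>f. \<not> hit_by 1 f"])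
    show "path_of {0..} (\<lambda>t \<omega>. norm (W t \<omega>)) \<in> N \<rightarrow>\<^sub>M path_space {0..}"
      unfolding path_of_def using norm_measurable by (intro measurable_restrict) simp
    have "Measurable.pred (path_space {0..}) (\<lambda>f. hit_by 1 f)"
      by (rule hit_by_measurable[of 1 1 "\<lambda>f. f"]) (auto intro!: measurable_component_singleton)
    then show "Measurable.pred (path_space {0..}) (\<lambda>f. \<not> hit_by 1 f)" by measurable
    show "AE \<omega> in N. \<not> hit_by 1 (path_of {0..} (\<lambda>t \<omega>. norm (W t \<omega>)) \<omega>)"
      unfolding c by (rule AE_not_hit[OF v])
  qed
  then show ?thesis unfolding c using AE_space
  proof eventually_elim
    case (elim \<omega>)
    have "continuous_on {0..1} (\<lambda>t. Y t \<omega>)"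
      by (rule continuous_on_subset[of "{0..}"]) (use BW(1) elim(2) in \<open>simp_all add: continuous_process_def\<close>)
    then show ?case using elim(1) hit_by_iff[of 1 "\<lambda>t. Y t \<omega>"] by (simp add: not_le)
  qed
qed

text \<open>Only the values at 0 and at rational times are transferred through the law; continuity
  of \<open>Z\<close> supplies the others.\<close>

lemma bessel_zero_nonneg:
  assumes Z: "bessel3 M 0 Z"
  shows "AE \<omega> in M. Z 0 \<omega> = 0 \<and> (\<forall>t\<ge>0. 0 \<le> Z t \<omega>)"
proof -
  obtain N :: "real measure" and v W where BW: "continuous_process M {0..} Z" "norm v = 0" "brownian_motion3 N v W"
    "path_law M {0..} Z = path_law N {0..} (\<lambda>t \<omega>. norm (W t \<omega>))"
    using Z unfolding bessel3_def by blast
  interpret brownian3 N v W by unfold_locales (rule BW(3))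
  have "AE \<omega> in M. (\<lambda>f. f 0 = 0 \<and> (\<forall>q\<in>\<rat> \<inter> {0..}. 0 \<le> f q)) (path_of {0..} Z \<omega>)"
  proof (rule path_law_AE[OF continuous_process_path_measurable[OF BW(1)] _ BW(4)])
    show "path_of {0..} (\<lambda>t \<omega>. norm (W t \<omega>)) \<in> N \<rightarrow>\<^sub>M path_space {0..}"
      unfolding path_of_def using norm_measurable by (intro measurable_restrict) simp
    have m: "(\<lambda>f. f q) \<in> borel_measurable (path_space {0..})" if "0 \<le> q" for q
      by (rule measurable_component_singleton) (use that in simp)
    have "{f\<in>space (path_space {0..}). f 0 = 0 \<and> (\<forall>q\<in>\<rat> \<inter> {0..}. 0 \<le> f q)} \<in> sets (path_space {0..})"
    proof (intro sets.sets_Collect_conj sets.sets_Collect_countable_All')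
      show "{f\<in>space (path_space {0..}). f 0 = 0} \<in> sets (path_space {0..})" using m[of 0] by measurable
      show "countable (\<rat> \<inter> {0..})" using countable_rat by (rule countable_Int1)
      fix q :: real assume "q \<in> \<rat> \<inter> {0..}"
      then have [measurable]: "(\<lambda>f. f q) \<in> borel_measurable (path_space {0..})" by (intro m) simp
      show "{f\<in>space (path_space {0..}). 0 \<le> f q} \<in> sets (path_space {0..})" by measurable
    qed
    then show "Measurable.pred (path_space {0..}) (\<lambda>f. f 0 = 0 \<and> (\<forall>q\<in>\<rat> \<inter> {0..}. 0 \<le> f q))" unfolding pred_def .
    show "AE \<omega> in N. path_of {0..} (\<lambda>t \<omega>. norm (W t \<omega>)) \<omega> 0 = 0 \<and> (\<forall>q\<in>\<rat> \<inter> {0..}. 0 \<le> path_of {0..} (\<lambda>t \<omega>. norm (W t \<omega>)) \<omega> q)"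
      using start_AE by eventually_elim (use BW(2) in \<open>auto simp: path_of_def\<close>)
  qed
  then show ?thesis using AE_space
  proof eventually_elim
    case (elim \<omega>)
    have c: "continuous_on {0..} (\<lambda>t. Z t \<omega>)" using BW(1) elim(2) unfolding continuous_process_def by blast
    have q: "0 \<le> Z q \<omega>" if "q \<in> \<rat>" "0 \<le> q" for q using elim(1) that by (simp add: path_of_def)
    have "0 \<le> Z t \<omega>" if t: "0 \<le> t" for t
    proof (rule ccontr)
      assume "\<not> 0 \<le> Z t \<omega>"
      then have neg: "0 < - Z t \<omega>" by simp
      obtain d where d: "0 < d" "\<And>s. s \<in> {0..} \<Longrightarrow> dist s t < d \<Longrightarrow> dist (Z s \<omega>) (Z t \<omega>) < - Z t \<omega>"
        using c[unfolded continuous_on_iff] t neg by (metis atLeast_iff)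
      obtain r where r: "r \<in> \<rat>" "t < r" "r < t + d" using Rats_dense_in_real[of t "t + d"] d(1) by auto
      have "dist (Z r \<omega>) (Z t \<omega>) < - Z t \<omega>" by (rule d(2)) (use r t in \<open>simp_all add: dist_real_def\<close>)
      then show False using q[OF r(1)] r t by (simp add: dist_real_def)
    qed
    then show ?case using elim(1) by (simp add: path_of_def)
  qed
qed

section \<open>The law of the path before and after time g\<close>

lemma emeasure_section_measurable:
  assumes "prob_space M" and P: "Measurable.pred (K \<Otimes>\<^sub>M M) (\<lambda>p. P (fst p) (snd p))"
  shows "(\<lambda>x. emeasure M {\<omega>\<in>space M. P x \<omega>}) \<in> borel_measurable K"
proof -
  interpret prob_space M by fact
  define S where "S = {p\<in>space (K \<Otimes>\<^sub>M M). P (fst p) (snd p)}"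
  have S: "S \<in> sets (K \<Otimes>\<^sub>M M)" using P unfolding S_def pred_def .
  have "Pair x -` S = {\<omega>\<in>space M. P x \<omega>}" if "x \<in> space K" for x
    using that unfolding S_def by (auto simp: space_pair_measure)
  then show ?thesis
    using measurable_emeasure_Pair[OF S] by (subst measurable_cong[where g="\<lambda>x. emeasure M (Pair x -` S)"]) simp_all
qed

lemma continuous_sublevel_borel:
  fixes h :: "real \<Rightarrow> real"
  assumes "continuous_on {0..1} h"
  shows "{r\<in>{0..1}. h r < 0} \<in> sets borel"
proof -
  have [measurable]: "(\<lambda>r. indicator {0..1} r *\<^sub>R h r) \<in> borel_measurable borel"
    by (rule borel_measurable_continuous_on_indicator[OF _ assms]) simp
  have "{r\<in>{0..1}. h r < 0} = {r\<in>space borel. indicator {0..1} r *\<^sub>R h r < 0}"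
    by (auto simp: indicator_def split: if_splits)
  also have "\<dots> \<in> sets borel" by measurable
  finally show ?thesis .
qed

lemma below_le_one: "below f \<le> 1"
proof -
  have "emeasure lborel {s\<in>{0..1}. f s < 0} \<le> emeasure lborel {0..1::real}"
    by (rule emeasure_mono) auto
  then have "enn2real (emeasure lborel {s\<in>{0..1}. f s < 0}) \<le> enn2real 1"
    by (intro enn2real_mono) simp_all
  then show ?thesis unfolding below_def measure_def by simp
qed

lemma scaled_bridge_unscaled: "scaled_bridge y x f s = unscaled y x f (s / x)"
  unfolding scaled_bridge_def unscaled_def by (simp add: algebra_simps)

lemma time_below_scaled_bridge:
  assumes x: "0 < x" and f: "continuous_on {0..1} f"
  shows "time_below_zero {0..x} (scaled_bridge y x f) = ennreal (x * below (unscaled y x f))"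
proof -
  define E where "E = {r\<in>{0..1}. unscaled y x f r < 0}"
  have E[measurable]: "E \<in> sets borel" unfolding E_def by (rule continuous_sublevel_borel[OF unscaled_continuous[OF f]])
  have fin: "emeasure lborel E \<noteq> top"
  proof -
    have "emeasure lborel E \<le> emeasure lborel {0..1::real}" unfolding E_def by (rule emeasure_mono) auto
    also have "\<dots> < top" by simp
    finally show ?thesis by simp
  qed
  have "time_below_zero {0..x} (scaled_bridge y x f) = (\<integral>\<^sup>+s. indicator E (s / x) \<partial>lborel)"
    unfolding time_below_zero_def
  proof (rule nn_integral_cong)
    fix s :: real
    have "s \<in> {0..x} \<longleftrightarrow> s / x \<in> {0..1}" using x by (simp add: zero_le_divide_iff divide_le_eq_1)
    then have "s / x \<in> E \<longleftrightarrow> s \<in> {0..x} \<and> scaled_bridge y x f s < 0"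
      unfolding E_def scaled_bridge_unscaled by blast
    then show "of_bool (scaled_bridge y x f s < 0) * indicator {0..x} s = (indicator E (s / x) :: ennreal)"
      by (simp only: indicator_def) auto
  qed
  also have "\<dots> = \<bar>x\<bar> * (\<integral>\<^sup>+r. indicator E ((0 + x * r) / x) \<partial>lborel)"
    by (rule nn_integral_real_affine) (use x in simp_all)
  also have "(\<integral>\<^sup>+r. indicator E ((0 + x * r) / x) \<partial>lborel) = (\<integral>\<^sup>+r. indicator E r \<partial>lborel)" using x by simp
  also have "\<dots> = emeasure lborel E" by simp
  also have "\<dots> = ennreal (below (unscaled y x f))"
    using emeasure_eq_ennreal_measure[OF fin] unfolding below_def E_def by simp
  also have "ennreal \<bar>x\<bar> * ennreal (below (unscaled y x f)) = ennreal (x * below (unscaled y x f))"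
    using x by (simp add: ennreal_mult below_nonneg)
  finally show ?thesis .
qed

definition path_occupation :: "real \<Rightarrow> real \<Rightarrow> (real \<Rightarrow> real) \<Rightarrow> real"
  where "path_occupation y x f = x * below (unscaled y x (regularize f))"

lemma path_occupation_measurable:
  assumes [measurable]: "X \<in> borel_measurable K" "F \<in> K \<rightarrow>\<^sub>M path_space {0..1}"
  shows "(\<lambda>p. path_occupation y (X p) (F p)) \<in> borel_measurable K"
proof -
  note [measurable] = unscaled_regularize_measurable
  have "(\<lambda>p. below (unscaled y (X p) (regularize (F p)))) \<in> borel_measurable K"
    unfolding below_def by (rule measure_unit_interval_measurable) measurable
  then show ?thesis unfolding path_occupation_def by (intro borel_measurable_times assms)
qed

lemma path_occupation_le_total: "0 \<le> x \<Longrightarrow> path_occupation y x f \<le> path_total y x f"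
  unfolding path_occupation_def path_total_def hit_time_measure_def by (intro mult_left_mono) simp_all

lemma path_occupation_le: "0 \<le> x \<Longrightarrow> path_occupation y x f \<le> x"
  unfolding path_occupation_def using mult_left_mono[OF below_le_one, of x] by simp

text \<open>Subtracting the line and rescaling inverts \<open>scaled_bridge\<close>, so every bridge
  of length \<open>t\<close> from \<open>y\<close> to 0 arises from a standard one.\<close>

lemma bridge_rescale:
  assumes B: "brownian_bridge N t y 0 B"
  shows "\<exists>V. bridge_space N V (\<lambda>s \<omega>. (B (t * s) \<omega> - y * (1 - s)) / sqrt t)"
proof -
  define m where "m s = y + (0 - y) * s / t" for s
  have t: "0 < t" and c: "continuous_process N {0..t} B"
    and g: "gaussian_process N {0..t} m (\<lambda>s u. min s u - s * u / t) B"
    using B unfolding brownian_bridge_def m_def by auto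
  have N: "prob_space N" using c unfolding continuous_process_def by simp
  define V where "V = linear_span {0..t} (\<lambda>s \<omega>. B s \<omega> - m s)"
  interpret gaussian_space N V unfolding V_def by (rule gaussian_process_space[OF N g])
  have ts: "t * s \<in> {0..t}" if "s \<in> {0..1}" for s using that t by (simp add: mult_left_le)
  have ms: "m (t * s) = y * (1 - s)" for s unfolding m_def using t by (simp add: algebra_simps)
  have "bridge_space N V (\<lambda>s \<omega>. (B (t * s) \<omega> - y * (1 - s)) / sqrt t)"
  proof (unfold_locales, goal_cases)
    case (1 s)
    have "(\<lambda>\<omega>. B (t * s) \<omega> - m (t * s)) \<in> V" unfolding V_def by (rule linear_span_base[OF ts[OF 1]])
    from scale_mem[OF this, of "1 / sqrt t"] show ?case by (simp add: ms)
  next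
    case (2 s u)
    have "expectation (\<lambda>\<omega>. (B (t * s) \<omega> - m (t * s)) * (B (t * u) \<omega> - m (t * u))) = min (t * s) (t * u) - t * s * (t * u) / t"
      using g ts[OF 2(1)] ts[OF 2(2)] unfolding gaussian_process_def by blast
    also have "min (t * s) (t * u) = t * min s u" using t by (simp add: min_mult_distrib_left)
    also have "t * min s u - t * s * (t * u) / t = t * (min s u - s * u)" using t by (simp add: right_diff_distrib)
    finally have e: "expectation (\<lambda>\<omega>. (B (t * s) \<omega> - y * (1 - s)) * (B (t * u) \<omega> - y * (1 - u))) = t * (min s u - s * u)"
      by (simp only: ms)
    have "(\<lambda>\<omega>. (B (t * s) \<omega> - y * (1 - s)) / sqrt t * ((B (t * u) \<omega> - y * (1 - u)) / sqrt t)) =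
      (\<lambda>\<omega>. (B (t * s) \<omega> - y * (1 - s)) * (B (t * u) \<omega> - y * (1 - u)) / t)"
      using t by (simp add: fun_eq_iff)
    then have "expectation (\<lambda>\<omega>. (B (t * s) \<omega> - y * (1 - s)) / sqrt t * ((B (t * u) \<omega> - y * (1 - u)) / sqrt t)) =
      expectation (\<lambda>\<omega>. (B (t * s) \<omega> - y * (1 - s)) * (B (t * u) \<omega> - y * (1 - u))) / t"
      by (simp only: integral_divide_zero)
    then show ?case unfolding e using t by simp
  next
    case (3 \<omega>)
    have "continuous_on {0..t} (\<lambda>s. B s \<omega>)" using c 3 unfolding continuous_process_def by blast
    then have "continuous_on {0..1} (\<lambda>s. B (t * s) \<omega>)"
      by (rule continuous_on_compose2) (use ts in \<open>auto intro: continuous_on_mult continuous_on_const continuous_on_id\<close>)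
    then show ?case using t
      by (intro continuous_on_divide continuous_on_diff continuous_on_mult continuous_on_const continuous_on_id) simp_all
  qed
  then show ?thesis ..
qed

context bridge_space
begin

definition occupation_event :: "real \<Rightarrow> real \<Rightarrow> 'a set"
  where "occupation_event y x = {\<omega>\<in>space M. path_occupation y x (bpath \<omega>) \<le> 1}"

lemma time_below_bpath:
  assumes x: "0 < x" and \<omega>: "\<omega> \<in> space M"
  shows "time_below_zero {0..x} (scaled_bridge y x (\<lambda>t. \<beta> t \<omega>)) = ennreal (path_occupation y x (bpath \<omega>))"
proof -
  have "below (unscaled y x (\<lambda>t. \<beta> t \<omega>)) = below (unscaled y x (regularize (bpath \<omega>)))"
    by (rule below_cong) (simp only: unscaled_def regularize_bpath[OF \<omega>])
  then show ?thesis
    using time_below_scaled_bridge[OF x bridge_continuous[OF \<omega>], of y] unfolding path_occupation_def by simp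
qed

lemma occupation_event_eq:
  assumes x: "0 < x"
  shows "{\<omega>\<in>space M. time_below_zero {0..x} (scaled_bridge y x (\<lambda>t. \<beta> t \<omega>)) \<le> 1} = occupation_event y x"
  unfolding occupation_event_def
  by (rule Collect_cong, rule conj_cong[OF refl]) (simp only: time_below_bpath[OF x] ennreal_le_1)

lemma occupation_event_measurable: "occupation_event y x \<in> events"
proof -
  have [measurable]: "(\<lambda>\<omega>. path_occupation y x (bpath \<omega>)) \<in> borel_measurable M"
    by (intro path_occupation_measurable measurable_bpath borel_measurable_const)
  show ?thesis unfolding occupation_event_def by measurable
qed

text \<open>The bridges defining \<open>q\<close> live on unrelated spaces, one for each
  \<open>t\<close>. Only their laws matter, so all of them are replaced by rescalings of a single
  standard bridge, which makes the dependence on \<open>t\<close> measurable.\<close>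

lemma bridge_occupation:
  assumes B: "brownian_bridge N t y 0 B"
  shows "measure N {\<omega>\<in>space N. time_below_zero {0..t} (\<lambda>s. B s \<omega>) \<le> 1} = prob (occupation_event y t)"
proof -
  define \<beta>' where "\<beta>' s \<omega> = (B (t * s) \<omega> - y * (1 - s)) / sqrt t" for s \<omega>
  have t: "0 < t" using B unfolding brownian_bridge_def by simp
  obtain V' where B': "bridge_space N V' \<beta>'"
    using bridge_rescale[OF B] unfolding \<beta>'_def[abs_def] by blast
  interpret N: bridge_space N V' \<beta>' by (rule B')
  have "scaled_bridge y t (\<lambda>s. \<beta>' s \<omega>) = (\<lambda>s. B s \<omega>)" for \<omega>
  proof
    fix s
    have "sqrt t * (c / sqrt t) = c" for c using t by simp
    then show "scaled_bridge y t (\<lambda>s. \<beta>' s \<omega>) s = B s \<omega>"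
      unfolding scaled_bridge_def \<beta>'_def using t by (simp only:) (simp add: algebra_simps)
  qed
  then have e: "{\<omega>\<in>space N. time_below_zero {0..t} (\<lambda>s. B s \<omega>) \<le> 1} = N.occupation_event y t"
    using N.occupation_event_eq[OF t, of y] by simp
  define Q where "Q = {f\<in>space (path_space {0..1}). path_occupation y t f \<le> 1}"
  have Q: "Q \<in> sets (path_space {0..1})"
  proof -
    have [measurable]: "(\<lambda>f. path_occupation y t f) \<in> borel_measurable (path_space {0..1})"
      by (intro path_occupation_measurable borel_measurable_const measurable_ident_sets refl)
    show ?thesis unfolding Q_def by measurable
  qed
  have "{\<omega>\<in>space N. path_of {0..1} \<beta>' \<omega> \<in> Q} = N.occupation_event y t" for \<omega> :: 'a
    unfolding Q_def N.occupation_event_def using measurable_space[OF N.measurable_bpath] by blast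
  moreover have "{\<omega>\<in>space M. bpath \<omega> \<in> Q} = occupation_event y t"
    unfolding Q_def occupation_event_def using measurable_space[OF measurable_bpath] by blast
  moreover have "bridge_space M V \<beta>" by unfold_locales
  ultimately show ?thesis unfolding e using bridge_space_prob[OF B' _ Q] by metis
qed

lemma conditioned_bridge_law_emeasure:
  assumes x: "0 < x" and C: "C \<in> sets (path_space {0..1})"
  shows "emeasure (conditioned_bridge_law M \<beta> y x) C =
    emeasure M {\<omega>\<in>space M. bpath \<omega> \<in> C \<and> path_occupation y x (bpath \<omega>) \<le> 1} / emeasure M (occupation_event y x)"
proof -
  have e: "occupation_event y x \<inter> (bpath -` C \<inter> space M) = {\<omega>\<in>space M. bpath \<omega> \<in> C \<and> path_occupation y x (bpath \<omega>) \<le> 1}"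
    unfolding occupation_event_def by blast
  have m: "bpath \<in> uniform_measure M (occupation_event y x) \<rightarrow>\<^sub>M path_space {0..1}"
    using measurable_bpath by (simp only: measurable_cong_sets[OF sets_uniform_measure refl])
  have C': "bpath -` C \<inter> space M \<in> events" by (rule measurable_sets[OF measurable_bpath C])
  show ?thesis
    unfolding conditioned_bridge_law_def occupation_event_eq[OF x] path_law_def emeasure_distr[OF m C] space_uniform_measure
    unfolding emeasure_uniform_measure[OF occupation_event_measurable C'] e by (rule refl)
qed

lemma occupation_emeasure_measurable:
  assumes [measurable]: "S \<in> sets (borel \<Otimes>\<^sub>M path_space {0..1})"
  shows "(\<lambda>x. emeasure M {\<omega>\<in>space M. (x, bpath \<omega>) \<in> S \<and> path_occupation y x (bpath \<omega>) \<le> 1}) \<in> borel_measurable borel"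
proof -
  have [measurable]: "(\<lambda>p. bpath (snd p)) \<in> borel \<Otimes>\<^sub>M M \<rightarrow>\<^sub>M path_space {0..1}" by measurable
  have [measurable]: "(\<lambda>p. path_occupation y (fst p) (bpath (snd p))) \<in> borel_measurable (borel \<Otimes>\<^sub>M M)"
    by (intro path_occupation_measurable) measurable
  show ?thesis
    by (rule emeasure_section_measurable[OF prob_space_axioms]) measurable
qed

lemma occupation_event_emeasure_measurable: "(\<lambda>x. emeasure M (occupation_event y x)) \<in> borel_measurable borel"
proof -
  have "occupation_event y x = {\<omega>\<in>space M. (x, bpath \<omega>) \<in> space (borel \<Otimes>\<^sub>M path_space {0..1}) \<and> path_occupation y x (bpath \<omega>) \<le> 1}" for x
    unfolding occupation_event_def using measurable_space[OF measurable_bpath] by (auto simp: space_pair_measure)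
  then show ?thesis using occupation_emeasure_measurable[OF sets.top] by simp
qed

text \<open>On \<open>g > 0\<close> the law of \<open>(g, b)\<close> has density \<open>weight y x / c\<close>, restricted to the conditioning event,
  with respect to Lebesgue measure times the law of the standard bridge: the normalisation of the conditional law
  cancels against the factor \<open>q\<close> in the density of \<open>g\<close>.\<close>

lemma joint_law:
  fixes P :: "'b measure" and g :: "'b \<Rightarrow> real" and F :: "'b \<Rightarrow> real \<Rightarrow> real"
  assumes P: "prob_space P" and K: "has_conditional_law P borel g (path_space {0..1}) F (conditioned_bridge_law M \<beta> y)"
    and d: "density (distr P borel g) (indicator {0<..}) =
      density lborel (\<lambda>x. indicator {0<..} x * (ennreal (weight y x / c) * emeasure M (occupation_event y x)))"
    and S: "S \<in> sets (borel \<Otimes>\<^sub>M path_space {0..1})"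
  shows "emeasure P {\<omega>\<in>space P. 0 < g \<omega> \<and> (g \<omega>, F \<omega>) \<in> S} =
    (\<integral>\<^sup>+x. indicator {0<..} x * (ennreal (weight y x / c) * emeasure M {\<omega>\<in>space M. (x, bpath \<omega>) \<in> S \<and> path_occupation y x (bpath \<omega>) \<le> 1}) \<partial>lborel)"
proof -
  interpret P: prob_space P by fact
  define T where "T = (borel :: real measure) \<Otimes>\<^sub>M path_space {0..1}"
  have gF[measurable]: "g \<in> borel_measurable P" "F \<in> P \<rightarrow>\<^sub>M path_space {0..1}" using K unfolding has_conditional_law_def by auto
  \<comment> \<open>\<open>\<nu>1\<close> is the law of \<open>(g, F)\<close> restricted to positive
    \<open>g\<close>, and \<open>\<nu>2\<close> below is the claimed one; they are compared on
    measurable rectangles.\<close>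
  define \<nu>1 where "\<nu>1 = distr (density P (\<lambda>\<omega>. indicator {0<..} (g \<omega>))) T (\<lambda>\<omega>. (g \<omega>, F \<omega>))"
  have m1: "(\<lambda>\<omega>. (g \<omega>, F \<omega>)) \<in> P \<rightarrow>\<^sub>M T" unfolding T_def by measurable
  have e1: "emeasure \<nu>1 S = emeasure P {\<omega>\<in>space P. 0 < g \<omega> \<and> (g \<omega>, F \<omega>) \<in> S}" if S: "S \<in> sets T" for S
  proof -
    have A: "(\<lambda>\<omega>. (g \<omega>, F \<omega>)) -` S \<inter> space P \<in> sets P" by (rule measurable_sets[OF m1 S])
    have m1': "(\<lambda>\<omega>. (g \<omega>, F \<omega>)) \<in> density P (\<lambda>\<omega>. indicator {0<..} (g \<omega>)) \<rightarrow>\<^sub>M T"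
      using m1 by (simp only: measurable_cong_sets[OF sets_density refl])
    have "emeasure \<nu>1 S = (\<integral>\<^sup>+\<omega>. indicator {0<..} (g \<omega>) * indicator ((\<lambda>\<omega>. (g \<omega>, F \<omega>)) -` S \<inter> space P) \<omega> \<partial>P)"
      unfolding \<nu>1_def emeasure_distr[OF m1' S] space_density by (rule emeasure_density) (use A in measurable)
    also have "\<dots> = (\<integral>\<^sup>+\<omega>. indicator {\<omega>\<in>space P. 0 < g \<omega> \<and> (g \<omega>, F \<omega>) \<in> S} \<omega> \<partial>P)"
      by (rule nn_integral_cong) (simp add: indicator_def)
    also have "\<dots> = emeasure P {\<omega>\<in>space P. 0 < g \<omega> \<and> (g \<omega>, F \<omega>) \<in> S}"
    proof (rule nn_integral_indicator)
      have "{\<omega>\<in>space P. 0 < g \<omega> \<and> (g \<omega>, F \<omega>) \<in> S} = {\<omega>\<in>space P. 0 < g \<omega>} \<inter> ((\<lambda>\<omega>. (g \<omega>, F \<omega>)) -` S \<inter> space P)" by blast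
      also have "\<dots> \<in> sets P" by (rule sets.Int[OF _ A]) measurable
      finally show "{\<omega>\<in>space P. 0 < g \<omega> \<and> (g \<omega>, F \<omega>) \<in> S} \<in> sets P" .
    qed
    finally show ?thesis .
  qed
  define \<phi> :: "real \<times> 'a \<Rightarrow> ennreal" where "\<phi> p = indicator {0<..} (fst p) * ennreal (weight y (fst p) / c) * indicator {..1} (path_occupation y (fst p) (bpath (snd p)))" for p
  define G where "G p = (fst p, bpath (snd p))" for p :: "real \<times> 'a"
  have bm[measurable]: "(\<lambda>p. bpath (snd p)) \<in> borel \<Otimes>\<^sub>M M \<rightarrow>\<^sub>M path_space {0..1}" by measurable
  have [measurable]: "(\<lambda>p. path_occupation y (fst p) (bpath (snd p))) \<in> borel_measurable (borel \<Otimes>\<^sub>M M)"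
    by (intro path_occupation_measurable) measurable
  have \<phi>m': "\<phi> \<in> borel_measurable (borel \<Otimes>\<^sub>M M)" unfolding \<phi>_def by measurable
  have ls: "sets (lborel \<Otimes>\<^sub>M M) = sets (borel \<Otimes>\<^sub>M M)" by (rule sets_pair_measure_cong) simp_all
  have \<phi>m: "\<phi> \<in> borel_measurable (lborel \<Otimes>\<^sub>M M)" using \<phi>m' by (simp only: measurable_cong_sets[OF ls refl])
  have Gm': "G \<in> borel \<Otimes>\<^sub>M M \<rightarrow>\<^sub>M T" unfolding G_def T_def by measurable
  have Gm: "G \<in> lborel \<Otimes>\<^sub>M M \<rightarrow>\<^sub>M T" using Gm' by (simp only: measurable_cong_sets[OF ls refl])
  define \<nu>2 where "\<nu>2 = distr (density (lborel \<Otimes>\<^sub>M M) \<phi>) T G"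
  have e2: "emeasure \<nu>2 S = (\<integral>\<^sup>+x. indicator {0<..} x * (ennreal (weight y x / c) * emeasure M {\<omega>\<in>space M. (x, bpath \<omega>) \<in> S \<and> path_occupation y x (bpath \<omega>) \<le> 1}) \<partial>lborel)"
    if S: "S \<in> sets T" for S
  proof -
    have A: "G -` S \<inter> space (lborel \<Otimes>\<^sub>M M) \<in> sets (lborel \<Otimes>\<^sub>M M)" by (rule measurable_sets[OF Gm S])
    have Gm2: "G \<in> density (lborel \<Otimes>\<^sub>M M) \<phi> \<rightarrow>\<^sub>M T" using Gm by (simp only: measurable_cong_sets[OF sets_density refl])
    have "emeasure \<nu>2 S = (\<integral>\<^sup>+p. \<phi> p * indicator (G -` S \<inter> space (lborel \<Otimes>\<^sub>M M)) p \<partial>(lborel \<Otimes>\<^sub>M M))"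
      unfolding \<nu>2_def emeasure_distr[OF Gm2 S] space_density by (rule emeasure_density[OF \<phi>m A])
    also have "\<dots> = (\<integral>\<^sup>+x. \<integral>\<^sup>+\<omega>. \<phi> (x, \<omega>) * indicator (G -` S \<inter> space (lborel \<Otimes>\<^sub>M M)) (x, \<omega>) \<partial>M \<partial>lborel)"
      by (rule nn_integral_fst[symmetric]) (use \<phi>m A in measurable)
    also have "\<dots> = (\<integral>\<^sup>+x. indicator {0<..} x * (ennreal (weight y x / c) * emeasure M {\<omega>\<in>space M. (x, bpath \<omega>) \<in> S \<and> path_occupation y x (bpath \<omega>) \<le> 1}) \<partial>lborel)"
    proof (rule nn_integral_cong)
      fix x :: real
      define R where "R = {\<omega>\<in>space M. (x, bpath \<omega>) \<in> S \<and> path_occupation y x (bpath \<omega>) \<le> 1}"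
      have Rm: "R \<in> events"
      proof -
        have [measurable]: "(\<lambda>\<omega>. path_occupation y x (bpath \<omega>)) \<in> borel_measurable M"
          by (intro path_occupation_measurable measurable_bpath borel_measurable_const)
        have [measurable]: "S \<in> sets (borel \<Otimes>\<^sub>M path_space {0..1})" using S unfolding T_def .
        show ?thesis unfolding R_def by measurable
      qed
      have "(\<integral>\<^sup>+\<omega>. \<phi> (x, \<omega>) * indicator (G -` S \<inter> space (lborel \<Otimes>\<^sub>M M)) (x, \<omega>) \<partial>M) =
        (\<integral>\<^sup>+\<omega>. (indicator {0<..} x * ennreal (weight y x / c)) * indicator R \<omega> \<partial>M)"
        by (rule nn_integral_cong) (auto simp: \<phi>_def G_def R_def indicator_def space_pair_measure)
      also have "\<dots> = (indicator {0<..} x * ennreal (weight y x / c)) * emeasure M R"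
        by (rule nn_integral_cmult_indicator[OF Rm])
      finally show "(\<integral>\<^sup>+\<omega>. \<phi> (x, \<omega>) * indicator (G -` S \<inter> space (lborel \<Otimes>\<^sub>M M)) (x, \<omega>) \<partial>M) =
        indicator {0<..} x * (ennreal (weight y x / c) * emeasure M {\<omega>\<in>space M. (x, bpath \<omega>) \<in> S \<and> path_occupation y x (bpath \<omega>) \<le> 1})"
        unfolding R_def by (simp only: mult.assoc)
    qed
    finally show ?thesis .
  qed
  have rect: "emeasure \<nu>1 (A \<times> C) = emeasure \<nu>2 (A \<times> C)" if A[measurable]: "A \<in> sets borel" and C: "C \<in> sets (path_space {0..1})" for A C
  proof -
    have AC: "A \<times> C \<in> sets T" unfolding T_def using A C by (rule pair_measureI)
    define r where "r x = emeasure M {\<omega>\<in>space M. bpath \<omega> \<in> C \<and> path_occupation y x (bpath \<omega>) \<le> 1}" for x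
    define h where "h x = emeasure M (occupation_event y x)" for x
    have [measurable]: "h \<in> borel_measurable borel" unfolding h_def by (rule occupation_event_emeasure_measurable)
    have [measurable]: "r \<in> borel_measurable borel"
    proof -
      have "UNIV \<times> C \<in> sets (borel \<Otimes>\<^sub>M path_space {0..1})" using C by (intro pair_measureI) simp_all
      from occupation_emeasure_measurable[OF this, of y] show ?thesis unfolding r_def by simp
    qed
    have rh: "h x * (r x / h x) = r x" for x
    proof (cases "h x = 0")
      case True
      have "r x \<le> h x" unfolding r_def h_def
        by (rule emeasure_mono[OF _ occupation_event_measurable]) (unfold occupation_event_def, blast)
      then show ?thesis using True by simp
    next
      case False
      have "h x \<noteq> top" unfolding h_def by simp
      then have "r x * h x / h x = r x" using False by (rule mult_divide_eq_ennreal[rotated])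
      then show ?thesis by (simp add: ennreal_times_divide mult.commute)
    qed
    define k where "k x = (r x / h x) * indicator A x" for x
    have km[measurable]: "k \<in> borel_measurable borel" unfolding k_def by measurable
    have "emeasure \<nu>1 (A \<times> C) = emeasure P {\<omega>\<in>space P. g \<omega> \<in> A \<inter> {0<..} \<and> F \<omega> \<in> C}"
      unfolding e1[OF AC] by (rule arg_cong[where f="emeasure P"]) auto
    also have "\<dots> = (\<integral>\<^sup>+x. emeasure (conditioned_bridge_law M \<beta> y x) C * indicator (A \<inter> {0<..}) x \<partial>distr P borel g)"
    proof -
      have "A \<inter> {0<..} \<in> sets borel" by measurable
      then show ?thesis using K C unfolding has_conditional_law_def by blast
    qed
    also have "\<dots> = (\<integral>\<^sup>+x. indicator {0<..} x * k x \<partial>distr P borel g)"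
    proof (rule nn_integral_cong)
      fix x :: real
      show "emeasure (conditioned_bridge_law M \<beta> y x) C * indicator (A \<inter> {0<..}) x = indicator {0<..} x * k x"
      proof (cases "0 < x")
        case True
        then show ?thesis using conditioned_bridge_law_emeasure[OF True C, of y] unfolding k_def r_def h_def by (simp add: indicator_def)
      qed simp
    qed
    also have "\<dots> = (\<integral>\<^sup>+x. k x \<partial>density (distr P borel g) (indicator {0<..}))"
      by (rule nn_integral_density[symmetric]) (use km in simp_all)
    also have "\<dots> = (\<integral>\<^sup>+x. k x \<partial>density lborel (\<lambda>x. indicator {0<..} x * (ennreal (weight y x / c) * h x)))"
      unfolding d h_def by (rule refl)
    also have "\<dots> = (\<integral>\<^sup>+x. (indicator {0<..} x * (ennreal (weight y x / c) * h x)) * k x \<partial>lborel)"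
      by (rule nn_integral_density) measurable
    also have "\<dots> = (\<integral>\<^sup>+x. indicator {0<..} x * (ennreal (weight y x / c) * emeasure M {\<omega>\<in>space M. (x, bpath \<omega>) \<in> A \<times> C \<and> path_occupation y x (bpath \<omega>) \<le> 1}) \<partial>lborel)"
    proof (rule nn_integral_cong)
      fix x :: real
      have "h x * k x = r x * indicator A x" unfolding k_def by (simp only: mult.assoc[symmetric] rh)
      also have "\<dots> = emeasure M {\<omega>\<in>space M. (x, bpath \<omega>) \<in> A \<times> C \<and> path_occupation y x (bpath \<omega>) \<le> 1}"
        unfolding r_def by (cases "x \<in> A") simp_all
      finally show "(indicator {0<..} x * (ennreal (weight y x / c) * h x)) * k x = indicator {0<..} x * (ennreal (weight y x / c) * emeasure M {\<omega>\<in>space M. (x, bpath \<omega>) \<in> A \<times> C \<and> path_occupation y x (bpath \<omega>) \<le> 1})"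
        by (simp only: mult.assoc)
    qed
    also have "\<dots> = emeasure \<nu>2 (A \<times> C)" by (rule e2[OF AC, symmetric])
    finally show ?thesis .
  qed
  \<comment> \<open>Rectangles form an intersection-stable generator, and the finite total mass of
    \<open>\<nu>1\<close> permits the extension.\<close>
  have "\<nu>1 = \<nu>2"
  proof (rule measure_eqI_generator_eq[OF Int_stable_pair_measure_generator[of "borel :: real measure" "path_space {0..1}"], where A="\<lambda>_. space T"])
    show "{a \<times> b |a b. a \<in> sets (borel :: real measure) \<and> b \<in> sets (path_space {0..1})} \<subseteq> Pow (space (borel :: real measure) \<times> space (path_space {0..1}))"
      by (rule pair_measure_closed)
    show "sets \<nu>1 = sigma_sets (space (borel :: real measure) \<times> space (path_space {0..1})) {a \<times> b |a b. a \<in> sets (borel :: real measure) \<and> b \<in> sets (path_space {0..1})}"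
      "sets \<nu>2 = sigma_sets (space (borel :: real measure) \<times> space (path_space {0..1})) {a \<times> b |a b. a \<in> sets (borel :: real measure) \<and> b \<in> sets (path_space {0..1})}"
      unfolding \<nu>1_def \<nu>2_def sets_distr T_def by (rule sets_pair_measure)+
    show "range (\<lambda>_::nat. space T) \<subseteq> {a \<times> b |a b. a \<in> sets (borel :: real measure) \<and> b \<in> sets (path_space {0..1})}"
      unfolding T_def space_pair_measure using sets.top[of "borel :: real measure"] sets.top[of "path_space {0..1}"] by blast
    show "(\<Union>i::nat. space T) = space (borel :: real measure) \<times> space (path_space {0..1})" unfolding T_def space_pair_measure by blast
    show "emeasure \<nu>1 (space T) \<noteq> \<infinity>" unfolding e1[OF sets.top] by simp
    fix X assume "X \<in> {a \<times> b |a b. a \<in> sets (borel :: real measure) \<and> b \<in> sets (path_space {0..1})}"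
    then show "emeasure \<nu>1 X = emeasure \<nu>2 X" using rect by blast
  qed
  then show ?thesis using e1[of S] e2[of S] S unfolding T_def by simp
qed

end

text \<open>The part after \<open>x\<close> is nonnegative and adds no time below 0, while
  \<open>z 0 = 0\<close> makes \<open>x\<close> itself a hitting time when the bridge has not hit
  earlier. This matches the convention that \<open>hit\<close> is at most 1.\<close>

lemma path_decomposition:
  fixes f z :: "real \<Rightarrow> real" and x y :: real
  assumes x: "0 < x" and f: "continuous_on {0..1} f" and z: "z 0 = 0" "\<And>t. 0 \<le> t \<Longrightarrow> 0 \<le> z t"
  defines "h \<equiv> \<lambda>t. if t < x then scaled_bridge y x f t else z (t - x)"
  shows "hitting_time h + time_below_zero {0..} h = ennreal (total y x f)"
proof -
  have "time_below_zero {0..} h = time_below_zero {0..x} (scaled_bridge y x f)"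
    unfolding time_below_zero_def
  proof (rule nn_integral_cong_AE)
    have "AE s in lborel. s \<noteq> x" by (rule AE_lborel_singleton)
    then show "AE s in lborel. of_bool (h s < 0) * indicator {0..} s = (of_bool (scaled_bridge y x f s < 0) * indicator {0..x} s :: ennreal)"
    proof eventually_elim
      case (elim s)
      show ?case
      proof (cases "s < x")
        case True
        then show ?thesis by (simp add: h_def indicator_def)
      next
        case False
        then have "x < s" using elim by simp
        then have "0 \<le> z (s - x)" "s \<notin> {0..x}" using z(2)[of "s - x"] by simp_all
        then show ?thesis using False by (simp add: h_def)
      qed
    qed
  qed
  then have 1: "time_below_zero {0..} h = ennreal (x * below (unscaled y x f))"
    using time_below_scaled_bridge[OF x f, of y] by simp
  have 2: "hitting_time h = ennreal (x * hit (unscaled y x f))"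
    unfolding hitting_time_def
  proof (rule antisym)
    show "Inf {ennreal t |t. 0 \<le> t \<and> h t \<le> 0} \<le> ennreal (x * hit (unscaled y x f))"
    proof (rule Inf_lower, rule CollectI, rule exI[of _ "x * hit (unscaled y x f)"], intro conjI)
      show "ennreal (x * hit (unscaled y x f)) = ennreal (x * hit (unscaled y x f))" by (rule refl)
      show "0 \<le> x * hit (unscaled y x f)" using x hit_bounds(1) by simp
      show "h (x * hit (unscaled y x f)) \<le> 0"
      proof (cases "hit (unscaled y x f) < 1")
        case True
        then have "x * hit (unscaled y x f) < x" using x by simp
        then show ?thesis
          using hit_attained[OF unscaled_continuous[OF f] True] x by (simp add: h_def scaled_bridge_unscaled)
      next
        case False
        then have "hit (unscaled y x f) = 1" using hit_bounds(2)[of "unscaled y x f"] by simp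
        then show ?thesis using z(1) by (simp add: h_def)
      qed
    qed
    show "ennreal (x * hit (unscaled y x f)) \<le> Inf {ennreal t |t. 0 \<le> t \<and> h t \<le> 0}"
    proof (rule Inf_greatest)
      fix e assume "e \<in> {ennreal t |t. 0 \<le> t \<and> h t \<le> 0}"
      then obtain t where t: "e = ennreal t" "0 \<le> t" "h t \<le> 0" by blast
      have "x * hit (unscaled y x f) \<le> t"
      proof (cases "t < x")
        case True
        have "hit (unscaled y x f) \<le> t / x"
          by (rule hit_le) (use t True x in \<open>simp_all add: h_def scaled_bridge_unscaled\<close>)
        then show ?thesis using x by (simp add: pos_le_divide_eq mult.commute)
      next
        case False
        have "x * hit (unscaled y x f) \<le> x * 1" by (rule mult_left_mono[OF hit_bounds(2)]) (use x in simp)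
        then show ?thesis using False by linarith
      qed
      then show "ennreal (x * hit (unscaled y x f)) \<le> e" unfolding t(1) by (rule ennreal_leI)
    qed
  qed
  show ?thesis unfolding 1 2 total_def
    using x hit_bounds(1)[of "unscaled y x f"] below_nonneg[of "unscaled y x f"] by (simp add: ennreal_plus[symmetric] distrib_left del: ennreal_plus)
qed

text \<open>Continuity keeps the function positive slightly beyond 1, which makes the inequality
  strict; this matters for u = 1.\<close>

lemma hitting_time_gt_one:
  assumes c: "continuous_on {0..} f" and pos: "\<And>t. t \<in> {0..1} \<Longrightarrow> 0 < f t"
  shows "1 < hitting_time f"
proof -
  have "0 < f 1" using pos by simp
  then obtain d where d: "0 < d" "\<And>s. s \<in> {0..} \<Longrightarrow> dist s 1 < d \<Longrightarrow> dist (f s) (f 1) < f 1"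
    using c[unfolded continuous_on_iff, rule_format, of 1 "f 1"] by auto
  have "ennreal (1 + d) \<le> hitting_time f"
    unfolding hitting_time_def
  proof (rule Inf_greatest)
    fix e assume "e \<in> {ennreal t |t. 0 \<le> t \<and> f t \<le> 0}"
    then obtain t where t: "e = ennreal t" "0 \<le> t" "f t \<le> 0" by blast
    have "1 < t" using pos[of t] t by force
    moreover have "\<not> dist t 1 < d"
    proof
      assume "dist t 1 < d"
      then have "dist (f t) (f 1) < f 1" using t by (intro d(2)) simp_all
      then show False using t(3) by (simp add: dist_real_def)
    qed
    ultimately have "1 + d \<le> t" by (simp add: dist_real_def)
    then show "ennreal (1 + d) \<le> e" unfolding t(1) by (rule ennreal_leI)
  qed
  moreover have "1 < ennreal (1 + d)" using d(1) by (simp add: one_less_ennreal)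
  ultimately show ?thesis by (rule order.strict_trans2[rotated])
qed

section \<open>Measurability of the occupation time and the hitting time of the process\<close>

lemma joint_measurable_continuous:
  fixes U :: "real \<Rightarrow> 'a \<Rightarrow> real"
  assumes U: "\<And>t. U t \<in> borel_measurable M" and c: "\<And>\<omega>. \<omega> \<in> space M \<Longrightarrow> continuous_on UNIV (\<lambda>t. U t \<omega>)"
  shows "(\<lambda>p. U (snd p) (fst p)) \<in> borel_measurable (M \<Otimes>\<^sub>M borel)"
proof -
  define r where "r n s = real_of_int \<lfloor>real (Suc n) * s\<rfloor> / real (Suc n)" for n :: nat and s :: real
  have rm: "(\<lambda>p. U (r n (snd p)) (fst p)) \<in> borel_measurable (M \<Otimes>\<^sub>M borel)" for n
  proof -
    have "(\<lambda>p. (\<lambda>k p. U (real_of_int k / real (Suc n)) (fst p)) \<lfloor>real (Suc n) * snd p\<rfloor> p) \<in> borel_measurable (M \<Otimes>\<^sub>M borel)"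
    proof (rule measurable_compose_countable[where f="\<lambda>k p. U (real_of_int k / real (Suc n)) (fst p)" and g="\<lambda>p. \<lfloor>real (Suc n) * snd p\<rfloor>"])
      show "(\<lambda>p. U (real_of_int k / real (Suc n)) (fst p)) \<in> borel_measurable (M \<Otimes>\<^sub>M borel)" for k :: int
        using U by (rule measurable_compose[OF measurable_fst])
      show "(\<lambda>p. \<lfloor>real (Suc n) * snd p\<rfloor>) \<in> M \<Otimes>\<^sub>M borel \<rightarrow>\<^sub>M count_space UNIV" by measurable
    qed
    then show ?thesis unfolding r_def .
  qed
  have lim: "(\<lambda>n. r n (snd p)) \<longlonglongrightarrow> snd p" for p :: "'a \<times> real"
  proof (rule real_tendsto_sandwich)
    show "\<forall>\<^sub>F n in sequentially. snd p - 1 / real (Suc n) \<le> r n (snd p)"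
    proof (intro always_eventually allI)
      fix n
      have "real (Suc n) * snd p - 1 \<le> real_of_int \<lfloor>real (Suc n) * snd p\<rfloor>" by linarith
      then have "(real (Suc n) * snd p - 1) / real (Suc n) \<le> r n (snd p)" unfolding r_def by (intro divide_right_mono) simp_all
      then show "snd p - 1 / real (Suc n) \<le> r n (snd p)" by (simp only: diff_divide_distrib) simp
    qed
    show "\<forall>\<^sub>F n in sequentially. r n (snd p) \<le> snd p"
    proof (intro always_eventually allI)
      fix n
      have "real_of_int \<lfloor>real (Suc n) * snd p\<rfloor> \<le> real (Suc n) * snd p" by linarith
      then have "r n (snd p) \<le> (real (Suc n) * snd p) / real (Suc n)" unfolding r_def by (intro divide_right_mono) simp_all
      then show "r n (snd p) \<le> snd p" by simp
    qed
    have "(\<lambda>n. snd p - 1 / real (Suc n)) \<longlonglongrightarrow> snd p - 0" by (intro tendsto_diff tendsto_const LIMSEQ_Suc[OF lim_1_over_n])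
    then show "(\<lambda>n. snd p - 1 / real (Suc n)) \<longlonglongrightarrow> snd p" by simp
  qed simp
  show ?thesis
  proof (rule borel_measurable_LIMSEQ_real[OF _ rm])
    fix p assume "p \<in> space (M \<Otimes>\<^sub>M (borel :: real measure))"
    then have p: "fst p \<in> space M" by (auto simp: space_pair_measure)
    show "(\<lambda>n. U (r n (snd p)) (fst p)) \<longlonglongrightarrow> U (snd p) (fst p)"
      using continuous_on_tendsto_compose[OF c[OF p] lim] by simp
  qed
qed

text \<open>A strict upper bound leaves room for a rational time after the hit, so the existential
  over real times becomes a countable one.\<close>

lemma hit_before_rational:
  fixes f :: "real \<Rightarrow> real"
  assumes f: "\<And>q. q < b \<Longrightarrow> continuous_on {0..q} f"
  shows "(\<exists>t. 0 \<le> t \<and> t < b \<and> f t \<le> 0) \<longleftrightarrow> (\<exists>q\<in>\<rat> \<inter> {0..}. q < b \<and> hit_by q f)"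
proof
  assume "\<exists>t. 0 \<le> t \<and> t < b \<and> f t \<le> 0"
  then obtain t where t: "0 \<le> t" "t < b" "f t \<le> 0" by blast
  obtain q where q: "q \<in> \<rat>" "t < q" "q < b" using Rats_dense_in_real[OF t(2)] by blast
  have "hit_by q f" using hit_by_iff[OF f[OF q(3)]] t q by (meson atLeastAtMost_iff less_imp_le)
  then show "\<exists>q\<in>\<rat> \<inter> {0..}. q < b \<and> hit_by q f" using q t by (intro bexI[of _ q]) simp_all
next
  assume "\<exists>q\<in>\<rat> \<inter> {0..}. q < b \<and> hit_by q f"
  then obtain q where q: "q < b" "hit_by q f" by blast
  then obtain r where "r \<in> {0..q}" "f r \<le> 0" using hit_by_iff[OF f[OF q(1)]] by blast
  then show "\<exists>t. 0 \<le> t \<and> t < b \<and> f t \<le> 0" using q by (intro exI[of _ r]) simp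
qed

lemma clamp_continuous: "continuous_on {0..1} f \<Longrightarrow> continuous_on UNIV (\<lambda>s::real. f (max 0 (min 1 s)))"
  by (rule continuous_on_compose2[of "{0..1}" f]) (auto intro!: continuous_on_max continuous_on_min continuous_on_const continuous_on_id)

lemma halfline_continuous: "continuous_on {0..} f \<Longrightarrow> continuous_on UNIV (\<lambda>s::real. f (max 0 s))"
  by (rule continuous_on_compose2[of "{0..}" f]) (auto intro!: continuous_on_max continuous_on_const continuous_on_id)

lemma halfline_joint_measurable:
  assumes Z: "continuous_process M {0..} Z"
  shows "(\<lambda>p. Z (max 0 (snd p)) (fst p)) \<in> borel_measurable (M \<Otimes>\<^sub>M borel)"
proof (rule joint_measurable_continuous)
  show "Z (max 0 t) \<in> borel_measurable M" for t using Z unfolding continuous_process_def by simp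
  show "continuous_on UNIV (\<lambda>t. Z (max 0 t) \<omega>)" if "\<omega> \<in> space M" for \<omega>
    by (rule halfline_continuous) (use Z that in \<open>simp add: continuous_process_def\<close>)
qed

lemma X_process_occupation_measurable:
  assumes g[measurable]: "g \<in> borel_measurable M" and g0: "\<And>\<omega>. \<omega> \<in> space M \<Longrightarrow> 0 \<le> g \<omega>"
    and b: "continuous_process M {0..1} b" and Z: "continuous_process M {0..} Z"
    and Y: "0 < y \<Longrightarrow> continuous_process M {0..} Y"
  shows "(\<lambda>\<omega>. time_below_zero {0..} (\<lambda>s. X_process y g b Z Y s \<omega>)) \<in> borel_measurable M"
proof -
  define b' where "b' p = b (max 0 (min 1 (snd p))) (fst p)" for p
  define Z' where "Z' p = Z (max 0 (snd p)) (fst p)" for p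
  \<comment> \<open>\<open>Y\<close> is known to be a continuous process only for positive
    \<open>y\<close>. Otherwise its coefficient in \<open>X_process\<close> is 0, and it is replaced
    by 0 here.\<close>
  define Y' where "Y' p = (if 0 < y then Y (max 0 (snd p)) (fst p) else 0)" for p
  have b'm: "b' \<in> borel_measurable (M \<Otimes>\<^sub>M borel)" unfolding b'_def
  proof (rule joint_measurable_continuous)
    show "b (max 0 (min 1 t)) \<in> borel_measurable M" for t using b unfolding continuous_process_def by simp
    show "continuous_on UNIV (\<lambda>t. b (max 0 (min 1 t)) \<omega>)" if "\<omega> \<in> space M" for \<omega>
      by (rule clamp_continuous) (use b that in \<open>simp add: continuous_process_def\<close>)
  qed
  have Z'm: "Z' \<in> borel_measurable (M \<Otimes>\<^sub>M borel)" unfolding Z'_def by (rule halfline_joint_measurable[OF Z])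
  have Y'm[measurable]: "Y' \<in> borel_measurable (M \<Otimes>\<^sub>M borel)"
  proof (cases "0 < y")
    case True
    then show ?thesis unfolding Y'_def using halfline_joint_measurable[OF Y[OF True]] by simp
  next
    case False
    have "Y' = (\<lambda>_. 0)" unfolding Y'_def using False by auto
    then show ?thesis by simp
  qed
  have [measurable]: "(\<lambda>p. b' (fst p, snd p / g (fst p))) \<in> borel_measurable (M \<Otimes>\<^sub>M borel)"
    by (rule measurable_compose[OF _ b'm]) measurable
  have [measurable]: "(\<lambda>p. Z' (fst p, snd p - g (fst p))) \<in> borel_measurable (M \<Otimes>\<^sub>M borel)"
    by (rule measurable_compose[OF _ Z'm]) measurable
  define V where "V p = (if 0 < g (fst p) then (if snd p < g (fst p)
      then sqrt (g (fst p)) * b' (fst p, snd p / g (fst p)) + y - snd p / g (fst p) * y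
      else Z' (fst p, snd p - g (fst p))) else Y' p)" for p
  have [measurable]: "(\<lambda>p. g (fst p)) \<in> borel_measurable (M \<Otimes>\<^sub>M borel)" by (rule measurable_compose[OF measurable_fst g])
  have [measurable]: "V \<in> borel_measurable (M \<Otimes>\<^sub>M borel)" unfolding V_def by measurable
  have V: "X_process y g b Z Y s \<omega> = V (\<omega>, s)" if w: "\<omega> \<in> space M" "0 \<le> s" for s \<omega>
  proof -
    consider "0 < g \<omega>" "s < g \<omega>" | "0 < g \<omega>" "g \<omega> \<le> s" | "g \<omega> = 0" using g0[OF w(1)] by linarith
    then show ?thesis
    proof cases
      case 1
      then have "max 0 (min 1 (s / g \<omega>)) = s / g \<omega>" using that(2) by (simp add: divide_le_eq_1 max_absorb2 min_absorb2)
      then show ?thesis using 1 unfolding X_process_def V_def b'_def scaled_bridge_def by simp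
    next
      case 2 then show ?thesis unfolding X_process_def V_def Z'_def by simp
    next
      case 3 then show ?thesis using that(2) unfolding X_process_def V_def Y'_def by simp
    qed
  qed
  define S where "S = {p\<in>space (M \<Otimes>\<^sub>M borel). 0 \<le> snd p \<and> V p < 0}"
  have "S \<in> sets (M \<Otimes>\<^sub>M borel)" unfolding S_def by measurable
  then have S: "S \<in> sets (M \<Otimes>\<^sub>M lborel)" by (simp cong: sets_pair_measure_cong)
  have "time_below_zero {0..} (\<lambda>s. X_process y g b Z Y s \<omega>) = emeasure lborel (Pair \<omega> -` S)" if w: "\<omega> \<in> space M" for \<omega>
  proof -
    have "time_below_zero {0..} (\<lambda>s. X_process y g b Z Y s \<omega>) = (\<integral>\<^sup>+s. indicator (Pair \<omega> -` S) s \<partial>lborel)"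
      unfolding time_below_zero_def
    proof (rule nn_integral_cong)
      fix s :: real
      have "s \<in> Pair \<omega> -` S \<longleftrightarrow> 0 \<le> s \<and> V (\<omega>, s) < 0" using w unfolding S_def by (auto simp: space_pair_measure)
      then show "of_bool (X_process y g b Z Y s \<omega> < 0) * indicator {0..} s = (indicator (Pair \<omega> -` S) s :: ennreal)"
        using V[OF w, of s] by (cases "0 \<le> s") (simp_all only: indicator_def, auto)
    qed
    then show ?thesis using sets_Pair1[OF S, of \<omega>] by simp
  qed
  then show ?thesis using lborel.measurable_emeasure_Pair[OF S]
    by (subst measurable_cong[where g="\<lambda>\<omega>. emeasure lborel (Pair \<omega> -` S)"]) simp_all
qed

text \<open>Splitting at \<open>g\<close> separates the rescaling of time before \<open>g\<close>
  from the shift of time after it; each piece is continuous and reduces to rational times. In the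
  last case the path is constantly 0.\<close>

lemma X_process_hit_iff:
  assumes \<omega>: "\<omega> \<in> space M" and g0: "0 \<le> g \<omega>"
    and b: "continuous_process M {0..1} b" and Z: "continuous_process M {0..} Z"
    and Y: "0 < y \<longrightarrow> continuous_process M {0..} Y"
  shows "(\<exists>t. 0 \<le> t \<and> t < c \<and> X_process y g b Z Y t \<omega> \<le> 0) \<longleftrightarrow>
    (if 0 < g \<omega> then (\<exists>q\<in>\<rat> \<inter> {0..}. q < min 1 (c / g \<omega>) \<and> hit_by q (unscaled y (g \<omega>) (\<lambda>s. b s \<omega>)))
        \<or> (\<exists>q\<in>\<rat> \<inter> {0..}. q < c - g \<omega> \<and> hit_by q (\<lambda>s. Z s \<omega>))
     else if 0 < y then (\<exists>q\<in>\<rat> \<inter> {0..}. q < c \<and> hit_by q (\<lambda>s. Y s \<omega>)) else 0 < c)"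
proof -
  have h: "(\<exists>t. 0 \<le> t \<and> t < c \<and> U t \<omega> \<le> 0) \<longleftrightarrow> (\<exists>q\<in>\<rat> \<inter> {0..}. q < c \<and> hit_by q (\<lambda>s. U s \<omega>))"
    if U: "continuous_process M {0..} U" for U c
  proof (rule hit_before_rational)
    fix q
    have "continuous_on {0..} (\<lambda>s. U s \<omega>)" using U \<omega> unfolding continuous_process_def by blast
    then show "continuous_on {0..q} (\<lambda>s. U s \<omega>)" by (rule continuous_on_subset) auto
  qed
  consider "0 < g \<omega>" | "g \<omega> = 0" "0 < y" | "g \<omega> = 0" "y \<le> 0" using g0 by linarith
  then show ?thesis
  proof cases
    case 1
    have X1: "X_process y g b Z Y t \<omega> = unscaled y (g \<omega>) (\<lambda>s. b s \<omega>) (t / g \<omega>)" if "t < g \<omega>" for t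
      using 1 that unfolding X_process_def scaled_bridge_unscaled by simp
    have X2: "X_process y g b Z Y t \<omega> = Z (t - g \<omega>) \<omega>" if "g \<omega> \<le> t" for t
      using 1 that unfolding X_process_def by simp
    have "(\<exists>t. 0 \<le> t \<and> t < c \<and> X_process y g b Z Y t \<omega> \<le> 0) \<longleftrightarrow>
      (\<exists>r. 0 \<le> r \<and> r < min 1 (c / g \<omega>) \<and> unscaled y (g \<omega>) (\<lambda>s. b s \<omega>) r \<le> 0) \<or> (\<exists>s. 0 \<le> s \<and> s < c - g \<omega> \<and> Z s \<omega> \<le> 0)"
    proof
      assume "\<exists>t. 0 \<le> t \<and> t < c \<and> X_process y g b Z Y t \<omega> \<le> 0"
      then obtain t where t: "0 \<le> t" "t < c" "X_process y g b Z Y t \<omega> \<le> 0" by blast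
      show "(\<exists>r. 0 \<le> r \<and> r < min 1 (c / g \<omega>) \<and> unscaled y (g \<omega>) (\<lambda>s. b s \<omega>) r \<le> 0) \<or> (\<exists>s. 0 \<le> s \<and> s < c - g \<omega> \<and> Z s \<omega> \<le> 0)"
      proof (cases "t < g \<omega>")
        case True
        then have "0 \<le> t / g \<omega>" "t / g \<omega> < min 1 (c / g \<omega>)" "unscaled y (g \<omega>) (\<lambda>s. b s \<omega>) (t / g \<omega>) \<le> 0"
          using t 1 X1 by (simp_all add: divide_strict_right_mono)
        then show ?thesis by blast
      next
        case False
        then have "0 \<le> t - g \<omega>" "t - g \<omega> < c - g \<omega>" "Z (t - g \<omega>) \<omega> \<le> 0" using t X2 by simp_all
        then show ?thesis by blast
      qed
    next
      assume "(\<exists>r. 0 \<le> r \<and> r < min 1 (c / g \<omega>) \<and> unscaled y (g \<omega>) (\<lambda>s. b s \<omega>) r \<le> 0) \<or> (\<exists>s. 0 \<le> s \<and> s < c - g \<omega> \<and> Z s \<omega> \<le> 0)"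
      then show "\<exists>t. 0 \<le> t \<and> t < c \<and> X_process y g b Z Y t \<omega> \<le> 0"
      proof (elim disjE exE conjE)
        fix r assume r: "0 \<le> r" "r < min 1 (c / g \<omega>)" "unscaled y (g \<omega>) (\<lambda>s. b s \<omega>) r \<le> 0"
        have "r * g \<omega> < g \<omega>" "r * g \<omega> < c" using r(2) 1 by (simp_all add: pos_less_divide_eq)
        then show ?thesis using X1[of "r * g \<omega>"] r 1 by (intro exI[of _ "r * g \<omega>"]) simp
      next
        fix s assume s: "0 \<le> s" "s < c - g \<omega>" "Z s \<omega> \<le> 0"
        then show ?thesis using X2[of "s + g \<omega>"] 1 by (intro exI[of _ "s + g \<omega>"]) simp
      qed
    qed
    moreover have "(\<exists>r. 0 \<le> r \<and> r < min 1 (c / g \<omega>) \<and> unscaled y (g \<omega>) (\<lambda>s. b s \<omega>) r \<le> 0) \<longleftrightarrow>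
      (\<exists>q\<in>\<rat> \<inter> {0..}. q < min 1 (c / g \<omega>) \<and> hit_by q (unscaled y (g \<omega>) (\<lambda>s. b s \<omega>)))"
    proof (rule hit_before_rational)
      fix q assume q: "q < min 1 (c / g \<omega>)"
      have "continuous_on {0..1} (\<lambda>s. b s \<omega>)" using b \<omega> unfolding continuous_process_def by blast
      then show "continuous_on {0..q} (unscaled y (g \<omega>) (\<lambda>s. b s \<omega>))"
        by (rule continuous_on_subset[OF unscaled_continuous]) (use q in auto)
    qed
    ultimately show ?thesis using 1 h[OF Z, of "c - g \<omega>"] by simp
  next
    case 2
    then have "X_process y g b Z Y t \<omega> = Y t \<omega>" for t unfolding X_process_def by simp
    then show ?thesis using 2 h[OF Y[rule_format, OF 2(2)], of c] by simp
  next
    case 3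
    then have "X_process y g b Z Y t \<omega> = 0" for t unfolding X_process_def by simp
    then show ?thesis using 3 by (auto intro: exI[of _ 0])
  qed
qed

text \<open>Measurability is required because the events of the final comparison agree only almost
  surely, and this gives equal probabilities only for measurable sets. Below a finite level the
  event is a countable combination of \<open>hit_by\<close> events; the level \<open>top\<close> is
  a union over the naturals.\<close>

lemma X_process_hitting_time_measurable:
  assumes g[measurable]: "g \<in> borel_measurable M" and g0: "\<And>\<omega>. \<omega> \<in> space M \<Longrightarrow> 0 \<le> g \<omega>"
    and b: "continuous_process M {0..1} b" and Z: "continuous_process M {0..} Z"
    and Y: "0 < y \<Longrightarrow> continuous_process M {0..} Y"
  shows "(\<lambda>\<omega>. hitting_time (\<lambda>s. X_process y g b Z Y s \<omega>)) \<in> borel_measurable M"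
proof (rule borel_measurableI_less)
  define \<tau> where "\<tau> \<omega> = hitting_time (\<lambda>s. X_process y g b Z Y s \<omega>)" for \<omega>
  have cr: "countable (\<rat> \<inter> {0::real..})" using countable_rat by (rule countable_Int1)
  have hm: "{\<omega>\<in>space M. q < f \<omega> \<and> hit_by q (\<lambda>s. U s \<omega>)} \<in> sets M"
    if U: "continuous_process M {0..} U" and f[measurable]: "f \<in> borel_measurable M" for U f and q :: real
  proof -
    have [measurable]: "Measurable.pred M (\<lambda>\<omega>. hit_by q (\<lambda>s. U s \<omega>))"
      by (rule hit_by_measurable[OF order_refl]) (use U in \<open>simp add: continuous_process_def\<close>)
    show ?thesis by measurable
  qed
  have bm: "{\<omega>\<in>space M. q < min 1 (c / g \<omega>) \<and> hit_by q (unscaled y (g \<omega>) (\<lambda>s. b s \<omega>))} \<in> sets M" for q c :: real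
  proof (cases "q \<le> 1")
    case True
    have [measurable]: "Measurable.pred M (\<lambda>\<omega>. hit_by q (unscaled y (g \<omega>) (\<lambda>s. b s \<omega>)))"
    proof (rule hit_by_measurable[OF True])
      fix r :: real assume "r \<in> {0..1}"
      then have [measurable]: "b r \<in> borel_measurable M" using b unfolding continuous_process_def by blast
      show "(\<lambda>\<omega>. unscaled y (g \<omega>) (\<lambda>s. b s \<omega>) r) \<in> borel_measurable M" unfolding unscaled_def by measurable
    qed
    show ?thesis by measurable
  next
    case False
    then have "{\<omega>\<in>space M. q < min 1 (c / g \<omega>) \<and> hit_by q (unscaled y (g \<omega>) (\<lambda>s. b s \<omega>))} = {}" by auto
    then show ?thesis by (simp only: sets.empty_sets)
  qed
  have Y': "0 < y \<longrightarrow> continuous_process M {0..} Y" using Y by blast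
  have less: "{\<omega>\<in>space M. \<tau> \<omega> < ennreal c} \<in> sets M" if c: "0 \<le> c" for c
  proof -
    have t: "\<tau> \<omega> < ennreal c \<longleftrightarrow> (\<exists>t. 0 \<le> t \<and> t < c \<and> X_process y g b Z Y t \<omega> \<le> 0)" for \<omega>
    proof -
      have "\<tau> \<omega> < ennreal c \<longleftrightarrow> (\<exists>e\<in>{ennreal t |t. 0 \<le> t \<and> X_process y g b Z Y t \<omega> \<le> 0}. e < ennreal c)"
        unfolding \<tau>_def hitting_time_def by (rule Inf_less_iff)
      also have "\<dots> \<longleftrightarrow> (\<exists>t. 0 \<le> t \<and> X_process y g b Z Y t \<omega> \<le> 0 \<and> ennreal t < ennreal c)" by blast
      also have "\<dots> \<longleftrightarrow> (\<exists>t. 0 \<le> t \<and> t < c \<and> X_process y g b Z Y t \<omega> \<le> 0)"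
        by (rule ex_cong1) (metis ennreal_less_iff)
      finally show ?thesis .
    qed
    define A1 where "A1 = {\<omega>\<in>space M. \<exists>q\<in>\<rat> \<inter> {0..}. q < min 1 (c / g \<omega>) \<and> hit_by q (unscaled y (g \<omega>) (\<lambda>s. b s \<omega>))}"
    define A2 where "A2 = {\<omega>\<in>space M. \<exists>q\<in>\<rat> \<inter> {0..}. q < c - g \<omega> \<and> hit_by q (\<lambda>s. Z s \<omega>)}"
    define A3 where "A3 = {\<omega>\<in>space M. if 0 < y then (\<exists>q\<in>\<rat> \<inter> {0..}. q < c \<and> hit_by q (\<lambda>s. Y s \<omega>)) else 0 < c}"
    have [measurable]: "A1 \<in> sets M" unfolding A1_def by (rule sets.sets_Collect_countable_Ex'[OF bm cr])
    have [measurable]: "A2 \<in> sets M" unfolding A2_def by (rule sets.sets_Collect_countable_Ex'[OF hm cr]) (use Z in measurable)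
    have [measurable]: "A3 \<in> sets M"
    proof (cases "0 < y")
      case True
      have "{\<omega>\<in>space M. \<exists>q\<in>\<rat> \<inter> {0..}. q < c \<and> hit_by q (\<lambda>s. Y s \<omega>)} \<in> sets M"
        by (rule sets.sets_Collect_countable_Ex'[OF hm[OF Y[OF True]] cr]) measurable
      then show ?thesis using True unfolding A3_def by simp
    next
      case False
      then show ?thesis unfolding A3_def by simp
    qed
    have "{\<omega>\<in>space M. \<tau> \<omega> < ennreal c} = {\<omega>\<in>space M. if 0 < g \<omega> then \<omega> \<in> A1 \<or> \<omega> \<in> A2 else \<omega> \<in> A3}"
    proof (rule Collect_cong, rule conj_cong[OF refl])
      fix \<omega> assume w: "\<omega> \<in> space M"
      show "\<tau> \<omega> < ennreal c \<longleftrightarrow> (if 0 < g \<omega> then \<omega> \<in> A1 \<or> \<omega> \<in> A2 else \<omega> \<in> A3)"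
        unfolding t X_process_hit_iff[where \<omega>=\<omega> and M=M and g=g and b=b and Z=Z and y=y and Y=Y and c=c, OF w g0[OF w] b Z Y'] A1_def A2_def A3_def mem_Collect_eq using w by argo
    qed
    also have "\<dots> \<in> sets M" by measurable
    finally show ?thesis .
  qed
  fix a :: ennreal
  show "{\<omega>\<in>space M. hitting_time (\<lambda>s. X_process y g b Z Y s \<omega>) < a} \<in> sets M"
  proof (cases a)
    case (real c)
    then show ?thesis using less[of c] unfolding \<tau>_def by simp
  next
    case top
    have "\<tau> \<omega> < a \<longleftrightarrow> (\<exists>n::nat. \<tau> \<omega> < ennreal (real n))" for \<omega>
    proof
      assume "\<tau> \<omega> < a"
      then show "\<exists>n::nat. \<tau> \<omega> < ennreal (real n)" using ennreal_Ex_less_of_nat[of "\<tau> \<omega>"] top by (simp add: ennreal_of_nat_eq_real_of_nat)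
    next
      assume "\<exists>n::nat. \<tau> \<omega> < ennreal (real n)"
      then obtain n :: nat where n: "\<tau> \<omega> < ennreal (real n)" by blast
      have "ennreal (real n) < top" by simp
      then show "\<tau> \<omega> < a" unfolding top using n by (rule order.strict_trans[rotated])
    qed
    then have "{\<omega>\<in>space M. \<tau> \<omega> < a} = (\<Union>n::nat. {\<omega>\<in>space M. \<tau> \<omega> < ennreal (real n)})" by blast
    also have "\<dots> \<in> sets M"
    proof (rule sets.countable_UN)
      have "{\<omega>\<in>space M. \<tau> \<omega> < ennreal (real n)} \<in> sets M" for n by (rule less) simp
      then show "range (\<lambda>n. {\<omega>\<in>space M. \<tau> \<omega> < ennreal (real n)}) \<subseteq> sets M" by blast
    qed
    finally show ?thesis unfolding \<tau>_def .
  qed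
qed

text \<open>Restriction to positive values removes a possible atom of \<open>g\<close> at 0; beyond
  that, half-lines generate the Borel sets.\<close>

lemma density_of_cdf:
  fixes g :: "'a \<Rightarrow> real" and D :: "real \<Rightarrow> ennreal"
  assumes P: "prob_space P" and g[measurable]: "g \<in> borel_measurable P" and D[measurable]: "D \<in> borel_measurable borel"
    and cdf: "\<And>x. 0 \<le> x \<Longrightarrow> emeasure P {\<omega>\<in>space P. 0 < g \<omega> \<and> g \<omega> \<le> x} = (\<integral>\<^sup>+t. D t * indicator {0<..x} t \<partial>lborel)"
  shows "density (distr P borel g) (indicator {0<..}) = density lborel (\<lambda>x. indicator {0<..} x * D x)"
proof -
  interpret P: prob_space P by fact
  have e1: "emeasure (density (distr P borel g) (indicator {0<..})) {..a} = emeasure P {\<omega>\<in>space P. 0 < g \<omega> \<and> g \<omega> \<le> a}" for a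
  proof -
    have "emeasure (density (distr P borel g) (indicator {0<..})) {..a} = (\<integral>\<^sup>+x. indicator {0<..} x * indicator {..a} x \<partial>distr P borel g)"
      by (rule emeasure_density) simp_all
    also have "\<dots> = (\<integral>\<^sup>+x. indicator {0<..a} x \<partial>distr P borel g)" by (rule nn_integral_cong) (auto simp: indicator_def)
    also have "\<dots> = emeasure (distr P borel g) {0<..a}" by simp
    also have "\<dots> = emeasure P (g -` {0<..a} \<inter> space P)" by (rule emeasure_distr) simp_all
    also have "g -` {0<..a} \<inter> space P = {\<omega>\<in>space P. 0 < g \<omega> \<and> g \<omega> \<le> a}" by auto
    finally show ?thesis .
  qed
  have e2: "emeasure (density lborel (\<lambda>x. indicator {0<..} x * D x)) {..a} = (\<integral>\<^sup>+t. D t * indicator {0<..a} t \<partial>lborel)" for a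
  proof -
    have "emeasure (density lborel (\<lambda>x. indicator {0<..} x * D x)) {..a} = (\<integral>\<^sup>+t. (indicator {0<..} t * D t) * indicator {..a} t \<partial>lborel)"
      by (rule emeasure_density) simp_all
    also have "\<dots> = (\<integral>\<^sup>+t. D t * indicator {0<..a} t \<partial>lborel)" by (rule nn_integral_cong) (auto simp: indicator_def)
    finally show ?thesis .
  qed
  show ?thesis
  proof (rule measure_eqI_generator_eq[where E="range atMost" and \<Omega>=UNIV and A="\<lambda>n. {..real n}"])
    show "Int_stable (range atMost :: real set set)" by (auto simp: Int_stable_def)
    show "sets (density (distr P borel g) (indicator {0<..})) = sigma_sets UNIV (range atMost)"
      "sets (density lborel (\<lambda>x. indicator {0<..} x * D x)) = sigma_sets UNIV (range atMost)"
      by (simp_all add: borel_eq_atMost)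
    show "(\<Union>n. {..real n}) = UNIV" using real_arch_simple by auto
    show "emeasure (density (distr P borel g) (indicator {0<..})) {..real n} \<noteq> \<infinity>" for n unfolding e1 by simp
    fix X :: "real set" assume "X \<in> range atMost"
    then obtain a where a: "X = {..a}" by blast
    show "emeasure (density (distr P borel g) (indicator {0<..})) X = emeasure (density lborel (\<lambda>x. indicator {0<..} x * D x)) X"
    proof (cases "0 \<le> a")
      case True
      then show ?thesis unfolding a e1 e2 by (rule cdf)
    next
      case False
      then have A: "{\<omega>\<in>space P. 0 < g \<omega> \<and> g \<omega> \<le> a} = {}" and B: "{0<..a} = {}" by auto
      show ?thesis unfolding a e1 e2 A B by simp
    qed
  qed auto
qed

section \<open>The density of g on the positive half-line\<close>

context bridge_space
begin

lemma occupation_event_small: "0 \<le> x \<Longrightarrow> x \<le> 1 \<Longrightarrow> occupation_event y x = space M"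
  unfolding occupation_event_def using path_occupation_le[of x y] order_trans by fastforce

lemma occupation_event_zero:
  assumes x: "1 < x"
  shows "emeasure M (occupation_event 0 x) = ennreal (1 / x)"
proof -
  have sx: "0 < sqrt x" using x by simp
  have "occupation_event 0 x = {\<omega>\<in>space M. below (\<lambda>s. \<beta> s \<omega>) \<le> 1 / x}"
    unfolding occupation_event_def
  proof (rule Collect_cong, rule conj_cong[OF refl])
    fix \<omega> assume w: "\<omega> \<in> space M"
    have "unscaled 0 x (regularize (bpath \<omega>)) r = sqrt x * \<beta> r \<omega>" if "r \<in> {0..1}" for r
      unfolding unscaled_def regularize_bpath[OF w that] by simp
    then have "below (unscaled 0 x (regularize (bpath \<omega>))) = below (\<lambda>s. \<beta> s \<omega>)"
      by (rule trans[OF below_cong below_scale[OF sx]])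
    then show "path_occupation 0 x (bpath \<omega>) \<le> 1 \<longleftrightarrow> below (\<lambda>s. \<beta> s \<omega>) \<le> 1 / x"
      unfolding path_occupation_def using x by (simp add: pos_le_divide_eq mult.commute)
  qed
  then show ?thesis using below_bridge_uniform'[of "1 / x"] x by (simp add: emeasure_eq_measure)
qed

text \<open>The joint law is expressed with nonnegative integrals. Comparison with
  \<open>1 / sqrt t\<close> shows integrability, without which the Lebesgue integral occurring in
  \<open>g_cdf\<close> would be 0 by convention.\<close>

lemma occupation_integral:
  assumes q: "\<And>t. 0 < t \<Longrightarrow> q t = prob (occupation_event y t)" and x: "0 \<le> x"
  shows "ennreal (LBINT t:{0<..x}. q t * (1 / sqrt t) * exp (- (y\<^sup>2 / (2 * t)))) =
      (\<integral>\<^sup>+t. (ennreal (weight y t) * emeasure M (occupation_event y t)) * indicator {0<..x} t \<partial>lborel)"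
    and "0 \<le> (LBINT t:{0<..x}. q t * (1 / sqrt t) * exp (- (y\<^sup>2 / (2 * t))))"
proof -
  define f where "f t = indicator {0<..x} t * (weight y t * prob (occupation_event y t))" for t
  have [measurable]: "(\<lambda>t. prob (occupation_event y t)) \<in> borel_measurable borel"
    unfolding measure_def using occupation_event_emeasure_measurable by measurable
  have fm: "f \<in> borel_measurable lborel" unfolding f_def by measurable
  have f0: "0 \<le> f t" for t unfolding f_def using weight_nonneg[of t y] by (simp add: indicator_def)
  have "(\<integral>\<^sup>+t. ennreal (f t) \<partial>lborel) \<le> (\<integral>\<^sup>+t. ennreal (1 / sqrt t) * indicator {0<..<x + 1} t \<partial>lborel)"
  proof (rule nn_integral_mono)
    fix t :: real
    show "ennreal (f t) \<le> ennreal (1 / sqrt t) * indicator {0<..<x + 1} t"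
    proof (cases "t \<in> {0<..x}")
      case True
      have "weight y t \<le> 1 / sqrt t" unfolding weight_def using True by (intro divide_right_mono) simp_all
      then have "weight y t * prob (occupation_event y t) \<le> 1 / sqrt t * 1"
        using True by (intro mult_mono) simp_all
      then show ?thesis using True by (simp add: f_def ennreal_leI)
    qed (simp add: f_def)
  qed
  also have "\<dots> = ennreal (2 * sqrt (x + 1))" by (rule nn_integral_inverse_sqrt) (use x in simp)
  also have "\<dots> < \<infinity>" by simp
  finally have int: "integrable lborel f" by (intro integrableI_nonneg fm) (use f0 in simp_all)
  have e: "(LBINT t:{0<..x}. q t * (1 / sqrt t) * exp (- (y\<^sup>2 / (2 * t)))) = integral\<^sup>L lborel f"
    unfolding set_lebesgue_integral_def
    by (rule Bochner_Integration.integral_cong[OF refl]) (use q in \<open>simp add: f_def weight_def indicator_def\<close>)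
  show "0 \<le> (LBINT t:{0<..x}. q t * (1 / sqrt t) * exp (- (y\<^sup>2 / (2 * t))))" unfolding e using f0 by simp
  have "ennreal (integral\<^sup>L lborel f) = (\<integral>\<^sup>+t. ennreal (f t) \<partial>lborel)"
    by (rule nn_integral_eq_integral[OF int, symmetric]) (use f0 in simp)
  also have "\<dots> = (\<integral>\<^sup>+t. (ennreal (weight y t) * emeasure M (occupation_event y t)) * indicator {0<..x} t \<partial>lborel)"
    by (rule nn_integral_cong) (use weight_nonneg[of _ y] in \<open>simp add: f_def indicator_def emeasure_eq_measure ennreal_mult\<close>)
  finally show "ennreal (LBINT t:{0<..x}. q t * (1 / sqrt t) * exp (- (y\<^sup>2 / (2 * t)))) =
      (\<integral>\<^sup>+t. (ennreal (weight y t) * emeasure M (occupation_event y t)) * indicator {0<..x} t \<partial>lborel)" unfolding e .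
qed

text \<open>Up to time 1 the conditioning is void, and beyond it the uniform law contributes the
  factor \<open>1 / t\<close>. The total mass 4 consists of 2 from [0, 1] and 2 from the
  tail.\<close>

lemma occupation_integral_zero:
  assumes x: "0 \<le> x"
  shows "(\<integral>\<^sup>+t. (ennreal (weight 0 t) * emeasure M (occupation_event 0 t)) * indicator {0<..x} t \<partial>lborel) =
    ennreal (4 * (of_bool (x \<le> 1) * (sqrt x / 2) + of_bool (x > 1) * (1 - 1 / (2 * sqrt x))))"
proof -
  have w: "weight 0 t = 1 / sqrt t" for t unfolding weight_def by simp
  have h1: "ennreal (weight 0 t) * emeasure M (occupation_event 0 t) = ennreal (1 / sqrt t)" if "0 \<le> t" "t \<le> 1" for t
    unfolding w occupation_event_small[OF that] by (simp add: emeasure_space_1)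
  have h2: "ennreal (weight 0 t) * emeasure M (occupation_event 0 t) = ennreal (1 / (t * sqrt t))" if "1 < t" for t
    unfolding w occupation_event_zero[OF that] using that by (simp add: ennreal_mult[symmetric] mult.commute)
  consider "x = 0" | "0 < x" "x \<le> 1" | "1 < x" using x by linarith
  then show ?thesis
  proof cases
    case 1 then show ?thesis by simp
  next
    case 2
    have "(\<integral>\<^sup>+t. (ennreal (weight 0 t) * emeasure M (occupation_event 0 t)) * indicator {0<..x} t \<partial>lborel) =
      (\<integral>\<^sup>+t. ennreal (1 / sqrt t) * indicator {0<..<x} t \<partial>lborel)"
    proof (rule nn_integral_cong_AE)
      have "AE t in lborel. t \<noteq> x" by (rule AE_lborel_singleton)
      then show "AE t in lborel. (ennreal (weight 0 t) * emeasure M (occupation_event 0 t)) * indicator {0<..x} t = ennreal (1 / sqrt t) * indicator {0<..<x} t"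
      proof eventually_elim
        case (elim t)
        consider "t \<le> 0" | "0 < t" "t < x" | "x < t" using elim by linarith
        then show ?case
        proof cases
          case 1 then show ?thesis by simp
        next
          case 2 then show ?thesis using h1[of t] \<open>x \<le> 1\<close> by simp
        next
          case 3 then show ?thesis by simp
        qed
      qed
    qed
    also have "\<dots> = ennreal (2 * sqrt x)" by (rule nn_integral_inverse_sqrt[OF 2(1)])
    finally show ?thesis using 2 by simp
  next
    case 3
    have "(\<integral>\<^sup>+t. (ennreal (weight 0 t) * emeasure M (occupation_event 0 t)) * indicator {0<..x} t \<partial>lborel) =
      (\<integral>\<^sup>+t. ennreal (1 / sqrt t) * indicator {0<..<1} t + ennreal (1 / (t * sqrt t)) * indicator {1<..<x} t \<partial>lborel)"
    proof (rule nn_integral_cong_AE)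
      have "AE t in lborel. t \<noteq> x" "AE t in lborel. t \<noteq> (1::real)" by (rule AE_lborel_singleton)+
      then show "AE t in lborel. (ennreal (weight 0 t) * emeasure M (occupation_event 0 t)) * indicator {0<..x} t =
        ennreal (1 / sqrt t) * indicator {0<..<1} t + ennreal (1 / (t * sqrt t)) * indicator {1<..<x} t"
      proof eventually_elim
        case (elim t)
        consider "t \<le> 0" | "0 < t" "t < 1" | "1 < t" "t < x" | "x < t" using elim by linarith
        then show ?case
        proof cases
          case 1 then show ?thesis using 3 by simp
        next
          case 2 then show ?thesis using h1[of t] 3 by simp
        next
          case 3 then show ?thesis using h2[of t] by simp
        next
          case 4 then show ?thesis using 3 by simp
        qed
      qed
    qed
    also have "\<dots> = (\<integral>\<^sup>+t. ennreal (1 / sqrt t) * indicator {0<..<1} t \<partial>lborel) + (\<integral>\<^sup>+t. ennreal (1 / (t * sqrt t)) * indicator {1<..<x} t \<partial>lborel)"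
      by (rule nn_integral_add) measurable
    also have "(\<integral>\<^sup>+t. ennreal (1 / sqrt t) * indicator {0<..<1} t \<partial>lborel) = ennreal (2 * sqrt 1)"
      by (rule nn_integral_inverse_sqrt) simp
    also have "(\<integral>\<^sup>+t. ennreal (1 / (t * sqrt t)) * indicator {1<..<x} t \<partial>lborel) = ennreal (- 2 / sqrt x - (- 2 / sqrt 1))"
    proof (rule nn_integral_FTC_open[OF 3])
      fix t :: real assume t: "1 < t"
      show "DERIV (\<lambda>t. - 2 / sqrt t) t :> 1 / (t * sqrt t)"
        using t by (auto intro!: derivative_eq_intros simp: field_simps)
      show "isCont (\<lambda>t. 1 / (t * sqrt t)) t"
        by (intro isCont_divide isCont_mult isCont_real_sqrt continuous_const continuous_ident) (use t in simp)
      show "0 \<le> 1 / (t * sqrt t)" using t by simp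
    next
      have c: "isCont (\<lambda>t. - 2 / sqrt t) s" if "0 < s" for s :: real
        by (intro isCont_divide isCont_real_sqrt continuous_const continuous_ident) (use that in simp)
      have c1: "((\<lambda>t. - 2 / sqrt t) \<longlongrightarrow> - 2 / sqrt 1) (at (1::real))" using c[of 1] unfolding isCont_def by simp
      have cx: "((\<lambda>t. - 2 / sqrt t) \<longlongrightarrow> - 2 / sqrt x) (at x)" using c[of x] 3 unfolding isCont_def by simp
      show "((\<lambda>t. - 2 / sqrt t) \<longlongrightarrow> - 2 / sqrt 1) (at_right (1::real))" by (rule filterlim_mono[OF c1 order_refl at_le]) simp
      show "((\<lambda>t. - 2 / sqrt t) \<longlongrightarrow> - 2 / sqrt x) (at_left x)" by (rule filterlim_mono[OF cx order_refl at_le]) simp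
    qed
    also have "ennreal (2 * sqrt 1) + ennreal (- 2 / sqrt x - (- 2 / sqrt 1)) = ennreal (4 - 2 / sqrt x)"
      using 3 by (subst ennreal_plus[symmetric]) (simp_all add: divide_le_eq)
    finally show ?thesis using 3 by simp
  qed
qed

text \<open>Only increments of \<open>g_cdf\<close> from 0 enter, so the atom at 0 for positive
  \<open>y\<close> drops out. The constant \<open>c\<close> is the denominator of
  \<open>g_cdf\<close>, or 4 when \<open>y = 0\<close>.\<close>

lemma density_of_g:
  fixes P :: "'b measure" and g :: "'b \<Rightarrow> real"
  assumes P: "prob_space P" and g[measurable]: "g \<in> borel_measurable P"
    and q: "\<And>t. 0 < t \<Longrightarrow> q t 1 = prob (occupation_event y t)"
    and cdf: "\<And>x. 0 \<le> x \<Longrightarrow> measure P {\<omega>\<in>space P. g \<omega> \<le> x} = g_cdf q y x"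
  shows "\<exists>c>0. density (distr P borel g) (indicator {0<..}) =
      density lborel (\<lambda>x. indicator {0<..} x * (ennreal (weight y x / c) * emeasure M (occupation_event y x)))"
proof -
  interpret P: prob_space P by fact
  define I where "I x = (LBINT t:{0<..x}. q t 1 * (1 / sqrt t) * exp (- (y\<^sup>2 / (2 * t))))" for x
  define L where "L x = (\<integral>\<^sup>+t. (ennreal (weight y t) * emeasure M (occupation_event y t)) * indicator {0<..x} t \<partial>lborel)" for x
  have IL: "ennreal (I x) = L x" "0 \<le> I x" if "0 \<le> x" for x
    using occupation_integral[of "\<lambda>t. q t 1", OF q that] unfolding I_def L_def by simp_all
  have I0: "I 0 = 0" unfolding I_def set_lebesgue_integral_def by simp
  have main: "density (distr P borel g) (indicator {0<..}) =
      density lborel (\<lambda>x. indicator {0<..} x * (ennreal (weight y x / c) * emeasure M (occupation_event y x)))"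
    if c: "0 < c" and Lc: "\<And>x. 0 \<le> x \<Longrightarrow> L x = ennreal (c * (g_cdf q y x - g_cdf q y 0))" for c
  proof (rule density_of_cdf[OF P g])
    show "(\<lambda>x. ennreal (weight y x / c) * emeasure M (occupation_event y x)) \<in> borel_measurable borel"
      using occupation_event_emeasure_measurable[of y] by measurable
    fix x :: real assume x: "0 \<le> x"
    have "{\<omega>\<in>space P. 0 < g \<omega> \<and> g \<omega> \<le> x} = {\<omega>\<in>space P. g \<omega> \<le> x} - {\<omega>\<in>space P. g \<omega> \<le> 0}" by auto
    moreover have "P.prob ({\<omega>\<in>space P. g \<omega> \<le> x} - {\<omega>\<in>space P. g \<omega> \<le> 0}) = P.prob {\<omega>\<in>space P. g \<omega> \<le> x} - P.prob {\<omega>\<in>space P. g \<omega> \<le> 0}"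
    proof (rule P.finite_measure_Diff)
      show "{\<omega>\<in>space P. g \<omega> \<le> 0} \<subseteq> {\<omega>\<in>space P. g \<omega> \<le> x}" using x by auto
    qed measurable
    ultimately have e: "emeasure P {\<omega>\<in>space P. 0 < g \<omega> \<and> g \<omega> \<le> x} = ennreal (g_cdf q y x - g_cdf q y 0)"
      using cdf[OF x] cdf[OF order_refl] by (simp add: P.emeasure_eq_measure)
    have "(\<integral>\<^sup>+t. (ennreal (weight y t / c) * emeasure M (occupation_event y t)) * indicator {0<..x} t \<partial>lborel) =
      (\<integral>\<^sup>+t. ennreal (1 / c) * ((ennreal (weight y t) * emeasure M (occupation_event y t)) * indicator {0<..x} t) \<partial>lborel)"
    proof (rule nn_integral_cong)
      fix t :: real
      show "(ennreal (weight y t / c) * emeasure M (occupation_event y t)) * indicator {0<..x} t =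
        ennreal (1 / c) * ((ennreal (weight y t) * emeasure M (occupation_event y t)) * indicator {0<..x} t)"
      proof (cases "t \<in> {0<..x}")
        case True
        have "ennreal (weight y t / c) = ennreal (1 / c * weight y t)" by simp
        also have "\<dots> = ennreal (1 / c) * ennreal (weight y t)" by (rule ennreal_mult) (use c weight_nonneg[of t y] True in simp_all)
        finally show ?thesis by (simp only: mult.assoc)
      qed simp
    qed
    also have "\<dots> = ennreal (1 / c) * L x"
      unfolding L_def by (rule nn_integral_cmult) (use occupation_event_emeasure_measurable[of y] in measurable)
    also have "\<dots> = ennreal (g_cdf q y x - g_cdf q y 0)"
    proof -
      have "0 \<le> g_cdf q y x - g_cdf q y 0"
      proof -
        have "P.prob {\<omega>\<in>space P. g \<omega> \<le> 0} \<le> P.prob {\<omega>\<in>space P. g \<omega> \<le> x}"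
          by (rule P.finite_measure_mono) (use x in auto)
        then show ?thesis using cdf[OF x] cdf[OF order_refl] by simp
      qed
      then show ?thesis unfolding Lc[OF x] using c by (simp add: ennreal_mult[symmetric])
    qed
    finally show "emeasure P {\<omega>\<in>space P. 0 < g \<omega> \<and> g \<omega> \<le> x} =
      (\<integral>\<^sup>+t. (ennreal (weight y t / c) * emeasure M (occupation_event y t)) * indicator {0<..x} t \<partial>lborel)" unfolding e by simp
  qed
  consider "y = 0" | "y < 0" | "0 < y" by linarith
  then show ?thesis
  proof cases
    case 1
    have "L x = ennreal (4 * (g_cdf q y x - g_cdf q y 0))" if "0 \<le> x" for x
      using occupation_integral_zero[OF that] unfolding L_def g_cdf_def 1 by simp
    then show ?thesis using main[of 4] by (intro exI[of _ 4]) simp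
  next
    case 2
    define J where "J = (LBINT t:{0<..1}. (1 / sqrt t) * exp (- (y\<^sup>2 / (2 * t))))"
    \<comment> \<open>On (0, 1] the conditioning event is certain, so the factor \<open>q\<close>
      equals 1.\<close>
    have J: "I 1 = J"
      unfolding I_def J_def set_lebesgue_integral_def
      by (rule Bochner_Integration.integral_cong[OF refl])
         (use q occupation_event_small[of _ y] in \<open>simp add: indicator_def prob_space\<close>)
    \<comment> \<open>The interval [1/2, 1], on which the weight is at least
      \<open>exp (- y\<^sup>2)\<close>, supplies the lower bound needed for dividing by
      \<open>2 * J\<close>.\<close>
    have "0 < J"
    proof -
      have "ennreal (exp (- y\<^sup>2) * (1 / 2)) = ennreal (exp (- y\<^sup>2)) * ennreal (1 / 2)" by (rule ennreal_mult) simp_all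
      also have "\<dots> = (\<integral>\<^sup>+t. ennreal (exp (- y\<^sup>2)) * indicator {1/2..1::real} t \<partial>lborel)"
        by (subst nn_integral_cmult_indicator) simp_all
      also have "\<dots> \<le> L 1" unfolding L_def
      proof (rule nn_integral_mono)
        fix t :: real
        show "ennreal (exp (- y\<^sup>2)) * indicator {1/2..1} t \<le> (ennreal (weight y t) * emeasure M (occupation_event y t)) * indicator {0<..1} t"
        proof (cases "t \<in> {1/2..1}")
          case True
          then have t: "0 < t" "1 \<le> 2 * t" "t \<le> 1" by auto
          have "y\<^sup>2 / (2 * t) \<le> y\<^sup>2 / 1" using t by (intro divide_left_mono) simp_all
          then have "exp (- y\<^sup>2) \<le> exp (- (y\<^sup>2 / (2 * t)))" by simp
          also have "\<dots> \<le> weight y t" unfolding weight_def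
          proof -
            have "exp (- (y\<^sup>2 / (2 * t))) / 1 \<le> exp (- (y\<^sup>2 / (2 * t))) / sqrt t"
              by (rule divide_left_mono) (use t in simp_all)
            then show "exp (- (y\<^sup>2 / (2 * t))) \<le> exp (- (y\<^sup>2 / (2 * t))) / sqrt t" by simp
          qed
          finally have "ennreal (exp (- y\<^sup>2)) \<le> ennreal (weight y t)" by (rule ennreal_leI)
          then show ?thesis using True t occupation_event_small[of t y] by (simp add: emeasure_space_1)
        qed simp
      qed
      also have "\<dots> = ennreal J" using IL(1)[of 1] J by simp
      finally have "ennreal (exp (- y\<^sup>2) * (1 / 2)) \<le> ennreal J" .
      moreover have "0 < ennreal (exp (- y\<^sup>2) * (1 / 2))" by simp
      ultimately have "0 < ennreal J" by (rule order.strict_trans2[rotated])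
      then show ?thesis by simp
    qed
    moreover have "g_cdf q y x = I x / (2 * J)" for x unfolding g_cdf_def I_def J_def using 2 by simp
    ultimately have "0 < 2 * J" "\<And>x. 0 \<le> x \<Longrightarrow> L x = ennreal (2 * J * (g_cdf q y x - g_cdf q y 0))"
      using IL I0 by simp_all
    then show ?thesis using main[of "2 * J"] by blast
  next
    case 3
    define a where "a = 2 * sqrt (2 * pi) * y"
    have a: "0 < a + 4" unfolding a_def using 3 by (intro add_nonneg_pos) simp_all
    have "g_cdf q y x = (a + I x) / (a + 4)" for x unfolding g_cdf_def I_def a_def using 3 by simp
    then have "\<And>x. 0 \<le> x \<Longrightarrow> L x = ennreal ((a + 4) * (g_cdf q y x - g_cdf q y 0))"
      using IL I0 a by (simp add: diff_divide_distrib[symmetric])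
    then show ?thesis using main[OF a] a by blast
  qed
qed

end

lemma g_cdf_zero: "y \<le> 0 \<Longrightarrow> g_cdf q y 0 = 0"
  unfolding g_cdf_def set_lebesgue_integral_def by simp

section \<open>The identity for the constructed process\<close>

theorem proposition3:
  fixes y :: real
    and N :: "real \<Rightarrow> 'n measure" and B :: "real \<Rightarrow> real \<Rightarrow> 'n \<Rightarrow> real"
    and N0 :: "'s measure" and \<beta> :: "real \<Rightarrow> 's \<Rightarrow> real"
    and M :: "'a measure" and g :: "'a \<Rightarrow> real" and b Z Y :: "real \<Rightarrow> 'a \<Rightarrow> real"
    and q :: "real \<Rightarrow> real \<Rightarrow> real" and X :: "real \<Rightarrow> 'a \<Rightarrow> real"
    and \<Gamma> \<tau> :: "'a \<Rightarrow> ennreal" and u :: real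
  assumes bridges: "\<And>t. t > 0 \<Longrightarrow> brownian_bridge (N t) t y 0 (B t)"
    and q_def: "q = bridge_occupation_cdf N B"
    and standard_bridge: "brownian_bridge N0 1 0 0 \<beta>"
    and M: "prob_space M"
    and g_measurable: "g \<in> borel_measurable M"
    and g_nonneg: "\<And>\<omega>. \<omega> \<in> space M \<Longrightarrow> g \<omega> \<ge> 0"
    and g_distribution: "\<And>x. x \<ge> 0 \<Longrightarrow> \<P>(\<omega> in M. g \<omega> \<le> x) = g_cdf q y x"
    and b_continuous: "continuous_process M {0..1} b"
    and b_law: "has_conditional_law M borel g (path_space {0..1}) (path_of {0..1} b)
                  (conditioned_bridge_law N0 \<beta> y)"
    and Z_bessel: "bessel3 M 0 Z"
    and Z_indep: "independent_rvs M
                    (borel \<Otimes>\<^sub>M path_space {0..1}) (\<lambda>\<omega>. (g \<omega>, path_of {0..1} b \<omega>))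
                    (path_space {0..}) (path_of {0..} Z)"
    and Y_bessel: "y > 0 \<Longrightarrow> bessel3 M y Y"
    and Y_indep: "y > 0 \<Longrightarrow> independent_rvs M
                    (borel \<Otimes>\<^sub>M path_space {0..1} \<Otimes>\<^sub>M path_space {0..})
                    (\<lambda>\<omega>. (g \<omega>, path_of {0..1} b \<omega>, path_of {0..} Z \<omega>))
                    (path_space {0..}) (path_of {0..} Y)"
    and X_def: "X = X_process y g b Z Y"
    and \<Gamma>_def: "\<Gamma> = (\<lambda>\<omega>. time_below_zero {0..} (\<lambda>s. X s \<omega>))"
    and \<tau>_def: "\<tau> = (\<lambda>\<omega>. hitting_time (\<lambda>t. X t \<omega>))"
    and u: "u \<in> {0..1}"
  shows "2 * \<P>(\<omega> in M. g \<omega> \<in> {0<..u}) = \<P>(\<omega> in M. \<tau> \<omega> + \<Gamma> \<omega> \<le> ennreal u)"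
proof -
  interpret M: prob_space M by (rule M)
  obtain V where V: "bridge_space N0 V \<beta>" using brownian_bridge_space[OF standard_bridge] by blast
  interpret bridge_space N0 V \<beta> by (rule V)
  note g_measurable[measurable]
  define F where "F = path_of {0..1} b"
  have Fm[measurable]: "F \<in> M \<rightarrow>\<^sub>M path_space {0..1}"
    unfolding F_def by (rule continuous_process_path_measurable[OF b_continuous])
  have qq: "q t 1 = prob (occupation_event y t)" if "0 < t" for t
    using bridge_occupation[OF bridges[OF that]] unfolding q_def bridge_occupation_cdf_def by simp
  obtain c where c: "0 < c" "density (distr M borel g) (indicator {0<..}) =
      density lborel (\<lambda>x. indicator {0<..} x * (ennreal (weight y x / c) * emeasure N0 (occupation_event y x)))"
    using density_of_g[OF M g_measurable qq g_distribution] by blast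
  note joint = joint_law[OF M b_law[folded F_def] c(2)]
  have pm[measurable]: "(\<lambda>p. path_total y (fst p) (snd p)) \<in> borel_measurable (borel \<Otimes>\<^sub>M path_space {0..1})"
    by (intro path_total_measurable) measurable
  have bsp: "bpath \<omega> \<in> space (path_space {0..1})" if "\<omega> \<in> space N0" for \<omega>
    by (rule measurable_space[OF measurable_bpath that])
  have Fsp: "F \<omega> \<in> space (path_space {0..1})" if "\<omega> \<in> space M" for \<omega>
    by (rule measurable_space[OF Fm that])
  have wc: "ennreal (weight y x / c) = ennreal (1 / c) * ennreal (weight y x)" if "0 < x" for x
  proof -
    have "ennreal (weight y x / c) = ennreal (1 / c * weight y x)" by simp
    also have "\<dots> = ennreal (1 / c) * ennreal (weight y x)"
      by (rule ennreal_mult) (use c(1) weight_nonneg[OF that, of y] in simp_all)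
    finally show ?thesis .
  qed
  define W where "W = (\<integral>\<^sup>+x. indicator {0<..} x * indicator {..<u} x * ennreal (weight y x) \<partial>lborel)"

  \<comment> \<open>Since u \<le> 1, a total time of at most \<open>u\<close> already implies an
    occupation time of at most 1. The conditioning event disappears, and the integrand is that of
    the unconditioned bridge.\<close>
  have E1: "emeasure M {\<omega>\<in>space M. 0 < g \<omega> \<and> path_total y (g \<omega>) (F \<omega>) \<le> u} = ennreal (1 / c) * (2 * W)"
  proof -
    define S where "S = {p\<in>space (borel \<Otimes>\<^sub>M path_space {0..1}). path_total y (fst p) (snd p) \<le> u}"
    have S: "S \<in> sets (borel \<Otimes>\<^sub>M path_space {0..1})" unfolding S_def by measurable
    have "{\<omega>\<in>space M. 0 < g \<omega> \<and> path_total y (g \<omega>) (F \<omega>) \<le> u} = {\<omega>\<in>space M. 0 < g \<omega> \<and> (g \<omega>, F \<omega>) \<in> S}"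
      using Fsp by (auto simp: S_def space_pair_measure)
    then have "emeasure M {\<omega>\<in>space M. 0 < g \<omega> \<and> path_total y (g \<omega>) (F \<omega>) \<le> u} =
      (\<integral>\<^sup>+x. indicator {0<..} x * (ennreal (weight y x / c) * emeasure N0 {\<omega>\<in>space N0. (x, bpath \<omega>) \<in> S \<and> path_occupation y x (bpath \<omega>) \<le> 1}) \<partial>lborel)"
      using joint[OF S] by simp
    also have "\<dots> = (\<integral>\<^sup>+x. ennreal (1 / c) * (indicator {0<..} x * (ennreal (weight y x) * emeasure N0 {\<omega>\<in>space N0. path_total y x (bpath \<omega>) \<le> u})) \<partial>lborel)"
    proof (rule nn_integral_cong)
      fix x :: real
      show "indicator {0<..} x * (ennreal (weight y x / c) * emeasure N0 {\<omega>\<in>space N0. (x, bpath \<omega>) \<in> S \<and> path_occupation y x (bpath \<omega>) \<le> 1}) =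
        ennreal (1 / c) * (indicator {0<..} x * (ennreal (weight y x) * emeasure N0 {\<omega>\<in>space N0. path_total y x (bpath \<omega>) \<le> u}))"
      proof (cases "0 < x")
        case True
        have "(x, bpath \<omega>) \<in> S \<and> path_occupation y x (bpath \<omega>) \<le> 1 \<longleftrightarrow> path_total y x (bpath \<omega>) \<le> u" if "\<omega> \<in> space N0" for \<omega>
          using bsp[OF that] path_occupation_le_total[of x y "bpath \<omega>"] True u by (auto simp: S_def space_pair_measure)
        then have "{\<omega>\<in>space N0. (x, bpath \<omega>) \<in> S \<and> path_occupation y x (bpath \<omega>) \<le> 1} = {\<omega>\<in>space N0. path_total y x (bpath \<omega>) \<le> u}" by blast
        then show ?thesis using True wc[OF True] by (simp add: mult.assoc)
      qed simp
    qed
    also have "\<dots> = ennreal (1 / c) * (\<integral>\<^sup>+x. indicator {0<..} x * (ennreal (weight y x) * emeasure N0 {\<omega>\<in>space N0. path_total y x (bpath \<omega>) \<le> u}) \<partial>lborel)"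
    proof (rule nn_integral_cmult)
      have [measurable]: "(\<lambda>p. path_total y (fst p) (bpath (snd p))) \<in> borel_measurable (borel \<Otimes>\<^sub>M N0)"
        by (intro path_total_measurable) measurable
      have "(\<lambda>x. emeasure N0 {\<omega>\<in>space N0. path_total y x (bpath \<omega>) \<le> u}) \<in> borel_measurable borel"
        by (rule emeasure_section_measurable[OF prob_space_axioms]) measurable
      then show "(\<lambda>x. indicator {0<..} x * (ennreal (weight y x) * emeasure N0 {\<omega>\<in>space N0. path_total y x (bpath \<omega>) \<le> u})) \<in> borel_measurable lborel"
        by measurable
    qed
    also have "(\<integral>\<^sup>+x. indicator {0<..} x * (ennreal (weight y x) * emeasure N0 {\<omega>\<in>space N0. path_total y x (bpath \<omega>) \<le> u}) \<partial>lborel) = 2 * W"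
      unfolding W_def by (rule path_total_integral) (use u in simp)
    finally show ?thesis .
  qed

  \<comment> \<open>A length of at most 1 bounds the occupation time by 1, so the conditioning event
    is again certain, and only the weight remains.\<close>
  have E2: "emeasure M {\<omega>\<in>space M. g \<omega> \<in> {0<..u}} = ennreal (1 / c) * W"
  proof -
    define S where "S = {p\<in>space (borel \<Otimes>\<^sub>M path_space {0..1}). fst p \<le> u}"
    have S: "S \<in> sets (borel \<Otimes>\<^sub>M path_space {0..1})" unfolding S_def by measurable
    have "{\<omega>\<in>space M. g \<omega> \<in> {0<..u}} = {\<omega>\<in>space M. 0 < g \<omega> \<and> (g \<omega>, F \<omega>) \<in> S}"
      using Fsp by (auto simp: S_def space_pair_measure)
    then have "emeasure M {\<omega>\<in>space M. g \<omega> \<in> {0<..u}} =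
      (\<integral>\<^sup>+x. indicator {0<..} x * (ennreal (weight y x / c) * emeasure N0 {\<omega>\<in>space N0. (x, bpath \<omega>) \<in> S \<and> path_occupation y x (bpath \<omega>) \<le> 1}) \<partial>lborel)"
      using joint[OF S] by simp
    also have "\<dots> = (\<integral>\<^sup>+x. ennreal (1 / c) * (indicator {0<..} x * indicator {..<u} x * ennreal (weight y x)) \<partial>lborel)"
    proof (rule nn_integral_cong_AE)
      have "AE x in lborel. x \<noteq> u" by (rule AE_lborel_singleton)
      then show "AE x in lborel. indicator {0<..} x * (ennreal (weight y x / c) * emeasure N0 {\<omega>\<in>space N0. (x, bpath \<omega>) \<in> S \<and> path_occupation y x (bpath \<omega>) \<le> 1}) =
        ennreal (1 / c) * (indicator {0<..} x * indicator {..<u} x * ennreal (weight y x))"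
      proof eventually_elim
        case (elim x)
        consider "x \<le> 0" | "0 < x" "x < u" | "u < x" using elim by linarith
        then show ?case
        proof cases
          case 1 then show ?thesis by simp
        next
          case 2
          have "(x, bpath \<omega>) \<in> S \<and> path_occupation y x (bpath \<omega>) \<le> 1" if "\<omega> \<in> space N0" for \<omega>
            using bsp[OF that] path_occupation_le[of x y "bpath \<omega>"] 2 u by (simp add: S_def space_pair_measure)
          then have "{\<omega>\<in>space N0. (x, bpath \<omega>) \<in> S \<and> path_occupation y x (bpath \<omega>) \<le> 1} = space N0" by blast
          then show ?thesis using 2 wc[OF 2(1)] by (simp add: emeasure_space_1)
        next
          case 3
          then have "(x, bpath \<omega>) \<notin> S" for \<omega> by (simp add: S_def)
          then have e: "{\<omega>\<in>space N0. (x, bpath \<omega>) \<in> S \<and> path_occupation y x (bpath \<omega>) \<le> 1} = {}" by blast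
          show ?thesis unfolding e using 3 by simp
        qed
      qed
    qed
    also have "\<dots> = ennreal (1 / c) * W" unfolding W_def by (rule nn_integral_cmult) measurable
    finally show ?thesis .
  qed

  have Zc: "continuous_process M {0..} Z" using Z_bessel unfolding bessel3_def by blast
  have Yc: "continuous_process M {0..} Y" if "0 < y" using Y_bessel[OF that] unfolding bessel3_def by blast
  have [measurable]: "\<Gamma> \<in> borel_measurable M"
    unfolding \<Gamma>_def X_def by (rule X_process_occupation_measurable[OF g_measurable g_nonneg b_continuous Zc Yc])
  have [measurable]: "\<tau> \<in> borel_measurable M"
    unfolding \<tau>_def X_def by (rule X_process_hitting_time_measurable[OF g_measurable g_nonneg b_continuous Zc Yc])
  \<comment> \<open>Where \<open>g\<close> vanishes only the case of positive \<open>y\<close>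
    survives, and there \<open>Y\<close> stays positive up to time 1.\<close>
  have gz: "AE \<omega> in M. g \<omega> = 0 \<longrightarrow> 0 < y \<and> (\<forall>t\<in>{0..1}. 0 < Y t \<omega>)"
  proof (cases "0 < y")
    case True
    show ?thesis using bessel_positive[OF Y_bessel[OF True] True] by eventually_elim (use True in blast)
  next
    case False
    then have "M.prob {\<omega>\<in>space M. g \<omega> \<le> 0} = 0" using g_distribution[of 0] g_cdf_zero[of y q] by simp
    moreover have "{\<omega>\<in>space M. g \<omega> \<le> 0} \<in> sets M" by measurable
    ultimately have "AE \<omega> in M. \<not> g \<omega> \<le> 0"
      by (subst AE_iff_measurable[of "{\<omega>\<in>space M. g \<omega> \<le> 0}"]) (simp_all add: M.emeasure_eq_measure)
    then show ?thesis by eventually_elim simp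
  qed
  have "M.prob {\<omega>\<in>space M. \<tau> \<omega> + \<Gamma> \<omega> \<le> ennreal u} = M.prob {\<omega>\<in>space M. 0 < g \<omega> \<and> path_total y (g \<omega>) (F \<omega>) \<le> u}"
  proof (rule M.finite_measure_eq_AE)
    show "AE \<omega> in M. (\<omega> \<in> {\<omega>\<in>space M. \<tau> \<omega> + \<Gamma> \<omega> \<le> ennreal u}) = (\<omega> \<in> {\<omega>\<in>space M. 0 < g \<omega> \<and> path_total y (g \<omega>) (F \<omega>) \<le> u})"
      using gz bessel_zero_nonneg[OF Z_bessel] AE_space
    proof eventually_elim
      case (elim \<omega>)
      show ?case
      proof (cases "0 < g \<omega>")
        case True
        have bc: "continuous_on {0..1} (\<lambda>s. b s \<omega>)" using b_continuous elim(3) unfolding continuous_process_def by blast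
        have Fc: "continuous_on {0..1} (F \<omega>)"
          by (rule continuous_on_eq[OF bc]) (simp add: F_def path_of_def)
        have X: "(\<lambda>t. X t \<omega>) = (\<lambda>t. if t < g \<omega> then scaled_bridge y (g \<omega>) (\<lambda>s. b s \<omega>) t else Z (t - g \<omega>) \<omega>)"
          unfolding X_def X_process_def using True by (simp add: fun_eq_iff)
        have "\<tau> \<omega> + \<Gamma> \<omega> = ennreal (total y (g \<omega>) (\<lambda>s. b s \<omega>))"
          unfolding \<tau>_def \<Gamma>_def X by (rule path_decomposition[OF True bc]) (use elim(2) in blast)+
        also have "total y (g \<omega>) (\<lambda>s. b s \<omega>) = path_total y (g \<omega>) (F \<omega>)"
          unfolding path_total_eq[OF Fc] by (rule total_cong) (simp add: F_def path_of_def)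
        finally have "\<tau> \<omega> + \<Gamma> \<omega> \<le> ennreal u \<longleftrightarrow> path_total y (g \<omega>) (F \<omega>) \<le> u" using u by simp
        then show ?thesis using True by simp
      next
        case False
        then have g: "g \<omega> = 0" using g_nonneg[OF elim(3)] by simp
        have X: "(\<lambda>t. X t \<omega>) = (\<lambda>t. Y t \<omega>)" unfolding X_def X_process_def using g elim(1) by simp
        have "continuous_on {0..} (\<lambda>t. Y t \<omega>)" using Yc elim g unfolding continuous_process_def by blast
        then have "1 < \<tau> \<omega>" unfolding \<tau>_def X by (rule hitting_time_gt_one) (use elim(1) g in blast)
        have "\<not> \<tau> \<omega> + \<Gamma> \<omega> \<le> ennreal u"
        proof
          assume le: "\<tau> \<omega> + \<Gamma> \<omega> \<le> ennreal u"
          have "\<tau> \<omega> \<le> \<tau> \<omega> + \<Gamma> \<omega>" by simp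
          also note le
          also have "ennreal u \<le> 1" using u by simp
          finally show False using \<open>1 < \<tau> \<omega>\<close> by simp
        qed
        then show ?thesis using False by simp
      qed
    qed
    show "{\<omega>\<in>space M. \<tau> \<omega> + \<Gamma> \<omega> \<le> ennreal u} \<in> sets M" by measurable
    have [measurable]: "(\<lambda>\<omega>. path_total y (g \<omega>) (F \<omega>)) \<in> borel_measurable M" by (rule path_total_measurable[OF g_measurable Fm])
    show "{\<omega>\<in>space M. 0 < g \<omega> \<and> path_total y (g \<omega>) (F \<omega>) \<le> u} \<in> sets M" by measurable
  qed
  \<comment> \<open>\<open>E1\<close> and \<open>E2\<close> share the normalising constant
    \<open>1 / c\<close>, so the ratio 2 is read off without its value.\<close>
  moreover have "emeasure M {\<omega>\<in>space M. 0 < g \<omega> \<and> path_total y (g \<omega>) (F \<omega>) \<le> u} = 2 * emeasure M {\<omega>\<in>space M. g \<omega> \<in> {0<..u}}"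
    unfolding E1 E2 by (rule mult.left_commute)
  then have "M.prob {\<omega>\<in>space M. 0 < g \<omega> \<and> path_total y (g \<omega>) (F \<omega>) \<le> u} = 2 * M.prob {\<omega>\<in>space M. g \<omega> \<in> {0<..u}}"
    unfolding measure_def by (simp add: enn2real_mult)
  ultimately show ?thesis by simp
qed

end
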